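(* Assume that $T_+$ is integral and let $\Theta$ be the set of all smooth sequences for $T_+$ (including the empty one). Then $$X_\phi^\Theta=\bigcup_{\underline\delta\in\Theta}\mathrm{Spec}\,\mathbb Z[T_+^{\underline\delta}]\subseteq\mathrm{Spec}\,\mathbb Z[T_+]$$ is the smooth locus of $\mathrm{Spec}\,\mathbb Z[T_+]$ (over $\mathbb Z$). In particular the smooth locus $\mathcal Z_\phi^{\mathrm{sm}}$ of $\mathcal Z_\phi$ satisfies $$\mathcal Z_\phi^{\mathrm{sm}}=\mathcal X_\phi^\Theta\simeq[X_\phi^\Theta/\mathrm D(\mathbb Z^r)],\qquad \mathcal X_\phi^\Theta=\bigcup_{\underline\delta\in\Theta}\mathcal X_\phi^{\underline\delta}\subseteq\mathcal Z_\phi .$$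
   Context: $T_+$ is a finitely generated commutative monoid whose associated group $T$ is free of finite rank; $T_+$ is integral if $a+b=a+c$ implies $b=c$, i.e. if $T_+\to T$ is injective. $\phi\colon T_+\to\mathbb Z^r$ is a monoid map, with extension $T\to\mathbb Z^r$ also denoted $\phi$. $\mathrm D(\mathbb Z^r)=\underline{\mathrm{Hom}}(\mathbb Z^r,\mathbb G_m)$ acts on $\mathrm{Spec}\,\mathbb Z[T_+]$ via the grading $\deg x_t=\phi(t)$ and, for integral $T_+$, $\mathcal Z_\phi=\mathcal X_\phi=[\mathrm{Spec}\,\mathbb Z[T_+]/\mathrm D(\mathbb Z^r)]$. $T_+^\vee=\mathrm{Hom}(T_+,\mathbb N)\subseteq\mathrm{Hom}(T,\mathbb Z)$. A smooth sequence for (integral) $T_+$ is a finite sequence $\underline{\mathcal E}=\mathcal E^1,\dots,\mathcal E^s\in T_+^\vee$ ($s\ge0$), regarded also as a map $\underline{\mathcal E}\colon T\to\mathbb Z^s$, such that $T_+\cap\mathrm{Ker}\,\underline{\mathcal E}$ generates the group $\mathrm{Ker}\,\underline{\mathcal E}\subseteq T$ and there are $v_1,\dots,v_s\in T_+$ with $\mathcal E^i(v_j)=\delta_{i,j}$. For a sequence $\underline{\mathcal E}$ in $T_+^\vee$ put $T_+^{\underline{\mathcal E}}=\{v\in T\mid\mathcal E^i(v)\ge0\ \forall i\}$ (so $T_+^{\emptyset}=T$) and $\mathcal X_\phi^{\underline{\mathcal E}}=[\mathrm{Spec}\,\mathbb Z[T_+^{\underline{\mathcal E}}]/\mathrm D(\mathbb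 Z^r)]$. For a smooth sequence, $\mathrm{Spec}\,\mathbb Z[T_+^{\underline{\mathcal E}}]$ is an (equivariant) open subscheme of $\mathrm{Spec}\,\mathbb Z[T_+]$ and $\mathcal X_\phi^{\underline{\mathcal E}}$ is an open substack of $\mathcal Z_\phi$. *)

theory Defs
  imports "HOL-Algebra.Algebra" "HOL-Algebra.Free_Abelian_Groups" "HOL-Combinatorics.Permutations"
    "HOL-Library.Poly_Mapping"
begin

section \<open>Spectra and smoothness over the integers\<close>

definition Spec :: "'a ring \<Rightarrow> 'a set set" where
  "Spec R = {p. primeideal p R}"

definition spec_map :: "'a ring \<Rightarrow> ('a \<Rightarrow> 'b) \<Rightarrow> 'b set \<Rightarrow> 'a set" where
  "spec_map R h q = {x \<in> carrier R. h x \<in> q}"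

definition zariski_open :: "'a ring \<Rightarrow> 'a set set \<Rightarrow> bool" where
  "zariski_open R U \<longleftrightarrow> (\<exists>I. ideal I R \<and> U = {p \<in> Spec R. \<not> I \<subseteq> p})"

text \<open>The map \<open>h\<close> exhibits \<open>S\<close> as the localization of \<open>R\<close> at the powers of \<open>g\<close>.\<close>

definition localization_away :: "'a ring \<Rightarrow> 'a \<Rightarrow> 'b ring \<Rightarrow> ('a \<Rightarrow> 'b) \<Rightarrow> bool" where
  "localization_away R g S h \<longleftrightarrow>
     h \<in> ring_hom R S \<and> h g \<in> Units S \<and>
     (\<forall>s \<in> carrier S. \<exists>x \<in> carrier R. \<exists>n::nat. s \<otimes>\<^bsub>S\<^esub> (h g [^]\<^bsub>S\<^esub> n) = h x) \<and>
     (\<forall>x \<in> carrier R. h x = \<zero>\<^bsub>S\<^esub> \<longrightarrow> (\<exists>n::nat. (g [^]\<^bsub>R\<^esub> n) \<otimes>\<^bsub>R\<^esub> x = \<zero>\<^bsub>R\<^esub>))"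

text \<open>Multiplication of finitely supported functions is convolution, so this is the monoid ring
  of the submonoid \<open>M\<close> with integer coefficients; the monomial \<open>x\<^sub>t\<close> is
  \<open>Poly_Mapping.single t 1\<close>.\<close>

definition monoid_ring :: "'m::comm_monoid_add set \<Rightarrow> ('m \<Rightarrow>\<^sub>0 int) ring" where
  "monoid_ring M = \<lparr>carrier = {p. Poly_Mapping.keys p \<subseteq> M}, monoid.mult = (*), one = 1,
                    ring.zero = 0, add = (+)\<rparr>"

type_synonym int_mpoly = "(nat \<Rightarrow>\<^sub>0 nat) \<Rightarrow>\<^sub>0 int"

text \<open>The polynomial ring in the variables \<open>x\<^sub>0, \<dots>, x\<^sub>n\<^sub>-\<^sub>1\<close>.\<close>

definition int_poly_ring :: "nat \<Rightarrow> int_mpoly ring" where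
  "int_poly_ring n = monoid_ring {m. Poly_Mapping.keys m \<subseteq> {..<n}}"

definition partial_deriv :: "nat \<Rightarrow> int_mpoly \<Rightarrow> int_mpoly" where
  "partial_deriv j p =
     (\<Sum>m \<in> Poly_Mapping.keys p.
        Poly_Mapping.single (m - Poly_Mapping.single j 1)
          (Poly_Mapping.lookup p m * int (Poly_Mapping.lookup m j)))"

text \<open>The determinant of \<open>(\<partial>f\<^sub>i / \<partial>x\<^sub>j)\<close>, \<open>i, j < c\<close>.\<close>

definition jacobian_minor :: "nat \<Rightarrow> (nat \<Rightarrow> int_mpoly) \<Rightarrow> int_mpoly" where
  "jacobian_minor c f =
     (\<Sum>\<pi> | \<pi> permutes {..<c}. of_int (sign \<pi>) * (\<Prod>i<c. partial_deriv (\<pi> i) (f i)))"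

text \<open>Smoothness of \<open>Spec R\<close> over the integers at the point \<open>p\<close>: some principal localization
  \<open>R\<^sub>g\<close> with \<open>g \<notin> p\<close> is a standard smooth algebra, that is, it is isomorphic to
  \<open>\<int>[x\<^sub>0, \<dots>, x\<^sub>n\<^sub>-\<^sub>1] / (f\<^sub>0, \<dots>, f\<^sub>c\<^sub>-\<^sub>1)\<close> where \<open>c \<le> n\<close> and the Jacobian minor with respect to the
  first \<open>c\<close> variables is invertible in the quotient.\<close>

definition smooth_at :: "'a ring \<Rightarrow> 'a set \<Rightarrow> bool" where
  "smooth_at R p \<longleftrightarrow>
     (\<exists>g \<in> carrier R - p. \<exists>n c f h. c \<le> n \<and> f ` {..<c} \<subseteq> carrier (int_poly_ring n) \<and>
        (let I = genideal (int_poly_ring n) (f ` {..<c}); S = int_poly_ring n Quot I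
         in localization_away R g S h \<and>
            I +>\<^bsub>int_poly_ring n\<^esub> jacobian_minor c f \<in> Units S))"

definition smooth_locus :: "'a ring \<Rightarrow> 'a set set" where
  "smooth_locus R = {p \<in> Spec R. smooth_at R p}"


section \<open>Smooth sequences\<close>

text \<open>An integral monoid \<open>T\<^sub>+\<close> is given as a submonoid of its associated group \<open>T\<close>; the latter is
  the whole type \<open>'t\<close>.\<close>

definition ambient_group :: "'t::ab_group_add monoid" where
  "ambient_group = \<lparr>carrier = UNIV, monoid.mult = (+), one = 0\<rparr>"

definition fg_submonoid :: "'t::comm_monoid_add set \<Rightarrow> bool" where
  "fg_submonoid M \<longleftrightarrow> (\<exists>A. finite A \<and> M = sum_list ` lists A)"

text \<open>\<open>Hom(T\<^sub>+, \<nat>)\<close>, as a subset of \<open>Hom(T, \<int>)\<close>.\<close>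

definition dual_monoid :: "'t::ab_group_add set \<Rightarrow> ('t \<Rightarrow> int) set" where
  "dual_monoid M = {E. (\<forall>s t. E (s + t) = E s + E t) \<and> (\<forall>t \<in> M. 0 \<le> E t)}"

definition seq_kernel :: "('t \<Rightarrow> int) list \<Rightarrow> 't set" where
  "seq_kernel Es = {t. \<forall>E \<in> set Es. E t = 0}"

definition smooth_sequence :: "'t::ab_group_add set \<Rightarrow> ('t \<Rightarrow> int) list \<Rightarrow> bool" where
  "smooth_sequence M Es \<longleftrightarrow>
     set Es \<subseteq> dual_monoid M \<and>
     generate ambient_group (M \<inter> seq_kernel Es) = seq_kernel Es \<and>
     (\<exists>v. \<forall>j < length Es. v j \<in> M \<and>
        (\<forall>i < length Es. (Es ! i) (v j) = (if i = j then 1 else 0)))"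

definition smooth_sequences :: "'t::ab_group_add set \<Rightarrow> ('t \<Rightarrow> int) list set" where
  "smooth_sequences M = {Es. smooth_sequence M Es}"

definition seq_monoid :: "('t \<Rightarrow> int) list \<Rightarrow> 't set" where
  "seq_monoid Es = {v. \<forall>E \<in> set Es. 0 \<le> E v}"

text \<open>The inclusion \<open>\<int>[T\<^sub>+] \<subseteq> \<int>[T\<^sub>+\<^sup>\<delta>]\<close> makes \<open>Spec \<int>[T\<^sub>+\<^sup>\<delta>]\<close> an open subscheme of \<open>Spec \<int>[T\<^sub>+]\<close>
  for smooth \<open>\<delta>\<close>; like every open subscheme it is represented by its set of points.\<close>

definition seq_open :: "'t::ab_group_add set \<Rightarrow> ('t \<Rightarrow> int) list \<Rightarrow> ('t \<Rightarrow>\<^sub>0 int) set set" where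
  "seq_open M Es = spec_map (monoid_ring M) id ` Spec (monoid_ring (seq_monoid Es))"

definition X_Theta :: "'t::ab_group_add set \<Rightarrow> ('t \<Rightarrow>\<^sub>0 int) set set" where
  "X_Theta M = (\<Union>Es \<in> smooth_sequences M. seq_open M Es)"


section \<open>Quotient stacks by the diagonalizable group of \<open>\<int>\<^sup>r\<close>\<close>

type_synonym zvec = "nat \<Rightarrow>\<^sub>0 int"

abbreviation Zr :: "nat \<Rightarrow> zvec set" where
  "Zr r \<equiv> carrier (free_Abelian_group {..<r})"

text \<open>An action of \<open>D(\<int>\<^sup>r)\<close> on \<open>Spec B\<close> is a \<open>\<int>\<^sup>r\<close>-grading of \<open>B\<close>; the values of \<open>gr\<close> outside
  \<open>Zr r\<close> are irrelevant.\<close>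

definition graded_cring :: "nat \<Rightarrow> 'b ring \<Rightarrow> (zvec \<Rightarrow> 'b set) \<Rightarrow> bool" where
  "graded_cring r B gr \<longleftrightarrow>
     cring B \<and>
     (\<forall>n \<in> Zr r. subgroup (gr n) (add_monoid B)) \<and>
     (\<forall>b \<in> carrier B. \<exists>!c. c \<in> (\<Pi>\<^sub>E n \<in> Zr r. gr n) \<and> finite {n \<in> Zr r. c n \<noteq> \<zero>\<^bsub>B\<^esub>} \<and>
        b = finsum B c {n \<in> Zr r. c n \<noteq> \<zero>\<^bsub>B\<^esub>}) \<and>
     \<one>\<^bsub>B\<^esub> \<in> gr 0 \<and>
     (\<forall>m \<in> Zr r. \<forall>n \<in> Zr r. \<forall>x \<in> gr m. \<forall>y \<in> gr n. x \<otimes>\<^bsub>B\<^esub> y \<in> gr (m + n))"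

text \<open>Torsors under \<open>D(\<int>\<^sup>r)\<close> are affine over the base: a torsor over \<open>Spec A\<close> is \<open>Spec B\<close> for a
  \<open>\<int>\<^sup>r\<close>-graded ring \<open>B\<close> with \<open>B\<^sub>0 = A\<close> and \<open>B\<^sub>m B\<^sub>n = B\<^sub>m\<^sub>+\<^sub>n\<close> for all \<open>m, n\<close> (SGA 3, Exp. VIII,
  Prop. 4.1). The base ring is therefore recovered as the degree zero part.\<close>

definition torsor :: "nat \<Rightarrow> 'b ring \<Rightarrow> (zvec \<Rightarrow> 'b set) \<Rightarrow> bool" where
  "torsor r B gr \<longleftrightarrow>
     graded_cring r B gr \<and>
     (\<forall>m \<in> Zr r. \<forall>n \<in> Zr r.
        generate (add_monoid B) {x \<otimes>\<^bsub>B\<^esub> y | x y. x \<in> gr m \<and> y \<in> gr n} = gr (m + n))"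

text \<open>For a \<open>\<int>\<^sup>r\<close>-graded ring \<open>(R, grR)\<close>, an object of \<open>[Spec R / D(\<int>\<^sup>r)]\<close> over an affine scheme
  is a torsor \<open>Spec B\<close> with an equivariant map \<open>Spec B \<rightarrow> Spec R\<close>, that is, a homomorphism
  \<open>R \<rightarrow> B\<close> of graded rings. A stack is determined by its objects over affine schemes. The carrier
  type \<open>'b\<close> bounds the size of the test rings.\<close>

record ('a, 'b) stack_obj =
  tring :: "'b ring"
  tgrad :: "zvec \<Rightarrow> 'b set"
  tmap :: "'a \<Rightarrow> 'b"

definition quotient_stack ::
    "nat \<Rightarrow> 'a ring \<Rightarrow> (zvec \<Rightarrow> 'a set) \<Rightarrow> ('a, 'b) stack_obj set" where
  "quotient_stack r R grR =
     {\<xi>. torsor r (tring \<xi>) (tgrad \<xi>) \<and> tmap \<xi> \<in> ring_hom R (tring \<xi>) \<and>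
         (\<forall>n \<in> Zr r. tmap \<xi> ` grR n \<subseteq> tgrad \<xi> n)}"

definition base_ring :: "('a, 'b) stack_obj \<Rightarrow> 'b ring" where
  "base_ring \<xi> = (tring \<xi>)\<lparr>carrier := tgrad \<xi> 0\<rparr>"

text \<open>The arrows \<open>\<xi>' \<rightarrow> \<xi>\<close> of the fibred category, written on rings. Such a map of graded rings
  restricts to a homomorphism of base rings and identifies \<open>\<xi>'\<close> with the pullback of \<open>\<xi>\<close> along
  it, as every equivariant map of torsors over a fixed base is an isomorphism.\<close>

definition stack_arrows ::
    "nat \<Rightarrow> 'a ring \<Rightarrow> ('a, 'b) stack_obj \<Rightarrow> ('a, 'b) stack_obj \<Rightarrow> ('b \<Rightarrow> 'b) set" where
  "stack_arrows r R \<xi> \<xi>' =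
     {h \<in> ring_hom (tring \<xi>) (tring \<xi>').
        (\<forall>n \<in> Zr r. h ` tgrad \<xi> n \<subseteq> tgrad \<xi>' n) \<and>
        (\<forall>x \<in> carrier R. h (tmap \<xi> x) = tmap \<xi>' x)}"

text \<open>Open substacks are full, so they are given by their objects. The condition says that the
  inclusion is represented by open immersions: for every \<open>\<xi>\<close> over \<open>Spec A\<close> there is an open
  \<open>U \<subseteq> Spec A\<close> such that a pullback of \<open>\<xi>\<close> along \<open>Spec A' \<rightarrow> Spec A\<close> lies in \<open>V\<close> iff this map
  factors through \<open>U\<close>.\<close>

definition open_substack ::
    "nat \<Rightarrow> 'a ring \<Rightarrow> (zvec \<Rightarrow> 'a set) \<Rightarrow> ('a, 'b) stack_obj set \<Rightarrow> bool" where
  "open_substack r R grR V \<longleftrightarrow>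
     V \<subseteq> quotient_stack r R grR \<and>
     (\<forall>\<xi> \<in> quotient_stack r R grR. \<exists>U. zariski_open (base_ring \<xi>) U \<and>
        (\<forall>\<xi>' \<in> quotient_stack r R grR. \<forall>h \<in> stack_arrows r R \<xi> \<xi>'.
           \<xi>' \<in> V \<longleftrightarrow> (\<forall>q \<in> Spec (base_ring \<xi>'). spec_map (base_ring \<xi>) h q \<in> U)))"

text \<open>The union of open substacks: the objects which belong to one of them Zariski locally on the
  base.\<close>

definition substack_union ::
    "nat \<Rightarrow> 'a ring \<Rightarrow> (zvec \<Rightarrow> 'a set) \<Rightarrow> ('a, 'b) stack_obj set set \<Rightarrow> ('a, 'b) stack_obj set" where
  "substack_union r R grR \<V> =
     {\<xi> \<in> quotient_stack r R grR.
        \<forall>q \<in> Spec (base_ring \<xi>). \<exists>V \<in> \<V>. \<exists>a \<in> carrier (base_ring \<xi>) - q.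
          \<exists>\<xi>' \<in> V. \<exists>h \<in> stack_arrows r R \<xi> \<xi>'.
            localization_away (base_ring \<xi>) a (base_ring \<xi>') h}"

text \<open>The points of the base of \<open>\<xi>\<close> over which \<open>\<xi>\<close> lies in \<open>V\<close>; for an open substack \<open>V\<close> this
  is the open set \<open>U\<close> in the definition of openness.\<close>

definition open_locus ::
    "nat \<Rightarrow> 'a ring \<Rightarrow> ('a, 'b) stack_obj set \<Rightarrow> ('a, 'b) stack_obj \<Rightarrow> 'b set set" where
  "open_locus r R V \<xi> =
     {q \<in> Spec (base_ring \<xi>). \<exists>\<xi>' \<in> V. \<exists>h \<in> stack_arrows r R \<xi> \<xi>'. \<exists>q' \<in> Spec (base_ring \<xi>').
        spec_map (base_ring \<xi>) h q' = q}"

text \<open>The canonical smooth atlas \<open>Spec R \<rightarrow> [Spec R / D(\<int>\<^sup>r)]\<close>: the trivial torsor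
  \<open>Spec R \<times> D(\<int>\<^sup>r)\<close> with the action map. Since the base ring has to live in the type \<open>'b\<close>, it is
  a copy of \<open>R\<close> via \<open>\<rho>\<close>; the trivialization is the family of units \<open>s\<close>, and the action map
  is \<open>x \<mapsto> \<rho> x \<cdot> s n\<close> on elements \<open>x\<close> of degree \<open>n\<close>.\<close>

definition is_atlas :: "nat \<Rightarrow> 'a ring \<Rightarrow> (zvec \<Rightarrow> 'a set) \<Rightarrow> ('a, 'b) stack_obj \<Rightarrow> bool" where
  "is_atlas r R grR \<xi> \<longleftrightarrow>
     \<xi> \<in> quotient_stack r R grR \<and>
     (\<exists>s \<rho>. (\<forall>n \<in> Zr r. s n \<in> tgrad \<xi> n) \<and> s 0 = \<one>\<^bsub>tring \<xi>\<^esub> \<and>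
        (\<forall>m \<in> Zr r. \<forall>n \<in> Zr r. s (m + n) = s m \<otimes>\<^bsub>tring \<xi>\<^esub> s n) \<and>
        \<rho> \<in> ring_iso R (base_ring \<xi>) \<and>
        (\<forall>n \<in> Zr r. \<forall>x \<in> grR n. tmap \<xi> x = \<rho> x \<otimes>\<^bsub>tring \<xi>\<^esub> s n))"

text \<open>An open substack is smooth if its preimage in the atlas is. All atlases in the above sense
  are isomorphic; one exists in \<open>'b\<close> if \<open>'b\<close> is infinite and \<open>R\<close> is countable.\<close>

definition smooth_substack ::
    "nat \<Rightarrow> 'a ring \<Rightarrow> (zvec \<Rightarrow> 'a set) \<Rightarrow> ('a, 'b) stack_obj set \<Rightarrow> bool" where
  "smooth_substack r R grR V \<longleftrightarrow>
     (\<forall>\<xi>. is_atlas r R grR \<xi> \<longrightarrow> (\<forall>q \<in> open_locus r R V \<xi>. smooth_at (base_ring \<xi>) q))"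

definition stack_smooth_locus ::
    "nat \<Rightarrow> 'a ring \<Rightarrow> (zvec \<Rightarrow> 'a set) \<Rightarrow> ('a, 'b) stack_obj set" where
  "stack_smooth_locus r R grR =
     substack_union r R grR {V. open_substack r R grR V \<and> smooth_substack r R grR V}"

text \<open>The quotient \<open>[U / D(\<int>\<^sup>r)]\<close> of an invariant open \<open>U \<subseteq> Spec R\<close>: the equivariant map
  \<open>Spec B \<rightarrow> Spec R\<close> factors through \<open>U\<close>.\<close>

definition open_quotient ::
    "nat \<Rightarrow> 'a ring \<Rightarrow> (zvec \<Rightarrow> 'a set) \<Rightarrow> 'a set set \<Rightarrow> ('a, 'b) stack_obj set" where
  "open_quotient r R grR U =
     {\<xi> \<in> quotient_stack r R grR. \<forall>q \<in> Spec (tring \<xi>). spec_map R (tmap \<xi>) q \<in> U}"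


section \<open>The stacks attached to \<open>\<phi>\<close>\<close>

definition phi_grading ::
    "('t \<Rightarrow> zvec) \<Rightarrow> 't::ab_group_add set \<Rightarrow> zvec \<Rightarrow> ('t \<Rightarrow>\<^sub>0 int) set" where
  "phi_grading \<phi> M n = {p \<in> carrier (monoid_ring M). \<forall>t \<in> Poly_Mapping.keys p. \<phi> t = n}"

definition Z_stack ::
    "nat \<Rightarrow> ('t \<Rightarrow> zvec) \<Rightarrow> 't::ab_group_add set \<Rightarrow> ('t \<Rightarrow>\<^sub>0 int, 'b) stack_obj set" where
  "Z_stack r \<phi> M = quotient_stack r (monoid_ring M) (phi_grading \<phi> M)"

definition Z_stack_smooth ::
    "nat \<Rightarrow> ('t \<Rightarrow> zvec) \<Rightarrow> 't::ab_group_add set \<Rightarrow> ('t \<Rightarrow>\<^sub>0 int, 'b) stack_obj set" where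
  "Z_stack_smooth r \<phi> M = stack_smooth_locus r (monoid_ring M) (phi_grading \<phi> M)"

text \<open>The substack of \<open>Z_stack\<close> which is the image of \<open>[Spec \<int>[T\<^sub>+\<^sup>\<delta>] / D(\<int>\<^sup>r)]\<close> under restriction
  of the structure map from \<open>\<int>[T\<^sub>+\<^sup>\<delta>]\<close> to \<open>\<int>[T\<^sub>+]\<close>.\<close>

definition X_seq_stack ::
    "nat \<Rightarrow> ('t \<Rightarrow> zvec) \<Rightarrow> 't::ab_group_add set \<Rightarrow> ('t \<Rightarrow> int) list \<Rightarrow>
      ('t \<Rightarrow>\<^sub>0 int, 'b) stack_obj set" where
  "X_seq_stack r \<phi> M Es =
     {\<xi> \<in> Z_stack r \<phi> M. \<exists>\<eta> \<in> Z_stack r \<phi> (seq_monoid Es).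
        tring \<eta> = tring \<xi> \<and> tgrad \<eta> = tgrad \<xi> \<and>
        (\<forall>x \<in> carrier (monoid_ring M). tmap \<xi> x = tmap \<eta> x)}"

definition X_Theta_stack ::
    "nat \<Rightarrow> ('t \<Rightarrow> zvec) \<Rightarrow> 't::ab_group_add set \<Rightarrow> ('t \<Rightarrow>\<^sub>0 int, 'b) stack_obj set" where
  "X_Theta_stack r \<phi> M =
     substack_union r (monoid_ring M) (phi_grading \<phi> M)
       {X_seq_stack r \<phi> M Es | Es. Es \<in> smooth_sequences M}"

end

theory Submission
  imports "Jordan_Normal_Form.Determinant" Defs
begin

text \<open>
  Write \<open>M\<close> for the monoid and \<open>T\<close> for its group, of rank \<open>N\<close>. The theorem has an affine part, the
  first equality, and a part about stacks which is deduced from it.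

  \<^emph>\<open>Charts of smooth sequences are smooth.\<close> For a smooth sequence \<open>\<E>\<close> the elements \<open>v\<^sub>j\<close> split
  \<open>T\<close> as the kernel of \<open>\<E>\<close> plus a free group on the \<open>v\<^sub>j\<close>, so that the monoid ring of
  \<open>{v. \<E>\<^sup>i(v) \<ge> 0}\<close> is a Laurent polynomial ring over a polynomial ring. It has a presentation by
  the single equation \<open>x\<^sub>0 x\<^sub>1 \<cdots> x\<^sub>k = 1\<close>, which is standard smooth. Moreover it is the localization
  of \<open>\<int>[M]\<close> at one monomial, the product of the generators of \<open>M\<close> on which \<open>\<E>\<close> vanishes. This is
  \<open>standard_smooth_chart\<close> and \<open>den_localization\<close>.

  \<^emph>\<open>Smooth points lie in such charts.\<close> The monomials which are units at a prime \<open>p\<close> form a face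
  \<open>F\<close> of \<open>M\<close>; let \<open>L\<close> be the group that it generates and \<open>k\<close> the rank of \<open>L\<close>. Choose a smallest
  set \<open>V\<close> of generators of \<open>M\<close> modulo \<open>L\<close>. If a standard smooth chart of relative dimension \<open>d\<close>
  contains \<open>p\<close>, then \<open>d\<close> can be compared with tangent spaces at real points of the chart. At a point
  of the dense torus the tangent space consists of additive functions on \<open>T\<close>, so \<open>d \<le> N\<close>. At a
  point of the torus of \<open>F\<close> there are \<open>k\<close> independent directions along the torus, and one more
  for each element of \<open>V\<close>, because these are irreducible modulo \<open>L\<close>; so \<open>k + |V| \<le> d\<close>. Now a basis
  of \<open>L\<close> together with \<open>V\<close> generates \<open>T\<close> and has at most \<open>N\<close> elements. Hence it is a basis of
  \<open>T\<close>, and the coordinates along \<open>V\<close> are a smooth sequence with kernel \<open>L\<close> whose chart contains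
  \<open>p\<close>. Real points suffice, also if \<open>p\<close> has positive residue characteristic, since the
  dimension of the chart is the same everywhere. This is \<open>smooth_point_in_chart\<close>, with the bounds
  \<open>dimension_le_rank\<close> and \<open>independent_derivations_le\<close>.

  \<^emph>\<open>Stacks.\<close> By the first part, the substack of a smooth sequence consists of the torsors with an
  equivariant map under which one fixed monomial becomes a unit. For every homogeneous \<open>f\<close> in a
  graded ring \<open>R\<close> the condition that \<open>f\<close> becomes a unit defines an open substack of the quotient
  stack (\<open>inverting_substack_open\<close>), and the union of these substacks for several \<open>f\<close> is the
  quotient of the union of the basic open sets (\<open>union_of_inverting_substacks\<close>); in both cases one
  uses that \<open>1\<close> is a sum of products of elements of opposite degrees in a torsor. This gives the
  last equality of the theorem, and shows that the union lies in the smooth locus. Conversely, an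
  object of the smooth locus has a smooth open substack \<open>V\<close> around each point. Pulling the object
  back to its own total space makes the torsor trivial, so that it becomes the pullback of the atlas
  along the equivariant map; as the atlas is smooth over \<open>V\<close>, the image of the equivariant map
  consists of smooth points (\<open>stack_smooth_locus_subset\<close>).
\<close>

section \<open>Localizations and prime ideals\<close>

lemma exists_prime_containing_ideal:
  assumes "cring R" and J: "ideal J R" and one: "\<one>\<^bsub>R\<^esub> \<notin> J"
  shows "\<exists>Q\<in>Spec R. J \<subseteq> Q"
proof -
  interpret R: cring R by fact
  let ?A = "{I. ideal I R \<and> J \<subseteq> I \<and> \<one>\<^bsub>R\<^esub> \<notin> I}"
  have "\<exists>M\<in>?A. \<forall>Y\<in>?A. M \<subseteq> Y \<longrightarrow> Y = M"
  proof (rule subset_Zorn_nonempty)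
    show "?A \<noteq> {}" using J one by auto
  next
    fix C assume C: "C \<noteq> {}" "subset.chain ?A C"
    then have ch: "I1 \<subseteq> I2 \<or> I2 \<subseteq> I1" if "I1 \<in> C" "I2 \<in> C" for I1 I2
      using that by (auto simp: subset.chain_def)
    from C have CA: "ideal I R" "J \<subseteq> I" "\<one>\<^bsub>R\<^esub> \<notin> I" if "I \<in> C" for I
      using that by (auto simp: subset.chain_def)
    have "ideal (\<Union>C) R"
    proof (rule idealI)
      show "ring R" by (rule R.ring_axioms)
      show "subgroup (\<Union>C) (add_monoid R)"
      proof (rule subgroup.intro)
        show "\<Union>C \<subseteq> carrier (add_monoid R)"
          using CA(1) ideal.Icarr by fastforce
        show "\<one>\<^bsub>add_monoid R\<^esub> \<in> \<Union>C"
          using C(1) CA(1) additive_subgroup.zero_closed ideal.axioms(1) by fastforce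
        fix x assume "x \<in> \<Union>C"
        then show "inv\<^bsub>add_monoid R\<^esub> x \<in> \<Union>C"
          using CA(1) additive_subgroup.a_inv_closed[OF ideal.axioms(1)] unfolding a_inv_def by fast
        fix y assume "y \<in> \<Union>C"
        with \<open>x \<in> \<Union>C\<close> obtain I1 I2 where "I1 \<in> C" "x \<in> I1" "I2 \<in> C" "y \<in> I2" by auto
        with ch[of I1 I2] obtain I where "I \<in> C" "x \<in> I" "y \<in> I" by blast
        then show "x \<otimes>\<^bsub>add_monoid R\<^esub> y \<in> \<Union>C"
          using additive_subgroup.a_closed[OF ideal.axioms(1)[OF CA(1)[of I]]] by auto
      qed
    next
      fix a x assume "a \<in> \<Union>C" "x \<in> carrier R"
      then show "x \<otimes>\<^bsub>R\<^esub> a \<in> \<Union>C" "a \<otimes>\<^bsub>R\<^esub> x \<in> \<Union>C"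
        using CA(1) ideal.I_l_closed ideal.I_r_closed by fast+
    qed
    moreover have "J \<subseteq> \<Union>C" using CA(2) C(1) by blast
    ultimately show "\<Union>C \<in> ?A" using CA(3) by auto
  qed
  then obtain M where M: "ideal M R" "J \<subseteq> M" "\<one>\<^bsub>R\<^esub> \<notin> M"
    and max: "\<And>Y. ideal Y R \<Longrightarrow> \<one>\<^bsub>R\<^esub> \<notin> Y \<Longrightarrow> M \<subseteq> Y \<Longrightarrow> Y = M"
    by auto
  have "maximalideal M R"
  proof (rule maximalidealI[OF M(1)])
    show "carrier R \<noteq> M" using M(3) by auto
    fix Y assume Y: "ideal Y R" "M \<subseteq> Y" "Y \<subseteq> carrier R"
    show "Y = M \<or> Y = carrier R"
      using max[OF Y(1) _ Y(2)] ideal.one_imp_carrier[OF Y(1)] by blast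
  qed
  then show ?thesis using R.maximalideal_prime M(2) by (auto simp: Spec_def)
qed

lemma Spec_one_notin:
  assumes "q \<in> Spec R" shows "\<one>\<^bsub>R\<^esub> \<notin> q"
  using assms ideal.one_imp_carrier primeideal.axioms(1) primeideal.I_notcarr
  unfolding Spec_def by blast

lemma Spec_unit_notin:
  assumes "q \<in> Spec R" "u \<in> Units R" shows "u \<notin> q"
proof
  assume u: "u \<in> q"
  interpret primeideal q R using assms(1) by (simp add: Spec_def)
  have "inv\<^bsub>R\<^esub> u \<otimes>\<^bsub>R\<^esub> u \<in> q" using u assms(2) by (intro I_l_closed) auto
  then show False using Spec_one_notin[OF assms(1)] assms(2) by simp
qed

lemma Spec_mult_iff:
  assumes "q \<in> Spec R" "x \<in> carrier R" "y \<in> carrier R"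
  shows "x \<otimes>\<^bsub>R\<^esub> y \<in> q \<longleftrightarrow> x \<in> q \<or> y \<in> q"
proof -
  interpret primeideal q R using assms(1) by (simp add: Spec_def)
  show ?thesis using I_prime[OF assms(2,3)] I_l_closed[of y x] I_r_closed[of x y] assms(2,3) by auto
qed

lemma Spec_pow_notin:
  assumes "q \<in> Spec R" "x \<in> carrier R" "x \<notin> q" shows "x [^]\<^bsub>R\<^esub> (n::nat) \<notin> q"
proof -
  interpret primeideal q R using assms(1) by (simp add: Spec_def)
  show ?thesis
    by (induct n) (use assms Spec_one_notin[OF assms(1)] Spec_mult_iff[OF assms(1)] in auto)
qed

lemma (in ring_hom_cring) hom_nat_pow:
  "x \<in> carrier R \<Longrightarrow> h (x [^] (n::nat)) = h x [^]\<^bsub>S\<^esub> n"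
  by (induct n) auto

lemma (in ring_hom_cring) hom_Units:
  assumes "u \<in> Units R" shows "h u \<in> Units S"
proof -
  have "h (inv u) \<otimes>\<^bsub>S\<^esub> h u = \<one>\<^bsub>S\<^esub>" "h u \<otimes>\<^bsub>S\<^esub> h (inv u) = \<one>\<^bsub>S\<^esub>"
    using assms by (simp_all add: hom_mult[symmetric] R.Units_closed del: hom_mult)
  then show ?thesis using assms unfolding Units_def[of S] by (auto simp: R.Units_closed)
qed

lemma spec_map_Spec:
  fixes R :: "'a ring" and S :: "'b ring"
  assumes h: "ring_hom_cring R S h" and q: "q \<in> Spec S"
  shows "spec_map R h q \<in> Spec R"
proof -
  interpret ring_hom_cring R S h by fact
  interpret q: primeideal q S using q by (simp add: Spec_def)
  have "ring_hom_ring R S h"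
    by (intro ring_hom_ringI2 R.ring_axioms S.ring_axioms homh)
  then have "ideal (spec_map R h q) R"
    unfolding spec_map_def using ring_hom_ring.ideal_vimage q.is_ideal by blast
  moreover have "carrier R \<noteq> spec_map R h q"
  proof
    assume "carrier R = spec_map R h q"
    then have "\<one>\<^bsub>R\<^esub> \<in> spec_map R h q" using R.one_closed by blast
    then show False using Spec_one_notin[OF q] by (simp add: spec_map_def)
  qed
  ultimately have "primeideal (spec_map R h q) R"
    by (rule primeidealI[OF _ R.is_cring])
      (use Spec_mult_iff[OF q hom_closed hom_closed] in \<open>auto simp: spec_map_def\<close>)
  then show ?thesis by (simp add: Spec_def)
qed

text \<open>The elements of \<open>S\<close> are the fractions with a power of \<open>g\<close> as denominator, and \<open>x / g\<^sup>n = y / g\<^sup>m\<close>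
  holds iff it does so after multiplication by a power of \<open>g\<close>. All facts about localizations below are
  obtained from this by clearing denominators.\<close>

locale localization = ring_hom_cring R S h
  for R :: "'a ring" (structure) and S :: "'b ring" (structure) and h +
  fixes g assumes g [simp, intro]: "g \<in> carrier R" and loc: "localization_away R g S h"
begin

lemma hg_unit: "h g \<in> Units S" using loc by (simp add: localization_away_def)

lemma hgn_unit: "h g [^]\<^bsub>S\<^esub> (n::nat) \<in> Units S"
  using hg_unit by (rule S.Units_pow_closed)

lemma fraction:
  assumes "s \<in> carrier S"
  obtains x n where "x \<in> carrier R" "s \<otimes>\<^bsub>S\<^esub> h g [^]\<^bsub>S\<^esub> (n::nat) = h x"
  using assms loc unfolding localization_away_def by blast

lemma hom_eqD:
  assumes "x \<in> carrier R" "y \<in> carrier R" "h x = h y"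
  obtains n where "g [^] (n::nat) \<otimes> x = g [^] n \<otimes> y"
proof -
  have "h (x \<ominus> y) = \<zero>\<^bsub>S\<^esub>" using assms by (simp add: a_minus_def S.r_neg)
  moreover have "x \<ominus> y \<in> carrier R" using assms by simp
  ultimately obtain n where "g [^] (n::nat) \<otimes> (x \<ominus> y) = \<zero>"
    using loc unfolding localization_away_def by blast
  then have "g [^] n \<otimes> x \<ominus> g [^] n \<otimes> y = \<zero>" using assms
    by (simp add: a_minus_def R.r_distr R.r_minus)
  then have "g [^] n \<otimes> x = g [^] n \<otimes> y" using assms by simp
  then show ?thesis by (rule that)
qed

lemma fraction_add:
  assumes "s \<in> carrier S" "t \<in> carrier S" "x \<in> carrier R" "y \<in> carrier R"
    and "s \<otimes>\<^bsub>S\<^esub> h g [^]\<^bsub>S\<^esub> (n::nat) = h x" and "t \<otimes>\<^bsub>S\<^esub> h g [^]\<^bsub>S\<^esub> (m::nat) = h y"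
  shows "(s \<oplus>\<^bsub>S\<^esub> t) \<otimes>\<^bsub>S\<^esub> h g [^]\<^bsub>S\<^esub> (n + m) = h (x \<otimes> g [^] m \<oplus> y \<otimes> g [^] n)"
proof -
  have "(s \<oplus>\<^bsub>S\<^esub> t) \<otimes>\<^bsub>S\<^esub> h g [^]\<^bsub>S\<^esub> (n + m) =
      (s \<otimes>\<^bsub>S\<^esub> h g [^]\<^bsub>S\<^esub> n) \<otimes>\<^bsub>S\<^esub> h g [^]\<^bsub>S\<^esub> m \<oplus>\<^bsub>S\<^esub> (t \<otimes>\<^bsub>S\<^esub> h g [^]\<^bsub>S\<^esub> m) \<otimes>\<^bsub>S\<^esub> h g [^]\<^bsub>S\<^esub> n"
    using assms(1-4) by (simp add: S.nat_pow_mult[symmetric] S.l_distr S.r_distr S.m_ac)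
  then show ?thesis unfolding assms(5,6) using assms(3,4) by (simp add: hom_nat_pow)
qed

lemma fraction_mult:
  assumes "s \<in> carrier S" "t \<in> carrier S" "x \<in> carrier R" "y \<in> carrier R"
    and "s \<otimes>\<^bsub>S\<^esub> h g [^]\<^bsub>S\<^esub> (n::nat) = h x" and "t \<otimes>\<^bsub>S\<^esub> h g [^]\<^bsub>S\<^esub> (m::nat) = h y"
  shows "(s \<otimes>\<^bsub>S\<^esub> t) \<otimes>\<^bsub>S\<^esub> h g [^]\<^bsub>S\<^esub> (n + m) = h (x \<otimes> y)"
proof -
  have "(s \<otimes>\<^bsub>S\<^esub> t) \<otimes>\<^bsub>S\<^esub> h g [^]\<^bsub>S\<^esub> (n + m) =
      (s \<otimes>\<^bsub>S\<^esub> h g [^]\<^bsub>S\<^esub> n) \<otimes>\<^bsub>S\<^esub> (t \<otimes>\<^bsub>S\<^esub> h g [^]\<^bsub>S\<^esub> m)"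
    using assms(1-4) by (simp add: S.nat_pow_mult[symmetric] S.m_ac)
  then show ?thesis using assms by simp
qed

lemma hom_unique:
  assumes "cring B" and u: "u \<in> ring_hom S B" and v: "v \<in> ring_hom S B"
    and eq: "\<And>x. x \<in> carrier R \<Longrightarrow> u (h x) = v (h x)" and s: "s \<in> carrier S"
  shows "u s = v s"
proof -
  interpret B: cring B by fact
  interpret u: ring_hom_cring S B u by unfold_locales (rule u)
  interpret v: ring_hom_cring S B v by unfold_locales (rule v)
  obtain x n where x: "x \<in> carrier R" "s \<otimes>\<^bsub>S\<^esub> h g [^]\<^bsub>S\<^esub> (n::nat) = h x"
    using s by (rule fraction)
  have "u s \<otimes>\<^bsub>B\<^esub> u (h g [^]\<^bsub>S\<^esub> n) = v s \<otimes>\<^bsub>B\<^esub> v (h g [^]\<^bsub>S\<^esub> n)"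
    using eq[OF x(1)] x(2) s
    by (metis S.Units_closed hgn_unit u.hom_mult v.hom_mult)
  also have "v (h g [^]\<^bsub>S\<^esub> n) = u (h g [^]\<^bsub>S\<^esub> n)"
    using eq[OF g] by (simp add: u.hom_nat_pow v.hom_nat_pow)
  finally show ?thesis
    using u.hom_Units[OF hgn_unit, of n] s B.Units_closed
    by (metis B.Units_l_cancel B.m_comm u.hom_closed v.hom_closed)
qed

text \<open>The value at \<open>x / g\<^sup>n\<close> is forced to be \<open>\<tau> x / \<tau> g\<^sup>n\<close>, and two representations of the same
  fraction give the same value because \<open>\<tau> g\<close> is a unit.\<close>

lemma hom_extends:
  assumes "cring B" and tau: "\<tau> \<in> ring_hom R B" and unit: "\<tau> g \<in> Units B"
  shows "\<exists>\<theta> \<in> ring_hom S B. \<forall>x \<in> carrier R. \<theta> (h x) = \<tau> x"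
proof -
  interpret B: cring B by fact
  interpret t: ring_hom_cring R B \<tau> by unfold_locales (rule tau)
  define P where "P s b \<longleftrightarrow> b \<in> carrier B \<and> (\<exists>x \<in> carrier R. \<exists>n::nat.
    s \<otimes>\<^bsub>S\<^esub> h g [^]\<^bsub>S\<^esub> n = h x \<and> b \<otimes>\<^bsub>B\<^esub> \<tau> g [^]\<^bsub>B\<^esub> n = \<tau> x)" for s b
  have un: "\<tau> g [^]\<^bsub>B\<^esub> (n::nat) \<in> Units B" for n
    using unit by (rule B.Units_pow_closed)
  have inj: "b = b'" if "P s b" "P s b'" "s \<in> carrier S" for s b b'
  proof -
    obtain x n where x: "x \<in> carrier R" "s \<otimes>\<^bsub>S\<^esub> h g [^]\<^bsub>S\<^esub> (n::nat) = h x"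
      "b \<otimes>\<^bsub>B\<^esub> \<tau> g [^]\<^bsub>B\<^esub> n = \<tau> x" "b \<in> carrier B" using \<open>P s b\<close> P_def by auto
    obtain y m where y: "y \<in> carrier R" "s \<otimes>\<^bsub>S\<^esub> h g [^]\<^bsub>S\<^esub> (m::nat) = h y"
      "b' \<otimes>\<^bsub>B\<^esub> \<tau> g [^]\<^bsub>B\<^esub> m = \<tau> y" "b' \<in> carrier B" using \<open>P s b'\<close> P_def by auto
    have "h (x \<otimes> g [^] m) = (s \<otimes>\<^bsub>S\<^esub> h g [^]\<^bsub>S\<^esub> n) \<otimes>\<^bsub>S\<^esub> h g [^]\<^bsub>S\<^esub> m"
      using x by (simp add: hom_nat_pow)
    also have "\<dots> = (s \<otimes>\<^bsub>S\<^esub> h g [^]\<^bsub>S\<^esub> m) \<otimes>\<^bsub>S\<^esub> h g [^]\<^bsub>S\<^esub> n"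
      using that by (simp add: S.m_ac)
    also have "\<dots> = h (y \<otimes> g [^] n)" using y by (simp add: hom_nat_pow)
    finally obtain k where k: "g [^] (k::nat) \<otimes> (x \<otimes> g [^] m) = g [^] k \<otimes> (y \<otimes> g [^] n)"
      using hom_eqD x(1) y(1) g by (metis R.m_closed R.nat_pow_closed)
    have "\<tau> (g [^] k \<otimes> (x \<otimes> g [^] m)) = \<tau> (g [^] k \<otimes> (y \<otimes> g [^] n))" using k by simp
    then have "\<tau> g [^]\<^bsub>B\<^esub> k \<otimes>\<^bsub>B\<^esub> (\<tau> x \<otimes>\<^bsub>B\<^esub> \<tau> g [^]\<^bsub>B\<^esub> m) =
        \<tau> g [^]\<^bsub>B\<^esub> k \<otimes>\<^bsub>B\<^esub> (\<tau> y \<otimes>\<^bsub>B\<^esub> \<tau> g [^]\<^bsub>B\<^esub> n)"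
      using x(1) y(1) by (simp add: t.hom_nat_pow)
    then have "\<tau> x \<otimes>\<^bsub>B\<^esub> \<tau> g [^]\<^bsub>B\<^esub> m = \<tau> y \<otimes>\<^bsub>B\<^esub> \<tau> g [^]\<^bsub>B\<^esub> n"
      using un[of k] x(1) y(1) by simp
    then have "(\<tau> g [^]\<^bsub>B\<^esub> n \<otimes>\<^bsub>B\<^esub> \<tau> g [^]\<^bsub>B\<^esub> m) \<otimes>\<^bsub>B\<^esub> b = (\<tau> g [^]\<^bsub>B\<^esub> n \<otimes>\<^bsub>B\<^esub> \<tau> g [^]\<^bsub>B\<^esub> m) \<otimes>\<^bsub>B\<^esub> b'"
      unfolding x(3)[symmetric] y(3)[symmetric] using x(4) y(4) by (simp add: B.m_ac)
    then show ?thesis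
      using un[of n] un[of m] x(4) y(4) by (metis B.Units_l_cancel B.Units_m_closed)
  qed
  have ex: "\<exists>b. P s b" if s: "s \<in> carrier S" for s
  proof -
    obtain x n where x: "x \<in> carrier R" "s \<otimes>\<^bsub>S\<^esub> h g [^]\<^bsub>S\<^esub> (n::nat) = h x"
      using s by (rule fraction)
    have "P s (\<tau> x \<otimes>\<^bsub>B\<^esub> inv\<^bsub>B\<^esub> (\<tau> g [^]\<^bsub>B\<^esub> n))"
      unfolding P_def using x un[of n] by (auto simp: B.m_assoc B.Units_closed intro!: bexI[of _ x])
    then show ?thesis ..
  qed
  define \<theta> where "\<theta> s = (SOME b. P s b)" for s
  have th: "P s (\<theta> s)" if "s \<in> carrier S" for s
    unfolding \<theta>_def using ex[OF that] by (rule someI_ex)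
  have theq: "\<theta> s = b" if "P s b" "s \<in> carrier S" for s b
    using inj[OF th that(1)] that by blast
  have Ph: "P (h x) (\<tau> x)" if "x \<in> carrier R" for x
    unfolding P_def using that by (auto intro!: bexI[of _ x] exI[of _ "0::nat"])
  have "\<theta> \<in> ring_hom S B"
  proof (rule ring_hom_memI)
    fix s assume s: "s \<in> carrier S"
    then show "\<theta> s \<in> carrier B" using th P_def by blast
    fix s' assume s': "s' \<in> carrier S"
    obtain x n where x: "x \<in> carrier R" "s \<otimes>\<^bsub>S\<^esub> h g [^]\<^bsub>S\<^esub> (n::nat) = h x"
      "\<theta> s \<otimes>\<^bsub>B\<^esub> \<tau> g [^]\<^bsub>B\<^esub> n = \<tau> x" "\<theta> s \<in> carrier B" using th[OF s] P_def by auto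
    obtain y m where y: "y \<in> carrier R" "s' \<otimes>\<^bsub>S\<^esub> h g [^]\<^bsub>S\<^esub> (m::nat) = h y"
      "\<theta> s' \<otimes>\<^bsub>B\<^esub> \<tau> g [^]\<^bsub>B\<^esub> m = \<tau> y" "\<theta> s' \<in> carrier B" using th[OF s'] P_def by auto
    have "(\<theta> s \<otimes>\<^bsub>B\<^esub> \<theta> s') \<otimes>\<^bsub>B\<^esub> \<tau> g [^]\<^bsub>B\<^esub> (n + m) = \<tau> (x \<otimes> y)"
    proof -
      have "(\<theta> s \<otimes>\<^bsub>B\<^esub> \<theta> s') \<otimes>\<^bsub>B\<^esub> \<tau> g [^]\<^bsub>B\<^esub> (n + m) =
         (\<theta> s \<otimes>\<^bsub>B\<^esub> \<tau> g [^]\<^bsub>B\<^esub> n) \<otimes>\<^bsub>B\<^esub> (\<theta> s' \<otimes>\<^bsub>B\<^esub> \<tau> g [^]\<^bsub>B\<^esub> m)"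
        using x(1,4) y(1,4) by (simp add: B.nat_pow_mult[symmetric] B.m_ac)
      then show ?thesis using x y by simp
    qed
    then have "P (s \<otimes>\<^bsub>S\<^esub> s') (\<theta> s \<otimes>\<^bsub>B\<^esub> \<theta> s')"
      unfolding P_def using x(1,4) y(1,4) fraction_mult[OF s s' x(1) y(1) x(2) y(2)] by blast
    then show "\<theta> (s \<otimes>\<^bsub>S\<^esub> s') = \<theta> s \<otimes>\<^bsub>B\<^esub> \<theta> s'" using s s' by (intro theq) auto
    have "(\<theta> s \<oplus>\<^bsub>B\<^esub> \<theta> s') \<otimes>\<^bsub>B\<^esub> \<tau> g [^]\<^bsub>B\<^esub> (n + m) = \<tau> (x \<otimes> g [^] m \<oplus> y \<otimes> g [^] n)"
    proof -
      have "(\<theta> s \<oplus>\<^bsub>B\<^esub> \<theta> s') \<otimes>\<^bsub>B\<^esub> \<tau> g [^]\<^bsub>B\<^esub> (n + m) =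
         (\<theta> s \<otimes>\<^bsub>B\<^esub> \<tau> g [^]\<^bsub>B\<^esub> n) \<otimes>\<^bsub>B\<^esub> \<tau> g [^]\<^bsub>B\<^esub> m \<oplus>\<^bsub>B\<^esub> (\<theta> s' \<otimes>\<^bsub>B\<^esub> \<tau> g [^]\<^bsub>B\<^esub> m) \<otimes>\<^bsub>B\<^esub> \<tau> g [^]\<^bsub>B\<^esub> n"
        using x(1,4) y(1,4) by (simp add: B.nat_pow_mult[symmetric] B.l_distr B.r_distr B.m_ac)
      then show ?thesis using x y by (simp add: t.hom_nat_pow)
    qed
    then have "P (s \<oplus>\<^bsub>S\<^esub> s') (\<theta> s \<oplus>\<^bsub>B\<^esub> \<theta> s')"
      unfolding P_def using x(1,4) y(1,4) fraction_add[OF s s' x(1) y(1) x(2) y(2)]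
      by (blast intro: R.m_closed R.a_closed R.nat_pow_closed g B.a_closed)
    then show "\<theta> (s \<oplus>\<^bsub>S\<^esub> s') = \<theta> s \<oplus>\<^bsub>B\<^esub> \<theta> s'" using s s' by (intro theq) auto
  next
    show "\<theta> \<one>\<^bsub>S\<^esub> = \<one>\<^bsub>B\<^esub>" using theq[OF Ph[OF R.one_closed]] by simp
  qed
  moreover have "\<theta> (h x) = \<tau> x" if "x \<in> carrier R" for x
    using theq[OF Ph[OF that]] that by simp
  ultimately show ?thesis by blast
qed

text \<open>The prime is the set of fractions with numerator in \<open>p\<close>. As \<open>g\<close> is outside of \<open>p\<close>, cancelling
  powers of \<open>g\<close> does not lead out of \<open>p\<close>, so it does not matter which numerator is taken.\<close>

lemma prime_extends:
  assumes p: "p \<in> Spec R" and gp: "g \<notin> p"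
  shows "\<exists>q \<in> Spec S. spec_map R h q = p"
proof -
  interpret p: primeideal p R using p by (simp add: Spec_def)
  define q where "q = {s \<in> carrier S. \<exists>x \<in> p. \<exists>n::nat. s \<otimes>\<^bsub>S\<^esub> h g [^]\<^bsub>S\<^esub> n = h x}"
  have mem: "x \<in> p" if sq: "s \<in> q" and xR: "x \<in> carrier R"
    and sx: "s \<otimes>\<^bsub>S\<^esub> h g [^]\<^bsub>S\<^esub> (n::nat) = h x" for s x n
  proof -
    obtain y m where y: "y \<in> p" "s \<otimes>\<^bsub>S\<^esub> h g [^]\<^bsub>S\<^esub> (m::nat) = h y" "s \<in> carrier S"
      using sq q_def by auto
    then have yR: "y \<in> carrier R" by (simp add: p.Icarr)
    have "h (x \<otimes> g [^] m) = (s \<otimes>\<^bsub>S\<^esub> h g [^]\<^bsub>S\<^esub> n) \<otimes>\<^bsub>S\<^esub> h g [^]\<^bsub>S\<^esub> m"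
      using sx xR by (simp add: hom_nat_pow)
    also have "\<dots> = (s \<otimes>\<^bsub>S\<^esub> h g [^]\<^bsub>S\<^esub> m) \<otimes>\<^bsub>S\<^esub> h g [^]\<^bsub>S\<^esub> n"
      using y(3) by (simp add: S.m_ac)
    also have "\<dots> = h (y \<otimes> g [^] n)" using y yR by (simp add: hom_nat_pow)
    finally obtain k where "g [^] (k::nat) \<otimes> (x \<otimes> g [^] m) = g [^] k \<otimes> (y \<otimes> g [^] n)"
      using hom_eqD xR yR g by (metis R.m_closed R.nat_pow_closed)
    moreover have "g [^] k \<otimes> (y \<otimes> g [^] n) \<in> p"
      using y(1) by (intro p.I_l_closed p.I_r_closed) auto
    ultimately show "x \<in> p"
      using xR Spec_mult_iff[OF p, of "g [^] k" "x \<otimes> g [^] m"] Spec_mult_iff[OF p xR, of "g [^] m"]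
        Spec_pow_notin[OF p g gp] by auto
  qed
  have memI: "s \<in> q" if "s \<in> carrier S" "x \<in> p" "s \<otimes>\<^bsub>S\<^esub> h g [^]\<^bsub>S\<^esub> (n::nat) = h x" for s x n
    using that q_def by auto
  have "primeideal q S"
  proof (intro primeidealI idealI S.ring_axioms S.is_cring subgroup.intro)
    show "q \<subseteq> carrier (add_monoid S)" using q_def by auto
    show "\<one>\<^bsub>add_monoid S\<^esub> \<in> q" by (rule memI[of _ "\<zero>" 0]) auto
  next
    fix s assume s: "s \<in> q"
    then obtain x n where x: "x \<in> p" "s \<otimes>\<^bsub>S\<^esub> h g [^]\<^bsub>S\<^esub> (n::nat) = h x" and sS: "s \<in> carrier S"
      using q_def by auto
    have xR: "x \<in> carrier R" using x p.Icarr by simp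
    show "inv\<^bsub>add_monoid S\<^esub> s \<in> q"
      unfolding a_inv_def[symmetric]
      by (rule memI[of _ "\<ominus> x" n]) (use x sS xR in \<open>auto simp: S.l_minus\<close>)
    fix s' assume "s' \<in> q"
    then obtain y m where y: "y \<in> p" "s' \<otimes>\<^bsub>S\<^esub> h g [^]\<^bsub>S\<^esub> (m::nat) = h y" and s'S: "s' \<in> carrier S"
      using q_def by auto
    have yR: "y \<in> carrier R" using y p.Icarr by simp
    show "s \<otimes>\<^bsub>add_monoid S\<^esub> s' \<in> q"
      using memI[OF _ _ fraction_add[OF sS s'S xR yR x(2) y(2)]] x(1) y(1) sS s'S
      by (auto intro!: p.a_closed p.I_r_closed)
  next
    fix s t assume s: "s \<in> q" and t: "t \<in> carrier S"
    then obtain x n where x: "x \<in> p" "s \<otimes>\<^bsub>S\<^esub> h g [^]\<^bsub>S\<^esub> (n::nat) = h x" and sS: "s \<in> carrier S"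
      using q_def by auto
    have xR: "x \<in> carrier R" using x p.Icarr by simp
    obtain y m where y: "y \<in> carrier R" "t \<otimes>\<^bsub>S\<^esub> h g [^]\<^bsub>S\<^esub> (m::nat) = h y"
      using t by (rule fraction)
    show "s \<otimes>\<^bsub>S\<^esub> t \<in> q"
      using memI[OF _ _ fraction_mult[OF sS t xR y(1) x(2) y(2)]] x(1) y(1) sS t
      by (auto intro!: p.I_r_closed)
    then show "t \<otimes>\<^bsub>S\<^esub> s \<in> q" using sS t by (simp add: S.m_comm)
  next
    show "carrier S \<noteq> q"
    proof
      assume "carrier S = q"
      then have "\<one> \<in> p" using mem[of "\<one>\<^bsub>S\<^esub>" "\<one>" 0] by auto
      then show False using Spec_one_notin[OF p] by simp
    qed
  next
    fix s t assume s: "s \<in> carrier S" and t: "t \<in> carrier S" and st: "s \<otimes>\<^bsub>S\<^esub> t \<in> q"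
    obtain x n where x: "x \<in> carrier R" "s \<otimes>\<^bsub>S\<^esub> h g [^]\<^bsub>S\<^esub> (n::nat) = h x"
      using s by (rule fraction)
    obtain y m where y: "y \<in> carrier R" "t \<otimes>\<^bsub>S\<^esub> h g [^]\<^bsub>S\<^esub> (m::nat) = h y"
      using t by (rule fraction)
    have "x \<otimes> y \<in> p" using mem[OF st _ fraction_mult[OF s t x(1) y(1) x(2) y(2)]] x y by auto
    then show "s \<in> q \<or> t \<in> q" using p.I_prime x y memI s t by blast
  qed
  moreover have "spec_map R h q = p"
  proof (intro Set.set_eqI iffI)
    fix x assume "x \<in> spec_map R h q"
    then show "x \<in> p" using mem[of "h x" x 0] by (auto simp: spec_map_def)
  next
    fix x assume "x \<in> p"
    then show "x \<in> spec_map R h q" using memI[of "h x" x 0] p.Icarr by (auto simp: spec_map_def)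
  qed
  ultimately show ?thesis by (auto simp: Spec_def)
qed

lemma spec_map_image: "spec_map R h ` Spec S = {p \<in> Spec R. g \<notin> p}"
proof (intro Set.set_eqI iffI)
  fix p assume "p \<in> spec_map R h ` Spec S"
  then show "p \<in> {p \<in> Spec R. g \<notin> p}"
    using spec_map_Spec[OF ring_hom_cring_axioms] Spec_unit_notin[OF _ hg_unit] by (auto simp: spec_map_def)
next
  fix p assume "p \<in> {p \<in> Spec R. g \<notin> p}"
  then obtain q where "q \<in> Spec S" "spec_map R h q = p" using prime_extends by blast
  then show "p \<in> spec_map R h ` Spec S" by (metis imageI)
qed

end

lemma localizationI:
  assumes "cring R" "cring S" "g \<in> carrier R" "localization_away R g S h"
  shows "localization R S h g"
  using assms
  by (simp add: localization_def ring_hom_cring_def ring_hom_cring_axioms_def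
      localization_axioms_def localization_away_def)

lemma localization_away_comp_iso:
  assumes "cring R" "cring S" "cring S'" "g \<in> carrier R"
    and loc: "localization_away R g S h" and k: "k \<in> ring_iso S S'"
  shows "localization_away R g S' (k \<circ> h)"
proof -
  interpret L: localization R S h g by (rule localizationI) fact+
  interpret S': cring S' by fact
  interpret k: ring_hom_cring S S' k by unfold_locales (use k in \<open>auto simp: ring_iso_def\<close>)
  have bij: "bij_betw k (carrier S) (carrier S')" using k by (auto simp: ring_iso_def)
  show ?thesis unfolding localization_away_def
  proof (intro conjI ballI impI)
    show "k \<circ> h \<in> ring_hom R S'" using L.homh k.homh by (rule ring_hom_trans)
    show "(k \<circ> h) g \<in> Units S'" using k.hom_Units[OF L.hg_unit] by simp
    fix s' assume "s' \<in> carrier S'"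
    then obtain s where s: "s \<in> carrier S" "s' = k s" using bij by (auto simp: bij_betw_def)
    obtain x n where x: "x \<in> carrier R" "s \<otimes>\<^bsub>S\<^esub> h g [^]\<^bsub>S\<^esub> (n::nat) = h x"
      using s(1) by (rule L.fraction)
    have "s' \<otimes>\<^bsub>S'\<^esub> (k \<circ> h) g [^]\<^bsub>S'\<^esub> n = k (s \<otimes>\<^bsub>S\<^esub> h g [^]\<^bsub>S\<^esub> n)"
      using s by (simp add: k.hom_nat_pow)
    then show "\<exists>x\<in>carrier R. \<exists>n::nat. s' \<otimes>\<^bsub>S'\<^esub> (k \<circ> h) g [^]\<^bsub>S'\<^esub> n = (k \<circ> h) x"
      using x by (intro bexI[of _ x] exI[of _ n]) simp_all
  next
    fix x assume x: "x \<in> carrier R" "(k \<circ> h) x = \<zero>\<^bsub>S'\<^esub>"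
    then have "k (h x) = k \<zero>\<^bsub>S\<^esub>" by simp
    then have "h x = \<zero>\<^bsub>S\<^esub>"
      using inj_onD[OF bij_betw_imp_inj_on[OF bij]] x(1) by simp
    then show "\<exists>n::nat. g [^]\<^bsub>R\<^esub> n \<otimes>\<^bsub>R\<^esub> x = \<zero>\<^bsub>R\<^esub>"
      using loc x(1) by (auto simp: localization_away_def)
  qed
qed

lemma localization_away_iso_comp:
  assumes "cring R" "cring R'" "cring S" "g \<in> carrier R"
    and loc: "localization_away R g S h" and k: "k \<in> ring_iso R' R" and g': "g' \<in> carrier R'" "k g' = g"
  shows "localization_away R' g' S (h \<circ> k)"
proof -
  interpret L: localization R S h g by (rule localizationI) fact+
  interpret R': cring R' by fact
  interpret k: ring_hom_cring R' R k by unfold_locales (use k in \<open>auto simp: ring_iso_def\<close>)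
  have bij: "bij_betw k (carrier R') (carrier R)" using k by (auto simp: ring_iso_def)
  show ?thesis unfolding localization_away_def
  proof (intro conjI ballI impI)
    show "h \<circ> k \<in> ring_hom R' S" using k.homh L.homh by (rule ring_hom_trans)
    show "(h \<circ> k) g' \<in> Units S" using L.hg_unit g' by simp
    fix s assume "s \<in> carrier S"
    then obtain x n where x: "x \<in> carrier R" "s \<otimes>\<^bsub>S\<^esub> h g [^]\<^bsub>S\<^esub> (n::nat) = h x"
      by (rule L.fraction)
    then obtain x' where "x' \<in> carrier R'" "k x' = x"
      using bij_betw_imp_surj_on[OF bij] by (metis imageE)
    with x show "\<exists>x\<in>carrier R'. \<exists>n::nat. s \<otimes>\<^bsub>S\<^esub> (h \<circ> k) g' [^]\<^bsub>S\<^esub> n = (h \<circ> k) x" using g' by auto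
  next
    fix x assume x: "x \<in> carrier R'" "(h \<circ> k) x = \<zero>\<^bsub>S\<^esub>"
    then obtain n where "g [^]\<^bsub>R\<^esub> (n::nat) \<otimes>\<^bsub>R\<^esub> k x = \<zero>\<^bsub>R\<^esub>"
      using loc by (auto simp: localization_away_def)
    then have "k (g' [^]\<^bsub>R'\<^esub> n \<otimes>\<^bsub>R'\<^esub> x) = k \<zero>\<^bsub>R'\<^esub>" using x g' by (simp add: k.hom_nat_pow)
    then have "g' [^]\<^bsub>R'\<^esub> n \<otimes>\<^bsub>R'\<^esub> x = \<zero>\<^bsub>R'\<^esub>"
      using inj_onD[OF bij_betw_imp_inj_on[OF bij]] x(1) g' by simp
    then show "\<exists>n::nat. g' [^]\<^bsub>R'\<^esub> n \<otimes>\<^bsub>R'\<^esub> x = \<zero>\<^bsub>R'\<^esub>" ..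
  qed
qed

section \<open>Monoid rings and their evaluations\<close>

definition additive_submonoid :: "'m::comm_monoid_add set \<Rightarrow> bool" where
  "additive_submonoid M \<longleftrightarrow> 0 \<in> M \<and> (\<forall>a\<in>M. \<forall>b\<in>M. a + b \<in> M)"

abbreviation xmon :: "'m \<Rightarrow> 'm \<Rightarrow>\<^sub>0 int" where
  "xmon t \<equiv> Poly_Mapping.single t 1"

lemma monoid_ring_simps [simp]:
  "carrier (monoid_ring M) = {p. Poly_Mapping.keys p \<subseteq> M}"
  "x \<otimes>\<^bsub>monoid_ring M\<^esub> y = x * y" "x \<oplus>\<^bsub>monoid_ring M\<^esub> y = x + y"
  "\<one>\<^bsub>monoid_ring M\<^esub> = 1" "\<zero>\<^bsub>monoid_ring M\<^esub> = 0"
  by (simp_all add: monoid_ring_def)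

lemma keys_mult_subset:
  assumes "additive_submonoid M" "Poly_Mapping.keys p \<subseteq> M" "Poly_Mapping.keys q \<subseteq> M"
  shows "Poly_Mapping.keys (p * q) \<subseteq> M"
  using keys_mult[of p q] assms unfolding additive_submonoid_def by blast

lemma keys_add_subset:
  assumes "Poly_Mapping.keys p \<subseteq> M" "Poly_Mapping.keys q \<subseteq> M"
  shows "Poly_Mapping.keys (p + q) \<subseteq> M"
  using Poly_Mapping.keys_add[of p q] assms by blast

lemma keys_one_subset: "additive_submonoid M \<Longrightarrow> Poly_Mapping.keys (1 :: 'm::comm_monoid_add \<Rightarrow>\<^sub>0 int) \<subseteq> M"
  by (simp add: additive_submonoid_def)

lemma cring_monoid_ring:
  assumes "additive_submonoid M" shows "cring (monoid_ring M)"
proof (rule cringI)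
  show "abelian_group (monoid_ring M)"
  proof (rule abelian_groupI)
    fix x assume "x \<in> carrier (monoid_ring M)"
    then show "\<exists>y\<in>carrier (monoid_ring M). y \<oplus>\<^bsub>monoid_ring M\<^esub> x = \<zero>\<^bsub>monoid_ring M\<^esub>"
      by (intro bexI[of _ "- x"]) auto
  qed (auto simp: algebra_simps keys_add_subset dest: subsetD[OF Poly_Mapping.keys_add])
  show "Group.comm_monoid (monoid_ring M)"
    by (rule comm_monoidI)
      (use keys_one_subset[OF assms] in \<open>simp_all add: keys_mult_subset[OF assms] mult_ac\<close>)
qed (simp add: algebra_simps)

lemma monoid_ring_pow [simp]: "x [^]\<^bsub>monoid_ring M\<^esub> (n::nat) = x ^ n"
  by (induct n) (simp_all add: nat_pow_def mult.commute)

lemma xmon_mult: "xmon s * xmon t = xmon (s + t)" by (simp add: mult_single)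

lemma xmon_zero: "xmon 0 = 1" by simp

lemma poly_mapping_as_sum:
  fixes p :: "'m \<Rightarrow>\<^sub>0 int"
  assumes "finite K" "Poly_Mapping.keys p \<subseteq> K"
  shows "p = (\<Sum>m\<in>K. Poly_Mapping.single m (Poly_Mapping.lookup p m))"
proof (rule poly_mapping_eqI)
  fix k
  show "Poly_Mapping.lookup p k =
      Poly_Mapping.lookup (\<Sum>m\<in>K. Poly_Mapping.single m (Poly_Mapping.lookup p m)) k"
    using assms by (auto simp: lookup_sum lookup_single when_def in_keys_iff)
qed

lemma poly_mapping_additive_induct [consumes 1, case_names zero single add]:
  fixes p :: "'m \<Rightarrow>\<^sub>0 int"
  assumes p: "Poly_Mapping.keys p \<subseteq> M" and z: "P 0"
    and s: "\<And>m c. m \<in> M \<Longrightarrow> P (Poly_Mapping.single m c)"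
    and a: "\<And>p q. Poly_Mapping.keys p \<subseteq> M \<Longrightarrow> Poly_Mapping.keys q \<subseteq> M \<Longrightarrow> P p \<Longrightarrow> P q \<Longrightarrow> P (p + q)"
  shows "P p"
proof -
  have "P (\<Sum>m\<in>K. Poly_Mapping.single m (Poly_Mapping.lookup p m)) \<and>
      Poly_Mapping.keys (\<Sum>m\<in>K. Poly_Mapping.single m (Poly_Mapping.lookup p m)) \<subseteq> M"
    if "finite K" "K \<subseteq> M" for K
    using that
  proof (induct K)
    case (insert x K)
    then show ?case
      by (auto intro!: a s keys_add_subset dest: subsetD[OF Poly_Mapping.keys_add] split: if_splits)
  qed (simp add: z)
  from this[of "Poly_Mapping.keys p"] show ?thesis
    using poly_mapping_as_sum[of "Poly_Mapping.keys p" p] p by simp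
qed

text \<open>The linear extension of \<open>\<chi>\<close> to the monoid ring. It is a ring homomorphism when \<open>\<chi>\<close> is a
  character, and all ring homomorphisms on monoid rings are of this form.\<close>

definition mon_eval :: "('m \<Rightarrow> 'a::comm_ring_1) \<Rightarrow> ('m \<Rightarrow>\<^sub>0 int) \<Rightarrow> 'a" where
  "mon_eval \<chi> p = (\<Sum>m\<in>Poly_Mapping.keys p. of_int (Poly_Mapping.lookup p m) * \<chi> m)"

lemma mon_eval_superset:
  assumes "finite K" "Poly_Mapping.keys p \<subseteq> K"
  shows "mon_eval \<chi> p = (\<Sum>m\<in>K. of_int (Poly_Mapping.lookup p m) * \<chi> m)"
  unfolding mon_eval_def using assms by (intro sum.mono_neutral_left) (auto simp: in_keys_iff)

lemma mon_eval_add: "mon_eval \<chi> (p + q) = mon_eval \<chi> p + mon_eval \<chi> q"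
proof -
  let ?K = "Poly_Mapping.keys p \<union> Poly_Mapping.keys q"
  have "Poly_Mapping.keys (p + q) \<subseteq> ?K" by (rule Poly_Mapping.keys_add)
  then show ?thesis
    by (simp add: mon_eval_superset[of ?K] lookup_add ring_distribs sum.distrib)
qed

lemma mon_eval_zero [simp]: "mon_eval \<chi> 0 = 0" by (simp add: mon_eval_def)

lemma mon_eval_single [simp]: "mon_eval \<chi> (Poly_Mapping.single m c) = of_int c * \<chi> m"
  by (simp add: mon_eval_superset[of "{m}"])

lemma mon_eval_one [simp]: "mon_eval \<chi> 1 = \<chi> 0"
  by (metis mon_eval_single xmon_zero mult_1 of_int_1)

lemma mon_eval_uminus: "mon_eval \<chi> (- p) = - mon_eval \<chi> p"
  by (simp add: mon_eval_def sum_negf)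

lemma mon_eval_diff: "mon_eval \<chi> (p - q) = mon_eval \<chi> p - mon_eval \<chi> q"
  using mon_eval_add[of \<chi> p "- q"] by (simp add: mon_eval_uminus)

lemma mon_eval_sum: "mon_eval \<chi> (\<Sum>i\<in>A. F i) = (\<Sum>i\<in>A. mon_eval \<chi> (F i))"
  by (induct A rule: infinite_finite_induct) (simp_all add: mon_eval_add)

text \<open>Characters may take the value \<open>0\<close>: these are the points of the spectrum on the boundary of the
  torus.\<close>

definition char_on :: "'m::comm_monoid_add set \<Rightarrow> ('m \<Rightarrow> 'a::comm_ring_1) \<Rightarrow> bool" where
  "char_on M \<chi> \<longleftrightarrow> \<chi> 0 = 1 \<and> (\<forall>s\<in>M. \<forall>t\<in>M. \<chi> (s + t) = \<chi> s * \<chi> t)"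

lemma mon_eval_mult:
  assumes "char_on M \<chi>" and p: "Poly_Mapping.keys p \<subseteq> M" and q: "Poly_Mapping.keys q \<subseteq> M"
  shows "mon_eval \<chi> (p * q) = mon_eval \<chi> p * mon_eval \<chi> q"
  using p
proof (induct p rule: poly_mapping_additive_induct)
  case (single m c)
  show ?case using q
  proof (induct q rule: poly_mapping_additive_induct)
    case (single m' c')
    then show ?case using assms(1) \<open>m \<in> M\<close> by (simp add: mult_single char_on_def mult_ac)
  qed (simp_all add: mon_eval_add ring_distribs)
qed (simp_all add: mon_eval_add ring_distribs)

text \<open>A ring given by a type class, as a target for homomorphisms of rings with carrier. It is used
  for the reals and for the dual numbers.\<close>

definition type_ring :: "'a::comm_ring_1 ring" where
  "type_ring = \<lparr>carrier = UNIV, monoid.mult = (*), one = 1, ring.zero = 0, add = (+)\<rparr>"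

lemma type_ring_simps [simp]:
  "carrier type_ring = UNIV"
  "x \<otimes>\<^bsub>type_ring\<^esub> y = x * y" "x \<oplus>\<^bsub>type_ring\<^esub> y = x + y"
  "\<one>\<^bsub>type_ring\<^esub> = 1" "\<zero>\<^bsub>type_ring\<^esub> = 0"
  by (simp_all add: type_ring_def)

lemma cring_type_ring: "cring (type_ring :: 'a::comm_ring_1 ring)"
proof (rule cringI)
  show "abelian_group (type_ring :: 'a ring)"
    by (rule abelian_groupI) (auto simp: algebra_simps intro: exI[of _ "- x" for x])
  show "Group.comm_monoid (type_ring :: 'a ring)"
    by (rule comm_monoidI) (auto simp: algebra_simps)
qed (simp add: algebra_simps)

lemma Units_type_ringI: "x * y = 1 \<Longrightarrow> x \<in> Units type_ring"
  unfolding Units_def by (auto simp: mult.commute)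

lemma Units_type_ring_field: "(x::'a::field) \<in> Units type_ring \<longleftrightarrow> x \<noteq> 0"
  unfolding Units_def by (auto intro: exI[of _ "inverse x"])

lemma mon_eval_hom:
  assumes "char_on M \<chi>"
  shows "mon_eval \<chi> \<in> ring_hom (monoid_ring M) type_ring"
  using assms by (intro ring_hom_memI) (auto simp: mon_eval_add mon_eval_mult, simp add: char_on_def)

lemma ring_hom_eq_mon_eval:
  fixes u :: "('m::comm_monoid_add \<Rightarrow>\<^sub>0 int) \<Rightarrow> 'a::comm_ring_1"
  assumes M: "additive_submonoid M" and u: "u \<in> ring_hom (monoid_ring M) type_ring"
    and p: "Poly_Mapping.keys p \<subseteq> M"
  shows "u p = mon_eval (\<lambda>m. u (xmon m)) p"
proof -
  interpret R: cring "monoid_ring M" using M by (rule cring_monoid_ring)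
  interpret A: cring "type_ring :: 'a ring" by (rule cring_type_ring)
  interpret u: ring_hom_cring "monoid_ring M" "type_ring :: 'a ring" u by unfold_locales (rule u)
  have add: "u (a + b) = u a + u b" if "Poly_Mapping.keys a \<subseteq> M" "Poly_Mapping.keys b \<subseteq> M" for a b
    using u.hom_add[of a b] that by simp
  have z: "u 0 = 0" using u.hom_zero by simp
  have sg: "u (Poly_Mapping.single m c) = of_int c * u (xmon m)" if m: "m \<in> M" for m c
  proof -
    have nat: "u (Poly_Mapping.single m (int k)) = of_nat k * u (xmon m)" for k
    proof (induct k)
      case (Suc k)
      have "Poly_Mapping.single m (int (Suc k)) = xmon m + Poly_Mapping.single m (int k)"
        by (simp add: single_add[symmetric])
      then show ?case using add[of "xmon m" "Poly_Mapping.single m (int k)"] m Suc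
        by (simp add: ring_distribs)
    qed (simp add: z)
    show ?thesis
    proof (cases "c \<ge> 0")
      case True
      then show ?thesis using nat[of "nat c"] by simp
    next
      case False
      have "u (Poly_Mapping.single m c) + u (Poly_Mapping.single m (- c)) = 0"
        using add[of "Poly_Mapping.single m c" "Poly_Mapping.single m (- c)"] m z
        by (simp add: single_add[symmetric])
      then have "u (Poly_Mapping.single m c) = - u (Poly_Mapping.single m (int (nat (- c))))"
        using False by (simp add: eq_neg_iff_add_eq_0)
      then show ?thesis using nat[of "nat (- c)"] False by simp
    qed
  qed
  show ?thesis using p
  proof (induct p rule: poly_mapping_additive_induct)
    case (single m c)
    then show ?case unfolding mon_eval_single by (rule sg)
  qed (simp_all add: z add mon_eval_add)
qed

subsection \<open>Evaluation of polynomials\<close>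

abbreviation poly_exps :: "nat \<Rightarrow> (nat \<Rightarrow>\<^sub>0 nat) set" where
  "poly_exps n \<equiv> {m. Poly_Mapping.keys m \<subseteq> {..<n}}"

lemma poly_exps_submonoid: "additive_submonoid (poly_exps n)"
  unfolding additive_submonoid_def using Poly_Mapping.keys_add by fastforce

lemma carrier_int_poly_ring: "carrier (int_poly_ring n) = {p. Poly_Mapping.keys p \<subseteq> poly_exps n}"
  by (simp add: int_poly_ring_def)

lemma cring_int_poly_ring: "cring (int_poly_ring n)"
  unfolding int_poly_ring_def by (intro cring_monoid_ring poly_exps_submonoid)

definition monomial_value :: "nat \<Rightarrow> (nat \<Rightarrow> 'a::comm_ring_1) \<Rightarrow> (nat \<Rightarrow>\<^sub>0 nat) \<Rightarrow> 'a" where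
  "monomial_value n a m = (\<Prod>j<n. a j ^ Poly_Mapping.lookup m j)"

lemma monomial_value_char: "char_on M (monomial_value n a)"
  by (simp add: char_on_def monomial_value_def lookup_add power_add prod.distrib)

abbreviation poly_eval :: "nat \<Rightarrow> (nat \<Rightarrow> 'a::comm_ring_1) \<Rightarrow> int_mpoly \<Rightarrow> 'a" where
  "poly_eval n a \<equiv> mon_eval (monomial_value n a)"

abbreviation Var :: "nat \<Rightarrow> int_mpoly" where
  "Var j \<equiv> xmon (Poly_Mapping.single j 1)"

lemma monomial_value_zero [simp]: "monomial_value n a 0 = 1"
  by (simp add: monomial_value_def)

lemma poly_eval_mult: "poly_eval n a (p * q) = poly_eval n a p * poly_eval n a q"
  by (rule mon_eval_mult[of UNIV]) (simp_all add: monomial_value_char)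

lemma poly_eval_Var: "j < n \<Longrightarrow> poly_eval n a (Var j) = a j"
  by (simp add: monomial_value_def lookup_single when_def if_distrib[where f="\<lambda>k. a _ ^ k"] prod.delta cong: if_cong)

lemma poly_eval_prod: "poly_eval n a (\<Prod>i\<in>A. F i) = (\<Prod>i\<in>A. poly_eval n a (F i))"
  by (induct A rule: infinite_finite_induct) (simp_all add: poly_eval_mult)

lemma poly_eval_of_int: "poly_eval n a (of_int k) = of_int k"
proof -
  have "(of_int k :: int_mpoly) = Poly_Mapping.single 0 (of_int k)" by (simp only: single_of_int)
  then have "poly_eval n a (of_int k) = poly_eval n a (Poly_Mapping.single 0 k)"
    by (simp only: of_int_eq_id id_apply)
  also have "\<dots> = of_int k" by (simp only: mon_eval_single) (simp add: monomial_value_def)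
  finally show ?thesis .
qed

lemma Var_carrier: "j < n \<Longrightarrow> Var j \<in> carrier (int_poly_ring n)"
  by (simp add: carrier_int_poly_ring)

lemma Var_power: "Var j ^ k = xmon (Poly_Mapping.single j k)"
  by (induct k) (simp_all add: xmon_mult single_add[symmetric])

lemma xmon_sum: "xmon (\<Sum>j\<in>A. F j) = (\<Prod>j\<in>A. xmon (F j))"
  by (induct A rule: infinite_finite_induct) (simp_all add: xmon_mult[symmetric])

lemma xmon_as_prod_Var:
  assumes "Poly_Mapping.keys m \<subseteq> {..<n}"
  shows "xmon m = (\<Prod>j<n. Var j ^ Poly_Mapping.lookup m j)"
proof -
  have "m = (\<Sum>j<n. Poly_Mapping.single j (Poly_Mapping.lookup m j))"
  proof (rule poly_mapping_eqI)
    fix k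
    show "Poly_Mapping.lookup m k =
      Poly_Mapping.lookup (\<Sum>j<n. Poly_Mapping.single j (Poly_Mapping.lookup m j)) k"
      using assms by (auto simp: lookup_sum lookup_single when_def in_keys_iff)
  qed
  then show ?thesis by (metis (no_types, lifting) Var_power xmon_sum prod.cong)
qed

lemma keys_power_subset:
  fixes p :: "'m::comm_monoid_add \<Rightarrow>\<^sub>0 int"
  assumes "additive_submonoid M" "Poly_Mapping.keys p \<subseteq> M"
  shows "Poly_Mapping.keys (p ^ k) \<subseteq> M"
  by (induct k) (simp_all add: assms keys_mult_subset keys_one_subset del: keys_one)

lemma keys_prod_subset:
  fixes F :: "'i \<Rightarrow> 'm::comm_monoid_add \<Rightarrow>\<^sub>0 int"
  assumes "additive_submonoid M" "\<And>i. i \<in> A \<Longrightarrow> Poly_Mapping.keys (F i) \<subseteq> M"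
  shows "Poly_Mapping.keys (\<Prod>i\<in>A. F i) \<subseteq> M"
  using assms(2)
  by (induct A rule: infinite_finite_induct)
    (simp_all add: assms(1) keys_mult_subset keys_one_subset del: keys_one)

lemma keys_sum_subset:
  fixes F :: "'i \<Rightarrow> 'm::comm_monoid_add \<Rightarrow>\<^sub>0 int"
  assumes "\<And>i. i \<in> A \<Longrightarrow> Poly_Mapping.keys (F i) \<subseteq> M"
  shows "Poly_Mapping.keys (\<Sum>i\<in>A. F i) \<subseteq> M"
  using Poly_Mapping.keys_sum[of F A] assms by blast

lemma ring_hom_eq_poly_eval:
  assumes u: "u \<in> ring_hom (int_poly_ring n) type_ring" and p: "p \<in> carrier (int_poly_ring n)"
  shows "u p = poly_eval n (\<lambda>j. u (Var j)) p"
proof -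
  note u' = u[unfolded int_poly_ring_def]
  have mult: "u (a * b) = u a * u b"
    if "Poly_Mapping.keys a \<subseteq> poly_exps n" "Poly_Mapping.keys b \<subseteq> poly_exps n" for a b
    using ring_hom_mult[OF u', of a b] that by simp
  have one: "u 1 = 1" using ring_hom_one[OF u'] by simp
  note kp = keys_power_subset[OF poly_exps_submonoid, of _ n]
  have pow: "u (a ^ k) = u a ^ k" if "Poly_Mapping.keys a \<subseteq> poly_exps n" for a k
    by (induct k) (use one mult kp that in auto)
  have prod: "u (\<Prod>j\<in>A. F j) = (\<Prod>j\<in>A. u (F j))"
    if "\<And>j. j \<in> A \<Longrightarrow> Poly_Mapping.keys (F j) \<subseteq> poly_exps n" for A :: "nat set" and F
    using that
    by (induct A rule: infinite_finite_induct)
      (simp_all add: one mult keys_prod_subset[OF poly_exps_submonoid])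
  have mon: "u (xmon m) = monomial_value n (\<lambda>j. u (Var j)) m" if "m \<in> poly_exps n" for m
  proof -
    have V: "Poly_Mapping.keys (Var j) \<subseteq> poly_exps n" if "j \<in> {..<n}" for j using that by auto
    have "u (xmon m) = u (\<Prod>j<n. Var j ^ Poly_Mapping.lookup m j)"
      using xmon_as_prod_Var that by auto
    also have "\<dots> = (\<Prod>j<n. u (Var j ^ Poly_Mapping.lookup m j))"
      by (rule prod) (use kp V in auto)
    also have "\<dots> = (\<Prod>j<n. u (Var j) ^ Poly_Mapping.lookup m j)"
      by (rule prod.cong) (use pow V in auto)
    finally show ?thesis by (simp add: monomial_value_def)
  qed
  have pk: "Poly_Mapping.keys p \<subseteq> poly_exps n" using p by (simp add: carrier_int_poly_ring)
  have "u p = mon_eval (\<lambda>m. u (xmon m)) p"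
    by (rule ring_hom_eq_mon_eval[OF poly_exps_submonoid u' pk])
  also have "\<dots> = poly_eval n (\<lambda>j. u (Var j)) p"
    unfolding mon_eval_def by (rule sum.cong) (use mon pk in auto)
  finally show ?thesis .
qed

subsection \<open>Dual numbers\<close>

text \<open>The ring \<open>\<real>[\<epsilon>] / (\<epsilon>\<^sup>2)\<close>. A homomorphism into it is a real point with a tangent vector, so that
  differential calculus on charts becomes a matter of evaluating polynomials.\<close>

datatype dual = Dual (re: real) (ep: real)

instantiation dual :: comm_ring_1
begin
definition "0 = Dual 0 0"
definition "1 = Dual 1 0"
definition "x + y = Dual (re x + re y) (ep x + ep y)"
definition "x - y = Dual (re x - re y) (ep x - ep y)"
definition "- x = Dual (- re x) (- ep x)"
definition "x * y = Dual (re x * re y) (re x * ep y + ep x * re y)"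
instance
  by standard
    (auto simp: zero_dual_def one_dual_def plus_dual_def minus_dual_def uminus_dual_def
      times_dual_def algebra_simps dual.expand)
end

lemma dual_sel [simp]:
  "re 0 = 0" "ep 0 = 0" "re 1 = 1" "ep 1 = 0"
  "re (x + y) = re x + re y" "ep (x + y) = ep x + ep y"
  "re (x * y) = re x * re y" "ep (x * y) = re x * ep y + ep x * re y"
  "re (- x) = - re x" "ep (- x) = - ep x"
  "re (x - y) = re x - re y" "ep (x - y) = ep x - ep y"
  by (simp_all add: zero_dual_def one_dual_def plus_dual_def minus_dual_def uminus_dual_def times_dual_def)

lemma dual_of_int [simp]: "re (of_int k) = of_int k" "ep (of_int k) = 0"
proof -
  have "re (of_nat k) = of_nat k \<and> ep (of_nat k) = 0" for k by (induct k) auto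
  then have n: "re (of_nat k) = of_nat k" "ep (of_nat k) = 0" for k by auto
  show "re (of_int k) = of_int k" "ep (of_int k) = 0"
    by (cases k; simp add: n)+
qed

lemma dual_sum: "re (\<Sum>i\<in>A. F i) = (\<Sum>i\<in>A. re (F i))" "ep (\<Sum>i\<in>A. F i) = (\<Sum>i\<in>A. ep (F i))"
  by (induct A rule: infinite_finite_induct) simp_all

lemma dual_power: "re (x ^ k) = re x ^ k" "ep (x ^ k) = of_nat k * re x ^ (k - 1) * ep x"
proof -
  show r: "re (x ^ k) = re x ^ k" for k by (induct k) simp_all
  show "ep (x ^ k) = of_nat k * re x ^ (k - 1) * ep x"
  proof (induct k)
    case (Suc k)
    then show ?case by (cases k) (simp_all add: r algebra_simps)
  qed simp
qed

lemma dual_re_prod: "re (\<Prod>i\<in>A. F i) = (\<Prod>i\<in>A. re (F i))"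
  by (induct A rule: infinite_finite_induct) simp_all

lemma dual_ep_prod:
  assumes "finite A"
  shows "ep (\<Prod>i\<in>A. F i) = (\<Sum>i\<in>A. ep (F i) * (\<Prod>j\<in>A-{i}. re (F j)))"
  using assms
proof (induct A)
  case (insert x A)
  have "(\<Sum>i\<in>A. ep (F i) * (\<Prod>j\<in>insert x A-{i}. re (F j))) =
     (\<Sum>i\<in>A. re (F x) * (ep (F i) * (\<Prod>j\<in>A-{i}. re (F j))))"
  proof (rule sum.cong)
    fix i assume i: "i \<in> A"
    then have "insert x A - {i} = insert x (A - {i})" using insert(2) by auto
    then show "ep (F i) * (\<Prod>j\<in>insert x A-{i}. re (F j)) =
        re (F x) * (ep (F i) * (\<Prod>j\<in>A-{i}. re (F j)))"
      using insert(1,2) by (simp add: algebra_simps)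
  qed simp
  then show ?case using insert by (simp add: dual_re_prod sum_distrib_left)
qed simp

lemma Units_dual: "re x \<noteq> 0 \<Longrightarrow> x \<in> Units type_ring"
  by (rule Units_type_ringI[of _ "Dual (1 / re x) (- ep x / (re x)\<^sup>2)"])
    (simp add: dual.expand one_dual_def times_dual_def power2_eq_square)

text \<open>The formula that defines \<open>partial_deriv\<close> sums over the support of a polynomial; a sum of two
  polynomials may have smaller support, but summands for coefficients \<open>0\<close> vanish.\<close>

lemma additive_keys_sum:
  fixes G :: "'m \<Rightarrow> int \<Rightarrow> 'b::comm_monoid_add"
  assumes "\<And>m. G m 0 = 0" "\<And>m a b. G m (a + b) = G m a + G m b"
  shows "(\<Sum>m\<in>Poly_Mapping.keys (p + q). G m (Poly_Mapping.lookup (p + q) m)) =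
    (\<Sum>m\<in>Poly_Mapping.keys p. G m (Poly_Mapping.lookup p m)) +
    (\<Sum>m\<in>Poly_Mapping.keys q. G m (Poly_Mapping.lookup q m))"
  by (rule setsum_keys_plus_distrib) (use assms in auto)

lemma partial_deriv_add: "partial_deriv j (p + q) = partial_deriv j p + partial_deriv j q"
  unfolding partial_deriv_def
  by (rule additive_keys_sum) (simp_all add: single_add[symmetric] ring_distribs)

lemma partial_deriv_zero [simp]: "partial_deriv j 0 = 0"
  by (simp add: partial_deriv_def)

lemma partial_deriv_single:
  "partial_deriv j (Poly_Mapping.single m c) =
    Poly_Mapping.single (m - Poly_Mapping.single j 1) (c * int (Poly_Mapping.lookup m j))"
  by (cases "c = 0") (simp_all add: partial_deriv_def)

lemma poly_eval_dual_re: "re (poly_eval n a p) = poly_eval n (\<lambda>j. re (a j)) p"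
  by (simp add: mon_eval_def dual_sum monomial_value_def dual_re_prod dual_power)

text \<open>Taylor expansion to first order.\<close>

lemma poly_eval_dual_ep:
  "ep (poly_eval n a p) = (\<Sum>j<n. ep (a j) * poly_eval n (\<lambda>j. re (a j)) (partial_deriv j p))"
proof -
  have "Poly_Mapping.keys p \<subseteq> UNIV" by simp
  then show ?thesis
  proof (induct p rule: poly_mapping_additive_induct)
    case (single m c)
    let ?x = "\<lambda>j. re (a j)"
    have *: "ep (a j ^ Poly_Mapping.lookup m j) * (\<Prod>i\<in>{..<n}-{j}. ?x i ^ Poly_Mapping.lookup m i) =
        ep (a j) * (of_nat (Poly_Mapping.lookup m j) * monomial_value n ?x (m - Poly_Mapping.single j 1))"
      if "j < n" for j
    proof -
      have "(\<Prod>i<n. ?x i ^ Poly_Mapping.lookup (m - Poly_Mapping.single j 1) i) =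
        ?x j ^ (Poly_Mapping.lookup m j - 1) * (\<Prod>i\<in>{..<n}-{j}. ?x i ^ Poly_Mapping.lookup m i)"
        using that by (subst prod.remove[of _ j])
          (auto simp: lookup_minus lookup_single intro!: prod.cong)
      then show ?thesis by (simp add: monomial_value_def dual_power mult_ac)
    qed
    have "ep (monomial_value n a m) =
       (\<Sum>j<n. ep (a j) * (of_nat (Poly_Mapping.lookup m j) * monomial_value n ?x (m - Poly_Mapping.single j 1)))"
      unfolding monomial_value_def[of n a] by (simp add: dual_ep_prod dual_power(1) *)
    then show ?case
      by (simp add: partial_deriv_single sum_distrib_left mult_ac)
  qed (simp_all add: mon_eval_add partial_deriv_add ring_distribs sum.distrib)
qed

lemma poly_eval_jacobian_minor:
  "poly_eval n a (jacobian_minor c f) =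
    (\<Sum>\<pi> | \<pi> permutes {..<c}. of_int (sign \<pi>) * (\<Prod>i<c. poly_eval n a (partial_deriv (\<pi> i) (f i))))"
  by (simp add: jacobian_minor_def mon_eval_sum poly_eval_mult poly_eval_prod poly_eval_of_int)

lemma partial_deriv_carrier:
  assumes "p \<in> carrier (int_poly_ring n)"
  shows "partial_deriv j p \<in> carrier (int_poly_ring n)"
proof -
  have "Poly_Mapping.keys (m - Poly_Mapping.single j (1::nat)) \<subseteq> Poly_Mapping.keys m" for m
    by (auto simp: in_keys_iff lookup_minus)
  then have "m - Poly_Mapping.single j 1 \<in> poly_exps n" if "m \<in> Poly_Mapping.keys p" for m
    using assms that unfolding carrier_int_poly_ring by blast
  then show ?thesis unfolding carrier_int_poly_ring partial_deriv_def mem_Collect_eq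
    by (intro keys_sum_subset) simp
qed

lemma keys_of_int_subset:
  "additive_submonoid M \<Longrightarrow> Poly_Mapping.keys (of_int k :: 'm::comm_monoid_add \<Rightarrow>\<^sub>0 int) \<subseteq> M"
  unfolding single_of_int[symmetric] by (auto simp: additive_submonoid_def split: if_splits)

lemma jacobian_minor_carrier:
  assumes "f ` {..<c} \<subseteq> carrier (int_poly_ring n)"
  shows "jacobian_minor c f \<in> carrier (int_poly_ring n)"
proof -
  have "Poly_Mapping.keys (partial_deriv j (f i)) \<subseteq> poly_exps n" if "i < c" for i j
    using partial_deriv_carrier[of "f i" n j] assms that by (auto simp: carrier_int_poly_ring)
  then show ?thesis unfolding carrier_int_poly_ring jacobian_minor_def mem_Collect_eq
    by (intro keys_sum_subset keys_mult_subset keys_prod_subset keys_of_int_subset poly_exps_submonoid) auto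
qed

subsection \<open>Homomorphisms from quotient rings\<close>

lemma quotient_hom_extends:
  assumes P: "cring P" and B: "cring B" and I: "ideal I P" and u: "u \<in> ring_hom P B"
    and ker: "\<And>x. x \<in> I \<Longrightarrow> u x = \<zero>\<^bsub>B\<^esub>"
  shows "\<exists>v \<in> ring_hom (P Quot I) B. \<forall>x \<in> carrier P. v (I +>\<^bsub>P\<^esub> x) = u x"
proof -
  interpret P: cring P by fact
  interpret B: cring B by fact
  interpret I: ideal I P by fact
  interpret u: ring_hom_cring P B u by unfold_locales (rule u)
  define v where "v C = u (SOME x. x \<in> carrier P \<and> C = I +>\<^bsub>P\<^esub> x)" for C
  have v: "v (I +>\<^bsub>P\<^esub> x) = u x" if x: "x \<in> carrier P" for x
  proof -
    let ?y = "SOME y. y \<in> carrier P \<and> I +>\<^bsub>P\<^esub> x = I +>\<^bsub>P\<^esub> y"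
    have y: "?y \<in> carrier P" "I +>\<^bsub>P\<^esub> x = I +>\<^bsub>P\<^esub> ?y"
      using someI[of "\<lambda>y. y \<in> carrier P \<and> I +>\<^bsub>P\<^esub> x = I +>\<^bsub>P\<^esub> y" x] x by auto
    then have "x \<ominus>\<^bsub>P\<^esub> ?y \<in> I"
      using x P.quotient_eq_iff_same_a_r_cos[OF I] by blast
    then have "u (x \<ominus>\<^bsub>P\<^esub> ?y) = \<zero>\<^bsub>B\<^esub>" by (rule ker)
    then have "u x \<ominus>\<^bsub>B\<^esub> u ?y = \<zero>\<^bsub>B\<^esub>" using x y(1) by (simp add: a_minus_def)
    then show ?thesis unfolding v_def using x y(1) by simp
  qed
  have rep: "\<exists>x \<in> carrier P. C = I +>\<^bsub>P\<^esub> x" if "C \<in> carrier (P Quot I)" for C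
    using that by (auto simp: FactRing_def A_RCOSETS_def' )
  note hom = I.rcos_ring_hom
  have "v \<in> ring_hom (P Quot I) B"
  proof (rule ring_hom_memI)
    fix C assume "C \<in> carrier (P Quot I)"
    then obtain x where x: "x \<in> carrier P" "C = I +>\<^bsub>P\<^esub> x" using rep by blast
    then show "v C \<in> carrier B" by (simp add: v)
    fix D assume "D \<in> carrier (P Quot I)"
    then obtain y where y: "y \<in> carrier P" "D = I +>\<^bsub>P\<^esub> y" using rep by blast
    show "v (C \<otimes>\<^bsub>P Quot I\<^esub> D) = v C \<otimes>\<^bsub>B\<^esub> v D"
      using x y by (simp add: ring_hom_mult[OF hom, symmetric] v)
    show "v (C \<oplus>\<^bsub>P Quot I\<^esub> D) = v C \<oplus>\<^bsub>B\<^esub> v D"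
      using x y by (simp add: ring_hom_add[OF hom, symmetric] v)
  next
    show "v \<one>\<^bsub>P Quot I\<^esub> = \<one>\<^bsub>B\<^esub>"
      by (simp add: ring_hom_one[OF hom, symmetric] v)
  qed
  then show ?thesis using v by blast
qed

lemma quotient_rep:
  assumes "C \<in> carrier (P Quot I)" obtains x where "x \<in> carrier P" "C = I +>\<^bsub>P\<^esub> x"
  using assms by (auto simp: FactRing_def A_RCOSETS_def')

lemma genideal_hom_zero:
  assumes P: "cring P" and B: "cring B" and u: "u \<in> ring_hom P B"
    and A: "A \<subseteq> carrier P" "\<And>x. x \<in> A \<Longrightarrow> u x = \<zero>\<^bsub>B\<^esub>" and x: "x \<in> genideal P A"
  shows "u x = \<zero>\<^bsub>B\<^esub>"
proof -
  interpret P: cring P by fact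
  interpret B: cring B by fact
  have uu: "ring_hom_ring P B u" by (intro ring_hom_ringI2 P.ring_axioms B.ring_axioms u)
  have "ideal (a_kernel P B u) P" by (rule ring_hom_ring.kernel_is_ideal[OF uu])
  moreover have "A \<subseteq> a_kernel P B u" using A by (auto simp: a_kernel_def')
  ultimately have "genideal P A \<subseteq> a_kernel P B u" by (rule P.genideal_minimal)
  then show ?thesis using x by (auto simp: a_kernel_def')
qed

section \<open>Linear algebra over the reals\<close>

text \<open>Induction on the number of equations: an equation with a non-zero coefficient eliminates one
  unknown.\<close>

lemma underdetermined_system:
  fixes A :: "'j \<Rightarrow> 'i \<Rightarrow> real"
  assumes "finite J" "finite I" "card J < card I"
  shows "\<exists>x. (\<exists>i\<in>I. x i \<noteq> 0) \<and> (\<forall>j\<in>J. (\<Sum>i\<in>I. A j i * x i) = 0)"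
  using assms
proof (induct J arbitrary: I A rule: finite_induct)
  case empty
  then have "I \<noteq> {}" by force
  then obtain i where "i \<in> I" by blast
  then show ?case by (intro exI[of _ "\<lambda>_. 1"] conjI bexI[of _ i]) simp_all
next
  case (insert j J)
  show ?case
  proof (cases "\<forall>i\<in>I. A j i = 0")
    case True
    have "card J < card I" using insert(1,2,5) by simp
    from insert(3)[OF insert(4) this, of A]
    obtain x where x: "\<exists>i\<in>I. x i \<noteq> 0" "\<forall>l\<in>J. (\<Sum>i\<in>I. A l i * x i) = 0"
      by (elim exE conjE)
    have "(\<Sum>i\<in>I. A j i * x i) = 0" using True by simp
    with x show ?thesis by (intro exI[of _ x] conjI) simp_all
  next
    case False
    then obtain k where k: "k \<in> I" "A j k \<noteq> 0" by auto
    let ?I = "I - {k}"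
    let ?A = "\<lambda>l i. A l i - A l k * A j i / A j k"
    have "card J < card ?I" using insert(1,2,4,5) k by simp
    from insert(3)[OF finite_Diff[OF insert(4)] this, of ?A]
    obtain x where x: "\<exists>i\<in>?I. x i \<noteq> 0" "\<forall>l\<in>J. (\<Sum>i\<in>?I. ?A l i * x i) = 0"
      by (elim exE conjE)
    define s where "s = (\<Sum>i\<in>?I. A j i * x i)"
    define y where "y = x(k := - s / A j k)"
    have sum: "(\<Sum>i\<in>I. A l i * y i) = A l k * (- s / A j k) + (\<Sum>i\<in>?I. A l i * x i)" for l
    proof -
      have "(\<Sum>i\<in>I. A l i * y i) = A l k * y k + (\<Sum>i\<in>?I. A l i * y i)"
        using k insert(4) by (simp only: sum.remove[of I k])
      also have "(\<Sum>i\<in>?I. A l i * y i) = (\<Sum>i\<in>?I. A l i * x i)"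
        by (rule sum.cong) (auto simp: y_def)
      finally show ?thesis by (simp add: y_def)
    qed
    have "(\<Sum>i\<in>I. A l i * y i) = 0" if "l \<in> J" for l
    proof -
      have "(\<Sum>i\<in>?I. ?A l i * x i) = (\<Sum>i\<in>?I. A l i * x i - A l k / A j k * (A j i * x i))"
        by (rule sum.cong) (simp_all add: left_diff_distrib)
      also have "\<dots> = (\<Sum>i\<in>?I. A l i * x i) - A l k / A j k * s"
        by (simp add: s_def sum_distrib_left sum_subtractf)
      finally have "(\<Sum>i\<in>?I. ?A l i * x i) = (\<Sum>i\<in>?I. A l i * x i) - A l k / A j k * s" .
      then show ?thesis using x(2) that by (simp add: sum)
    qed
    moreover have "(\<Sum>i\<in>I. A j i * y i) = 0" using k by (simp add: sum s_def[symmetric])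
    moreover have "\<exists>i\<in>I. y i \<noteq> 0" using x(1) by (auto simp: y_def)
    ultimately show ?thesis by (intro exI[of _ y] conjI) simp_all
  qed
qed

lemma nonzero_determinant_kernel:
  fixes a :: "nat \<Rightarrow> nat \<Rightarrow> real"
  assumes det: "(\<Sum>\<pi> | \<pi> permutes {..<c}. of_int (sign \<pi>) * (\<Prod>i<c. a i (\<pi> i))) \<noteq> 0"
    and ker: "\<And>i. i < c \<Longrightarrow> (\<Sum>j<c. a i j * x j) = 0" and j: "j < c"
  shows "x j = 0"
proof -
  define A where "A = mat c c (\<lambda>(i, j). a i j)"
  have A: "A \<in> carrier_mat c c" by (simp add: A_def)
  have "det A = (\<Sum>\<pi> | \<pi> permutes {..<c}. of_int (sign \<pi>) * (\<Prod>i<c. a i (\<pi> i)))"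
    unfolding det_def'[OF A] atLeast0LessThan
  proof (rule sum.cong)
    fix \<pi> assume "\<pi> \<in> {\<pi>. \<pi> permutes {..<c}}"
    then have "\<pi> i < c" if "i < c" for i using permutes_in_image[of \<pi> "{..<c}" i] that by simp
    then show "signof \<pi> * (\<Prod>i<c. A $$ (i, \<pi> i)) = of_int (sign \<pi>) * (\<Prod>i<c. a i (\<pi> i))"
      by (simp add: A_def)
  qed simp
  then have "det A \<noteq> 0" using det by simp
  moreover have "A *\<^sub>v vec c x = 0\<^sub>v c"
    by (rule eq_vecI) (simp_all add: A_def scalar_prod_def ker atLeast0LessThan)
  ultimately have "vec c x = 0\<^sub>v c" using det_0_iff_vec_prod_zero[OF A] vec_carrier by blast
  then show ?thesis using j by (metis index_vec index_zero_vec(1))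
qed

section \<open>Finitely generated free groups\<close>

definition zmul :: "int \<Rightarrow> 't::ab_group_add \<Rightarrow> 't" where
  "zmul k t = (if k \<ge> 0 then ((+) t ^^ nat k) 0 else - ((+) t ^^ nat (- k)) 0)"

lemma zmul_of_nat: "zmul (int k) t = ((+) t ^^ k) 0" by (simp add: zmul_def)

lemma zmul_uminus_left: "zmul (- k) t = - zmul k t" by (auto simp: zmul_def)

lemma zmul_zero [simp]: "zmul 0 t = 0" by (simp add: zmul_def)

lemma zmul_succ: "zmul (k + 1) t = zmul k t + t"
proof (cases "k \<ge> 0")
  case True
  then show ?thesis by (simp add: zmul_def nat_add_distrib add.commute)
next
  case False
  then obtain n where n: "k = - int (Suc n)" by (metis int_cases not_le of_nat_0_le_iff)
  then have "zmul k t = - (t + zmul (int n) t)"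
    using zmul_uminus_left[of "int (Suc n)" t] zmul_of_nat[of "Suc n" t] zmul_of_nat[of n t] by simp
  moreover have "zmul (k + 1) t = - zmul (int n) t"
    using n zmul_uminus_left[of "int n" t] by simp
  ultimately show ?thesis by simp
qed

lemma zmul_additive:
  assumes "f 0 = (0::'b::ab_group_add)" "\<And>k. f (k + 1) = f k + c"
  shows "f k = zmul k c"
  by (induct k rule: int_induct[of _ 0])
    (use assms zmul_succ[of _ c] in \<open>auto, metis add_right_cancel diff_add_cancel\<close>)

lemma zmul_one [simp]: "zmul 1 t = t" using zmul_succ[of 0 t] by simp

lemma zmul_add_left: "zmul (k + l) t = zmul k t + zmul l t"
proof -
  have "zmul (k + l) t - zmul k t = zmul l t"
    by (rule zmul_additive[of "\<lambda>l. zmul (k + l) t - zmul k t"])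
      (simp_all add: add.assoc[symmetric] zmul_succ)
  then show ?thesis by (simp add: algebra_simps)
qed

lemma zmul_diff_left: "zmul (k - l) t = zmul k t - zmul l t"
  using zmul_add_left[of k "- l" t] by (simp add: zmul_uminus_left)

lemma zmul_additive_image:
  assumes "\<And>s t. f (s + t) = f s + f (t :: 'a::ab_group_add)"
  shows "f (zmul k t) = zmul k (f t :: 'b::ab_group_add)"
proof (rule zmul_additive[of "\<lambda>k. f (zmul k t)"])
  show "f (zmul 0 t) = 0" using assms[of 0 0] by simp
qed (simp add: zmul_succ assms)

lemma zmul_add_right: "zmul k (s + t) = zmul k s + zmul k t"
  by (rule zmul_additive[of "\<lambda>k. zmul k s + zmul k t", symmetric]) (simp_all add: zmul_succ algebra_simps)

lemma zmul_zero_right [simp]: "zmul k 0 = 0"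
  using zmul_add_right[of k 0 0] by simp

lemma zmul_uminus_right: "zmul k (- t) = - zmul k t"
  using zmul_add_right[of k t "- t"] by (simp add: eq_neg_iff_add_eq_0 add.commute)

lemma zmul_int [simp]: "zmul k (x::int) = k * x"
  by (rule zmul_additive[of "\<lambda>k. k * x", symmetric]) (simp_all add: ring_distribs)

lemma zmul_real [simp]: "zmul k (x::real) = of_int k * x"
  by (rule zmul_additive[of "\<lambda>k. of_int k * x", symmetric]) (simp_all add: ring_distribs)

definition additive_subgp :: "'t::ab_group_add set \<Rightarrow> bool" where
  "additive_subgp H \<longleftrightarrow> 0 \<in> H \<and> (\<forall>s\<in>H. \<forall>t\<in>H. s - t \<in> H)"

lemma additive_subgpD:
  assumes "additive_subgp H"
  shows "0 \<in> H" "s \<in> H \<Longrightarrow> t \<in> H \<Longrightarrow> s - t \<in> H" "s \<in> H \<Longrightarrow> - s \<in> H"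
    "s \<in> H \<Longrightarrow> t \<in> H \<Longrightarrow> s + t \<in> H"
proof -
  show z: "0 \<in> H" and d: "s \<in> H \<Longrightarrow> t \<in> H \<Longrightarrow> s - t \<in> H" for s t
    using assms by (auto simp: additive_subgp_def)
  show m: "s \<in> H \<Longrightarrow> - s \<in> H" for s using d[OF z, of s] by simp
  show "s \<in> H \<Longrightarrow> t \<in> H \<Longrightarrow> s + t \<in> H" using d[of s "- t"] m[of t] by simp
qed

lemma additive_subgp_zmul:
  assumes H: "additive_subgp H" and t: "t \<in> H" shows "zmul k t \<in> H"
proof -
  have "((+) t ^^ n) 0 \<in> H" for n
    by (induct n) (use additive_subgpD[OF H] t in auto)
  then show ?thesis unfolding zmul_def using additive_subgpD(3)[OF H] by auto
qed

lemma additive_subgp_sum: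
  assumes H: "additive_subgp H" and t: "\<And>i. i \<in> A \<Longrightarrow> F i \<in> H" shows "(\<Sum>i\<in>A. F i) \<in> H"
  using t by (induct A rule: infinite_finite_induct) (use additive_subgpD[OF H] in auto)

definition zbasis :: "'t::ab_group_add set \<Rightarrow> nat \<Rightarrow> (nat \<Rightarrow> 't) \<Rightarrow> bool" where
  "zbasis H k b \<longleftrightarrow> (\<forall>i<k. b i \<in> H) \<and> (\<forall>t\<in>H. \<exists>c. t = (\<Sum>i<k. zmul (c i) (b i))) \<and>
     (\<forall>c. (\<Sum>i<k. zmul (c i) (b i)) = 0 \<longrightarrow> (\<forall>i<k. c i = 0))"

text \<open>Induction on the number of coordinates: the last coordinate maps \<open>H\<close> onto \<open>d \<int>\<close> for some \<open>d\<close>,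
  and an element with last coordinate \<open>d\<close> completes a basis of its kernel to a basis of \<open>H\<close>.\<close>

lemma subgroup_has_zbasis:
  fixes \<kappa> :: "nat \<Rightarrow> 't::ab_group_add \<Rightarrow> int"
  assumes add: "\<And>i s t. \<kappa> i (s + t) = \<kappa> i s + \<kappa> i t" and H: "additive_subgp H"
    and sep: "\<And>t. t \<in> H \<Longrightarrow> (\<And>i. i < n \<Longrightarrow> \<kappa> i t = 0) \<Longrightarrow> t = 0"
  shows "\<exists>k b. zbasis H k b"
  using H sep
proof (induct n arbitrary: H)
  case 0
  then have "\<forall>t\<in>H. t = 0" by blast
  then show ?case by (intro exI[of _ 0]) (auto simp: zbasis_def)
next
  case (Suc n)
  note Hs = additive_subgpD[OF Suc(2)]
  have kz: "\<kappa> i (zmul k t) = k * \<kappa> i t" for i k t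
    using zmul_additive_image[of "\<kappa> i" k t] add by simp
  have kd: "\<kappa> i (s - t) = \<kappa> i s - \<kappa> i t" for i s t
    using add[of i "s - t" t] by simp
  let ?H = "{t \<in> H. \<kappa> n t = 0}"
  have k0: "\<kappa> i 0 = 0" for i using add[of i 0 0] by simp
  have H': "additive_subgp ?H" using Hs by (auto simp: additive_subgp_def kd k0)
  have "\<exists>k b. zbasis ?H k b"
  proof (rule Suc(1)[OF H'])
    fix t assume "t \<in> ?H" "\<And>i. i < n \<Longrightarrow> \<kappa> i t = 0"
    then show "t = 0" by (intro Suc(3)) (auto simp: less_Suc_eq)
  qed
  then obtain k b where b: "zbasis ?H k b" by blast
  show ?case
  proof (cases "?H = H")
    case True
    with b show ?thesis by auto
  next
    case False
    then obtain t0 where t0: "t0 \<in> H" "\<kappa> n t0 \<noteq> 0" by auto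
    let ?P = "\<lambda>d. 0 < d \<and> (\<exists>t\<in>H. \<kappa> n t = int d)"
    have "\<kappa> n (- t0) = - \<kappa> n t0" using kd[of n 0 t0] k0 by simp
    then have "?P (nat \<bar>\<kappa> n t0\<bar>)" using t0 Hs(3)[of t0]
      by (cases "\<kappa> n t0 > 0") (auto intro: bexI[of _ t0] bexI[of _ "- t0"])
    then have P: "?P (LEAST d. ?P d)" by (rule LeastI)
    define d where "d = (LEAST d. ?P d)"
    obtain h where d: "0 < d" and h: "h \<in> H" "\<kappa> n h = int d" using P d_def by auto
    have least: "d \<le> e" if "?P e" for e using that unfolding d_def by (rule Least_le)
    define b' where "b' = b(k := h)"
    have sumb': "(\<Sum>i<Suc k. zmul (c i) (b' i)) = (\<Sum>i<k. zmul (c i) (b i)) + zmul (c k) h" for c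
      by (simp add: b'_def)
    have "zbasis H (Suc k) b'"
      unfolding zbasis_def
    proof (intro conjI ballI allI impI)
      fix i assume "i < Suc k"
      then show "b' i \<in> H" using b h(1) by (auto simp: b'_def zbasis_def less_Suc_eq)
    next
      fix t assume t: "t \<in> H"
      define q where "q = \<kappa> n t div int d"
      have th: "t - zmul q h \<in> H" using t h(1) Hs(2) additive_subgp_zmul[OF Suc(2)] by blast
      have "\<kappa> n (t - zmul q h) = \<kappa> n t mod int d"
        by (simp add: kd kz h(2) q_def minus_div_mult_eq_mod)
      moreover have "\<kappa> n t mod int d = 0"
      proof (rule ccontr)
        assume "\<kappa> n t mod int d \<noteq> 0"
        then have "0 < \<kappa> n t mod int d" "\<kappa> n t mod int d < int d"
          using d pos_mod_sign[of "int d" "\<kappa> n t"] pos_mod_bound[of "int d" "\<kappa> n t"] by linarith+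
        moreover have "?P (nat (\<kappa> n t mod int d))"
          using calculation th \<open>\<kappa> n (t - zmul q h) = \<kappa> n t mod int d\<close>
          by (intro conjI bexI[of _ "t - zmul q h"]) auto
        ultimately show False using least[of "nat (\<kappa> n t mod int d)"] by linarith
      qed
      ultimately obtain c where c: "t - zmul q h = (\<Sum>i<k. zmul (c i) (b i))"
        using b th unfolding zbasis_def by auto
      have "t = (\<Sum>i<Suc k. zmul ((c(k := q)) i) (b' i))"
        unfolding sumb' using c by (simp add: algebra_simps)
      then show "\<exists>c. t = (\<Sum>i<Suc k. zmul (c i) (b' i))" by blast
    next
      fix c i assume c: "(\<Sum>i<Suc k. zmul (c i) (b' i)) = 0" and i: "i < Suc k"
      have bH: "(\<Sum>i<k. zmul (c i) (b i)) \<in> ?H"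
        by (rule additive_subgp_sum[OF H'], rule additive_subgp_zmul[OF H'])
          (use b in \<open>auto simp: zbasis_def\<close>)
      have "\<kappa> n ((\<Sum>i<k. zmul (c i) (b i)) + zmul (c k) h) = 0" using c k0 unfolding sumb' by simp
      then have "c k * int d = 0" using bH by (simp add: add kz h(2))
      then have ck: "c k = 0" using d by simp
      then have "(\<Sum>i<k. zmul (c i) (b i)) = 0" using c unfolding sumb' by simp
      then have "\<forall>i<k. c i = 0" using b by (auto simp: zbasis_def)
      then show "c i = 0" using i ck by (auto simp: less_Suc_eq)
    qed
    then show ?thesis by blast
  qed
qed

lemma zbasis_coordinates:
  assumes H: "additive_subgp H" and b: "zbasis H k b"
  obtains c where "\<And>t. t \<in> H \<Longrightarrow> t = (\<Sum>i<k. zmul (c i t) (b i))"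
    "\<And>i s t. i < k \<Longrightarrow> s \<in> H \<Longrightarrow> t \<in> H \<Longrightarrow> c i (s + t) = c i s + c i t"
    "\<And>i j. i < k \<Longrightarrow> j < k \<Longrightarrow> c i (b j) = (if i = j then 1 else 0)"
proof -
  have "\<forall>t\<in>H. \<exists>c. t = (\<Sum>i<k. zmul (c i) (b i))" using b by (simp add: zbasis_def)
  then obtain C where C: "\<And>t. t \<in> H \<Longrightarrow> t = (\<Sum>i<k. zmul (C t i) (b i))" by metis
  have ind: "c i = 0" if "(\<Sum>i<k. zmul (c i) (b i)) = 0" "i < k" for c i
    using b that by (simp add: zbasis_def)
  have uniq: "C t i = e i" if "t \<in> H" "t = (\<Sum>i<k. zmul (e i) (b i))" "i < k" for t e i
  proof -
    have "(\<Sum>i<k. zmul (C t i - e i) (b i)) = (\<Sum>i<k. zmul (C t i) (b i)) - (\<Sum>i<k. zmul (e i) (b i))"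
      by (simp add: zmul_diff_left sum_subtractf)
    also have "\<dots> = 0" using C[OF that(1)] that(2) by simp
    finally have "C t i - e i = 0" using that(3) by (rule ind)
    then show ?thesis by simp
  qed
  show ?thesis
  proof (rule that[of "\<lambda>i t. C t i"])
    fix i s t assume "i < k" "s \<in> H" "t \<in> H"
    then show "C (s + t) i = C s i + C t i"
      by (intro uniq[of _ "\<lambda>i. C s i + C t i"])
        (use additive_subgpD[OF H] C in \<open>auto simp: zmul_add_left sum.distrib\<close>)
  next
    fix i j assume "i < k" "j < k"
    then show "C (b j) i = (if i = j then 1 else 0)"
    proof (intro uniq[of _ "\<lambda>i. if i = j then 1 else 0"])
      show "b j \<in> H" using b \<open>j < k\<close> by (simp add: zbasis_def)
      have "(\<Sum>i<k. zmul (if i = j then 1 else 0) (b i)) = (\<Sum>i<k. if i = j then b i else 0)"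
        by (rule sum.cong) auto
      then show "b j = (\<Sum>i<k. zmul (if i = j then 1 else 0) (b i))" using \<open>j < k\<close> by simp
    qed
  qed (use C in auto)
qed

text \<open>At most \<open>N\<close> generators of a free group of rank \<open>N\<close> are independent. Namely, some non-zero real
  functional kills all generators except the one with index \<open>j0\<close>, as this is a system of fewer than
  \<open>N\<close> equations. A relation with a non-zero coefficient at \<open>j0\<close> would make it kill the last generator
  as well, and with it the whole group.\<close>

lemma zbasis_if_generating:
  fixes w :: "'i \<Rightarrow> 't::ab_group_add" and t :: "nat \<Rightarrow> 't"
  assumes t: "zbasis UNIV N t" and J: "finite J" "card J \<le> N"
    and gen: "\<And>x. \<exists>c. x = (\<Sum>j\<in>J. zmul (c j) (w j))"
    and rel: "(\<Sum>j\<in>J. zmul (c j) (w j)) = 0" and j0: "j0 \<in> J"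
  shows "c j0 = 0"
proof (rule ccontr)
  assume c0: "c j0 \<noteq> 0"
  have U: "additive_subgp (UNIV :: 't set)" by (simp add: additive_subgp_def)
  obtain e :: "nat \<Rightarrow> 't \<Rightarrow> int" where e: "\<And>x. x = (\<Sum>i<N. zmul (e i x) (t i))"
    "\<And>i x y. i < N \<Longrightarrow> e i (x + y) = e i x + e i y"
    "\<And>i j. i < N \<Longrightarrow> j < N \<Longrightarrow> e i (t j) = (if i = j then 1 else 0)"
    using zbasis_coordinates[OF U t] by auto
  have "card (J - {j0}) < card {..<N}"
    using card_Diff1_less[OF J(1) j0] J(2) by simp
  then obtain y where y: "\<exists>i<N. y i \<noteq> 0" "\<And>j. j \<in> J - {j0} \<Longrightarrow> (\<Sum>i<N. real_of_int (e i (w j)) * y i) = 0"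
    using underdetermined_system[of "J - {j0}" "{..<N}" "\<lambda>j i. of_int (e i (w j))"] J by auto
  define lf where "lf x = (\<Sum>i<N. real_of_int (e i x) * y i)" for x
  have add: "lf (x + x') = lf x + lf x'" for x x'
    unfolding lf_def using e(2) by (simp add: ring_distribs sum.distrib)
  have lz: "lf (zmul k x) = of_int k * lf x" for k x
    using zmul_additive_image[of lf, OF add] by simp
  have l0: "lf 0 = 0" using add[of 0 0] by simp
  have lsum: "lf (\<Sum>j\<in>J. zmul (d j) (w j)) = of_int (d j0) * lf (w j0)" for d
  proof -
    have "lf (\<Sum>j\<in>A. F j) = (\<Sum>j\<in>A. lf (F j))" for A :: "'i set" and F
      by (induct A rule: infinite_finite_induct) (simp_all add: l0 add)
    then have "lf (\<Sum>j\<in>J. zmul (d j) (w j)) = (\<Sum>j\<in>J. of_int (d j) * lf (w j))" by (simp add: lz)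
    also have "\<dots> = of_int (d j0) * lf (w j0) + (\<Sum>j\<in>J - {j0}. of_int (d j) * lf (w j))"
      using J j0 by (simp add: sum.remove)
    also have "(\<Sum>j\<in>J - {j0}. of_int (d j) * lf (w j)) = 0"
      by (rule sum.neutral) (use y(2) lf_def in auto)
    finally show ?thesis by simp
  qed
  have "of_int (c j0) * lf (w j0) = 0" using lsum[of c] rel l0 by simp
  then have "lf (w j0) = 0" using c0 by simp
  then have zero: "lf x = 0" for x using gen[of x] lsum by auto
  obtain i where i: "i < N" "y i \<noteq> 0" using y(1) by auto
  have "lf (t i) = (\<Sum>j<N. if j = i then y j else 0)"
    unfolding lf_def by (rule sum.cong) (use e(3) i in auto)
  then show False using i zero by simp
qed

section \<open>Characters that do not kill a given Laurent polynomial\<close>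

text \<open>The coordinates of \<open>x\<close> are made the coefficients of a polynomial \<open>P x\<close>. Distinct elements have
  distinct polynomials, and an integer that is not a root of the finitely many differences separates
  their values.\<close>

lemma separating_functional:
  fixes t :: "nat \<Rightarrow> 't::ab_group_add"
  assumes t: "zbasis UNIV N t" and K: "finite K"
  obtains lam :: "'t \<Rightarrow> int" where "\<And>x y. lam (x + y) = lam x + lam y" "inj_on lam K"
proof -
  have U: "additive_subgp (UNIV :: 't set)" by (simp add: additive_subgp_def)
  obtain e :: "nat \<Rightarrow> 't \<Rightarrow> int" where e: "\<And>x. x = (\<Sum>i<N. zmul (e i x) (t i))"
    "\<And>i x y. i < N \<Longrightarrow> e i (x + y) = e i x + e i y"
    "\<And>i j. i < N \<Longrightarrow> j < N \<Longrightarrow> e i (t j) = (if i = j then 1 else 0)"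
    using zbasis_coordinates[OF U t] by auto
  define P where "P x = (\<Sum>i<N. Polynomial.monom (e i x) i)" for x
  have Padd: "P (x + y) = P x + P y" for x y
    by (simp add: P_def e(2) Polynomial.add_monom[symmetric] sum.distrib)
  have Pinj: "x = y" if "P x = P y" for x y
  proof -
    have "Polynomial.coeff (P x) i = e i x" if "i < N" for x i
      using that by (simp add: P_def Polynomial.coeff_sum)
    then have "e i x = e i y" if "i < N" for i using \<open>P x = P y\<close> that by metis
    then show ?thesis using e(1)[of x] e(1)[of y] by simp
  qed
  let ?B = "\<Union>(x, y)\<in>{(x, y). x \<in> K \<and> y \<in> K \<and> x \<noteq> y}. {z. poly (P x - P y) z = 0}"
  have "finite {(x, y). x \<in> K \<and> y \<in> K \<and> x \<noteq> y}"
    by (rule finite_subset[of _ "K \<times> K"]) (use K in auto)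
  moreover have "finite {z. poly (P x - P y) z = 0}" if "x \<noteq> y" for x y
    by (rule poly_roots_finite) (use Pinj that in auto)
  ultimately have "finite ?B" by (intro finite_UN_I) (auto simp del: poly_diff)
  then obtain z where z: "z \<notin> ?B" using ex_new_if_finite[OF infinite_UNIV_int] by blast
  show ?thesis
  proof (rule that[of "\<lambda>x. poly (P x) z"])
    show "inj_on (\<lambda>x. poly (P x) z) K" using z by (force simp: inj_on_def)
  qed (simp add: Padd)
qed

lemma positive_character_zero:
  fixes \<chi> :: "'t::ab_group_add \<Rightarrow> real"
  assumes "\<And>x y. \<chi> (x + y) = \<chi> x * \<chi> y" "\<And>x. \<chi> x > 0" shows "\<chi> 0 = 1"
proof -
  have "\<chi> 0 * \<chi> 0 = \<chi> 0" by (rule assms(1)[of 0 0, unfolded add_0, symmetric])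
  then show ?thesis using assms(2)[of 0] mult_cancel_right2[of "\<chi> 0" "\<chi> 0"] by simp
qed

text \<open>On the one-parameter subgroup \<open>z \<mapsto> (x \<mapsto> z\<^bsup>lam x\<^esup>)\<close> for a functional \<open>lam\<close> which separates the
  exponents in \<open>K\<close>, the Laurent polynomial becomes a non-zero Laurent polynomial in one variable. It
  has only finitely many zeros, so it does not vanish at some positive \<open>z\<close>.\<close>

lemma nonvanishing_character:
  fixes t :: "nat \<Rightarrow> 't::ab_group_add"
  assumes t: "zbasis UNIV N t" and K: "finite K" "K \<noteq> {}"
    and w: "\<And>x. x \<in> K \<Longrightarrow> w x \<noteq> (0::int)"
  obtains \<chi> :: "'t \<Rightarrow> real" where "\<And>x. \<chi> x > 0" "\<And>x y. \<chi> (x + y) = \<chi> x * \<chi> y"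
    "(\<Sum>x\<in>K. of_int (w x) * \<chi> x) \<noteq> 0"
proof -
  obtain lam :: "'t \<Rightarrow> int" where l: "\<And>x y. lam (x + y) = lam x + lam y" "inj_on lam K"
    using separating_functional[OF t K(1)] by blast
  obtain x0 where x0: "x0 \<in> K" using K by auto
  define m where "m = Min (lam ` K)"
  have m: "m \<le> lam x" if "x \<in> K" for x using that K by (simp add: m_def)
  define Q where "Q = (\<Sum>x\<in>K. Polynomial.monom (real_of_int (w x)) (nat (lam x - m)))"
  have "Polynomial.coeff Q (nat (lam x0 - m)) = (\<Sum>x\<in>K. if x = x0 then real_of_int (w x) else 0)"
    unfolding Q_def Polynomial.coeff_sum
  proof (rule sum.cong)
    fix x assume x: "x \<in> K"
    then have "nat (lam x - m) = nat (lam x0 - m) \<longleftrightarrow> x = x0"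
      using m[OF x] m[OF x0] inj_onD[OF l(2), of x x0] x0 by (auto simp: eq_nat_nat_iff)
    then show "Polynomial.coeff (Polynomial.monom (real_of_int (w x)) (nat (lam x - m))) (nat (lam x0 - m)) =
       (if x = x0 then real_of_int (w x) else 0)" by simp
  qed simp
  then have "Polynomial.coeff Q (nat (lam x0 - m)) \<noteq> 0" using x0 K w by simp
  then have "Q \<noteq> 0" by auto
  then have "finite {z. poly Q z = 0}" by (rule poly_roots_finite)
  moreover have "infinite {0 :: real <..}" by (rule infinite_Ioi)
  ultimately obtain z where z: "z > 0" "poly Q z \<noteq> 0"
    by (metis (mono_tags, lifting) finite_subset greaterThan_iff mem_Collect_eq subsetI)
  define \<chi> where "\<chi> x = z powi lam x" for x
  have "poly Q z * z powi m = (\<Sum>x\<in>K. of_int (w x) * \<chi> x)"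
    unfolding Q_def poly_sum sum_distrib_right
  proof (rule sum.cong)
    fix x assume "x \<in> K"
    then have "z ^ nat (lam x - m) = z powi (lam x - m)" using m by (simp add: power_int_def)
    then show "poly (Polynomial.monom (real_of_int (w x)) (nat (lam x - m))) z * z powi m =
        of_int (w x) * \<chi> x"
      using z by (simp add: poly_monom \<chi>_def power_int_add[symmetric] mult.assoc)
  qed simp
  then have "(\<Sum>x\<in>K. of_int (w x) * \<chi> x) \<noteq> 0" using z by (metis mult_eq_0_iff order_less_irrefl power_int_eq_0_iff)
  then show ?thesis
    by (intro that[of \<chi>]) (use z in \<open>auto simp: \<chi>_def l(1) power_int_add\<close>)
qed

section \<open>Tangent spaces of standard smooth charts\<close>

text \<open>A chart as in the definition of smoothness, for a monoid ring. The two bounds for its relative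
  dimension \<open>n - c\<close> at the end are what the classification of smooth points is based on.\<close>

locale smooth_chart =
  fixes M :: "'m::comm_monoid_add set" and g :: "'m \<Rightarrow>\<^sub>0 int" and n c :: nat and f :: "nat \<Rightarrow> int_mpoly"
    and h :: "('m \<Rightarrow>\<^sub>0 int) \<Rightarrow> int_mpoly set"
  assumes M: "additive_submonoid M" and g: "Poly_Mapping.keys g \<subseteq> M" and cn: "c \<le> n"
    and f: "f ` {..<c} \<subseteq> carrier (int_poly_ring n)"
    and loc: "localization_away (monoid_ring M) g
      (int_poly_ring n Quot genideal (int_poly_ring n) (f ` {..<c})) h"
    and jac: "genideal (int_poly_ring n) (f ` {..<c}) +>\<^bsub>int_poly_ring n\<^esub> jacobian_minor c f
      \<in> Units (int_poly_ring n Quot genideal (int_poly_ring n) (f ` {..<c}))"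
begin

abbreviation "P \<equiv> int_poly_ring n"
abbreviation "I \<equiv> genideal P (f ` {..<c})"
abbreviation "S \<equiv> P Quot I"
abbreviation "cls p \<equiv> I +>\<^bsub>P\<^esub> p"

lemma P_cring: "cring P" by (rule cring_int_poly_ring)

lemma I_ideal: "ideal I P"
  using ring.genideal_ideal[OF cring.axioms(1)[OF P_cring] f] .

lemma cls_hom: "(\<lambda>p. cls p) \<in> ring_hom P S"
  by (rule ideal.rcos_ring_hom[OF I_ideal])

sublocale L: localization "monoid_ring M" S h g
  by (rule localizationI[OF cring_monoid_ring[OF M] ideal.quotient_is_cring[OF I_ideal P_cring] _ loc])
    (simp add: g)

lemma cls_f: "i < c \<Longrightarrow> cls (f i) = \<zero>\<^bsub>S\<^esub>"
  using ring.genideal_self[OF cring.axioms(1)[OF P_cring] f] ring.a_rcos_zero[OF cring.axioms(1)[OF P_cring] I_ideal]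
  by (auto simp: FactRing_def)

lemma cls_Var: "j < n \<Longrightarrow> cls (Var j) \<in> carrier S"
  using ring_hom_closed[OF cls_hom] Var_carrier by blast

lemma hom_eval:
  assumes th: "\<theta> \<in> ring_hom S type_ring" and p: "p \<in> carrier P"
  shows "\<theta> (cls p) = poly_eval n (\<lambda>j. \<theta> (cls (Var j))) p"
  using ring_hom_eq_poly_eval[OF ring_hom_trans[OF cls_hom th] p] by simp

lemma hom_eval_f:
  fixes \<theta> :: "int_mpoly set \<Rightarrow> 'a::comm_ring_1"
  assumes th: "\<theta> \<in> ring_hom S type_ring" and i: "i < c"
  shows "poly_eval n (\<lambda>j. \<theta> (cls (Var j))) (f i) = 0"
proof -
  interpret A: cring "type_ring :: 'a ring" by (rule cring_type_ring)
  interpret t: ring_hom_cring S "type_ring :: 'a ring" \<theta> by unfold_locales (rule th)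
  have "f i \<in> carrier P" using f i by auto
  from hom_eval[OF th this] have "poly_eval n (\<lambda>j. \<theta> (cls (Var j))) (f i) = \<theta> (cls (f i))" by (rule sym)
  also have "\<dots> = 0" using t.hom_zero by (simp only: cls_f[OF i] type_ring_simps)
  finally show ?thesis .
qed

lemma hom_of_point:
  fixes a :: "nat \<Rightarrow> 'a::comm_ring_1"
  assumes a: "\<And>i. i < c \<Longrightarrow> poly_eval n a (f i) = 0"
  obtains \<theta> where "\<theta> \<in> ring_hom S type_ring" "\<And>p. p \<in> carrier P \<Longrightarrow> \<theta> (cls p) = poly_eval n a p"
proof -
  have u: "poly_eval n a \<in> ring_hom P type_ring"
    unfolding int_poly_ring_def by (rule mon_eval_hom[OF monomial_value_char])
  have "poly_eval n a x = \<zero>\<^bsub>type_ring\<^esub>" if "x \<in> I" for x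
    by (rule genideal_hom_zero[OF P_cring cring_type_ring u f _ that]) (use a in auto)
  then show ?thesis
    using quotient_hom_extends[OF P_cring cring_type_ring I_ideal u] that by blast
qed

lemma tangent_coordinates:
  fixes \<theta> :: "int_mpoly set \<Rightarrow> dual"
  assumes th: "\<theta> \<in> ring_hom S type_ring" and p: "p \<in> carrier P"
  shows "ep (\<theta> (cls p)) =
    (\<Sum>j<n. ep (\<theta> (cls (Var j))) * poly_eval n (\<lambda>j. re (\<theta> (cls (Var j)))) (partial_deriv j p))"
  unfolding hom_eval[OF th p] by (rule poly_eval_dual_ep)

text \<open>The invertible minor allows to solve the linearized equations for the first \<open>c\<close> coordinates, so a
  tangent vector is determined by its last \<open>n - c\<close> coordinates.\<close>

lemma tangent_vanishes:
  fixes \<theta> :: "int_mpoly set \<Rightarrow> real"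
  assumes th: "\<theta> \<in> ring_hom S type_ring"
    and eq: "\<And>i. i < c \<Longrightarrow> (\<Sum>j<n. v j * poly_eval n (\<lambda>j. \<theta> (cls (Var j))) (partial_deriv j (f i))) = 0"
    and v: "\<And>j. c \<le> j \<Longrightarrow> j < n \<Longrightarrow> v j = 0" and j: "j < n"
  shows "v j = 0"
proof (cases "j < c")
  case True
  let ?x = "\<lambda>j. \<theta> (cls (Var j))"
  interpret A: cring "type_ring :: real ring" by (rule cring_type_ring)
  interpret t: ring_hom_cring S "type_ring :: real ring" \<theta> by unfold_locales (rule th)
  have "poly_eval n ?x (jacobian_minor c f) \<noteq> 0"
    using t.hom_Units[OF jac] hom_eval[OF th jacobian_minor_carrier[OF f]]
    by (simp add: Units_type_ring_field)
  then show ?thesis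
    unfolding poly_eval_jacobian_minor
  proof (rule nonzero_determinant_kernel[OF _ _ True])
    fix i assume i: "i < c"
    have "(\<Sum>j<c. poly_eval n ?x (partial_deriv j (f i)) * v j) =
        (\<Sum>j<n. poly_eval n ?x (partial_deriv j (f i)) * v j)"
      by (rule sum.mono_neutral_left) (use cn v in auto)
    then show "(\<Sum>j<c. poly_eval n ?x (partial_deriv j (f i)) * v j) = 0"
      using eq[OF i] by (simp add: mult.commute)
  qed
qed (use v j in auto)

lemma lift_hom:
  fixes \<phi> :: "('m \<Rightarrow>\<^sub>0 int) \<Rightarrow> 'a::comm_ring_1"
  assumes "\<phi> \<in> ring_hom (monoid_ring M) type_ring" "\<phi> g \<in> Units type_ring"
  obtains \<theta> where "\<theta> \<in> ring_hom S type_ring" "\<And>x. Poly_Mapping.keys x \<subseteq> M \<Longrightarrow> \<theta> (h x) = \<phi> x"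
  using L.hom_extends[OF cring_type_ring assms] by auto

lemma h_rep:
  assumes "m \<in> M" obtains p where "p \<in> carrier P" "h (xmon m) = cls p"
proof -
  have "h (xmon m) \<in> carrier S" using assms by simp
  then show ?thesis using that by (rule quotient_rep)
qed

lemma re_hom:
  "\<theta> \<in> ring_hom S type_ring \<Longrightarrow> (\<lambda>s. re (\<theta> s)) \<in> ring_hom S type_ring"
  by (auto simp: ring_hom_def)

text \<open>Each \<open>D e\<close> is a tangent vector at the real point \<open>\<chi>\<close>: the Leibniz rule says that
  \<open>m \<mapsto> \<chi> m + \<epsilon> (D e m)\<close> is a character with values in the dual numbers. It extends to the chart,
  as \<open>g\<close> does not vanish at \<open>\<chi>\<close>. If there were more than \<open>n - c\<close> of them, then a non-trivial linear
  combination would have the last \<open>n - c\<close> coordinates equal to \<open>0\<close>, and would vanish.\<close>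

lemma independent_derivations_le:
  fixes \<chi> :: "'m \<Rightarrow> real" and D :: "'e \<Rightarrow> 'm \<Rightarrow> real"
  assumes ch: "char_on M \<chi>" and chg: "mon_eval \<chi> g \<noteq> 0" and E: "finite E"
    and leibniz: "\<And>e s t. e \<in> E \<Longrightarrow> s \<in> M \<Longrightarrow> t \<in> M \<Longrightarrow> D e (s + t) = \<chi> s * D e t + D e s * \<chi> t"
    and indep: "\<And>\<alpha> e. (\<And>m. m \<in> M \<Longrightarrow> (\<Sum>e\<in>E. \<alpha> e * D e m) = 0) \<Longrightarrow> e \<in> E \<Longrightarrow> \<alpha> e = 0"
  shows "card E \<le> n - c"
proof (rule ccontr)
  assume "\<not> card E \<le> n - c"
  then have cE: "card {c..<n} < card E" by simp
  obtain \<theta>0 where t0: "\<theta>0 \<in> ring_hom S type_ring"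
    "\<And>x. Poly_Mapping.keys x \<subseteq> M \<Longrightarrow> \<theta>0 (h x) = mon_eval \<chi> x"
    using lift_hom[OF mon_eval_hom[OF ch]] chg by (auto simp: Units_type_ring_field)
  define \<xi> where "\<xi> j = \<theta>0 (cls (Var j))" for j
  let ?d = "\<lambda>e m. Dual (\<chi> m) (D e m)"
  have M0: "0 \<in> M" using M by (simp add: additive_submonoid_def)
  have "\<exists>\<theta>. \<theta> \<in> ring_hom S type_ring \<and> (\<forall>x. Poly_Mapping.keys x \<subseteq> M \<longrightarrow> \<theta> (h x) = mon_eval (?d e) x)"
    if e: "e \<in> E" for e
  proof -
    have "D e 0 = 0" using leibniz[OF e M0 M0] ch by (simp add: char_on_def)
    then have "char_on M (?d e)"
      using ch leibniz[OF e] by (simp add: char_on_def one_dual_def times_dual_def)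
    moreover have "re (mon_eval (?d e) g) = mon_eval \<chi> g"
      by (simp add: mon_eval_def dual_sum)
    ultimately show ?thesis
      using lift_hom[OF mon_eval_hom, of "?d e"] Units_dual[of "mon_eval (?d e) g"] chg by metis
  qed
  then obtain \<theta> where t: "\<And>e. e \<in> E \<Longrightarrow> \<theta> e \<in> ring_hom S type_ring"
    "\<And>e x. e \<in> E \<Longrightarrow> Poly_Mapping.keys x \<subseteq> M \<Longrightarrow> \<theta> e (h x) = mon_eval (?d e) x"
    by metis
  have re: "re (\<theta> e (cls (Var j))) = \<xi> j" if e: "e \<in> E" and j: "j < n" for e j
    unfolding \<xi>_def
  proof (rule L.hom_unique[OF cring_type_ring re_hom[OF t(1)[OF e]] t0(1) _ cls_Var[OF j]])
    fix x assume "x \<in> carrier (monoid_ring M)"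
    then show "re (\<theta> e (h x)) = \<theta>0 (h x)" using t(2)[OF e] t0(2) by (simp add: mon_eval_def dual_sum)
  qed
  define v where "v e j = ep (\<theta> e (cls (Var j)))" for e j
  have ev: "ep (\<theta> e (cls p)) = (\<Sum>j<n. v e j * poly_eval n \<xi> (partial_deriv j p))"
    if "e \<in> E" "p \<in> carrier P" for e p
  proof -
    have "poly_eval n (\<lambda>j. re (\<theta> e (cls (Var j)))) q = poly_eval n \<xi> q" for q
    proof -
      have "monomial_value n (\<lambda>j. re (\<theta> e (cls (Var j)))) m = monomial_value n \<xi> m" for m
        unfolding monomial_value_def by (rule prod.cong) (use re that in auto)
      then show ?thesis by (simp add: mon_eval_def)
    qed
    then show ?thesis using tangent_coordinates[OF t(1)[OF that(1)] that(2)] by (simp add: v_def)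
  qed
  obtain x where x: "\<exists>e\<in>E. x e \<noteq> 0" "\<forall>j\<in>{c..<n}. (\<Sum>e\<in>E. v e j * x e) = 0"
    using underdetermined_system[OF _ E cE, of "\<lambda>j e. v e j"] by auto
  define w where "w j = (\<Sum>e\<in>E. v e j * x e)" for j
  have lin: "(\<Sum>j<n. w j * y j) = (\<Sum>e\<in>E. x e * (\<Sum>j<n. v e j * y j))" for y
    unfolding w_def sum_distrib_right sum_distrib_left
    by (subst sum.swap) (simp add: mult_ac)
  have w0: "w j = 0" if "j < n" for j
  proof (rule tangent_vanishes[OF t0(1) _ _ that, folded \<xi>_def])
    fix i assume i: "i < c"
    have fi: "f i \<in> carrier P" using f i by auto
    have "(\<Sum>j<n. v e j * poly_eval n \<xi> (partial_deriv j (f i))) = 0" if "e \<in> E" for e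
    proof -
      have "\<theta> e (cls (f i)) = 0" using hom_eval[OF t(1)[OF that] fi] hom_eval_f[OF t(1)[OF that] i] by simp
      then show ?thesis using ev[OF that fi] by simp
    qed
    then show "(\<Sum>j<n. w j * poly_eval n \<xi> (partial_deriv j (f i))) = 0" by (simp add: lin)
  qed (use x(2) w_def in auto)
  have "(\<Sum>e\<in>E. x e * D e m) = 0" if m: "m \<in> M" for m
  proof -
    obtain p where p: "p \<in> carrier P" "h (xmon m) = cls p" using m by (rule h_rep)
    have "D e m = (\<Sum>j<n. v e j * poly_eval n \<xi> (partial_deriv j p))" if "e \<in> E" for e
      using t(2)[OF that, of "xmon m"] m ev[OF that p(1)] p(2) by simp
    then have "(\<Sum>e\<in>E. x e * D e m) = (\<Sum>j<n. w j * poly_eval n \<xi> (partial_deriv j p))"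
      by (simp add: lin)
    then show ?thesis using w0 by simp
  qed
  then show False using indep[of x] x(1) by blast
qed

text \<open>At a point with \<open>\<chi> \<noteq> 0\<close> on \<open>M\<close>, a tangent vector \<open>D\<close> gives the additive function
  \<open>m \<mapsto> D m / \<chi> m\<close>. By \<open>gen\<close>, it is determined by \<open>N\<close> numbers; in the application the differences
  \<open>a i - b i\<close> are a basis of the group. A chart of larger dimension would have a non-zero tangent
  vector for which these \<open>N\<close> numbers vanish.\<close>

lemma dimension_le_rank:
  fixes \<chi> :: "'m \<Rightarrow> real" and a b :: "nat \<Rightarrow> 'm"
  assumes ch: "char_on M \<chi>" and chg: "mon_eval \<chi> g \<noteq> 0" and nz: "\<And>m. m \<in> M \<Longrightarrow> \<chi> m \<noteq> 0"
    and ab: "\<And>i. i < N \<Longrightarrow> a i \<in> M \<and> b i \<in> M"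
    and gen: "\<And>l :: 'm \<Rightarrow> real. (\<And>s t. s \<in> M \<Longrightarrow> t \<in> M \<Longrightarrow> l (s + t) = l s + l t) \<Longrightarrow>
      (\<And>i. i < N \<Longrightarrow> l (a i) = l (b i)) \<Longrightarrow> (\<And>m. m \<in> M \<Longrightarrow> l m = 0)"
  shows "n - c \<le> N"
proof (rule ccontr)
  assume "\<not> n - c \<le> N"
  then have card: "card ({..<c} <+> {..<N}) < card {..<n}" by (simp add: card_Plus)
  obtain \<theta>0 where t0: "\<theta>0 \<in> ring_hom S type_ring"
    "\<And>x. Poly_Mapping.keys x \<subseteq> M \<Longrightarrow> \<theta>0 (h x) = mon_eval \<chi> x"
    using lift_hom[OF mon_eval_hom[OF ch]] chg by (auto simp: Units_type_ring_field)
  define \<xi> where "\<xi> j = \<theta>0 (cls (Var j))" for j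
  have "\<forall>m\<in>M. \<exists>p. p \<in> carrier P \<and> h (xmon m) = cls p" using h_rep by metis
  then obtain p where p: "\<And>m. m \<in> M \<Longrightarrow> p m \<in> carrier P" "\<And>m. m \<in> M \<Longrightarrow> h (xmon m) = cls (p m)"
    by metis
  define A where "A k j = (case k of Inl i \<Rightarrow> poly_eval n \<xi> (partial_deriv j (f i))
     | Inr i \<Rightarrow> poly_eval n \<xi> (partial_deriv j (p (a i))) / \<chi> (a i)
         - poly_eval n \<xi> (partial_deriv j (p (b i))) / \<chi> (b i))" for k j
  obtain x where x: "\<exists>j\<in>{..<n}. x j \<noteq> 0" "\<forall>k\<in>{..<c} <+> {..<N}. (\<Sum>j<n. A k j * x j) = 0"
    using underdetermined_system[OF _ _ card, of A] by auto
  have x1: "(\<Sum>j<n. x j * poly_eval n \<xi> (partial_deriv j (f i))) = 0" if "i < c" for i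
    using bspec[OF x(2), of "Inl i"] that by (auto simp: A_def mult.commute)
  have x2: "(\<Sum>j<n. x j * poly_eval n \<xi> (partial_deriv j (p (a i)))) / \<chi> (a i) =
      (\<Sum>j<n. x j * poly_eval n \<xi> (partial_deriv j (p (b i)))) / \<chi> (b i)" if "i < N" for i
    using bspec[OF x(2), of "Inr i"] that
    by (auto simp: A_def sum_divide_distrib right_diff_distrib left_diff_distrib sum_subtractf mult.commute)
  define q where "q j = Dual (\<xi> j) (x j)" for j
  have q: "ep (poly_eval n q r) = (\<Sum>j<n. x j * poly_eval n \<xi> (partial_deriv j r))" for r
    using poly_eval_dual_ep[of n q r] by (simp add: q_def)
  have qr: "re (poly_eval n q r) = poly_eval n \<xi> r" for r
    using poly_eval_dual_re[of n q r] by (simp add: q_def)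
  have "poly_eval n q (f i) = 0" if "i < c" for i
    using x1[OF that] hom_eval_f[OF t0(1) that, folded \<xi>_def] q[of "f i"] qr[of "f i"]
    by (simp add: dual.expand)
  then obtain \<theta> where th: "\<theta> \<in> ring_hom S type_ring" "\<And>r. r \<in> carrier P \<Longrightarrow> \<theta> (cls r) = poly_eval n q r"
    using hom_of_point by blast
  \<comment> \<open>The same point with the tangent vector \<open>0\<close>; it is to be shown that it agrees
    with \<open>\<theta>\<close>.\<close>
  let ?i = "\<lambda>s. Dual (\<theta>0 s) 0"
  have i: "?i \<in> ring_hom S type_ring"
    using t0(1) by (auto simp: ring_hom_def dual.expand)
  have rem: "re (\<theta> (h (xmon m))) = \<chi> m" if "m \<in> M" for m
    using th(2) p that qr hom_eval[OF t0(1) p(1)[OF that], folded \<xi>_def] t0(2)[of "xmon m"] by simp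
  define l where "l m = ep (\<theta> (h (xmon m))) / \<chi> m" for m
  have hm: "h \<in> ring_hom (monoid_ring M) S" by (rule L.homh)
  have "l m = 0" if m: "m \<in> M" for m
  proof (rule gen[OF _ _ m])
    fix s t assume s: "s \<in> M" and t: "t \<in> M"
    have "\<theta> (h (xmon (s + t))) = \<theta> (h (xmon s)) * \<theta> (h (xmon t))"
      using ring_hom_mult[OF ring_hom_trans[OF hm th(1)], of "xmon s" "xmon t"] s t
      by (simp add: xmon_mult)
    moreover have "\<chi> (s + t) = \<chi> s * \<chi> t" using ch s t by (simp add: char_on_def)
    ultimately show "l (s + t) = l s + l t"
      using nz[OF s] nz[OF t] rem[OF s] rem[OF t] by (simp add: l_def field_simps)
  next
    fix i assume "i < N"
    then show "l (a i) = l (b i)" using x2 ab[of i] th(2) p q by (simp add: l_def)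
  qed
  then have "ep (\<theta> (h (xmon m))) = 0" if "m \<in> M" for m using nz that by (auto simp: l_def)
  then have mon: "\<theta> (h (xmon m)) = ?i (h (xmon m))" if "m \<in> M" for m
    using rem that t0(2)[of "xmon m"] by (simp add: dual.expand)
  have eq: "\<theta> (h y) = ?i (h y)" if y: "y \<in> carrier (monoid_ring M)" for y
  proof -
    have k: "Poly_Mapping.keys y \<subseteq> M" using y by simp
    have "\<theta> (h y) = mon_eval (\<lambda>m. \<theta> (h (xmon m))) y"
      using ring_hom_eq_mon_eval[OF M ring_hom_trans[OF hm th(1)] k] by simp
    also have "\<dots> = mon_eval (\<lambda>m. ?i (h (xmon m))) y"
      unfolding mon_eval_def by (rule sum.cong) (use mon k in auto)
    also have "\<dots> = ?i (h y)"
      using ring_hom_eq_mon_eval[OF M ring_hom_trans[OF hm i] k] by simp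
    finally show ?thesis .
  qed
  have "x j = 0" if "j < n" for j
  proof -
    have "\<theta> (cls (Var j)) = ?i (cls (Var j))"
      by (rule L.hom_unique[OF cring_type_ring th(1) i eq cls_Var[OF that]])
    moreover have "\<theta> (cls (Var j)) = q j" using th(2) Var_carrier[OF that] poly_eval_Var[OF that] by simp
    ultimately show ?thesis by (simp add: q_def)
  qed
  then show False using x(1) by auto
qed

end

section \<open>Smooth sequences and localization of the monoid\<close>

lemma ambient_group_simps [simp]:
  "carrier ambient_group = UNIV" "x \<otimes>\<^bsub>ambient_group\<^esub> y = x + y" "\<one>\<^bsub>ambient_group\<^esub> = 0"
  by (simp_all add: ambient_group_def)

lemma group_ambient_group: "group (ambient_group :: 't::ab_group_add monoid)"
proof (rule groupI)
  fix x :: 't assume "x \<in> carrier ambient_group"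
  show "\<exists>y\<in>carrier ambient_group. y \<otimes>\<^bsub>ambient_group\<^esub> x = \<one>\<^bsub>ambient_group\<^esub>"
    by (rule bexI[of _ "- x"]) simp_all
qed (simp_all add: add.assoc)

lemma inv_ambient_group [simp]: "inv\<^bsub>ambient_group\<^esub> x = - x"
  by (rule group.inv_equality[OF group_ambient_group]) simp_all

definition differences :: "'t::ab_group_add set \<Rightarrow> 't set" where
  "differences F = {a - b | a b. a \<in> F \<and> b \<in> F}"

lemma additive_subgp_differences:
  assumes "additive_submonoid F" shows "additive_subgp (differences F)"
proof -
  have "a - b - (c - d) \<in> differences F" if "a \<in> F" "b \<in> F" "c \<in> F" "d \<in> F" for a b c d
    unfolding differences_def mem_Collect_eq
    by (rule exI[of _ "a + d"], rule exI[of _ "b + c"])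
      (use assms that in \<open>auto simp: additive_submonoid_def\<close>)
  moreover have "0 \<in> differences F"
    unfolding differences_def using assms by (force simp: additive_submonoid_def)
  ultimately show ?thesis unfolding additive_subgp_def by (auto simp: differences_def)
qed

lemma subset_differences: "additive_submonoid F \<Longrightarrow> F \<subseteq> differences F"
  unfolding differences_def additive_submonoid_def by force

lemma generate_ambient_group:
  assumes F: "additive_submonoid F" shows "generate ambient_group F = differences F"
proof
  have "x \<in> differences F" if "x \<in> generate ambient_group F" for x
    using that
    by (induct x rule: generate.induct)
      (use subset_differences[OF F] additive_subgpD[OF additive_subgp_differences[OF F]] in auto)
  then show "generate ambient_group F \<subseteq> differences F" by blast
  show "differences F \<subseteq> generate ambient_group F"
  proof
    fix x assume "x \<in> differences F"
    then obtain a b where ab: "x = a - b" "a \<in> F" "b \<in> F" by (auto simp: differences_def)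
    have "a + - b \<in> generate ambient_group F"
      using generate.eng[OF generate.incl generate.inv, of a F b ambient_group] ab by simp
    then show "x \<in> generate ambient_group F" using ab by simp
  qed
qed

lemma submonoid_add: "additive_submonoid M \<Longrightarrow> a \<in> M \<Longrightarrow> b \<in> M \<Longrightarrow> a + b \<in> M"
  by (simp add: additive_submonoid_def)

lemma sum_list_in:
  assumes "additive_submonoid M" "set xs \<subseteq> M" shows "sum_list xs \<in> M"
  using assms(2) by (induct xs) (use assms(1) in \<open>auto simp: additive_submonoid_def\<close>)

lemma sum_in:
  assumes M: "additive_submonoid M" and F: "\<And>i. i \<in> A \<Longrightarrow> F i \<in> M" shows "(\<Sum>i\<in>A. F i) \<in> M"
  using F by (induct A rule: infinite_finite_induct) (use M in \<open>auto simp: additive_submonoid_def\<close>)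

lemma zmul_in:
  assumes M: "additive_submonoid M" and x: "x \<in> M" and k: "k \<ge> 0" shows "zmul k x \<in> M"
proof -
  have "((+) x ^^ n) 0 \<in> M" for n
    by (induct n) (use M x in \<open>auto simp: additive_submonoid_def\<close>)
  then show ?thesis using k by (simp add: zmul_def)
qed

lemma fg_submonoid_additive:
  assumes "fg_submonoid M" shows "additive_submonoid M"
proof -
  obtain A where A: "M = sum_list ` lists A" using assms by (auto simp: fg_submonoid_def)
  have "sum_list xs + sum_list ys \<in> M" if "xs \<in> lists A" "ys \<in> lists A" for xs ys
    unfolding A using that by (intro image_eqI[of _ _ "xs @ ys"]) auto
  moreover have "0 \<in> M" unfolding A by (intro image_eqI[of _ _ "[]"]) auto
  ultimately show ?thesis unfolding additive_submonoid_def using A by auto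
qed

lemma xmon_power: "xmon a ^ k = xmon (zmul (int k) a)"
proof (induct k)
  case (Suc k)
  then show ?case using zmul_succ[of "int k" a] by (simp add: xmon_mult add.commute)
qed simp

text \<open>Each monomial of \<open>\<int>[N]\<close> is moved into \<open>\<int>[M]\<close> by all sufficiently large powers of \<open>x\<^sub>a\<close>, so a
  finite sum of them is moved by a common power.\<close>

lemma submonoid_localization:
  fixes M N :: "'t::ab_group_add set"
  assumes M: "additive_submonoid M" and N: "additive_submonoid N" and MN: "M \<subseteq> N"
    and a: "a \<in> M" "- a \<in> N" and den: "\<And>t. t \<in> N \<Longrightarrow> \<exists>k::nat. t + zmul (int k) a \<in> M"
  shows "localization_away (monoid_ring M) (xmon a) (monoid_ring N) id"
  unfolding localization_away_def
proof (intro conjI ballI impI)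
  show "id \<in> ring_hom (monoid_ring M) (monoid_ring N)"
    using MN by (auto simp: ring_hom_def)
  have "a \<in> N" using a MN by blast
  then show "id (xmon a) \<in> Units (monoid_ring N)"
    unfolding Units_def using a(2)
    by (intro CollectI conjI bexI[of _ "xmon (- a)"]) (simp_all add: xmon_mult)
  fix s assume "s \<in> carrier (monoid_ring N)"
  then have "Poly_Mapping.keys s \<subseteq> N" by simp
  then have "\<exists>k. \<forall>l\<ge>k. Poly_Mapping.keys (s * xmon (zmul (int l) a)) \<subseteq> M"
  proof (induct s rule: poly_mapping_additive_induct)
    case (single t c)
    then obtain k :: nat where k: "t + zmul (int k) a \<in> M" using den by blast
    have "t + zmul (int l) a \<in> M" if "k \<le> l" for l
    proof -
      have "zmul (int l) a = zmul (int k) a + zmul (int (l - k)) a"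
        using that by (simp add: zmul_add_left[symmetric] of_nat_diff)
      then have *: "t + zmul (int l) a = (t + zmul (int k) a) + zmul (int (l - k)) a"
        by (simp add: add.assoc)
      show ?thesis unfolding * by (intro submonoid_add[OF M] k zmul_in[OF M a(1)]) simp
    qed
    then show ?case by (auto simp: mult_single)
  next
    case (add p q)
    then obtain k l where "\<forall>i\<ge>k. Poly_Mapping.keys (p * xmon (zmul (int i) a)) \<subseteq> M"
      "\<forall>i\<ge>l. Poly_Mapping.keys (q * xmon (zmul (int i) a)) \<subseteq> M" by auto
    then show ?case
      by (intro exI[of _ "max k l"]) (simp add: ring_distribs keys_add_subset)
  qed simp
  then obtain k where k: "Poly_Mapping.keys (s * xmon (zmul (int k) a)) \<subseteq> M" by blast
  then show "\<exists>x\<in>carrier (monoid_ring M). \<exists>n::nat. s \<otimes>\<^bsub>monoid_ring N\<^esub> id (xmon a) [^]\<^bsub>monoid_ring N\<^esub> n = id x"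
    by (intro bexI[of _ "s * xmon (zmul (int k) a)"] exI[of _ k]) (simp_all add: xmon_power)
next
  fix x assume "id x = \<zero>\<^bsub>monoid_ring N\<^esub>"
  then show "\<exists>n::nat. xmon a [^]\<^bsub>monoid_ring M\<^esub> n \<otimes>\<^bsub>monoid_ring M\<^esub> x = \<zero>\<^bsub>monoid_ring M\<^esub>" by simp
qed

locale smooth_seq =
  fixes M :: "'t::ab_group_add set" and Es :: "('t \<Rightarrow> int) list"
  assumes fg: "fg_submonoid M" and smooth: "smooth_sequence M Es"
begin

abbreviation "N \<equiv> seq_monoid Es"

lemma M: "additive_submonoid M" by (rule fg_submonoid_additive[OF fg])

lemma E_add: "E \<in> set Es \<Longrightarrow> E (s + t) = E s + E t"
  using smooth by (auto simp: smooth_sequence_def dual_monoid_def)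

lemma E_nonneg: "E \<in> set Es \<Longrightarrow> t \<in> M \<Longrightarrow> E t \<ge> 0"
  using smooth by (auto simp: smooth_sequence_def dual_monoid_def)

lemma E_zero: "E \<in> set Es \<Longrightarrow> E 0 = 0" using E_add[of E 0 0] by simp

lemma E_diff: "E \<in> set Es \<Longrightarrow> E (s - t) = E s - E t" using E_add[of E "s - t" t] by simp

lemma E_zmul: "E \<in> set Es \<Longrightarrow> E (zmul k t) = k * E t"
  using zmul_additive_image[of E k t] E_add by simp

lemma E_sum: "E \<in> set Es \<Longrightarrow> E (\<Sum>i\<in>A. F i) = (\<Sum>i\<in>A. E (F i))"
  by (induct A rule: infinite_finite_induct) (simp_all add: E_zero E_add)

lemma N: "additive_submonoid N"
  by (auto simp: additive_submonoid_def seq_monoid_def E_zero E_add)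

lemma MN: "M \<subseteq> N" using E_nonneg by (auto simp: seq_monoid_def)

lemma kernel_subgp: "additive_subgp (seq_kernel Es)"
  by (auto simp: additive_subgp_def seq_kernel_def E_zero E_diff)

lemma kernel_differences: "seq_kernel Es = differences (M \<inter> seq_kernel Es)"
proof -
  have "additive_submonoid (M \<inter> seq_kernel Es)"
    using M additive_subgpD[OF kernel_subgp] by (auto simp: additive_submonoid_def)
  from generate_ambient_group[OF this] show ?thesis using smooth by (simp add: smooth_sequence_def)
qed

definition v :: "nat \<Rightarrow> 't" where
  "v = (SOME v. \<forall>j < length Es. v j \<in> M \<and> (\<forall>i < length Es. (Es ! i) (v j) = (if i = j then 1 else 0)))"

lemma v: "j < length Es \<Longrightarrow> v j \<in> M"
  "i < length Es \<Longrightarrow> j < length Es \<Longrightarrow> (Es ! i) (v j) = (if i = j then 1 else 0)"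
proof -
  have "\<exists>v. \<forall>j < length Es. v j \<in> M \<and> (\<forall>i < length Es. (Es ! i) (v j) = (if i = j then 1 else 0))"
    using smooth by (simp add: smooth_sequence_def)
  from someI_ex[OF this, folded v_def]
  show "j < length Es \<Longrightarrow> v j \<in> M"
    "i < length Es \<Longrightarrow> j < length Es \<Longrightarrow> (Es ! i) (v j) = (if i = j then 1 else 0)" by auto
qed

text \<open>The projection to the kernel of the sequence, along the elements \<open>v j\<close>.\<close>

definition u :: "'t \<Rightarrow> 't" where
  "u t = t - (\<Sum>j<length Es. zmul ((Es ! j) t) (v j))"

lemma u_kernel: "u t \<in> seq_kernel Es"
  unfolding seq_kernel_def
proof (intro CollectI ballI)
  fix E assume E: "E \<in> set Es"
  then obtain i where i: "i < length Es" "E = Es ! i" by (auto simp: in_set_conv_nth)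
  have "E (u t) = E t - (\<Sum>j<length Es. (Es ! j) t * E (v j))"
    using E by (simp add: u_def E_diff E_sum E_zmul)
  also have "(\<Sum>j<length Es. (Es ! j) t * E (v j)) = (\<Sum>j<length Es. if j = i then E t else 0)"
    by (rule sum.cong) (use v(2) i in auto)
  finally show "E (u t) = 0" using i by simp
qed

lemma u_add: "u (s + t) = u s + u t"
proof -
  have "(\<Sum>j<length Es. zmul ((Es ! j) (s + t)) (v j)) =
    (\<Sum>j<length Es. zmul ((Es ! j) s) (v j)) + (\<Sum>j<length Es. zmul ((Es ! j) t) (v j))"
    unfolding sum.distrib[symmetric] by (rule sum.cong) (auto simp: E_add zmul_add_left)
  then show ?thesis by (simp add: u_def)
qed

lemma u_on_kernel:
  assumes "t \<in> seq_kernel Es" shows "u t = t"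
proof -
  have "(Es ! j) t = 0" if "j < length Es" for j
    using assms nth_mem[OF that] by (simp add: seq_kernel_def)
  then have "(\<Sum>j<length Es. zmul ((Es ! j) t) (v j)) = 0" by simp
  then show ?thesis by (simp add: u_def)
qed

lemma u_v:
  assumes "i < length Es" shows "u (v i) = 0"
proof -
  have "(\<Sum>j<length Es. zmul ((Es ! j) (v i)) (v j)) = (\<Sum>j<length Es. if j = i then v i else 0)"
    by (rule sum.cong) (use v(2) assms in auto)
  then show ?thesis using assms by (simp add: u_def)
qed

text \<open>Take the sum \<open>a\<close> of the generators of \<open>M\<close> in the kernel. Since the sequence is non-negative on
  \<open>M\<close>, every element of \<open>M\<close> in the kernel is a sum of such generators, and is therefore dominated by a
  multiple of \<open>a\<close>. An element \<open>t\<close> of \<open>N\<close> is a non-negative combination of the \<open>v j\<close> plus \<open>u t\<close>, which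
  is a difference of two elements of \<open>M\<close> in the kernel.\<close>

lemma denominator_exists:
  "\<exists>a. a \<in> M \<and> - a \<in> N \<and> (\<forall>t\<in>N. \<exists>k::nat. t + zmul (int k) a \<in> M)"
proof -
  obtain A where A: "finite A" "M = sum_list ` lists A" using fg by (auto simp: fg_submonoid_def)
  have AM: "A \<subseteq> M"
  proof
    fix x assume "x \<in> A"
    then show "x \<in> M" unfolding A(2) by (intro image_eqI[of _ _ "[x]"]) auto
  qed
  define B where "B = A \<inter> seq_kernel Es"
  let ?F = "M \<inter> seq_kernel Es"
  have F: "additive_submonoid ?F"
    using M additive_subgpD[OF kernel_subgp] by (auto simp: additive_submonoid_def)
  have BF: "B \<subseteq> ?F" using AM by (auto simp: B_def)
  define a where "a = \<Sum>B"
  have aF: "a \<in> ?F" unfolding a_def by (rule sum_in[OF F]) (use BF in auto)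
  have ax: "a - x \<in> ?F" if "x \<in> B" for x
  proof -
    have "a = x + \<Sum>(B - {x})" unfolding a_def using A(1) that by (simp add: B_def sum.remove)
    moreover have "\<Sum>(B - {x}) \<in> ?F" by (rule sum_in[OF F]) (use BF in auto)
    ultimately show ?thesis by simp
  qed
  have lists: "\<exists>k::nat. zmul (int k) a - sum_list xs \<in> ?F" if "set xs \<subseteq> B" for xs
    using that
  proof (induct xs)
    case Nil
    then show ?case using F by (intro exI[of _ 0]) (simp add: additive_submonoid_def)
  next
    case (Cons x xs)
    then obtain k :: nat where k: "zmul (int k) a - sum_list xs \<in> ?F" by auto
    have "zmul (int (Suc k)) a - sum_list (x # xs) = (zmul (int k) a - sum_list xs) + (a - x)"
      using zmul_succ[of "int k" a] by (simp add: algebra_simps)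
    also have "\<dots> \<in> ?F" using k ax[of x] Cons(2) F unfolding additive_submonoid_def by simp
    finally show ?case by blast
  qed
  have dom: "\<exists>k::nat. zmul (int k) a - x \<in> ?F" if "x \<in> ?F" for x
  proof -
    have "x \<in> sum_list ` lists A" using that A(2) by blast
    then obtain xs where xs: "set xs \<subseteq> A" "x = sum_list xs" by auto
    have "set xs \<subseteq> B"
    proof
      fix y assume y: "y \<in> set xs"
      have "E y = 0" if E: "E \<in> set Es" for E
      proof -
        have "E (sum_list zs) = sum_list (map E zs)" for zs
          by (induct zs) (simp_all add: E_zero[OF E] E_add[OF E])
        then have "sum_list (map E xs) = E x" using xs(2) by simp
        also have "\<dots> = 0" using \<open>x \<in> ?F\<close> E by (simp add: seq_kernel_def)
        finally have "sum_list (map E xs) = 0" .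
        moreover have "\<forall>z\<in>set (map E xs). 0 \<le> z" using E_nonneg[OF E] xs(1) AM by auto
        ultimately show "E y = 0" using y sum_list_nonneg_eq_0_iff[of "map E xs"] by auto
      qed
      then show "y \<in> B" using y xs(1) by (auto simp: B_def seq_kernel_def)
    qed
    then show ?thesis using lists xs(2) by blast
  qed
  have "\<exists>k::nat. t + zmul (int k) a \<in> M" if t: "t \<in> N" for t
  proof -
    have "u t \<in> differences ?F" using u_kernel[of t] kernel_differences by simp
    then obtain x y where xy: "u t = x - y" "x \<in> ?F" "y \<in> ?F"
      unfolding differences_def by blast
    obtain k :: nat where k: "zmul (int k) a - y \<in> ?F" using dom xy(3) by blast
    have s: "(\<Sum>j<length Es. zmul ((Es ! j) t) (v j)) \<in> M"
      by (rule sum_in[OF M], rule zmul_in[OF M]) (use t v(1) in \<open>auto simp: seq_monoid_def\<close>)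
    have "t + zmul (int k) a = x + (zmul (int k) a - y) + (\<Sum>j<length Es. zmul ((Es ! j) t) (v j))"
      using xy(1) by (simp add: u_def algebra_simps)
    also have "\<dots> \<in> M" using s k xy(2) by (intro submonoid_add[OF M]) blast+
    finally show ?thesis ..
  qed
  moreover have "- a \<in> N"
    using aF additive_subgpD(3)[OF kernel_subgp, of a] by (simp add: seq_kernel_def seq_monoid_def)
  ultimately show ?thesis using aF by blast
qed

definition den :: 't where
  "den = (SOME a. a \<in> M \<and> - a \<in> N \<and> (\<forall>t\<in>N. \<exists>k::nat. t + zmul (int k) a \<in> M))"

lemma den: "den \<in> M" "- den \<in> N" "t \<in> N \<Longrightarrow> \<exists>k::nat. t + zmul (int k) den \<in> M"
  using someI_ex[OF denominator_exists] unfolding den_def by blast+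

lemma den_localization: "localization_away (monoid_ring M) (xmon den) (monoid_ring N) id"
  by (rule submonoid_localization[OF M N MN den])

lemma seq_open_eq: "seq_open M Es = {p \<in> Spec (monoid_ring M). xmon den \<notin> p}"
proof -
  interpret localization "monoid_ring M" "monoid_ring N" id "xmon den"
    by (rule localizationI[OF cring_monoid_ring[OF M] cring_monoid_ring[OF N] _ den_localization])
      (simp add: den)
  show ?thesis unfolding seq_open_def by (rule spec_map_image)
qed

end

section \<open>The charts of smooth sequences are standard smooth\<close>

text \<open>Freeness of finite rank, in a form which passes to all subgroups.\<close>

definition has_coordinates :: "'t::ab_group_add itself \<Rightarrow> bool" where
  "has_coordinates (_ :: 't itself) \<longleftrightarrow> (\<exists>n. \<exists>\<kappa> :: nat \<Rightarrow> 't \<Rightarrow> int.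
     (\<forall>i s t. \<kappa> i (s + t) = \<kappa> i s + \<kappa> i t) \<and> (\<forall>t. (\<forall>i<n. \<kappa> i t = 0) \<longrightarrow> t = 0))"

lemma free_has_coordinates:
  assumes "(ambient_group :: 't::ab_group_add monoid) \<cong> free_Abelian_group {..<n::nat}"
  shows "has_coordinates TYPE('t)"
proof -
  obtain j where j: "j \<in> Group.iso (ambient_group :: 't monoid) (free_Abelian_group {..<n})"
    using assms by (auto simp: is_iso_def)
  have add: "j (s + t) = j s + j t" for s t
    using j by (auto simp: Group.iso_def hom_def)
  have carr: "Poly_Mapping.keys (j t) \<subseteq> {..<n}" for t
    using j unfolding Group.iso_def hom_def by (metis (lifting) IntE PiE UNIV_I ambient_group_simps(1) carrier_free_Abelian_group_iff mem_Collect_eq)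
  have inj: "inj j" using j by (auto simp: Group.iso_def bij_betw_def)
  have j0: "j 0 = 0" using add[of 0 0] by simp
  have "t = 0" if "\<forall>i<n. Poly_Mapping.lookup (j t) i = 0" for t
  proof -
    have "j t = 0"
    proof (rule poly_mapping_eqI)
      fix i show "Poly_Mapping.lookup (j t) i = Poly_Mapping.lookup 0 i"
        using that carr[of t] by (cases "i < n") (auto simp: in_keys_iff subset_eq)
    qed
    then show ?thesis using inj j0 by (metis injD)
  qed
  then show ?thesis unfolding has_coordinates_def
    by (intro exI[of _ n] exI[of _ "\<lambda>i t. Poly_Mapping.lookup (j t) i"]) (auto simp: add lookup_add)
qed

lemma has_zbasis:
  assumes "has_coordinates TYPE('t::ab_group_add)" "additive_subgp (H :: 't set)"
  obtains k b where "zbasis H k b"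
  using assms subgroup_has_zbasis unfolding has_coordinates_def by metis

lemma of_int_xmon: "of_int c * xmon t = Poly_Mapping.single t c"
proof -
  have "(of_int c :: 'a \<Rightarrow>\<^sub>0 int) = Poly_Mapping.single 0 (of_int c)" by (simp only: single_of_int)
  then show ?thesis by (simp add: mult_single)
qed

context smooth_seq begin

text \<open>Let \<open>e\<close> be a basis of the kernel, of size \<open>k\<close>. The monoid \<open>N\<close> is the product of the group with basis
  \<open>e\<close> and of the free monoid on the \<open>v j\<close>. As a monoid it is generated by \<open>e\<close>, the \<open>v j\<close> and the
  negative of the sum of \<open>e\<close>; let \<open>x\<^sub>1, \<dots>, x\<^sub>k\<close>, the remaining variables and \<open>x\<^sub>0\<close> correspond to
  these. Then the only relation is \<open>x\<^sub>0 x\<^sub>1 \<cdots> x\<^sub>k = 1\<close>, and its derivative with respect to \<open>x\<^sub>0\<close> is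
  \<open>x\<^sub>1 \<cdots> x\<^sub>k\<close>, the inverse of \<open>x\<^sub>0\<close>.\<close>

lemma standard_smooth_chart:
  assumes coord: "has_coordinates TYPE('t)"
  shows "\<exists>n c f k. c \<le> n \<and> f ` {..<c} \<subseteq> carrier (int_poly_ring n) \<and>
     (let I = genideal (int_poly_ring n) (f ` {..<c}); S = int_poly_ring n Quot I in
       k \<in> ring_iso (monoid_ring N) S \<and> I +>\<^bsub>int_poly_ring n\<^esub> jacobian_minor c f \<in> Units S)"
proof -
  obtain k e where e: "zbasis (seq_kernel Es) k e" using has_zbasis[OF coord kernel_subgp] .
  have eH: "e i \<in> seq_kernel Es" if "i < k" for i using e that by (simp add: zbasis_def)
  obtain C where C: "\<And>t. t \<in> seq_kernel Es \<Longrightarrow> t = (\<Sum>i<k. zmul (C i t) (e i))"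
    "\<And>i s t. i < k \<Longrightarrow> s \<in> seq_kernel Es \<Longrightarrow> t \<in> seq_kernel Es \<Longrightarrow> C i (s + t) = C i s + C i t"
    "\<And>i j. i < k \<Longrightarrow> j < k \<Longrightarrow> C i (e j) = (if i = j then 1 else 0)"
    using zbasis_coordinates[OF kernel_subgp e] by blast
  define s where "s = length Es"
  define n where "n = Suc (k + s)"
  define cc where "cc i t = C i (u t)" for i t
  have cadd: "cc i (x + y) = cc i x + cc i y" if "i < k" for i x y
    using that C(2)[OF that u_kernel u_kernel] by (simp add: cc_def u_add)
  have c0: "cc i 0 = 0" if "i < k" for i using cadd[OF that, of 0 0] by simp
  have czm: "cc i (zmul l x) = l * cc i x" if "i < k" for i l x
    using zmul_additive_image[of "cc i" l x] cadd[OF that] by simp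
  have csum: "cc i (\<Sum>j\<in>A. F j) = (\<Sum>j\<in>A. cc i (F j))" if "i < k" for i F and A :: "nat set"
    by (induct A rule: infinite_finite_induct) (simp_all add: c0[OF that] cadd[OF that])
  have ce: "cc i (e j) = (if i = j then 1 else 0)" if "i < k" "j < k" for i j
    using C(3)[OF that] u_on_kernel[OF eH[OF that(2)]] by (simp add: cc_def)
  have cv: "cc i (v j) = 0" if "i < k" "j < s" for i j
    using u_v[of j] that C(2)[of i 0 0] additive_subgpD(1)[OF kernel_subgp] by (simp add: cc_def s_def)
  have decomp: "t = (\<Sum>i<k. zmul (cc i t) (e i)) + (\<Sum>j<s. zmul ((Es ! j) t) (v j))" for t
    using C(1)[OF u_kernel[of t]] by (simp add: cc_def s_def u_def algebra_simps)
  define y where "y j = (case j of 0 \<Rightarrow> - (\<Sum>i<k. e i) | Suc i \<Rightarrow> if i < k then e i else v (i - k))" for j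
  define \<mu> :: "(nat \<Rightarrow>\<^sub>0 nat) \<Rightarrow> 't" where
    "\<mu> m = (\<Sum>j<n. zmul (int (Poly_Mapping.lookup m j)) (y j))" for m
  have split: "(\<Sum>j<n. F j) = F 0 + (\<Sum>i<k. F (Suc i)) + (\<Sum>j<s. F (Suc (k + j)))" for F :: "nat \<Rightarrow> 'z::comm_monoid_add"
  proof -
    have "(\<Sum>j<n. F j) = F 0 + (\<Sum>i<k + s. F (Suc i))" by (simp only: n_def sum.lessThan_Suc_shift)
    also have "(\<Sum>i<k + s. F (Suc i)) = (\<Sum>i<k. F (Suc i)) + (\<Sum>j<s. F (Suc (k + j)))"
      by (induct s) (simp_all add: add.assoc)
    finally show ?thesis by (simp add: add.assoc)
  qed
  have mu_add: "\<mu> (m + m') = \<mu> m + \<mu> m'" for m m'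
    by (simp add: \<mu>_def lookup_add zmul_add_left sum.distrib)
  have mu0: "\<mu> 0 = 0" by (simp add: \<mu>_def)
  have mu_split: "\<mu> m = zmul (int (Poly_Mapping.lookup m 0)) (- (\<Sum>i<k. e i)) +
      (\<Sum>i<k. zmul (int (Poly_Mapping.lookup m (Suc i))) (e i)) +
      (\<Sum>j<s. zmul (int (Poly_Mapping.lookup m (Suc (k + j)))) (v j))" for m
    unfolding \<mu>_def split by (simp add: y_def)
  have c_mu: "cc i (\<mu> m) = int (Poly_Mapping.lookup m (Suc i)) - int (Poly_Mapping.lookup m 0)" if i: "i < k" for i m
  proof -
    have neg: "cc i (- x) = - cc i x" for x using cadd[OF i, of x "- x"] c0[OF i] by simp
    have "(\<Sum>j<k. cc i (e j)) = (\<Sum>j<k. if j = i then 1 else 0)"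
      by (rule sum.cong) (use ce i in auto)
    then have 1: "(\<Sum>j<k. cc i (e j)) = 1" using i by simp
    have "(\<Sum>j<k. int (Poly_Mapping.lookup m (Suc j)) * cc i (e j)) =
        (\<Sum>j<k. if j = i then int (Poly_Mapping.lookup m (Suc j)) else 0)"
      by (rule sum.cong) (use ce i in auto)
    then have 2: "(\<Sum>j<k. int (Poly_Mapping.lookup m (Suc j)) * cc i (e j)) = int (Poly_Mapping.lookup m (Suc i))"
      using i by simp
    have 3: "(\<Sum>j<s. int (Poly_Mapping.lookup m (Suc (k + j))) * cc i (v j)) = 0"
      by (rule sum.neutral) (use cv i in auto)
    show ?thesis unfolding mu_split by (simp add: cadd[OF i] czm[OF i] csum[OF i] neg 1 2 3)
  qed
  have E_mu: "(Es ! l) (\<mu> m) = int (Poly_Mapping.lookup m (Suc (k + l)))" if l: "l < s" for l m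
  proof -
    have El: "Es ! l \<in> set Es" using l by (simp add: s_def)
    have Ee: "(Es ! l) (e i) = 0" if "i < k" for i using eH[OF that] El by (simp add: seq_kernel_def)
    have "(Es ! l) (- (\<Sum>i<k. e i)) = 0"
      using E_diff[OF El, of 0 "\<Sum>i<k. e i"] by (simp add: E_zero[OF El] E_sum[OF El] Ee)
    moreover have "(\<Sum>j<s. int (Poly_Mapping.lookup m (Suc (k + j))) * (Es ! l) (v j)) =
        (\<Sum>j<s. if j = l then int (Poly_Mapping.lookup m (Suc (k + j))) else 0)"
      by (rule sum.cong) (use v(2) l in \<open>auto simp: s_def\<close>)
    ultimately show ?thesis unfolding mu_split using l
      by (simp add: E_add[OF El] E_zmul[OF El] E_sum[OF El] Ee)
  qed
  have mu_N: "\<mu> m \<in> N" for m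
    unfolding seq_monoid_def using E_mu by (auto simp: in_set_conv_nth s_def)
  \<comment> \<open>The vector \<open>\<sigma> t\<close> is a preimage of \<open>t\<close> under
    \<open>\<mu>\<close>. The coordinates \<open>cc i t\<close> may be negative; adding \<open>d t\<close> to
    them and using \<open>x\<^sub>0\<close> with exponent \<open>d t\<close> compensates for this.\<close>
  define d where "d t = (\<Sum>i<k. nat (- cc i t))" for t
  have d: "0 \<le> cc i t + int (d t)" if "i < k" for i t
  proof -
    have "nat (- cc i t) \<le> d t" unfolding d_def by (rule member_le_sum) (use that in auto)
    then show ?thesis by linarith
  qed
  define w where "w t j = (case j of 0 \<Rightarrow> d t | Suc i \<Rightarrow>
     if i < k then nat (cc i t + int (d t)) else nat ((Es ! (i - k)) t))" for t j
  define \<sigma> where "\<sigma> t = (\<Sum>j<n. Poly_Mapping.single j (w t j))" for t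
  have lookup_sigma: "Poly_Mapping.lookup (\<sigma> t) j = (if j < n then w t j else 0)" for t j
    by (simp add: \<sigma>_def lookup_sum lookup_single when_def)
  have sigma_exps: "\<sigma> t \<in> poly_exps n" for t
    by (auto simp: in_keys_iff lookup_sigma split: if_splits)
  have mu_sigma: "\<mu> (\<sigma> t) = t" if t: "t \<in> N" for t
  proof -
    have "(\<Sum>i<k. zmul (int (w t (Suc i))) (e i)) = (\<Sum>i<k. zmul (cc i t) (e i)) + zmul (int (d t)) (\<Sum>i<k. e i)"
    proof -
      have "zmul l (\<Sum>i\<in>A. F i) = (\<Sum>i\<in>A. zmul l (F i))" for l and A :: "nat set" and F :: "nat \<Rightarrow> 't"
        by (induct A rule: infinite_finite_induct) (simp_all add: zmul_add_right)
      then show ?thesis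
        unfolding sum.distrib[symmetric] zmul_add_left[symmetric]
        by (simp add: sum.distrib[symmetric] zmul_add_left[symmetric] w_def d)
    qed
    moreover have "(\<Sum>j<s. zmul (int (w t (Suc (k + j)))) (v j)) = (\<Sum>j<s. zmul ((Es ! j) t) (v j))"
      using t by (intro sum.cong) (auto simp: w_def seq_monoid_def s_def)
    moreover have "w t 0 = d t" by (simp add: w_def)
    ultimately show ?thesis
      using decomp[of t] unfolding mu_split by (simp add: lookup_sigma n_def zmul_uminus_right)
  qed
  define W :: "nat \<Rightarrow> nat \<Rightarrow>\<^sub>0 nat" where "W l = (\<Sum>j<Suc k. Poly_Mapping.single j l)" for l
  define U where "U = W 1"
  have smU: "Poly_Mapping.lookup (W l) j = (if j \<le> k then l else 0)" for l j
    by (simp add: W_def lookup_sum lookup_single when_def less_Suc_eq_le del: sum.lessThan_Suc)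
  have lookup_U: "Poly_Mapping.lookup U j = (if j \<le> k then 1 else 0)" for j
    by (simp add: U_def smU)
  have W0: "W 0 = 0" by (rule poly_mapping_eqI) (simp add: smU)
  have WSuc: "W (Suc l) = W l + U" for l by (rule poly_mapping_eqI) (simp add: smU lookup_add lookup_U)
  \<comment> \<open>Exponents with the same image under \<open>\<mu>\<close> differ by multiples of
    \<open>U\<close>, the exponent of \<open>x\<^sub>0 x\<^sub>1 \<cdots> x\<^sub>k\<close>.\<close>
  have lookup_sm: "\<sigma> (\<mu> m) + W (Poly_Mapping.lookup m 0) = m + W (d (\<mu> m))" if m: "m \<in> poly_exps n" for m
  proof (rule poly_mapping_eqI)
    fix j
    show "Poly_Mapping.lookup (\<sigma> (\<mu> m) + W (Poly_Mapping.lookup m 0)) j =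
        Poly_Mapping.lookup (m + W (d (\<mu> m))) j"
    proof (cases "j < n")
      case False
      then have "j \<notin> Poly_Mapping.keys m" using m by auto
      then show ?thesis using False by (simp add: lookup_add lookup_sigma smU n_def in_keys_iff)
    next
      case True
      consider "j = 0" | i where "j = Suc i" "i < k" | l where "j = Suc (k + l)" "l < s"
        using True n_def by (metis add_diff_inverse_nat less_Suc_eq_0_disj nat_add_left_cancel_less)
      then show ?thesis
      proof cases
        case 1
        then show ?thesis by (simp add: lookup_add lookup_sigma smU n_def w_def)
      next
        case 2
        have "int (w (\<mu> m) j) = int (Poly_Mapping.lookup m j) - int (Poly_Mapping.lookup m 0) + int (d (\<mu> m))"
          using 2 d[of i "\<mu> m"] c_mu[OF 2(2), of m] by (simp add: w_def)
        then show ?thesis using 2 True by (simp add: lookup_add lookup_sigma smU)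
      next
        case 3
        then show ?thesis using E_mu[OF 3(2), of m] True by (simp add: lookup_add lookup_sigma smU w_def)
      qed
    qed
  qed
  \<comment> \<open>As \<open>x\<^sup>U = 1\<close> in the quotient, \<open>\<sigma>\<close> induces a
    homomorphism \<open>\<zeta>\<close> on monoid rings up to the ideal, and it is inverse to the homomorphism
    \<open>\<psi>\<close> induced by \<open>\<mu>\<close>.\<close>
  let ?P = "int_poly_ring n"
  interpret P: cring ?P by (rule cring_int_poly_ring)
  have P_simps: "x \<otimes>\<^bsub>?P\<^esub> y = x * y" "x \<oplus>\<^bsub>?P\<^esub> y = x + y" "\<one>\<^bsub>?P\<^esub> = 1" "\<zero>\<^bsub>?P\<^esub> = 0" for x y
    by (simp_all add: int_poly_ring_def)
  define f :: "nat \<Rightarrow> int_mpoly" where "f = (\<lambda>_. xmon U - 1)"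
  have Uexp: "U \<in> poly_exps n" by (auto simp: in_keys_iff lookup_U n_def split: if_splits)
  have xP: "xmon m \<in> carrier ?P" if "m \<in> poly_exps n" for m using that by (simp add: carrier_int_poly_ring)
  have oneP: "1 \<in> carrier ?P" using P.one_closed by (simp add: P_simps)
  have diffP: "p - q \<in> carrier ?P" if "p \<in> carrier ?P" "q \<in> carrier ?P" for p q
    using that Poly_Mapping.keys_diff[of p q] by (auto simp: carrier_int_poly_ring)
  have minus_eq: "p \<ominus>\<^bsub>?P\<^esub> q = p - q" if "p \<in> carrier ?P" "q \<in> carrier ?P" for p q
  proof -
    have "0 \<in> carrier ?P" using P.zero_closed by (simp only: P_simps)
    then have "- q \<in> carrier ?P" using diffP[of 0 q] that by simp
    then have "\<ominus>\<^bsub>?P\<^esub> q = - q" using that by (intro P.minus_equality) (simp_all add: P_simps)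
    then show ?thesis by (simp add: a_minus_def P_simps)
  qed
  have fP: "f ` {..<1} \<subseteq> carrier ?P" using diffP[OF xP[OF Uexp] oneP] by (auto simp: f_def)
  define I where "I = genideal ?P (f ` {..<1})"
  have I: "ideal I ?P" unfolding I_def by (rule P.genideal_ideal[OF fP])
  interpret I: ideal I ?P by (rule I)
  define S where "S = ?P Quot I"
  interpret S: cring S unfolding S_def by (rule I.quotient_is_cring[OF cring_int_poly_ring])
  define cls where "cls p = I +>\<^bsub>?P\<^esub> p" for p
  have cls: "cls \<in> ring_hom ?P S"
    using I.rcos_ring_hom by (simp add: cls_def[abs_def] S_def)
  interpret cls: ring_hom_cring ?P S cls by unfold_locales (rule cls)
  have cls_eq: "cls p = cls q \<longleftrightarrow> p - q \<in> I" if "p \<in> carrier ?P" "q \<in> carrier ?P" for p q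
    using P.quotient_eq_iff_same_a_r_cos[OF I that] minus_eq[OF that] by (simp add: cls_def)
  have clsU: "cls (xmon U) = \<one>\<^bsub>S\<^esub>"
  proof -
    have "xmon U - 1 \<in> I" unfolding I_def using P.genideal_self[OF fP] by (auto simp: f_def)
    then have "cls (xmon U) = cls 1" using cls_eq[OF xP[OF Uexp] oneP] by simp
    then show ?thesis using cls.hom_one by (simp add: P_simps)
  qed
  have sumU: "W l \<in> poly_exps n" for l
    by (auto simp: in_keys_iff smU n_def split: if_splits)
  have exps_add: "m + m' \<in> poly_exps n" if "m \<in> poly_exps n" "m' \<in> poly_exps n" for m m'
    using submonoid_add[OF poly_exps_submonoid that] .
  have cls_shift: "cls (xmon (m + W l)) = cls (xmon m)" if m: "m \<in> poly_exps n" for m l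
  proof (induct l)
    case (Suc l)
    have "xmon (m + W (Suc l)) = xmon (m + W l) \<otimes>\<^bsub>?P\<^esub> xmon U"
      by (simp add: P_simps xmon_mult add.assoc WSuc)
    then have "cls (xmon (m + W (Suc l))) = cls (xmon (m + W l))"
      using xP[OF Uexp] xP[OF exps_add[OF m sumU]] by (simp add: clsU)
    then show ?case using Suc by simp
  qed (simp add: W0)
  have cls_sm: "cls (xmon (\<sigma> (\<mu> m))) = cls (xmon m)" if m: "m \<in> poly_exps n" for m
    using lookup_sm[OF m] cls_shift[OF m] cls_shift[OF sigma_exps] by metis
  define \<psi> where "\<psi> = mon_eval (\<lambda>m. xmon (\<mu> m))"
  have mu_char: "char_on A (\<lambda>m. xmon (\<mu> m))" for A
    by (simp add: char_on_def mu_add mu0 xmon_mult[symmetric])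
  have psi_mult: "\<psi> (p * q) = \<psi> p * \<psi> q" for p q
    unfolding \<psi>_def by (rule mon_eval_mult[of UNIV]) (simp_all add: mu_char)
  have psi_add: "\<psi> (p + q) = \<psi> p + \<psi> q" for p q unfolding \<psi>_def by (rule mon_eval_add)
  have psi_N: "Poly_Mapping.keys (\<psi> p) \<subseteq> N" for p
    unfolding \<psi>_def mon_eval_def
    by (intro keys_sum_subset keys_mult_subset[OF N] keys_of_int_subset[OF N]) (use mu_N in auto)
  have psi_hom: "\<psi> \<in> ring_hom ?P (monoid_ring UNIV)"
    by (rule ring_hom_memI) (simp_all add: P_simps psi_mult psi_add, simp add: \<psi>_def mu0)
  have psi_I: "\<psi> x = 0" if "x \<in> I" for x
  proof -
    have "\<mu> U = 0"
      unfolding mu_split by (simp add: lookup_U zmul_uminus_right)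
    then have "\<psi> (xmon U - 1) = 0" by (simp add: \<psi>_def mon_eval_diff mu0)
    then have "\<psi> x = \<zero>\<^bsub>monoid_ring UNIV\<^esub>"
      using genideal_hom_zero[OF cring_int_poly_ring cring_monoid_ring psi_hom fP _ that[unfolded I_def]]
      by (auto simp: f_def additive_submonoid_def)
    then show ?thesis by simp
  qed
  define \<zeta> where "\<zeta> = mon_eval (\<lambda>t. xmon (\<sigma> t))"
  have zeta_add: "\<zeta> (p + q) = \<zeta> p + \<zeta> q" for p q unfolding \<zeta>_def by (rule mon_eval_add)
  have zetaP: "\<zeta> q \<in> carrier ?P" for q
    unfolding \<zeta>_def mon_eval_def carrier_int_poly_ring mem_Collect_eq
    by (intro keys_sum_subset keys_mult_subset[OF poly_exps_submonoid] keys_of_int_subset[OF poly_exps_submonoid])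
      (use sigma_exps in auto)
  have zeta_psi: "cls (\<zeta> (\<psi> p)) = cls p" if "p \<in> carrier ?P" for p
    using that unfolding carrier_int_poly_ring mem_Collect_eq
  proof (induct p rule: poly_mapping_additive_induct)
    case zero
    show ?case by (simp add: \<zeta>_def \<psi>_def)
  next
    case (single m c)
    have ci: "of_int c \<in> carrier ?P"
      using keys_of_int_subset[OF poly_exps_submonoid] by (simp add: carrier_int_poly_ring)
    have "\<zeta> (\<psi> (Poly_Mapping.single m c)) = of_int c * xmon (\<sigma> (\<mu> m))"
      by (simp add: \<psi>_def \<zeta>_def of_int_xmon)
    also have "cls \<dots> = cls (of_int c) \<otimes>\<^bsub>S\<^esub> cls (xmon (\<sigma> (\<mu> m)))"
      using cls.hom_mult[OF ci xP[OF sigma_exps]] by (simp add: P_simps)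
    also have "\<dots> = cls (of_int c * xmon m)"
      using cls.hom_mult[OF ci xP[OF single]] cls_sm[OF single] by (simp add: P_simps)
    finally show ?case by (simp add: of_int_xmon)
  next
    case (add p q)
    then have "p \<in> carrier ?P" "q \<in> carrier ?P" by (simp_all add: carrier_int_poly_ring)
    then have "cls (p + q) = cls p \<oplus>\<^bsub>S\<^esub> cls q" using cls.hom_add by (simp add: P_simps)
    moreover have "cls (\<zeta> (\<psi> p) + \<zeta> (\<psi> q)) = cls (\<zeta> (\<psi> p)) \<oplus>\<^bsub>S\<^esub> cls (\<zeta> (\<psi> q))"
      using cls.hom_add[OF zetaP zetaP] by (simp add: P_simps)
    ultimately show ?case using add by (simp add: psi_add zeta_add)
  qed
  have psi_zeta: "\<psi> (\<zeta> q) = q" if "Poly_Mapping.keys q \<subseteq> N" for q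
    using that
  proof (induct q rule: poly_mapping_additive_induct)
    case (single t c)
    then show ?case by (simp add: \<psi>_def \<zeta>_def of_int_xmon mu_sigma)
  qed (simp_all add: psi_add zeta_add, simp add: \<psi>_def \<zeta>_def)
  let ?k = "\<lambda>q. cls (\<zeta> q)"
  have "?k \<in> ring_iso (monoid_ring N) S"
  proof (rule ring_iso_memI)
    fix p assume "p \<in> carrier (monoid_ring N)"
    then have p: "Poly_Mapping.keys p \<subseteq> N" by simp
    show "?k p \<in> carrier S" using zetaP by simp
    fix q assume "q \<in> carrier (monoid_ring N)"
    then have q: "Poly_Mapping.keys q \<subseteq> N" by simp
    show "?k (p \<oplus>\<^bsub>monoid_ring N\<^esub> q) = ?k p \<oplus>\<^bsub>S\<^esub> ?k q"
      using cls.hom_add[OF zetaP zetaP] by (simp add: P_simps zeta_add)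
    have zz: "\<zeta> p * \<zeta> q \<in> carrier ?P" using P.m_closed[OF zetaP zetaP] by (simp add: P_simps)
    have "p * q = \<psi> (\<zeta> p * \<zeta> q)" using psi_zeta[OF p] psi_zeta[OF q] by (simp add: psi_mult)
    then show "?k (p \<otimes>\<^bsub>monoid_ring N\<^esub> q) = ?k p \<otimes>\<^bsub>S\<^esub> ?k q"
      using zeta_psi[OF zz] cls.hom_mult[OF zetaP zetaP] by (simp add: P_simps)
  next
    have "\<psi> 1 = 1" by (simp add: \<psi>_def mu0)
    then show "?k \<one>\<^bsub>monoid_ring N\<^esub> = \<one>\<^bsub>S\<^esub>" using zeta_psi[OF oneP] cls.hom_one by (simp add: P_simps)
  next
    show "bij_betw ?k (carrier (monoid_ring N)) (carrier S)"
      unfolding bij_betw_def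
    proof
      show "inj_on ?k (carrier (monoid_ring N))"
      proof (rule inj_onI)
        fix p q assume pq: "p \<in> carrier (monoid_ring N)" "q \<in> carrier (monoid_ring N)" "?k p = ?k q"
        then have "\<zeta> p - \<zeta> q \<in> I" using cls_eq[OF zetaP zetaP] by simp
        then have "\<psi> (\<zeta> p - \<zeta> q) = 0" by (rule psi_I)
        then have "\<psi> (\<zeta> p) = \<psi> (\<zeta> q)" by (simp add: \<psi>_def mon_eval_diff)
        then show "p = q" using psi_zeta pq by simp
      qed
      show "?k ` carrier (monoid_ring N) = carrier S"
      proof
        show "carrier S \<subseteq> ?k ` carrier (monoid_ring N)"
        proof
          fix D assume "D \<in> carrier S"
          then obtain p where p: "p \<in> carrier ?P" "D = cls p"
            unfolding S_def cls_def by (rule quotient_rep)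
          then have "D = ?k (\<psi> p)" using zeta_psi by simp
          then show "D \<in> ?k ` carrier (monoid_ring N)" using psi_N by auto
        qed
      qed (use zetaP in auto)
    qed
  qed
  moreover have "cls (jacobian_minor 1 f) \<in> Units S"
  proof -
    have "{\<pi>. \<pi> permutes {..<1::nat}} = {id}" by (simp add: lessThan_Suc permutes_sing)
    then have "jacobian_minor 1 f = partial_deriv 0 (f 0)" by (simp add: jacobian_minor_def)
    also have "\<dots> = xmon (U - Poly_Mapping.single 0 1)"
    proof -
      have "f 0 = Poly_Mapping.single U 1 + Poly_Mapping.single 0 (- 1)" by (simp add: f_def single_uminus)
      then show ?thesis by (simp only: partial_deriv_add partial_deriv_single) (simp add: lookup_U)
    qed
    finally have J: "jacobian_minor 1 f = xmon (U - Poly_Mapping.single 0 1)" .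
    have U': "U - Poly_Mapping.single 0 1 \<in> poly_exps n"
      using Uexp by (auto simp: in_keys_iff lookup_minus subset_iff)
    have V: "Poly_Mapping.single 0 1 \<in> poly_exps n" by (simp add: n_def)
    have "U - Poly_Mapping.single 0 1 + Poly_Mapping.single 0 1 = U"
      by (rule poly_mapping_eqI) (simp add: lookup_add lookup_minus lookup_U lookup_single when_def)
    then have "cls (xmon (U - Poly_Mapping.single 0 1)) \<otimes>\<^bsub>S\<^esub> cls (xmon (Poly_Mapping.single 0 1)) = \<one>\<^bsub>S\<^esub>"
      using cls.hom_mult[OF xP[OF U'] xP[OF V]] clsU by (simp add: P_simps xmon_mult)
    moreover have "cls (xmon (U - Poly_Mapping.single 0 1)) \<in> carrier S"
      "cls (xmon (Poly_Mapping.single 0 1)) \<in> carrier S"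
      using xP[OF U'] xP[OF V] by simp_all
    ultimately show ?thesis unfolding J Units_def using S.m_comm by auto
  qed
  moreover have "1 \<le> n" by (simp add: n_def)
  ultimately have "1 \<le> n \<and> f ` {..<1} \<subseteq> carrier ?P \<and>
      ?k \<in> ring_iso (monoid_ring N) S \<and> cls (jacobian_minor 1 f) \<in> Units S"
    using fP by blast
  then show ?thesis
    unfolding Let_def cls_def S_def I_def
    by (rule_tac exI[of _ n], rule_tac exI[of _ "1::nat"], rule_tac exI[of _ f], rule_tac exI)
qed

lemma smooth_at_seq_open:
  assumes coord: "has_coordinates TYPE('t)" and p: "p \<in> seq_open M Es"
  shows "smooth_at (monoid_ring M) p"
proof -
  obtain n c f k where *: "c \<le> n" "f ` {..<c} \<subseteq> carrier (int_poly_ring n)"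
    "k \<in> ring_iso (monoid_ring N) (int_poly_ring n Quot genideal (int_poly_ring n) (f ` {..<c}))"
    "genideal (int_poly_ring n) (f ` {..<c}) +>\<^bsub>int_poly_ring n\<^esub> jacobian_minor c f
      \<in> Units (int_poly_ring n Quot genideal (int_poly_ring n) (f ` {..<c}))"
    using standard_smooth_chart[OF coord] by (auto simp: Let_def)
  have P: "cring (int_poly_ring n)" by (rule cring_int_poly_ring)
  have Q: "cring (int_poly_ring n Quot genideal (int_poly_ring n) (f ` {..<c}))"
    by (rule ideal.quotient_is_cring[OF ring.genideal_ideal[OF cring.axioms(1)[OF P] *(2)] P])
  have "localization_away (monoid_ring M) (xmon den)
     (int_poly_ring n Quot genideal (int_poly_ring n) (f ` {..<c})) (k \<circ> id)"
    by (rule localization_away_comp_iso[OF cring_monoid_ring[OF M] cring_monoid_ring[OF N] Q _ den_localization *(3)])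
      (simp add: den)
  moreover have "xmon den \<in> carrier (monoid_ring M) - p"
    using p den(1) by (simp add: seq_open_eq)
  ultimately show ?thesis unfolding smooth_at_def Let_def using * by blast
qed

end

section \<open>Smooth points lie in a chart of a smooth sequence\<close>

lemma additive_extends_to_differences:
  fixes l :: "'t::ab_group_add \<Rightarrow> real"
  assumes M: "additive_submonoid M" and gen: "\<And>t. \<exists>a\<in>M. \<exists>b\<in>M. t = a - b"
    and l: "\<And>s t. s \<in> M \<Longrightarrow> t \<in> M \<Longrightarrow> l (s + t) = l s + l t"
  obtains l' :: "'t \<Rightarrow> real" where "\<And>s t. l' (s + t) = l' s + l' t" "\<And>m. m \<in> M \<Longrightarrow> l' m = l m"
proof -
  obtain a b where ab: "\<And>t. a t \<in> M" "\<And>t. b t \<in> M" "\<And>t. t = a t - b t"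
    using gen by metis
  define l' where "l' t = l (a t) - l (b t)" for t
  have l': "l' t = l x - l y" if "t = x - y" "x \<in> M" "y \<in> M" for t x y
  proof -
    have "a t - b t = x - y" using ab(3)[of t] that(1) by metis
    then have "a t + y = x + b t" by (simp add: algebra_simps)
    then have "l (a t) + l y = l x + l (b t)" using l that ab by metis
    then show ?thesis by (simp add: l'_def)
  qed
  show ?thesis
  proof (rule that[of l'])
    fix s t
    have "s + t = (a s + a t) - (b s + b t)" using ab(3)[of s] ab(3)[of t] by (simp add: algebra_simps)
    then have "l' (s + t) = l (a s + a t) - l (b s + b t)"
      using submonoid_add[OF M] ab by (intro l') auto
    then show "l' (s + t) = l' s + l' t" using l ab by (simp add: l'_def)
  next
    fix m assume m: "m \<in> M"
    have "0 \<in> M" using M by (simp add: additive_submonoid_def)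
    then have "l 0 = 0" using l[of 0 0] by simp
    then show "l' m = l m" using l'[of m m 0] m \<open>0 \<in> M\<close> by simp
  qed
qed

text \<open>The rank \<open>N\<close> of the group bounds the dimension of the chart from above, and \<open>k + card V\<close> bounds it
  from below, where \<open>k\<close> is the rank of the group \<open>L\<close> of the face \<open>F\<close> of monomials that are invertible
  at \<open>p\<close>, and \<open>V\<close> is a smallest set of generators of \<open>M\<close> modulo \<open>L\<close>. Thus generators of the group are
  found that are few enough to be a basis, and the coordinates with respect to \<open>V\<close> are the required
  smooth sequence.\<close>

lemma smooth_point_in_chart:
  fixes M :: "'t::ab_group_add set"
  assumes fg: "fg_submonoid M" and gen: "\<And>t. \<exists>a\<in>M. \<exists>b\<in>M. t = a - b"
    and coord: "has_coordinates TYPE('t)"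
    and p: "p \<in> Spec (monoid_ring M)" and smooth: "smooth_at (monoid_ring M) p"
  shows "\<exists>Es\<in>smooth_sequences M. p \<in> seq_open M Es"
proof -
  have M: "additive_submonoid M" by (rule fg_submonoid_additive[OF fg])
  have M0: "0 \<in> M" using M by (simp add: additive_submonoid_def)
  note Madd = submonoid_add[OF M]
  interpret R: cring "monoid_ring M" by (rule cring_monoid_ring[OF M])
  interpret p: primeideal p "monoid_ring M" using p by (simp add: Spec_def)
  obtain g n c f h where g: "Poly_Mapping.keys g \<subseteq> M" "g \<notin> p"
    and chart: "smooth_chart M g n c f h"
  proof -
    obtain g n c f h where *: "g \<in> carrier (monoid_ring M) - p" "c \<le> n"
      "f ` {..<c} \<subseteq> carrier (int_poly_ring n)"
      "localization_away (monoid_ring M) g (int_poly_ring n Quot genideal (int_poly_ring n) (f ` {..<c})) h"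
      "genideal (int_poly_ring n) (f ` {..<c}) +>\<^bsub>int_poly_ring n\<^esub> jacobian_minor c f
        \<in> Units (int_poly_ring n Quot genideal (int_poly_ring n) (f ` {..<c}))"
      using smooth by (auto simp: smooth_at_def Let_def)
    show thesis
      by (rule that[of g n c f h]) (use * M in \<open>auto intro: smooth_chart.intro\<close>)
  qed
  interpret chart: smooth_chart M g n c f h by (rule chart)
  \<comment> \<open>As \<open>p\<close> is prime, \<open>F\<close> is a face: a sum lies in \<open>F\<close>
    only if both summands do. Therefore \<open>F\<close> is recovered from its group \<open>L\<close> as
    \<open>M \<inter> L\<close>.\<close>
  define F where "F = {m \<in> M. xmon m \<notin> p}"
  have FM: "F \<subseteq> M" by (auto simp: F_def)
  have face: "s + t \<in> F \<longleftrightarrow> s \<in> F \<and> t \<in> F" if "s \<in> M" "t \<in> M" for s t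
    using Spec_mult_iff[OF p, of "xmon s" "xmon t"] that Madd by (simp add: F_def xmon_mult)
  have F0: "0 \<in> F" using M0 Spec_one_notin[OF p] by (simp add: F_def)
  have F: "additive_submonoid F" using F0 face FM by (auto simp: additive_submonoid_def)
  define L where "L = differences F"
  have L: "additive_subgp L" unfolding L_def by (rule additive_subgp_differences[OF F])
  have FL: "F \<subseteq> L" unfolding L_def by (rule subset_differences[OF F])
  have MLF: "m \<in> F" if mM: "m \<in> M" and mL: "m \<in> L" for m
  proof -
    obtain a b where ab: "m = a - b" "a \<in> F" "b \<in> F" using mL unfolding L_def differences_def by blast
    then have "m + b \<in> F" by simp
    then show ?thesis using face[OF mM, of b] ab FM by blast
  qed
  have "additive_subgp (UNIV :: 't set)" by (simp add: additive_subgp_def)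
  then obtain N t where t: "zbasis (UNIV :: 't set) N t" using has_zbasis[OF coord] by blast
  obtain k e where e: "zbasis L k e" using has_zbasis[OF coord L] .
  have eL: "e i \<in> L" if "i < k" for i using e that by (simp add: zbasis_def)
  obtain C where C: "\<And>t. t \<in> L \<Longrightarrow> t = (\<Sum>i<k. zmul (C i t) (e i))"
    "\<And>i s t. i < k \<Longrightarrow> s \<in> L \<Longrightarrow> t \<in> L \<Longrightarrow> C i (s + t) = C i s + C i t"
    "\<And>i j. i < k \<Longrightarrow> j < k \<Longrightarrow> C i (e j) = (if i = j then 1 else 0)"
    using zbasis_coordinates[OF L e] by blast
  \<comment> \<open>A real point of the dense torus where \<open>g\<close> does not vanish gives the upper
    bound.\<close>
  have "g \<noteq> 0" using g(2) p.zero_closed by auto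
  have dim: "n - c \<le> N"
  proof -
    have gk: "finite (Poly_Mapping.keys g)" "Poly_Mapping.keys g \<noteq> {}" using \<open>g \<noteq> 0\<close> by auto
    obtain \<chi> :: "'t \<Rightarrow> real" where ch: "\<And>x. \<chi> x > 0" "\<And>x y. \<chi> (x + y) = \<chi> x * \<chi> y"
      "(\<Sum>x\<in>Poly_Mapping.keys g. of_int (Poly_Mapping.lookup g x) * \<chi> x) \<noteq> 0"
      by (rule nonvanishing_character[OF t gk, of "Poly_Mapping.lookup g"]) (simp add: in_keys_iff, rule that)
    have "\<chi> 0 = 1" by (rule positive_character_zero[OF ch(2,1)])
    then have char: "char_on M \<chi>" by (simp add: char_on_def ch(2))
    have "\<forall>i. \<exists>a b. a \<in> M \<and> b \<in> M \<and> t i = a - b" using gen by blast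
    then obtain a b where ab: "\<And>i. a i \<in> M" "\<And>i. b i \<in> M" "\<And>i. t i = a i - b i" by metis
    show ?thesis
    proof (rule chart.dimension_le_rank[OF char, of N a b])
      show "mon_eval \<chi> g \<noteq> 0" using ch(3) by (simp add: mon_eval_def)
      show "\<chi> m \<noteq> 0" for m using ch(1)[of m] by simp
      show "a i \<in> M \<and> b i \<in> M" for i using ab by simp
      fix l :: "'t \<Rightarrow> real" and m
      assume l: "\<And>s t. s \<in> M \<Longrightarrow> t \<in> M \<Longrightarrow> l (s + t) = l s + l t"
        and lab: "\<And>i. i < N \<Longrightarrow> l (a i) = l (b i)" and m: "m \<in> M"
      obtain l' where l': "\<And>s t. l' (s + t) = l' s + l' t" "\<And>m. m \<in> M \<Longrightarrow> l' m = l m"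
        using additive_extends_to_differences[OF M gen l] by blast
      have lt: "l' (t i) = 0" if "i < N" for i
      proof -
        have "l' (a i) = l' (t i) + l' (b i)" using l'(1)[of "t i" "b i"] ab(3)[of i] by simp
        then show ?thesis using lab[OF that] l'(2) ab by simp
      qed
      have "\<exists>d. m = (\<Sum>i<N. zmul (d i) (t i))" using t by (simp add: zbasis_def)
      then obtain d where d: "m = (\<Sum>i<N. zmul (d i) (t i))" ..
      have z: "l' 0 = 0" using l'(1)[of 0 0] by simp
      have "l' (\<Sum>i\<in>A. G i) = (\<Sum>i\<in>A. l' (G i))" for A :: "nat set" and G
        by (induct A rule: infinite_finite_induct) (simp_all add: z l'(1))
      then have "l' m = (\<Sum>i<N. of_int (d i) * l' (t i))"
        unfolding d using zmul_additive_image[of l', OF l'(1)] by simp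
      then show "l m = 0" using l'(2)[OF m] lt by simp
    qed
  qed
  \<comment> \<open>Minimality of \<open>V\<close> is used in the form that no element of \<open>V\<close> is a
    combination of the other ones modulo \<open>L\<close>.\<close>
  obtain A where A: "finite A" "M = sum_list ` lists A" using fg by (auto simp: fg_submonoid_def)
  have AM: "A \<subseteq> M"
  proof
    fix x assume "x \<in> A"
    then show "x \<in> M" unfolding A(2) by (intro image_eqI[of _ _ "[x]"]) auto
  qed
  define G where "G V \<longleftrightarrow> V \<subseteq> A - F \<and> (\<forall>m\<in>M. \<exists>l\<in>L. \<exists>xs\<in>lists V. m = l + sum_list xs)" for V
  have "G (A - F)"
  proof -
    have "\<exists>l\<in>L. \<exists>ys\<in>lists (A - F). sum_list xs = l + sum_list ys" if "set xs \<subseteq> A" for xs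
      using that
    proof (induct xs)
      case Nil
      show ?case using additive_subgpD(1)[OF L] by (intro bexI[of _ 0] bexI[of _ "[]"]) auto
    next
      case (Cons x xs)
      then obtain l ys where ly: "l \<in> L" "ys \<in> lists (A - F)" "sum_list xs = l + sum_list ys" by auto
      show ?case
      proof (cases "x \<in> F")
        case True
        then have "x + l \<in> L" using FL ly(1) additive_subgpD(4)[OF L] by blast
        then show ?thesis using ly by (intro bexI[of _ "x + l"] bexI[of _ ys]) (auto simp: add.assoc)
      next
        case False
        then show ?thesis using ly Cons(2)
          by (intro bexI[of _ l] bexI[of _ "x # ys"]) (auto simp: algebra_simps)
      qed
    qed
    then show ?thesis unfolding G_def A(2) by auto
  qed
  then obtain V where V: "G V" and Vmin: "\<And>V'. G V' \<Longrightarrow> card V \<le> card V'"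
    using ex_has_least_nat[of G "A - F" card] by blast
  have VA: "V \<subseteq> A - F" using V by (simp add: G_def)
  then have VM: "v \<in> M" and VF: "v \<notin> F" if "v \<in> V" for v using that AM by auto
  have finV: "finite V" using VA A(1) by (meson finite_Diff finite_subset)
  have Vgen: "\<exists>l\<in>L. \<exists>xs\<in>lists V. m = l + sum_list xs" if "m \<in> M" for m
    using V that by (simp add: G_def)
  have irred: "v \<noteq> l + sum_list xs" if v: "v \<in> V" and l: "l \<in> L" and xs: "set xs \<subseteq> V - {v}" for v l xs
  proof
    assume eq: "v = l + sum_list xs"
    have red: "\<exists>l'\<in>L. \<exists>zs\<in>lists (V - {v}). sum_list ys = l' + sum_list zs" if "set ys \<subseteq> V" for ys
      using that
    proof (induct ys)
      case Nil
      show ?case using additive_subgpD(1)[OF L] by (intro bexI[of _ 0] bexI[of _ "[]"]) auto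
    next
      case (Cons y ys)
      then obtain l' zs where lz: "l' \<in> L" "set zs \<subseteq> V - {v}" "sum_list ys = l' + sum_list zs" by auto
      show ?case
      proof (cases "y = v")
        case True
        then have "sum_list (y # ys) = (l + l') + sum_list (xs @ zs)"
          using lz eq by (simp add: algebra_simps)
        then show ?thesis using lz xs l additive_subgpD(4)[OF L]
          by (intro bexI[of _ "l + l'"] bexI[of _ "xs @ zs"]) auto
      next
        case False
        then show ?thesis using lz Cons(2)
          by (intro bexI[of _ l'] bexI[of _ "y # zs"]) (auto simp: algebra_simps)
      qed
    qed
    have "G (V - {v})"
      unfolding G_def
    proof (intro conjI ballI)
      show "V - {v} \<subseteq> A - F" using VA by auto
      fix m assume "m \<in> M"
      then obtain l1 ys where 1: "l1 \<in> L" "set ys \<subseteq> V" "m = l1 + sum_list ys" using Vgen by blast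
      then obtain l2 zs where 2: "l2 \<in> L" "zs \<in> lists (V - {v})" "sum_list ys = l2 + sum_list zs"
        using red by blast
      show "\<exists>l\<in>L. \<exists>xs\<in>lists (V - {v}). m = l + sum_list xs"
        using 1 2 additive_subgpD(4)[OF L]
        by (intro bexI[of _ "l1 + l2"] bexI[of _ zs]) (auto simp: add.assoc)
    qed
    then have "card V \<le> card (V - {v})" by (rule Vmin)
    then show False using v finV by (metis card_Diff1_less not_le)
  qed
  have nonunit: False if "w \<in> M" "w \<notin> F" "x \<in> M" "w + x \<in> L" for w x
    using MLF[OF Madd[OF that(1,3)] that(4)] face[OF that(1,3)] that(2) by simp
  have sumV: "sum_list xs \<in> M" if "set xs \<subseteq> V" for xs
    by (rule sum_list_in[OF M]) (use that VM in auto)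
  \<comment> \<open>Elements of \<open>V\<close> are irreducible in \<open>M\<close> modulo \<open>L\<close>. If
    \<open>v\<close> occurred in a decomposition of itself, the remaining summands would be units modulo
    \<open>L\<close>.\<close>
  have irred2: "m + m' - v \<notin> L" if m: "m \<in> M" "m \<notin> F" and m': "m' \<in> M" "m' \<notin> F" and v: "v \<in> V" for m m' v
  proof
    assume mv: "m + m' - v \<in> L"
    obtain l xs where 1: "l \<in> L" "set xs \<subseteq> V" "m = l + sum_list xs" using Vgen[OF m(1)] by blast
    obtain l' ys where 2: "l' \<in> L" "set ys \<subseteq> V" "m' = l' + sum_list ys" using Vgen[OF m'(1)] by blast
    have xs: "xs \<noteq> []" using 1 m MLF by auto
    have ys: "ys \<noteq> []" using 2 m' MLF by auto
    have "l + l' - (m + m' - v) \<in> L"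
      by (intro additive_subgpD(2)[OF L] additive_subgpD(4)[OF L] 1(1) 2(1) mv)
    moreover have "l + l' - (m + m' - v) = v - sum_list (xs @ ys)" using 1 2 by (simp add: algebra_simps)
    ultimately have dL: "v - sum_list (xs @ ys) \<in> L" by simp
    show False
    proof (cases "v \<in> set (xs @ ys)")
      case False
      have "set (xs @ ys) \<subseteq> V - {v}" using False 1(2) 2(2) by auto
      then show False using irred[OF v dL, of "xs @ ys"] by simp
    next
      case True
      define zs where "zs = remove1 v (xs @ ys)"
      have sz: "sum_list (xs @ ys) = v + sum_list zs"
        using sum_list_map_remove1[OF True, of id] by (simp add: zs_def)
      have "length zs > 0" using True xs ys by (simp add: zs_def length_remove1) (cases xs; cases ys; simp)
      then obtain w ws where w: "zs = w # ws" by (cases zs) auto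
      have "set zs \<subseteq> V" using 1(2) 2(2) set_remove1_subset[of v "xs @ ys"] by (auto simp: zs_def)
      then have wV: "w \<in> V" "set ws \<subseteq> V" using w by auto
      have "- (w + sum_list ws) \<in> L" using dL sz w by simp
      from additive_subgpD(3)[OF L this] have "w + sum_list ws \<in> L" by (simp add: add.commute)
      then show False using nonunit[OF VM[OF wV(1)] VF[OF wV(1)] sumV[OF wV(2)]] by simp
    qed
  qed
  have Vdiff: "v - v' \<notin> L" if "v \<in> V" "v' \<in> V" "v \<noteq> v'" for v v'
    using irred[OF that(1), of "v - v'" "[v']"] that by auto
  have VL: "v \<notin> L" if "v \<in> V" for v using MLF VM VF that by blast
  \<comment> \<open>A real point \<open>\<chi>F\<close> of the torus of \<open>F\<close> gives the lower bound.
    The polynomial \<open>g\<close> has a monomial in \<open>F\<close>, as it would belong to \<open>p\<close>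
    otherwise, so the point can be chosen with \<open>g \<noteq> 0\<close>. The derivations for \<open>Inl
    j\<close> are tangent to the torus. The derivation for \<open>Inr v\<close> is supported on \<open>v +
    L\<close>; the Leibniz rule holds for it since a sum of two elements of \<open>M\<close> outside of
    \<open>F\<close> is never in \<open>v + L\<close>.\<close>
  have low: "k + card V \<le> n - c"
  proof -
    let ?K = "Poly_Mapping.keys g \<inter> F"
    have "?K \<noteq> {}"
    proof
      assume K: "?K = {}"
      have "(\<Sum>m\<in>B. Poly_Mapping.single m (Poly_Mapping.lookup g m)) \<in> p" if "finite B" "B \<subseteq> M - F" for B
        using that
      proof (induct B)
        case empty
        then show ?case using p.zero_closed by simp
      next
        case (insert x B)
        then have x: "x \<in> M" "xmon x \<in> p" by (auto simp: F_def)
        have "of_int (Poly_Mapping.lookup g x) \<otimes>\<^bsub>monoid_ring M\<^esub> xmon x \<in> p"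
          using keys_of_int_subset[OF M] by (intro p.I_l_closed x) auto
        then have "Poly_Mapping.single x (Poly_Mapping.lookup g x) \<in> p" by (simp add: of_int_xmon)
        then show ?case using insert p.a_closed by auto
      qed
      from this[of "Poly_Mapping.keys g"] have "g \<in> p"
        using poly_mapping_as_sum[of "Poly_Mapping.keys g" g] K g(1) by auto
      then show False using g(2) by simp
    qed
    note Kne = this
    obtain \<chi> :: "'t \<Rightarrow> real" where ch: "\<And>x. \<chi> x > 0" "\<And>x y. \<chi> (x + y) = \<chi> x * \<chi> y"
      "(\<Sum>x\<in>?K. of_int (Poly_Mapping.lookup g x) * \<chi> x) \<noteq> 0"
      by (rule nonvanishing_character[OF t _ Kne, of "Poly_Mapping.lookup g"])
        (simp, simp add: in_keys_iff, rule that)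
    have ch0: "\<chi> 0 = 1" by (rule positive_character_zero[OF ch(2,1)])
    define \<chi>F where "\<chi>F m = (if m \<in> F then \<chi> m else 0)" for m
    have char: "char_on M \<chi>F" using face F0 by (auto simp: char_on_def \<chi>F_def ch0 ch(2))
    have "mon_eval \<chi>F g = (\<Sum>x\<in>?K. of_int (Poly_Mapping.lookup g x) * \<chi> x)"
      unfolding mon_eval_def by (rule sum.mono_neutral_cong_right) (auto simp: \<chi>F_def)
    then have nz: "mon_eval \<chi>F g \<noteq> 0" using ch(3) by simp
    define D where "D e m = (case e of Inl j \<Rightarrow> if m \<in> F then \<chi> m * of_int (C j m) else 0
      | Inr v \<Rightarrow> if m - v \<in> L then \<chi> (m - v) else 0)" for e m
    let ?I = "{..<k} <+> V"
    have DF: "D (Inr v) m = 0" if "v \<in> V" "m \<in> F" for v m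
    proof -
      have "m - v \<notin> L"
      proof
        assume "m - v \<in> L"
        then have "m - (m - v) \<in> L" using additive_subgpD(2)[OF L] FL that(2) by blast
        then show False using VL[OF that(1)] by simp
      qed
      then show ?thesis by (simp add: D_def)
    qed
    have leib_right: "D (Inr v) (s + t) = \<chi> s * D (Inr v) t" if "v \<in> V" "s \<in> F" for v s t
    proof -
      have "s + t - v \<in> L \<longleftrightarrow> t - v \<in> L"
      proof
        assume "s + t - v \<in> L"
        then have "s + t - v - s \<in> L" using additive_subgpD(2)[OF L] FL that(2) by blast
        then show "t - v \<in> L" by (simp add: algebra_simps)
      next
        assume "t - v \<in> L"
        then have "s + (t - v) \<in> L" using additive_subgpD(4)[OF L] FL that(2) by blast
        then show "s + t - v \<in> L" by (simp add: algebra_simps)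
      qed
      moreover have "\<chi> (s + t - v) = \<chi> s * \<chi> (t - v)" using ch(2)[of s "t - v"] by (simp add: algebra_simps)
      ultimately show ?thesis by (simp add: D_def)
    qed
    have "card ?I \<le> n - c"
    proof (rule chart.independent_derivations_le[OF char nz, of ?I D])
      show "finite ?I" using finV by simp
    next
      fix e s t assume e: "e \<in> ?I" and s: "s \<in> M" and t: "t \<in> M"
      show "D e (s + t) = \<chi>F s * D e t + D e s * \<chi>F t"
      proof (cases e)
        case (Inl j)
        then have "j < k" using e by auto
        then have "C j (s + t) = C j s + C j t" if "s \<in> F" "t \<in> F" using C(2) FL that by blast
        then show ?thesis using face[OF s t] Inl by (auto simp: D_def \<chi>F_def ch(2) algebra_simps)
      next
        case (Inr v)
        then have v: "v \<in> V" using e by auto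
        show ?thesis
        proof (cases "s \<in> F")
          case sF: True
          show ?thesis
          proof (cases "t \<in> F")
            case True
            then show ?thesis using leib_right[OF v sF, of t] sF DF[OF v] by (simp add: Inr \<chi>F_def)
          next
            case False
            then show ?thesis using leib_right[OF v sF, of t] sF by (simp add: Inr \<chi>F_def)
          qed
        next
          case sF: False
          show ?thesis
          proof (cases "t \<in> F")
            case True
            then show ?thesis using leib_right[OF v True, of s] sF by (simp add: Inr \<chi>F_def add.commute)
          next
            case False
            then show ?thesis using irred2[OF s sF t False v] sF by (simp add: Inr \<chi>F_def D_def)
          qed
        qed
      qed
    next
      fix \<alpha> e0 assume al: "\<And>m. m \<in> M \<Longrightarrow> (\<Sum>e\<in>?I. \<alpha> e * D e m) = 0" and e0: "e0 \<in> ?I"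
      have al': "(\<Sum>j<k. \<alpha> (Inl j) * D (Inl j) m) + (\<Sum>v\<in>V. \<alpha> (Inr v) * D (Inr v) m) = 0" if "m \<in> M" for m
        using al[OF that] finV by (simp add: sum.Plus)
      have aV: "\<alpha> (Inr v) = 0" if v: "v \<in> V" for v
      proof -
        have "(\<Sum>j<k. \<alpha> (Inl j) * D (Inl j) v) = 0" using VF[OF v] by (simp add: D_def)
        moreover have "(\<Sum>v'\<in>V. \<alpha> (Inr v') * D (Inr v') v) = (\<Sum>v'\<in>V. if v' = v then \<alpha> (Inr v') else 0)"
          by (rule sum.cong) (use Vdiff v ch0 additive_subgpD(1)[OF L] in \<open>auto simp: D_def\<close>)
        ultimately show ?thesis using al'[OF VM[OF v]] v finV by simp
      qed
      have aF: "(\<Sum>j<k. \<alpha> (Inl j) * of_int (C j m)) = 0" if m: "m \<in> F" for m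
      proof -
        have "(\<Sum>j<k. \<alpha> (Inl j) * D (Inl j) m) = 0"
          using al'[of m] m FM aV by auto
        then have "\<chi> m * (\<Sum>j<k. \<alpha> (Inl j) * of_int (C j m)) = 0"
          using m by (simp add: D_def sum_distrib_left mult_ac)
        then show ?thesis using ch(1)[of m] by simp
      qed
      have aL: "\<alpha> (Inl j) = 0" if j: "j < k" for j
      proof -
        obtain a b where ab: "e j = a - b" "a \<in> F" "b \<in> F"
          using eL[OF j] by (auto simp: L_def differences_def)
        have "C i a = C i (e j) + C i b" if "i < k" for i
          using C(2)[OF that eL[OF j], of b] ab FL by auto
        then have "(\<Sum>i<k. \<alpha> (Inl i) * of_int (C i (e j))) =
            (\<Sum>i<k. \<alpha> (Inl i) * of_int (C i a)) - (\<Sum>i<k. \<alpha> (Inl i) * of_int (C i b))"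
          unfolding sum_subtractf[symmetric] by (intro sum.cong) (auto simp: algebra_simps)
        also have "\<dots> = 0" using aF ab by simp
        also have "(\<Sum>i<k. \<alpha> (Inl i) * of_int (C i (e j))) = (\<Sum>i<k. if i = j then \<alpha> (Inl i) else 0)"
          by (rule sum.cong) (use C(3) j in auto)
        finally show ?thesis using j by simp
      qed
      show "\<alpha> e0 = 0" using e0 aV aL by auto
    qed
    then show ?thesis using finV by (simp add: card_Plus)
  qed
  \<comment> \<open>The elements of \<open>V\<close> and of a basis of \<open>L\<close> generate the group and
    are at most \<open>N\<close> in number, so they are a basis; \<open>co\<close> denotes the
    coordinates.\<close>
  define w where "w = case_sum e (\<lambda>v. v)"
  let ?I = "{..<k} <+> V"
  have IL: "Inl i \<in> ?I" if "i < k" for i using that by (auto intro: InlI)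
  have IR: "Inr v \<in> ?I" if "v \<in> V" for v using that by (auto intro: InrI)
  define H where "H = {x. \<exists>d. x = (\<Sum>i\<in>?I. zmul (d i) (w i))}"
  have H: "additive_subgp H"
    unfolding additive_subgp_def
  proof (intro conjI ballI)
    show "0 \<in> H" unfolding H_def by (intro CollectI exI[of _ "\<lambda>_. 0"]) simp
    fix x y assume "x \<in> H" "y \<in> H"
    then obtain d d' where "x = (\<Sum>i\<in>?I. zmul (d i) (w i))" "y = (\<Sum>i\<in>?I. zmul (d' i) (w i))"
      by (auto simp: H_def)
    then show "x - y \<in> H" unfolding H_def
      by (intro CollectI exI[of _ "\<lambda>i. d i - d' i"]) (simp add: zmul_diff_left sum_subtractf)
  qed
  have wH: "w i \<in> H" if "i \<in> ?I" for i
  proof -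
    have "(\<Sum>j\<in>?I. zmul (if j = i then 1 else 0) (w j)) = (\<Sum>j\<in>?I. if j = i then w j else 0)"
      by (rule sum.cong) auto
    also have "\<dots> = w i" using that finV by simp
    finally show ?thesis unfolding H_def by (intro CollectI exI) (rule sym)
  qed
  have LH: "x \<in> H" if "x \<in> L" for x
  proof -
    have "(\<Sum>i<k. zmul (C i x) (e i)) \<in> H"
    proof (intro additive_subgp_sum[OF H] additive_subgp_zmul[OF H])
      fix i assume "i \<in> {..<k}"
      then show "e i \<in> H" using wH[OF IL, of i] by (simp add: w_def)
    qed
    then show ?thesis using C(1)[OF that, symmetric] by simp
  qed
  have VH: "sum_list xs \<in> H" if "set xs \<subseteq> V" for xs
    using that
  proof (induct xs)
    case (Cons x xs)
    have "x \<in> H" using wH[OF IR, of x] Cons(2) by (simp add: w_def)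
    with Cons show ?case using additive_subgpD(4)[OF H] by simp
  qed (simp add: additive_subgpD(1)[OF H])
  have MH: "m \<in> H" if mM: "m \<in> M" for m
  proof -
    obtain l xs where "l \<in> L" "set xs \<subseteq> V" "m = l + sum_list xs" using Vgen[OF mM] by blast
    then show ?thesis using additive_subgpD(4)[OF H LH VH] by simp
  qed
  have UH: "x \<in> H" for x using gen[of x] MH additive_subgpD(2)[OF H] by auto
  then have wgen: "\<exists>d. x = (\<Sum>i\<in>?I. zmul (d i) (w i))" for x unfolding H_def by blast
  have windep: "d i = 0" if "(\<Sum>i\<in>?I. zmul (d i) (w i)) = 0" "i \<in> ?I" for d i
  proof (rule zbasis_if_generating[OF t _ _ wgen that])
    show "finite ?I" using finV by simp
    show "card ?I \<le> N" using low dim finV by (simp add: card_Plus)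
  qed
  have "\<forall>x. \<exists>d. (\<Sum>i\<in>?I. zmul (d i) (w i)) = x" using wgen by metis
  then obtain co where co: "\<And>x. (\<Sum>i\<in>?I. zmul (co x i) (w i)) = x" by metis
  have couniq: "co x i = d i" if "x = (\<Sum>i\<in>?I. zmul (d i) (w i))" "i \<in> ?I" for x d i
  proof -
    have "(\<Sum>i\<in>?I. zmul (co x i - d i) (w i)) = x - x"
      using co[of x] that(1) by (simp add: zmul_diff_left sum_subtractf)
    then show ?thesis using windep[of "\<lambda>i. co x i - d i" i] that(2) by simp
  qed
  have coadd: "co (x + y) i = co x i + co y i" if "i \<in> ?I" for x y i
  proof (rule couniq[OF _ that, of _ "\<lambda>i. co x i + co y i"])
    show "x + y = (\<Sum>i\<in>?I. zmul (co x i + co y i) (w i))"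
      using co[of x] co[of y] by (simp add: zmul_add_left sum.distrib)
  qed
  have cow: "co (w j) i = (if i = j then 1 else 0)" if "i \<in> ?I" "j \<in> ?I" for i j
  proof (rule couniq[OF _ that(1), of _ "\<lambda>i. if i = j then 1 else 0"])
    have "(\<Sum>i\<in>?I. zmul (if i = j then 1 else 0) (w i)) = (\<Sum>i\<in>?I. if i = j then w i else 0)"
      by (rule sum.cong) auto
    then show "w j = (\<Sum>i\<in>?I. zmul (if i = j then 1 else 0) (w i))" using that finV by simp
  qed
  have co0: "co 0 i = 0" if "i \<in> ?I" for i using coadd[OF that, of 0 0] by simp
  have coL: "co x (Inr v) = 0" if "x \<in> L" "v \<in> V" for x v
  proof -
    have I: "Inr v \<in> ?I" using IR that by blast
    have "co (\<Sum>i\<in>B. zmul (d i) (e i)) (Inr v) = 0" if "B \<subseteq> {..<k}" for B d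
      using finite_subset[OF that finite_lessThan] that
    proof (induct B)
      case (insert i B)
      have "co (e i) (Inr v) = 0" using cow[OF I IL, of i] insert by (simp add: w_def)
      then have "co (zmul (d i) (e i)) (Inr v) = 0"
        using zmul_additive_image[of "\<lambda>x. co x (Inr v)" "d i" "e i", OF coadd[OF I]] by simp
      then show ?case using insert by (simp add: coadd[OF I])
    qed (simp add: co0[OF I])
    from this[of "{..<k}" "\<lambda>i. C i x"] show ?thesis using C(1)[OF that(1), symmetric] by simp
  qed
  obtain vs where vs: "set vs = V" "distinct vs" using finite_distinct_list[OF finV] by blast
  define Es where "Es = map (\<lambda>v x. co x (Inr v)) vs"
  have kerE: "seq_kernel Es = L"
  proof (intro Set.set_eqI iffI)
    fix x assume "x \<in> seq_kernel Es"
    then have x0: "co x (Inr v) = 0" if "v \<in> V" for v using that vs by (auto simp: seq_kernel_def Es_def)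
    have "x = (\<Sum>i<k. zmul (co x (Inl i)) (e i)) + (\<Sum>v\<in>V. zmul (co x (Inr v)) v)"
      using co[of x] finV by (simp add: sum.Plus w_def)
    also have "\<dots> = (\<Sum>i<k. zmul (co x (Inl i)) (e i))" using x0 by simp
    also have "\<dots> \<in> L" using eL by (intro additive_subgp_sum[OF L] additive_subgp_zmul[OF L]) auto
    finally show "x \<in> L" .
  qed (use coL vs in \<open>auto simp: seq_kernel_def Es_def\<close>)
  have "M \<inter> L = F" using MLF FM FL by auto
  then have kergen: "generate ambient_group (M \<inter> seq_kernel Es) = seq_kernel Es"
    unfolding kerE using generate_ambient_group[OF F] by (simp add: L_def)
  have pos: "0 \<le> co m (Inr v)" if m: "m \<in> M" and v: "v \<in> V" for m v
  proof -
    have I: "Inr v \<in> ?I" using IR v by blast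
    obtain l xs where lx: "l \<in> L" "set xs \<subseteq> V" "m = l + sum_list xs" using Vgen[OF m] by blast
    have "0 \<le> co (sum_list xs) (Inr v)" using lx(2)
    proof (induct xs)
      case (Cons x xs)
      then have "co x (Inr v) = (if v = x then 1 else 0)" using cow[OF I IR, of x] by (auto simp: w_def)
      then show ?case using Cons by (simp add: coadd[OF I])
    qed (simp add: co0[OF I])
    then show ?thesis using coL[OF lx(1) v] lx(3) by (simp add: coadd[OF I])
  qed
  have Es: "smooth_sequence M Es"
    unfolding smooth_sequence_def
  proof (intro conjI kergen)
    show "set Es \<subseteq> dual_monoid M"
      using vs coadd pos by (auto simp: Es_def dual_monoid_def)
    show "\<exists>v. \<forall>j<length Es. v j \<in> M \<and> (\<forall>i<length Es. (Es ! i) (v j) = (if i = j then 1 else 0))"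
    proof (intro exI[of _ "\<lambda>j. vs ! j"] allI impI conjI)
      fix j assume j: "j < length Es"
      then have jV: "vs ! j \<in> V" using vs by (auto simp: Es_def)
      then show "vs ! j \<in> M" by (rule VM)
      fix i assume i: "i < length Es"
      then have iV: "vs ! i \<in> V" using vs by (auto simp: Es_def)
      have "vs ! i = vs ! j \<longleftrightarrow> i = j"
        using nth_eq_iff_index_eq[OF vs(2)] i j by (simp add: Es_def)
      then show "(Es ! i) (vs ! j) = (if i = j then 1 else 0)"
        using i cow[OF IR[OF iV] IR[OF jV]] by (auto simp: Es_def w_def)
    qed
  qed
  interpret sq: smooth_seq M Es by unfold_locales (fact fg, fact Es)
  \<comment> \<open>The sequence vanishes on the denominator of the chart, because the sequence is non-negative
    both on it and on its negative. So the denominator is a unit at \<open>p\<close>.\<close>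
  have "sq.den \<in> L"
  proof -
    have "E sq.den = 0" if "E \<in> set Es" for E
    proof -
      have "0 \<le> E (- sq.den)" using sq.den(2) that by (auto simp: seq_monoid_def)
      moreover have "E (- sq.den) = - E sq.den" using sq.E_diff[OF that, of 0] sq.E_zero[OF that] by simp
      moreover have "0 \<le> E sq.den" using sq.E_nonneg[OF that sq.den(1)] .
      ultimately show ?thesis by simp
    qed
    then show ?thesis unfolding kerE[symmetric] by (simp add: seq_kernel_def)
  qed
  then have "sq.den \<in> F" using MLF sq.den(1) by blast
  then have "p \<in> seq_open M Es" unfolding sq.seq_open_eq using p by (simp add: F_def)
  then show ?thesis using Es by (auto simp: smooth_sequences_def)
qed

theorem X_Theta_eq_smooth_locus:
  fixes M :: "'t::ab_group_add set"
  assumes fg: "fg_submonoid M" and gen: "\<And>t. \<exists>a\<in>M. \<exists>b\<in>M. t = a - b"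
    and coord: "has_coordinates TYPE('t)"
  shows "X_Theta M = smooth_locus (monoid_ring M)"
proof (intro Set.set_eqI iffI)
  fix p assume "p \<in> X_Theta M"
  then obtain Es where Es: "smooth_sequence M Es" "p \<in> seq_open M Es"
    by (auto simp: X_Theta_def smooth_sequences_def)
  interpret smooth_seq M Es by unfold_locales (fact fg, fact Es(1))
  show "p \<in> smooth_locus (monoid_ring M)"
    using smooth_at_seq_open[OF coord Es(2)] Es(2) by (auto simp: smooth_locus_def seq_open_eq)
next
  fix p assume "p \<in> smooth_locus (monoid_ring M)"
  then show "p \<in> X_Theta M"
    using smooth_point_in_chart[OF fg gen coord, of p] by (auto simp: smooth_locus_def X_Theta_def)
qed

section \<open>Graded rings and torsors\<close>

lemma mem_Zr: "n \<in> Zr r \<longleftrightarrow> Poly_Mapping.keys n \<subseteq> {..<r}" by simp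

lemma Zr_closed [simp]:
  "0 \<in> Zr r" "m \<in> Zr r \<Longrightarrow> n \<in> Zr r \<Longrightarrow> m + n \<in> Zr r" "n \<in> Zr r \<Longrightarrow> - n \<in> Zr r"
  "m \<in> Zr r \<Longrightarrow> n \<in> Zr r \<Longrightarrow> m - n \<in> Zr r"
  unfolding mem_Zr using Poly_Mapping.keys_add[of m n] Poly_Mapping.keys_diff[of m n] by auto

declare carrier_free_Abelian_group_iff [simp del]

lemma graded_cringD:
  assumes "graded_cring r B gr"
  shows "cring B" "n \<in> Zr r \<Longrightarrow> subgroup (gr n) (add_monoid B)" "\<one>\<^bsub>B\<^esub> \<in> gr 0"
    "m \<in> Zr r \<Longrightarrow> n \<in> Zr r \<Longrightarrow> x \<in> gr m \<Longrightarrow> y \<in> gr n \<Longrightarrow> x \<otimes>\<^bsub>B\<^esub> y \<in> gr (m + n)"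
  using assms unfolding graded_cring_def by blast+

locale graded =
  fixes r :: nat and B :: "'b ring" (structure) and gr :: "zvec \<Rightarrow> 'b set"
  assumes graded: "graded_cring r B gr"
begin

sublocale cring B using graded by (rule graded_cringD)

lemma gr_carrier: "n \<in> Zr r \<Longrightarrow> x \<in> gr n \<Longrightarrow> x \<in> carrier B"
  using subgroup.subset[OF graded_cringD(2)[OF graded]] by auto

lemma gr_add: "n \<in> Zr r \<Longrightarrow> x \<in> gr n \<Longrightarrow> y \<in> gr n \<Longrightarrow> x \<oplus> y \<in> gr n"
  using subgroup.m_closed[OF graded_cringD(2)[OF graded]] by simp

lemma gr_zero: "n \<in> Zr r \<Longrightarrow> \<zero> \<in> gr n"
  using subgroup.one_closed[OF graded_cringD(2)[OF graded]] by simp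

lemma gr_uminus: "n \<in> Zr r \<Longrightarrow> x \<in> gr n \<Longrightarrow> \<ominus> x \<in> gr n"
  using subgroup.m_inv_closed[OF graded_cringD(2)[OF graded]] by (simp add: a_inv_def)

lemma gr_one: "\<one> \<in> gr 0" by (rule graded_cringD[OF graded])

lemma gr_mult: "m \<in> Zr r \<Longrightarrow> n \<in> Zr r \<Longrightarrow> x \<in> gr m \<Longrightarrow> y \<in> gr n \<Longrightarrow> x \<otimes> y \<in> gr (m + n)"
  by (rule graded_cringD[OF graded])

lemma gr_mult0: "n \<in> Zr r \<Longrightarrow> x \<in> gr 0 \<Longrightarrow> y \<in> gr n \<Longrightarrow> x \<otimes> y \<in> gr n"
  using gr_mult[of 0 n x y] by simp

lemma gr_mult_neg: "n \<in> Zr r \<Longrightarrow> x \<in> gr n \<Longrightarrow> y \<in> gr (- n) \<Longrightarrow> x \<otimes> y \<in> gr 0"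
  using gr_mult[of n "- n" x y] by simp

lemma gr_pow: "a \<in> gr 0 \<Longrightarrow> a [^] (k::nat) \<in> gr 0"
  by (induct k) (use gr_one gr_mult0[of 0] gr_carrier[of 0] in auto)

text \<open>The homogeneous component of degree \<open>n\<close>.\<close>

definition comp :: "zvec \<Rightarrow> 'b \<Rightarrow> 'b" where
  "comp n b = (THE c. c \<in> (\<Pi>\<^sub>E n \<in> Zr r. gr n) \<and> finite {n \<in> Zr r. c n \<noteq> \<zero>} \<and>
        b = finsum B c {n \<in> Zr r. c n \<noteq> \<zero>}) n"

lemma decomposition_unique:
  assumes c: "\<And>n. n \<in> Zr r \<Longrightarrow> c n \<in> gr n" "finite {n \<in> Zr r. c n \<noteq> \<zero>}"
    and b: "b = finsum B c {n \<in> Zr r. c n \<noteq> \<zero>}" and n: "n \<in> Zr r"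
  shows "comp n b = c n"
proof -
  let ?Q = "\<lambda>b c. c \<in> (\<Pi>\<^sub>E n \<in> Zr r. gr n) \<and> finite {n \<in> Zr r. c n \<noteq> \<zero>} \<and>
        b = finsum B c {n \<in> Zr r. c n \<noteq> \<zero>}"
  let ?c = "restrict c (Zr r)"
  have "b \<in> carrier B" unfolding b by (rule finsum_closed) (use c gr_carrier in auto)
  then have ex: "\<exists>!c. ?Q b c" using graded unfolding graded_cring_def by blast
  have s: "{n \<in> Zr r. ?c n \<noteq> \<zero>} = {n \<in> Zr r. c n \<noteq> \<zero>}" by auto
  have "finsum B ?c {n \<in> Zr r. c n \<noteq> \<zero>} = finsum B c {n \<in> Zr r. c n \<noteq> \<zero>}"
    by (rule finsum_cong') (use c gr_carrier in auto)
  then have "?Q b ?c" using c b unfolding s by auto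
  then have "(THE c. ?Q b c) = ?c" using ex by (rule the1_equality[rotated])
  then show ?thesis unfolding comp_def using n by simp
qed

lemma comp_props:
  assumes b: "b \<in> carrier B"
  shows "n \<in> Zr r \<Longrightarrow> comp n b \<in> gr n" "finite {n \<in> Zr r. comp n b \<noteq> \<zero>}"
    "b = finsum B (\<lambda>n. comp n b) {n \<in> Zr r. comp n b \<noteq> \<zero>}"
proof -
  let ?Q = "\<lambda>c. c \<in> (\<Pi>\<^sub>E n \<in> Zr r. gr n) \<and> finite {n \<in> Zr r. c n \<noteq> \<zero>} \<and>
        b = finsum B c {n \<in> Zr r. c n \<noteq> \<zero>}"
  have "\<exists>!c. ?Q c" using graded b unfolding graded_cring_def by blast
  from theI'[OF this] have Q: "?Q (\<lambda>n. comp n b)" unfolding comp_def .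
  show "n \<in> Zr r \<Longrightarrow> comp n b \<in> gr n" "finite {n \<in> Zr r. comp n b \<noteq> \<zero>}"
    "b = finsum B (\<lambda>n. comp n b) {n \<in> Zr r. comp n b \<noteq> \<zero>}"
    using Q by (auto simp: PiE_def Pi_def)
qed

lemma comp_carrier: "b \<in> carrier B \<Longrightarrow> n \<in> Zr r \<Longrightarrow> comp n b \<in> carrier B"
  using comp_props(1) gr_carrier by blast

lemma comp_homogeneous:
  assumes m: "m \<in> Zr r" and n: "n \<in> Zr r" and x: "x \<in> gr m"
  shows "comp n x = (if n = m then x else \<zero>)"
proof (rule decomposition_unique[OF _ _ _ n])
  let ?c = "\<lambda>n. if n = m then x else \<zero>"
  show "?c n \<in> gr n" if "n \<in> Zr r" for n using x gr_zero[OF that] by simp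
  have xB: "x \<in> carrier B" using gr_carrier[OF m x] .
  show "finite {n \<in> Zr r. ?c n \<noteq> \<zero>}" by (rule finite_subset[of _ "{m}"]) auto
  show "x = finsum B ?c {n \<in> Zr r. ?c n \<noteq> \<zero>}"
  proof (cases "x = \<zero>")
    case True
    then have "{n \<in> Zr r. ?c n \<noteq> \<zero>} = {}" by auto
    then show ?thesis using True by simp
  next
    case False
    then have "{n \<in> Zr r. ?c n \<noteq> \<zero>} = {m}" using m by auto
    then show ?thesis using xB by simp
  qed
qed

lemma comp_superset:
  assumes b: "b \<in> carrier B" and K: "finite K" "K \<subseteq> Zr r" "{n \<in> Zr r. comp n b \<noteq> \<zero>} \<subseteq> K"
  shows "b = finsum B (\<lambda>n. comp n b) K"
proof -
  have "finsum B (\<lambda>n. comp n b) {n \<in> Zr r. comp n b \<noteq> \<zero>} = finsum B (\<lambda>n. comp n b) K"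
    by (rule add.finprod_mono_neutral_cong_left) (use K b comp_carrier in auto)
  then show ?thesis using comp_props(3)[OF b] by simp
qed

lemma comp_add:
  assumes b: "b \<in> carrier B" and c: "c \<in> carrier B" and n: "n \<in> Zr r"
  shows "comp n (b \<oplus> c) = comp n b \<oplus> comp n c"
proof (rule decomposition_unique[OF _ _ _ n])
  let ?K = "{n \<in> Zr r. comp n b \<noteq> \<zero>} \<union> {n \<in> Zr r. comp n c \<noteq> \<zero>}"
  let ?f = "\<lambda>n. comp n b \<oplus> comp n c"
  have K: "finite ?K" using comp_props(2)[OF b] comp_props(2)[OF c] by simp
  have sub: "{n \<in> Zr r. ?f n \<noteq> \<zero>} \<subseteq> ?K" by auto
  show "?f n \<in> gr n" if "n \<in> Zr r" for n using comp_props(1)[OF b that] comp_props(1)[OF c that] gr_add that by simp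
  show "finite {n \<in> Zr r. ?f n \<noteq> \<zero>}" using K sub by (rule finite_subset[rotated])
  have "finsum B ?f {n \<in> Zr r. ?f n \<noteq> \<zero>} = finsum B ?f ?K"
    by (rule add.finprod_mono_neutral_cong_left) (use K sub b c comp_carrier in auto)
  also have "\<dots> = finsum B (\<lambda>n. comp n b) ?K \<oplus> finsum B (\<lambda>n. comp n c) ?K"
    by (rule finsum_addf) (use b c comp_carrier in auto)
  also have "finsum B (\<lambda>n. comp n b) ?K = b" by (rule comp_superset[symmetric]) (use K b in auto)
  also have "finsum B (\<lambda>n. comp n c) ?K = c" by (rule comp_superset[symmetric]) (use K c in auto)
  finally show "b \<oplus> c = finsum B ?f {n \<in> Zr r. ?f n \<noteq> \<zero>}" by simp
qed

lemma homogeneous_induct [consumes 1, case_names zero homogeneous add]: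
  assumes b: "b \<in> carrier B" and z: "P \<zero>"
    and h: "\<And>n x. n \<in> Zr r \<Longrightarrow> x \<in> gr n \<Longrightarrow> P x"
    and a: "\<And>x y. x \<in> carrier B \<Longrightarrow> y \<in> carrier B \<Longrightarrow> P x \<Longrightarrow> P y \<Longrightarrow> P (x \<oplus> y)"
  shows "P b"
proof -
  have "P (finsum B (\<lambda>n. comp n b) K)" if "finite K" "K \<subseteq> Zr r" for K
    using that
  proof (induct K)
    case (insert k K)
    have c: "(\<lambda>n. comp n b) \<in> K \<rightarrow> carrier B" "comp k b \<in> carrier B"
      using insert comp_carrier[OF b] by auto
    have "P (comp k b \<oplus> finsum B (\<lambda>n. comp n b) K)"
    proof (rule a)
      show "P (comp k b)" using insert(4) comp_props(1)[OF b] by (intro h[of k]) auto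
    qed (use insert c in auto)
    then show ?case using insert c by simp
  qed (simp add: z)
  from this[OF comp_props(2)[OF b]] show ?thesis using comp_props(3)[OF b] by auto
qed

lemma comp_zero: "n \<in> Zr r \<Longrightarrow> comp n \<zero> = \<zero>"
  using comp_homogeneous[of 0 n \<zero>] gr_zero[of 0] by (simp split: if_splits)

lemma comp_separates:
  assumes "b \<in> carrier B" "\<And>n. n \<in> Zr r \<Longrightarrow> comp n b = \<zero>" shows "b = \<zero>"
proof -
  have "{n \<in> Zr r. comp n b \<noteq> \<zero>} = {}" using assms(2) by auto
  then have "finsum B (\<lambda>n. comp n b) {n \<in> Zr r. comp n b \<noteq> \<zero>} = \<zero>" by (simp only: finsum_empty)
  then show ?thesis by (subst comp_props(3)[OF assms(1)])
qed

lemma comp_mult_homogeneous: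
  assumes m: "m \<in> Zr r" and n: "n \<in> Zr r" and x: "x \<in> gr m" and b: "b \<in> carrier B"
  shows "comp (m + n) (x \<otimes> b) = x \<otimes> comp n b"
  using b
proof (induct b rule: homogeneous_induct)
  case zero
  then show ?case using gr_carrier[OF m x] m n by (simp add: comp_zero)
next
  case (homogeneous k y)
  then show ?case using comp_homogeneous[OF Zr_closed(2)[OF m homogeneous(1)] Zr_closed(2)[OF m n] gr_mult[OF m homogeneous(1) x homogeneous(2)]]
      comp_homogeneous[OF homogeneous(1) n homogeneous(2)] gr_carrier[OF m x] by simp
next
  case (add y z)
  then show ?case using m n gr_carrier[OF m x] by (simp add: r_distr comp_add comp_carrier)
qed

end

text \<open>Additive projections onto the homogeneous parts give existence and uniqueness of the decomposition
  into homogeneous elements at once.\<close>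

lemma graded_cringI:
  fixes B :: "'b ring" (structure)
  assumes B: "cring B" and sub: "\<And>n. n \<in> Zr r \<Longrightarrow> subgroup (gr n) (add_monoid B)"
    and mem: "\<And>n b. n \<in> Zr r \<Longrightarrow> b \<in> carrier B \<Longrightarrow> \<pi> n b \<in> gr n"
    and add: "\<And>n b c. n \<in> Zr r \<Longrightarrow> b \<in> carrier B \<Longrightarrow> c \<in> carrier B \<Longrightarrow> \<pi> n (b \<oplus> c) = \<pi> n b \<oplus> \<pi> n c"
    and hom: "\<And>m n x. m \<in> Zr r \<Longrightarrow> n \<in> Zr r \<Longrightarrow> x \<in> gr m \<Longrightarrow> \<pi> n x = (if n = m then x else \<zero>)"
    and fin: "\<And>b. b \<in> carrier B \<Longrightarrow> finite {n \<in> Zr r. \<pi> n b \<noteq> \<zero>}"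
    and sep: "\<And>b. b \<in> carrier B \<Longrightarrow> (\<And>n. n \<in> Zr r \<Longrightarrow> \<pi> n b = \<zero>) \<Longrightarrow> b = \<zero>"
    and one: "\<one> \<in> gr 0"
    and mult: "\<And>m n x y. m \<in> Zr r \<Longrightarrow> n \<in> Zr r \<Longrightarrow> x \<in> gr m \<Longrightarrow> y \<in> gr n \<Longrightarrow> x \<otimes> y \<in> gr (m + n)"
  shows "graded_cring r B gr"
proof -
  interpret cring B by fact
  have car: "x \<in> carrier B" if "n \<in> Zr r" "x \<in> gr n" for n x
    using subgroup.subset[OF sub[OF that(1)]] that(2) by auto
  have z: "\<pi> n \<zero> = \<zero>" if "n \<in> Zr r" for n
  proof -
    have "\<pi> n \<zero> \<oplus> \<pi> n \<zero> = \<pi> n \<zero>" using add[OF that zero_closed zero_closed] by simp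
    then show ?thesis using car[OF that mem[OF that zero_closed]] by (metis add.l_cancel_one' )
  qed
  have sum: "\<pi> m (finsum B c K) = (if m \<in> K then c m else \<zero>)"
    if "finite K" "K \<subseteq> Zr r" "\<And>n. n \<in> Zr r \<Longrightarrow> c n \<in> gr n" "m \<in> Zr r" for K c m
    using that(1,2)
  proof (induct K)
    case (insert k K)
    have c: "c \<in> K \<rightarrow> carrier B" "c k \<in> carrier B" using insert car that(3) by auto
    have "\<pi> m (finsum B c (insert k K)) = \<pi> m (c k) \<oplus> \<pi> m (finsum B c K)"
      using insert c add[OF that(4)] by simp
    moreover have "\<pi> m (c k) = (if m = k then c k else \<zero>)" using insert hom[OF _ that(4)] that(3) by simp
    ultimately show ?case using insert c that(3,4) car by auto
  qed (simp add: z that)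
  show ?thesis
    unfolding graded_cring_def
  proof (intro conjI ballI B sub one mult)
    fix b assume b: "b \<in> carrier B"
    let ?Q = "\<lambda>c. c \<in> (\<Pi>\<^sub>E n \<in> Zr r. gr n) \<and> finite {n \<in> Zr r. c n \<noteq> \<zero>} \<and>
        b = finsum B c {n \<in> Zr r. c n \<noteq> \<zero>}"
    show "\<exists>!c. ?Q c"
    proof (rule ex1I)
      fix c assume c: "?Q c"
      show "c = restrict (\<lambda>n. \<pi> n b) (Zr r)"
      proof
        fix n
        show "c n = restrict (\<lambda>n. \<pi> n b) (Zr r) n"
        proof (cases "n \<in> Zr r")
          case True
          have "\<pi> n (finsum B c {n \<in> Zr r. c n \<noteq> \<zero>}) = (if n \<in> {n \<in> Zr r. c n \<noteq> \<zero>} then c n else \<zero>)"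
            by (rule sum) (use c True in auto)
          then have "\<pi> n b = c n" using c True by auto
          then show ?thesis using True by simp
        qed (use c in \<open>auto simp: PiE_def extensional_def\<close>)
      qed
    next
      let ?c = "restrict (\<lambda>n. \<pi> n b) (Zr r)"
      let ?K = "{n \<in> Zr r. ?c n \<noteq> \<zero>}"
      have K: "?K = {n \<in> Zr r. \<pi> n b \<noteq> \<zero>}" by auto
      have fK: "finite ?K" unfolding K by (rule fin[OF b])
      have gc: "?c n \<in> gr n" if "n \<in> Zr r" for n using that mem b by simp
      have s: "finsum B ?c ?K \<in> carrier B" by (rule finsum_closed) (use gc car in auto)
      have "b \<ominus> finsum B ?c ?K = \<zero>"
      proof (rule sep)
        fix n assume n: "n \<in> Zr r"
        have "\<pi> n (finsum B ?c ?K) = \<pi> n b"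
          using sum[of ?K ?c n] fK gc n by auto
        moreover have "\<pi> n b = \<pi> n (b \<ominus> finsum B ?c ?K) \<oplus> \<pi> n (finsum B ?c ?K)"
        proof -
          have "(b \<ominus> finsum B ?c ?K) \<oplus> finsum B ?c ?K = b"
            using b s by (simp add: a_minus_def a_assoc l_neg)
          then show ?thesis using add[OF n, of "b \<ominus> finsum B ?c ?K" "finsum B ?c ?K"] b s by simp
        qed
        ultimately have eq: "\<pi> n (b \<ominus> finsum B ?c ?K) \<oplus> \<pi> n b = \<pi> n b" by simp
        have c: "\<pi> n b \<in> carrier B" "\<pi> n (b \<ominus> finsum B ?c ?K) \<in> carrier B"
          using car[OF n mem[OF n]] b s by simp_all
        show "\<pi> n (b \<ominus> finsum B ?c ?K) = \<zero>"
          using add.right_cancel[OF c(1) c(2) zero_closed] eq c(1) by simp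
      qed (use b s in simp)
      then have "b = finsum B ?c ?K" using b s by simp
      then show "?Q ?c" using gc fK by auto
    qed
  qed
qed

lemma torsorD: "torsor r B gr \<Longrightarrow> graded_cring r B gr" by (simp add: torsor_def)

locale torsor_ring = graded r B gr for r and B :: "'b ring" (structure) and gr +
  assumes torsor: "torsor r B gr"
begin

text \<open>In a torsor, \<open>1\<close> is a sum of products of elements of degrees \<open>n\<close> and \<open>- n\<close>. So a property of
  elements of degree \<open>0\<close> which is compatible with addition and negation, and holds for such products,
  holds for \<open>1\<close>.\<close>

lemma product_induct [consumes 1, case_names zero incl neg add]:
  assumes n: "n \<in> Zr r"
    and z: "P \<zero>" and i: "\<And>x y. x \<in> gr n \<Longrightarrow> y \<in> gr (- n) \<Longrightarrow> P (x \<otimes> y)"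
    and m: "\<And>w. w \<in> gr 0 \<Longrightarrow> P w \<Longrightarrow> P (\<ominus> w)"
    and a: "\<And>v w. v \<in> gr 0 \<Longrightarrow> w \<in> gr 0 \<Longrightarrow> P v \<Longrightarrow> P w \<Longrightarrow> P (v \<oplus> w)"
  shows "P \<one>"
proof -
  let ?A = "{x \<otimes> y | x y. x \<in> gr n \<and> y \<in> gr (- n)}"
  have "generate (add_monoid B) ?A = gr (n + - n)"
    using torsor n Zr_closed(3)[OF n] unfolding torsor_def by blast
  then have gen: "generate (add_monoid B) ?A = gr 0" by simp
  have "P w \<and> w \<in> gr 0" if "w \<in> generate (add_monoid B) ?A" for w
    using that
  proof (induct w rule: generate.induct)
    case one
    then show ?case using z gr_zero by simp
  next
    case (incl h)
    then show ?case using i gr_mult_neg[OF n] by auto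
  next
    case (inv h)
    then have "P h" "h \<in> gr 0" using i gr_mult_neg[OF n] by auto
    then show ?case using m gr_uminus[of 0] by (simp add: a_inv_def)
  next
    case (eng h1 h2)
    then show ?case using a gr_add[of 0] by simp
  qed
  then show ?thesis using gr_one gen by blast
qed

end

lemma torsor_ringI: "torsor r B gr \<Longrightarrow> torsor_ring r B gr"
  by (simp add: torsor_ring_def torsor_ring_axioms_def graded_def torsorD)

text \<open>If \<open>1\<close> is a sum of products \<open>x y\<close> with \<open>x\<close> of degree \<open>m\<close> and \<open>y\<close> of degree \<open>- m\<close>, then every \<open>z\<close> of
  degree \<open>m + n\<close> is the sum of the products \<open>x (y z)\<close>.\<close>

lemma torsorI:
  fixes B :: "'b ring" (structure)
  assumes gr: "graded_cring r B gr"
    and one: "\<And>n. n \<in> Zr r \<Longrightarrow> \<one> \<in> generate (add_monoid B) {x \<otimes> y | x y. x \<in> gr n \<and> y \<in> gr (- n)}"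
  shows "torsor r B gr"
  unfolding torsor_def
proof (intro conjI gr ballI)
  interpret graded r B gr by unfold_locales (rule gr)
  fix m n assume m: "m \<in> Zr r" and n: "n \<in> Zr r"
  let ?A = "{x \<otimes> y | x y. x \<in> gr m \<and> y \<in> gr n}"
  let ?A' = "{x \<otimes> y | x y. x \<in> gr m \<and> y \<in> gr (- m)}"
  have "?A \<subseteq> gr (m + n)" using gr_mult[OF m n] by auto
  then have sub: "generate (add_monoid B) ?A \<subseteq> gr (m + n)"
    by (rule group.generate_subgroup_incl[OF abelian_group.a_group[OF abelian_group_axioms]])
      (use graded_cringD(2)[OF gr] m n in auto)
  have "w \<otimes> z \<in> generate (add_monoid B) ?A"
    if w: "w \<in> generate (add_monoid B) ?A'" and z: "z \<in> gr (m + n)" for w z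
  proof -
    have zB: "z \<in> carrier B" by (rule gr_carrier[OF Zr_closed(2)[OF m n] z])
    show ?thesis using w
  proof (induct w rule: generate.induct)
    case one
    then show ?case using zB generate.one[of "add_monoid B" ?A] by simp
  next
    case (incl h)
    then obtain x y where xy: "h = x \<otimes> y" "x \<in> gr m" "y \<in> gr (- m)" by auto
    have "y \<otimes> z \<in> gr (- m + (m + n))" using gr_mult[OF Zr_closed(3)[OF m] Zr_closed(2)[OF m n] xy(3) z] .
    then have "y \<otimes> z \<in> gr n" by simp
    moreover have "h \<otimes> z = x \<otimes> (y \<otimes> z)"
      unfolding xy(1) by (intro m_assoc gr_carrier[OF m xy(2)] gr_carrier[OF Zr_closed(3)[OF m] xy(3)] zB)
    ultimately show ?case using xy(2) by (intro generate.incl) auto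
  next
    case (inv h)
    then obtain x y where xy: "h = x \<otimes> y" "x \<in> gr m" "y \<in> gr (- m)" by auto
    have "y \<otimes> z \<in> gr (- m + (m + n))" using gr_mult[OF Zr_closed(3)[OF m] Zr_closed(2)[OF m n] xy(3) z] .
    then have yz: "y \<otimes> z \<in> gr n" by simp
    note c = gr_carrier[OF m xy(2)] gr_carrier[OF Zr_closed(3)[OF m] xy(3)] zB
    have "inv\<^bsub>add_monoid B\<^esub> h \<otimes> z = inv\<^bsub>add_monoid B\<^esub> (x \<otimes> (y \<otimes> z))"
      unfolding a_inv_def[symmetric] using c xy by (simp add: l_minus m_assoc)
    moreover have "x \<otimes> (y \<otimes> z) \<in> ?A" using xy(2) yz by auto
    ultimately show ?case using generate.inv[of "x \<otimes> (y \<otimes> z)" ?A "add_monoid B"] by simp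
  next
    case (eng h1 h2)
    have "generate (add_monoid B) ?A' \<subseteq> gr 0"
      by (rule group.generate_subgroup_incl[OF abelian_group.a_group[OF abelian_group_axioms]])
        (use graded_cringD(2)[OF gr] gr_mult_neg[OF m] in auto)
    then have "h1 \<in> carrier B" "h2 \<in> carrier B" using eng gr_carrier[of 0] by auto
    then show ?case
      using generate.eng[OF eng(2,4)] zB by (simp add: l_distr)
  qed
  qed
  note gen = this
  show "generate (add_monoid B) ?A = gr (m + n)"
  proof (intro subset_antisym sub subsetI)
    fix z assume z: "z \<in> gr (m + n)"
    then show "z \<in> generate (add_monoid B) ?A"
      using gen[OF one[OF m] z] gr_carrier[OF Zr_closed(2)[OF m n] z] by simp
  qed
qed

text \<open>The representation of \<open>1\<close> as a sum of products of opposite degrees is mapped to such a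
  representation.\<close>

lemma torsor_hom_image:
  assumes B: "torsor r B gr" and B': "graded_cring r B' gr'"
    and h: "h \<in> ring_hom B B'" "\<And>n. n \<in> Zr r \<Longrightarrow> h ` gr n \<subseteq> gr' n"
  shows "torsor r B' gr'"
proof (rule torsorI[OF B'])
  interpret T: torsor_ring r B gr using B by (rule torsor_ringI)
  interpret T': graded r B' gr' by unfold_locales (rule B')
  interpret h: ring_hom_cring B B' h by unfold_locales (rule h)
  fix n assume n: "n \<in> Zr r"
  let ?G = "generate (add_monoid B') {x \<otimes>\<^bsub>B'\<^esub> y | x y. x \<in> gr' n \<and> y \<in> gr' (- n)}"
  have sub: "{x \<otimes>\<^bsub>B'\<^esub> y | x y. x \<in> gr' n \<and> y \<in> gr' (- n)} \<subseteq> carrier (add_monoid B')"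
    using T'.gr_carrier[OF n] T'.gr_carrier[OF Zr_closed(3)[OF n]] by auto
  have grp: "group (add_monoid B')" using T'.a_group .
  have "h \<one>\<^bsub>B\<^esub> \<in> ?G"
  proof (rule T.product_induct[OF n, where P = "\<lambda>w. h w \<in> ?G"])
    show "h \<zero>\<^bsub>B\<^esub> \<in> ?G" using generate.one[of "add_monoid B'"] by simp
  next
    fix x y assume xy: "x \<in> gr n" "y \<in> gr (- n)"
    then have "h x \<in> gr' n" "h y \<in> gr' (- n)" using h(2)[OF n] h(2)[OF Zr_closed(3)[OF n]] by auto
    moreover have "h (x \<otimes>\<^bsub>B\<^esub> y) = h x \<otimes>\<^bsub>B'\<^esub> h y"
      by (intro h.hom_mult T.gr_carrier[OF n xy(1)] T.gr_carrier[OF Zr_closed(3)[OF n] xy(2)])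
    ultimately show "h (x \<otimes>\<^bsub>B\<^esub> y) \<in> ?G" by (intro generate.incl) auto
  next
    fix w assume w: "w \<in> gr 0" "h w \<in> ?G"
    have "inv\<^bsub>add_monoid B'\<^esub> (h w) \<in> ?G" by (rule group.generate_m_inv_closed[OF grp sub w(2)])
    then show "h (\<ominus>\<^bsub>B\<^esub> w) \<in> ?G"
      unfolding a_inv_def[symmetric] using T.gr_carrier[of 0 w] w by simp
  next
    fix v w assume "v \<in> gr 0" "w \<in> gr 0" "h v \<in> ?G" "h w \<in> ?G"
    then show "h (v \<oplus>\<^bsub>B\<^esub> w) \<in> ?G" using T.gr_carrier[of 0] generate.eng[of "h v" "add_monoid B'" _ "h w"] by simp
  qed
  then show "\<one>\<^bsub>B'\<^esub> \<in> ?G" by simp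
qed

subsection \<open>The degree zero part\<close>

abbreviation degree_zero :: "'b ring \<Rightarrow> (zvec \<Rightarrow> 'b set) \<Rightarrow> 'b ring" where
  "degree_zero B gr \<equiv> B\<lparr>carrier := gr 0\<rparr>"

lemma degree_zero_pow: "x [^]\<^bsub>degree_zero B gr\<^esub> (k::nat) = x [^]\<^bsub>B\<^esub> k"
  by (simp add: nat_pow_def)

context graded begin

lemma degree_zero_cring: "cring (degree_zero B gr)"
proof (rule cringI)
  show "abelian_group (degree_zero B gr)"
  proof (rule abelian_groupI)
    fix x assume x: "x \<in> carrier (degree_zero B gr)"
    then show "\<exists>y\<in>carrier (degree_zero B gr). y \<oplus>\<^bsub>degree_zero B gr\<^esub> x = \<zero>\<^bsub>degree_zero B gr\<^esub>"
      using gr_uminus[of 0 x] gr_carrier[of 0 x] by (intro bexI[of _ "\<ominus> x"]) (auto simp: l_neg)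
  qed (use gr_add[of 0] gr_zero[of 0] gr_carrier[of 0] in \<open>auto simp: a_ac\<close>)
  show "Group.comm_monoid (degree_zero B gr)"
    by (rule comm_monoidI) (use gr_mult0[of 0] gr_one gr_carrier[of 0] in \<open>auto simp: m_ac\<close>)
qed (use gr_carrier[of 0] in \<open>auto simp: l_distr\<close>)

text \<open>The component of degree \<open>- n\<close> of the inverse is an inverse too.\<close>

lemma unit_inverse_homogeneous:
  assumes n: "n \<in> Zr r" and x: "x \<in> gr n" and u: "x \<in> Units B"
  shows "\<exists>y \<in> gr (- n). x \<otimes> y = \<one>"
proof -
  obtain y where y: "y \<in> carrier B" "x \<otimes> y = \<one>" using u Units_r_inv_ex by blast
  have "comp (n + - n) (x \<otimes> y) = x \<otimes> comp (- n) y"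
    by (rule comp_mult_homogeneous[OF n Zr_closed(3)[OF n] x y(1)])
  also have "comp (n + - n) (x \<otimes> y) = \<one>"
    using comp_homogeneous[of 0 0 \<one>] gr_one y by simp
  finally show ?thesis using comp_props(1)[OF y(1) Zr_closed(3)[OF n]] by metis
qed

lemma degree_zero_Units:
  assumes "x \<in> gr 0" shows "x \<in> Units (degree_zero B gr) \<longleftrightarrow> x \<in> Units B"
proof
  assume "x \<in> Units (degree_zero B gr)"
  then show "x \<in> Units B" using gr_carrier[of 0] by (auto simp: Units_def)
next
  assume "x \<in> Units B"
  from unit_inverse_homogeneous[OF _ assms this] obtain y where y: "y \<in> gr 0" "x \<otimes> y = \<one>" by auto
  then have "y \<otimes> x = \<one>" using m_comm[of y x] gr_carrier[of 0] assms by simp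
  then show "x \<in> Units (degree_zero B gr)" using assms y by (auto simp: Units_def)
qed

end

lemma degree_zero_hom:
  assumes "h \<in> ring_hom B B'" "h ` gr 0 \<subseteq> gr' 0" "gr 0 \<subseteq> carrier B"
  shows "h \<in> ring_hom (degree_zero B gr) (degree_zero B' gr')"
  using assms by (auto simp: ring_hom_def subset_iff)

lemma graded_hom_comp:
  assumes B: "graded_cring r B gr" and B': "graded_cring r B' gr'"
    and h: "h \<in> ring_hom B B'" "\<And>n. n \<in> Zr r \<Longrightarrow> h ` gr n \<subseteq> gr' n"
    and b: "b \<in> carrier B" and n: "n \<in> Zr r"
  shows "h (graded.comp r B gr n b) = graded.comp r B' gr' n (h b)"
proof -
  interpret B: graded r B gr by unfold_locales (rule B)
  interpret B': graded r B' gr' by unfold_locales (rule B')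
  interpret h: ring_hom_cring B B' h by unfold_locales (rule h)
  show ?thesis using b
  proof (induct b rule: B.homogeneous_induct)
    case zero
    then show ?case using n by (simp add: B.comp_zero B'.comp_zero)
  next
    case (homogeneous k x)
    then have "h x \<in> gr' k" using h(2) by blast
    then show ?case using B.comp_homogeneous[OF homogeneous(1) n homogeneous(2)]
        B'.comp_homogeneous[OF homogeneous(1) n] by simp
  next
    case (add x y)
    then show ?case using n by (simp add: B.comp_add B'.comp_add B.comp_carrier)
  qed
qed

text \<open>A torsor is pulled back from a localization of its base by localizing it at the same element. By
  \<open>product_induct\<close> with \<open>P w\<close> about the product of \<open>w\<close> with a homogeneous element \<open>s\<close>, properties of
  \<open>s\<close> are reduced to elements \<open>x (y s)\<close> where \<open>y s\<close> has degree \<open>0\<close>, and there they are known.\<close>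

lemma torsor_localization:
  assumes B: "torsor r B gr" and B': "graded_cring r B' gr'"
    and h: "h \<in> ring_hom B B'" "\<And>n. n \<in> Zr r \<Longrightarrow> h ` gr n \<subseteq> gr' n"
    and a: "a \<in> gr 0" and loc: "localization_away (degree_zero B gr) a (degree_zero B' gr') h"
  shows "localization_away B a B' h"
proof -
  interpret B: torsor_ring r B gr using B by (rule torsor_ringI)
  interpret B': graded r B' gr' by unfold_locales (rule B')
  interpret h: ring_hom_cring B B' h by unfold_locales (rule h)
  have hgr: "h x \<in> gr' n" if "n \<in> Zr r" "x \<in> gr n" for n x using h(2) that by blast
  have aB: "a \<in> carrier B" using B.gr_carrier[of 0] a by simp
  have ha: "h a \<in> gr' 0" using hgr a by simp
  have frac0: "\<exists>x\<in>gr 0. \<exists>k::nat. s \<otimes>\<^bsub>B'\<^esub> h a [^]\<^bsub>B'\<^esub> k = h x" if "s \<in> gr' 0" for s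
    using loc that unfolding localization_away_def degree_zero_pow by simp
  have ker0: "\<exists>k::nat. a [^]\<^bsub>B\<^esub> k \<otimes>\<^bsub>B\<^esub> x = \<zero>\<^bsub>B\<^esub>" if "x \<in> gr 0" "h x = \<zero>\<^bsub>B'\<^esub>" for x
    using loc that unfolding localization_away_def degree_zero_pow by simp
  have add: "\<exists>x\<in>carrier B. \<exists>k::nat. (s \<oplus>\<^bsub>B'\<^esub> t) \<otimes>\<^bsub>B'\<^esub> h a [^]\<^bsub>B'\<^esub> k = h x"
    if s: "s \<in> carrier B'" "\<exists>x\<in>carrier B. \<exists>k::nat. s \<otimes>\<^bsub>B'\<^esub> h a [^]\<^bsub>B'\<^esub> k = h x"
      and t: "t \<in> carrier B'" "\<exists>x\<in>carrier B. \<exists>k::nat. t \<otimes>\<^bsub>B'\<^esub> h a [^]\<^bsub>B'\<^esub> k = h x" for s t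
  proof -
    obtain x k where x: "x \<in> carrier B" "s \<otimes>\<^bsub>B'\<^esub> h a [^]\<^bsub>B'\<^esub> (k::nat) = h x" using s(2) by blast
    obtain y l where y: "y \<in> carrier B" "t \<otimes>\<^bsub>B'\<^esub> h a [^]\<^bsub>B'\<^esub> (l::nat) = h y" using t(2) by blast
    have "(s \<oplus>\<^bsub>B'\<^esub> t) \<otimes>\<^bsub>B'\<^esub> h a [^]\<^bsub>B'\<^esub> (k + l) =
      (s \<otimes>\<^bsub>B'\<^esub> h a [^]\<^bsub>B'\<^esub> k) \<otimes>\<^bsub>B'\<^esub> h a [^]\<^bsub>B'\<^esub> l \<oplus>\<^bsub>B'\<^esub> (t \<otimes>\<^bsub>B'\<^esub> h a [^]\<^bsub>B'\<^esub> l) \<otimes>\<^bsub>B'\<^esub> h a [^]\<^bsub>B'\<^esub> k"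
      using s(1) t(1) aB by (simp add: B'.nat_pow_mult[symmetric] B'.l_distr B'.r_distr B'.m_ac)
    also have "\<dots> = h (x \<otimes>\<^bsub>B\<^esub> a [^]\<^bsub>B\<^esub> l \<oplus>\<^bsub>B\<^esub> y \<otimes>\<^bsub>B\<^esub> a [^]\<^bsub>B\<^esub> k)"
      unfolding x(2) y(2) using x(1) y(1) aB by (simp add: h.hom_nat_pow)
    finally show ?thesis using x(1) y(1) aB
      by (intro bexI[of _ "x \<otimes>\<^bsub>B\<^esub> a [^]\<^bsub>B\<^esub> l \<oplus>\<^bsub>B\<^esub> y \<otimes>\<^bsub>B\<^esub> a [^]\<^bsub>B\<^esub> k"] exI[of _ "k + l"]) auto
  qed
  have homog: "\<exists>x\<in>carrier B. \<exists>k::nat. s \<otimes>\<^bsub>B'\<^esub> h a [^]\<^bsub>B'\<^esub> k = h x" if n: "n \<in> Zr r" and s: "s \<in> gr' n" for n s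
  proof -
    have sB: "s \<in> carrier B'" using B'.gr_carrier[OF n s] .
    have "\<exists>x\<in>carrier B. \<exists>k::nat. (h \<one>\<^bsub>B\<^esub> \<otimes>\<^bsub>B'\<^esub> s) \<otimes>\<^bsub>B'\<^esub> h a [^]\<^bsub>B'\<^esub> k = h x"
    proof (rule B.product_induct[OF n, where P = "\<lambda>w. \<exists>x\<in>carrier B. \<exists>k::nat. (h w \<otimes>\<^bsub>B'\<^esub> s) \<otimes>\<^bsub>B'\<^esub> h a [^]\<^bsub>B'\<^esub> k = h x"])
      show "\<exists>x\<in>carrier B. \<exists>k::nat. (h \<zero>\<^bsub>B\<^esub> \<otimes>\<^bsub>B'\<^esub> s) \<otimes>\<^bsub>B'\<^esub> h a [^]\<^bsub>B'\<^esub> k = h x"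
        using sB aB by (intro bexI[of _ "\<zero>\<^bsub>B\<^esub>"] exI[of _ 0]) auto
    next
      fix x y assume x: "x \<in> gr n" and y: "y \<in> gr (- n)"
      have xB: "x \<in> carrier B" "y \<in> carrier B" using B.gr_carrier n Zr_closed(3)[OF n] x y by blast+
      have "h y \<otimes>\<^bsub>B'\<^esub> s \<in> gr' (- n + n)" using B'.gr_mult[OF Zr_closed(3)[OF n] n hgr[OF Zr_closed(3)[OF n] y] s] .
      then have "h y \<otimes>\<^bsub>B'\<^esub> s \<in> gr' 0" by simp
      from frac0[OF this] obtain z k where
        z: "z \<in> gr 0" "(h y \<otimes>\<^bsub>B'\<^esub> s) \<otimes>\<^bsub>B'\<^esub> h a [^]\<^bsub>B'\<^esub> (k::nat) = h z" by blast
      have zB: "z \<in> carrier B" using B.gr_carrier[of 0] z by simp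
      have "(h (x \<otimes>\<^bsub>B\<^esub> y) \<otimes>\<^bsub>B'\<^esub> s) \<otimes>\<^bsub>B'\<^esub> h a [^]\<^bsub>B'\<^esub> k = h x \<otimes>\<^bsub>B'\<^esub> ((h y \<otimes>\<^bsub>B'\<^esub> s) \<otimes>\<^bsub>B'\<^esub> h a [^]\<^bsub>B'\<^esub> k)"
        using xB sB aB by (simp add: B'.m_assoc)
      also have "\<dots> = h (x \<otimes>\<^bsub>B\<^esub> z)" unfolding z(2) using xB zB by simp
      finally show "\<exists>u\<in>carrier B. \<exists>k::nat. (h (x \<otimes>\<^bsub>B\<^esub> y) \<otimes>\<^bsub>B'\<^esub> s) \<otimes>\<^bsub>B'\<^esub> h a [^]\<^bsub>B'\<^esub> k = h u"
        using xB zB by (intro bexI[of _ "x \<otimes>\<^bsub>B\<^esub> z"] exI[of _ k]) auto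
    next
      fix w assume w: "w \<in> gr 0" and "\<exists>x\<in>carrier B. \<exists>k::nat. (h w \<otimes>\<^bsub>B'\<^esub> s) \<otimes>\<^bsub>B'\<^esub> h a [^]\<^bsub>B'\<^esub> k = h x"
      then obtain x k where x: "x \<in> carrier B" "(h w \<otimes>\<^bsub>B'\<^esub> s) \<otimes>\<^bsub>B'\<^esub> h a [^]\<^bsub>B'\<^esub> (k::nat) = h x" by blast
      have wB: "w \<in> carrier B" using B.gr_carrier[of 0] w by simp
      have "(h (\<ominus>\<^bsub>B\<^esub> w) \<otimes>\<^bsub>B'\<^esub> s) \<otimes>\<^bsub>B'\<^esub> h a [^]\<^bsub>B'\<^esub> k = \<ominus>\<^bsub>B'\<^esub> ((h w \<otimes>\<^bsub>B'\<^esub> s) \<otimes>\<^bsub>B'\<^esub> h a [^]\<^bsub>B'\<^esub> k)"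
        using wB sB aB by (simp add: B'.l_minus)
      then show "\<exists>x\<in>carrier B. \<exists>k::nat. (h (\<ominus>\<^bsub>B\<^esub> w) \<otimes>\<^bsub>B'\<^esub> s) \<otimes>\<^bsub>B'\<^esub> h a [^]\<^bsub>B'\<^esub> k = h x"
        using x by (intro bexI[of _ "\<ominus>\<^bsub>B\<^esub> x"] exI[of _ k]) auto
    next
      fix v w assume "v \<in> gr 0" "w \<in> gr 0"
        and e: "\<exists>x\<in>carrier B. \<exists>k::nat. (h v \<otimes>\<^bsub>B'\<^esub> s) \<otimes>\<^bsub>B'\<^esub> h a [^]\<^bsub>B'\<^esub> k = h x"
          "\<exists>x\<in>carrier B. \<exists>k::nat. (h w \<otimes>\<^bsub>B'\<^esub> s) \<otimes>\<^bsub>B'\<^esub> h a [^]\<^bsub>B'\<^esub> k = h x"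
      then have c: "v \<in> carrier B" "w \<in> carrier B" using B.gr_carrier[of 0] by simp_all
      have "h (v \<oplus>\<^bsub>B\<^esub> w) \<otimes>\<^bsub>B'\<^esub> s = h v \<otimes>\<^bsub>B'\<^esub> s \<oplus>\<^bsub>B'\<^esub> h w \<otimes>\<^bsub>B'\<^esub> s" using c sB by (simp add: B'.l_distr)
      then show "\<exists>x\<in>carrier B. \<exists>k::nat. (h (v \<oplus>\<^bsub>B\<^esub> w) \<otimes>\<^bsub>B'\<^esub> s) \<otimes>\<^bsub>B'\<^esub> h a [^]\<^bsub>B'\<^esub> k = h x"
        using add[OF _ e(1) _ e(2)] c sB by simp
    qed
    then show ?thesis using sB by simp
  qed
  have kerh: "\<exists>k::nat. a [^]\<^bsub>B\<^esub> k \<otimes>\<^bsub>B\<^esub> x = \<zero>\<^bsub>B\<^esub>" if n: "n \<in> Zr r" and x: "x \<in> gr n" and hx: "h x = \<zero>\<^bsub>B'\<^esub>" for n x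
  proof -
    have xB: "x \<in> carrier B" using B.gr_carrier[OF n x] .
    have "\<exists>k::nat. a [^]\<^bsub>B\<^esub> k \<otimes>\<^bsub>B\<^esub> (\<one>\<^bsub>B\<^esub> \<otimes>\<^bsub>B\<^esub> x) = \<zero>\<^bsub>B\<^esub>"
    proof (rule B.product_induct[OF n, where P = "\<lambda>w. \<exists>k::nat. a [^]\<^bsub>B\<^esub> k \<otimes>\<^bsub>B\<^esub> (w \<otimes>\<^bsub>B\<^esub> x) = \<zero>\<^bsub>B\<^esub>"])
      show "\<exists>k::nat. a [^]\<^bsub>B\<^esub> k \<otimes>\<^bsub>B\<^esub> (\<zero>\<^bsub>B\<^esub> \<otimes>\<^bsub>B\<^esub> x) = \<zero>\<^bsub>B\<^esub>" using xB aB by simp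
    next
      fix u y assume u: "u \<in> gr n" and y: "y \<in> gr (- n)"
      have uB: "u \<in> carrier B" "y \<in> carrier B" using B.gr_carrier n Zr_closed(3)[OF n] u y by blast+
      have "y \<otimes>\<^bsub>B\<^esub> x \<in> gr (- n + n)" using B.gr_mult[OF Zr_closed(3)[OF n] n y x] .
      moreover have "h (y \<otimes>\<^bsub>B\<^esub> x) = \<zero>\<^bsub>B'\<^esub>" using uB xB hx by simp
      ultimately obtain k where k: "a [^]\<^bsub>B\<^esub> (k::nat) \<otimes>\<^bsub>B\<^esub> (y \<otimes>\<^bsub>B\<^esub> x) = \<zero>\<^bsub>B\<^esub>" using ker0 by auto
      have "a [^]\<^bsub>B\<^esub> k \<otimes>\<^bsub>B\<^esub> ((u \<otimes>\<^bsub>B\<^esub> y) \<otimes>\<^bsub>B\<^esub> x) = u \<otimes>\<^bsub>B\<^esub> (a [^]\<^bsub>B\<^esub> k \<otimes>\<^bsub>B\<^esub> (y \<otimes>\<^bsub>B\<^esub> x))"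
        using uB xB aB by (simp add: B.m_ac)
      then show "\<exists>k::nat. a [^]\<^bsub>B\<^esub> k \<otimes>\<^bsub>B\<^esub> ((u \<otimes>\<^bsub>B\<^esub> y) \<otimes>\<^bsub>B\<^esub> x) = \<zero>\<^bsub>B\<^esub>" using k uB by auto
    next
      fix w assume w: "w \<in> gr 0" "\<exists>k::nat. a [^]\<^bsub>B\<^esub> k \<otimes>\<^bsub>B\<^esub> (w \<otimes>\<^bsub>B\<^esub> x) = \<zero>\<^bsub>B\<^esub>"
      then show "\<exists>k::nat. a [^]\<^bsub>B\<^esub> k \<otimes>\<^bsub>B\<^esub> (\<ominus>\<^bsub>B\<^esub> w \<otimes>\<^bsub>B\<^esub> x) = \<zero>\<^bsub>B\<^esub>"
        using B.gr_carrier[of 0 w] xB aB by (auto simp: B.l_minus B.r_minus)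
    next
      fix v w assume vw: "v \<in> gr 0" "w \<in> gr 0" "\<exists>k::nat. a [^]\<^bsub>B\<^esub> k \<otimes>\<^bsub>B\<^esub> (v \<otimes>\<^bsub>B\<^esub> x) = \<zero>\<^bsub>B\<^esub>"
         "\<exists>k::nat. a [^]\<^bsub>B\<^esub> k \<otimes>\<^bsub>B\<^esub> (w \<otimes>\<^bsub>B\<^esub> x) = \<zero>\<^bsub>B\<^esub>"
      then obtain k l where kl: "a [^]\<^bsub>B\<^esub> (k::nat) \<otimes>\<^bsub>B\<^esub> (v \<otimes>\<^bsub>B\<^esub> x) = \<zero>\<^bsub>B\<^esub>"
         "a [^]\<^bsub>B\<^esub> (l::nat) \<otimes>\<^bsub>B\<^esub> (w \<otimes>\<^bsub>B\<^esub> x) = \<zero>\<^bsub>B\<^esub>" by blast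
      have c: "v \<in> carrier B" "w \<in> carrier B" using B.gr_carrier[of 0] vw by simp_all
      have "a [^]\<^bsub>B\<^esub> (k + l) \<otimes>\<^bsub>B\<^esub> ((v \<oplus>\<^bsub>B\<^esub> w) \<otimes>\<^bsub>B\<^esub> x) =
         a [^]\<^bsub>B\<^esub> l \<otimes>\<^bsub>B\<^esub> (a [^]\<^bsub>B\<^esub> k \<otimes>\<^bsub>B\<^esub> (v \<otimes>\<^bsub>B\<^esub> x)) \<oplus>\<^bsub>B\<^esub> a [^]\<^bsub>B\<^esub> k \<otimes>\<^bsub>B\<^esub> (a [^]\<^bsub>B\<^esub> l \<otimes>\<^bsub>B\<^esub> (w \<otimes>\<^bsub>B\<^esub> x))"
        using c xB aB by (simp add: B.nat_pow_mult[symmetric] B.l_distr B.r_distr B.m_ac)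
      then show "\<exists>k::nat. a [^]\<^bsub>B\<^esub> k \<otimes>\<^bsub>B\<^esub> ((v \<oplus>\<^bsub>B\<^esub> w) \<otimes>\<^bsub>B\<^esub> x) = \<zero>\<^bsub>B\<^esub>" using kl aB by auto
    qed
    then show ?thesis using xB by simp
  qed
  show ?thesis
    unfolding localization_away_def
  proof (intro conjI ballI impI)
    show "h \<in> ring_hom B B'" by (rule h)
    show "h a \<in> Units B'"
      using loc B'.degree_zero_Units[OF ha] by (simp add: localization_away_def)
    fix s assume "s \<in> carrier B'"
    then show "\<exists>x\<in>carrier B. \<exists>k::nat. s \<otimes>\<^bsub>B'\<^esub> h a [^]\<^bsub>B'\<^esub> k = h x"
    proof (induct s rule: B'.homogeneous_induct)
      case zero
      then show ?case using aB by (intro bexI[of _ "\<zero>\<^bsub>B\<^esub>"] exI[of _ 0]) auto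
    qed (use homog add in blast)+
  next
    fix x assume x: "x \<in> carrier B" "h x = \<zero>\<^bsub>B'\<^esub>"
    let ?K = "{n \<in> Zr r. B.comp n x \<noteq> \<zero>\<^bsub>B\<^esub>}"
    have "\<exists>k::nat. a [^]\<^bsub>B\<^esub> k \<otimes>\<^bsub>B\<^esub> B.comp n x = \<zero>\<^bsub>B\<^esub>" if n: "n \<in> Zr r" for n
    proof (rule kerh[OF n B.comp_props(1)[OF x(1) n]])
      show "h (B.comp n x) = \<zero>\<^bsub>B'\<^esub>"
        using graded_hom_comp[OF torsorD[OF B] B' h x(1) n] x(2) B'.comp_zero[OF n] by simp
    qed
    then obtain k where k: "\<And>n. n \<in> Zr r \<Longrightarrow> a [^]\<^bsub>B\<^esub> (k n :: nat) \<otimes>\<^bsub>B\<^esub> B.comp n x = \<zero>\<^bsub>B\<^esub>" by metis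
    define l where "l = (\<Sum>n\<in>?K. k n)"
    have "a [^]\<^bsub>B\<^esub> l \<otimes>\<^bsub>B\<^esub> x = \<zero>\<^bsub>B\<^esub>"
    proof (rule B.comp_separates)
      fix n assume n: "n \<in> Zr r"
      have "a [^]\<^bsub>B\<^esub> l \<otimes>\<^bsub>B\<^esub> B.comp n x = \<zero>\<^bsub>B\<^esub>"
      proof (cases "B.comp n x = \<zero>\<^bsub>B\<^esub>")
        case False
        then have "k n \<le> l" unfolding l_def using n B.comp_props(2)[OF x(1)] by (intro member_le_sum) auto
        then have "a [^]\<^bsub>B\<^esub> l \<otimes>\<^bsub>B\<^esub> B.comp n x = a [^]\<^bsub>B\<^esub> (l - k n) \<otimes>\<^bsub>B\<^esub> (a [^]\<^bsub>B\<^esub> k n \<otimes>\<^bsub>B\<^esub> B.comp n x)"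
          using aB B.comp_carrier[OF x(1) n] by (simp add: B.m_assoc[symmetric] B.nat_pow_mult)
        then show ?thesis using k[OF n] aB by simp
      qed (use aB in simp)
      then show "B.comp n (a [^]\<^bsub>B\<^esub> l \<otimes>\<^bsub>B\<^esub> x) = \<zero>\<^bsub>B\<^esub>"
        using B.comp_mult_homogeneous[OF _ n B.gr_pow[OF a] x(1), of l] by simp
    qed (use aB x in simp)
    then show "\<exists>k::nat. a [^]\<^bsub>B\<^esub> k \<otimes>\<^bsub>B\<^esub> x = \<zero>\<^bsub>B\<^esub>" ..
  qed
qed

section \<open>Localizations with a prescribed carrier type\<close>

lemma inj_times_nat:
  assumes "infinite (UNIV :: 'b set)" obtains i :: "'b \<times> nat \<Rightarrow> 'b" where "inj i"
proof -
  have "|UNIV :: nat set| \<le>o |UNIV :: 'b set|" using assms by (simp add: infinite_iff_card_of_nat)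
  then have "|(UNIV :: 'b set) \<times> (UNIV :: nat set)| =o |UNIV :: 'b set|"
    using card_of_Times_infinite[OF assms] by blast
  then have "|(UNIV :: 'b set) \<times> (UNIV :: nat set)| \<le>o |UNIV :: 'b set|"
    by (rule ordIso_imp_ordLeq)
  then show ?thesis unfolding card_of_ordLeq[symmetric] using that by auto
qed

context
  fixes B :: "'b ring" (structure) and a :: 'b
  assumes B: "cring B" and a: "a \<in> carrier B" and inf: "infinite (UNIV :: 'b set)"
begin

interpretation cring B by (rule B)

definition fraction_equiv :: "'b \<times> nat \<Rightarrow> 'b \<times> nat \<Rightarrow> bool" where
  "fraction_equiv p q \<longleftrightarrow> (\<exists>j::nat. a [^] j \<otimes> (a [^] snd q \<otimes> fst p) = a [^] j \<otimes> (a [^] snd p \<otimes> fst q))"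

lemma pow_a_closed [simp]: "a [^] (k::nat) \<in> carrier B" using a by simp

lemma pow_a_add: "a [^] (k + l :: nat) = a [^] k \<otimes> a [^] l" using a by (simp add: nat_pow_mult)

lemma fraction_equiv_trans:
  assumes bc: "fraction_equiv (b, k) (c, l)" and cd: "fraction_equiv (c, l) (d, m)"
    and car: "b \<in> carrier B" "c \<in> carrier B" "d \<in> carrier B"
  shows "fraction_equiv (b, k) (d, m)"
proof -
  obtain i where i: "a [^] (i::nat) \<otimes> (a [^] l \<otimes> b) = a [^] i \<otimes> (a [^] k \<otimes> c)"
    using bc by (auto simp: fraction_equiv_def)
  obtain j where j: "a [^] (j::nat) \<otimes> (a [^] m \<otimes> c) = a [^] j \<otimes> (a [^] l \<otimes> d)"
    using cd by (auto simp: fraction_equiv_def)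
  have "a [^] (i + j + l) \<otimes> (a [^] m \<otimes> b) = (a [^] j \<otimes> a [^] m) \<otimes> (a [^] i \<otimes> (a [^] l \<otimes> b))"
    using car by (simp add: pow_a_add m_ac)
  also have "\<dots> = (a [^] i \<otimes> a [^] k) \<otimes> (a [^] j \<otimes> (a [^] m \<otimes> c))"
    unfolding i using car by (simp add: m_ac)
  also have "\<dots> = a [^] (i + j + l) \<otimes> (a [^] k \<otimes> d)"
    unfolding j using car by (simp add: pow_a_add m_ac)
  finally show ?thesis unfolding fraction_equiv_def by auto
qed

lemma fraction_equiv_sym: "fraction_equiv p q \<Longrightarrow> fraction_equiv q p"
  unfolding fraction_equiv_def by metis

text \<open>Equivalence classes of fractions are encoded by elements of \<open>'b\<close>: a representative of each class
  is chosen and mapped to \<open>'b\<close> by an injection of the set of pairs.\<close>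

lemma frac_function:
  obtains f :: "'b \<times> nat \<Rightarrow> 'b" where
    "\<And>b c k l. b \<in> carrier B \<Longrightarrow> c \<in> carrier B \<Longrightarrow> f (b, k) = f (c, l) \<longleftrightarrow> fraction_equiv (b, k) (c, l)"
proof -
  obtain i :: "'b \<times> nat \<Rightarrow> 'b" where i: "inj i" using inj_times_nat[OF inf] .
  define C where "C p = {q. fst q \<in> carrier B \<and> fraction_equiv p q}" for p
  have self: "p \<in> C p" if "fst p \<in> carrier B" for p using that by (auto simp: C_def fraction_equiv_def)
  have eq: "C (b, k) = C (c, l)" if "b \<in> carrier B" "c \<in> carrier B" "fraction_equiv (b, k) (c, l)" for b c k l
    using fraction_equiv_trans[OF that(3)] fraction_equiv_trans[OF fraction_equiv_sym[OF that(3)]] that(1,2)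
    unfolding C_def by auto
  show ?thesis
  proof (rule that[of "\<lambda>p. i (SOME q. q \<in> C p)"], rule iffI)
    fix b c k l assume bc: "b \<in> carrier B" "c \<in> carrier B"
    assume "i (SOME q. q \<in> C (b, k)) = i (SOME q. q \<in> C (c, l))"
    then have e: "(SOME q. q \<in> C (b, k)) = (SOME q. q \<in> C (c, l))" using i by (simp add: inj_eq)
    obtain d m where dm: "(SOME q. q \<in> C (b, k)) = (d, m)" by fastforce
    have "(d, m) \<in> C (b, k)" using someI[of "\<lambda>q. q \<in> C (b, k)", OF self] bc dm by simp
    moreover have "(d, m) \<in> C (c, l)" using someI[of "\<lambda>q. q \<in> C (c, l)", OF self] bc dm e by simp
    ultimately have *: "d \<in> carrier B" "fraction_equiv (b, k) (d, m)" "fraction_equiv (c, l) (d, m)" by (auto simp: C_def)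
    show "fraction_equiv (b, k) (c, l)" by (rule fraction_equiv_trans[OF *(2) fraction_equiv_sym[OF *(3)] bc(1) *(1) bc(2)])
  next
    fix b c k l assume "b \<in> carrier B" "c \<in> carrier B" "fraction_equiv (b, k) (c, l)"
    then show "i (SOME q. q \<in> C (b, k)) = i (SOME q. q \<in> C (c, l))" using eq by simp
  qed
qed

lemma localization_exists: "\<exists>(S :: 'b ring) h. cring S \<and> localization_away B a S h"
proof -
  obtain f :: "'b \<times> nat \<Rightarrow> 'b" where
    f: "\<And>b c k l. b \<in> carrier B \<Longrightarrow> c \<in> carrier B \<Longrightarrow> f (b, k) = f (c, l) \<longleftrightarrow> fraction_equiv (b, k) (c, l)"
    using frac_function by blast
  define rp where "rp u = (SOME p. fst p \<in> carrier B \<and> f p = u)" for u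
  define S where "S = \<lparr>carrier = f ` (carrier B \<times> UNIV),
     monoid.mult = (\<lambda>u v. f (fst (rp u) \<otimes> fst (rp v), snd (rp u) + snd (rp v))), one = f (\<one>, 0),
     ring.zero = f (\<zero>, 0),
     add = (\<lambda>u v. f (a [^] snd (rp v) \<otimes> fst (rp u) \<oplus> a [^] snd (rp u) \<otimes> fst (rp v), snd (rp u) + snd (rp v)))\<rparr>"
  have rp: "\<exists>c l j. rp (f (b, k)) = (c, l) \<and> c \<in> carrier B \<and>
      a [^] (j::nat) \<otimes> (a [^] k \<otimes> c) = a [^] j \<otimes> (a [^] l \<otimes> b)" if b: "b \<in> carrier B" for b k
  proof -
    obtain c l where cl: "rp (f (b, k)) = (c, l)" by fastforce
    have "fst (rp (f (b, k))) \<in> carrier B \<and> f (rp (f (b, k))) = f (b, k)"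
      unfolding rp_def by (rule someI[of _ "(b, k)"]) (use b in simp)
    then have "c \<in> carrier B" "fraction_equiv (c, l) (b, k)" using cl f b by auto
    then show ?thesis using cl by (auto simp: fraction_equiv_def)
  qed
  have feqI: "f (b, k) = f (c, l)"
    if "b \<in> carrier B" "c \<in> carrier B" "a [^] (j::nat) \<otimes> (a [^] l \<otimes> b) = a [^] j \<otimes> (a [^] k \<otimes> c)" for b c k l j
    using f[OF that(1,2)] that(3) by (auto simp: fraction_equiv_def)
  have mult: "f (b, k) \<otimes>\<^bsub>S\<^esub> f (c, l) = f (b \<otimes> c, k + l)" if b: "b \<in> carrier B" and c: "c \<in> carrier B" for b c k l
  proof -
    obtain b' k' i where 1: "rp (f (b, k)) = (b', k')" "b' \<in> carrier B"
      "a [^] (i::nat) \<otimes> (a [^] k \<otimes> b') = a [^] i \<otimes> (a [^] k' \<otimes> b)" using rp[OF b] by blast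
    obtain c' l' j where 2: "rp (f (c, l)) = (c', l')" "c' \<in> carrier B"
      "a [^] (j::nat) \<otimes> (a [^] l \<otimes> c') = a [^] j \<otimes> (a [^] l' \<otimes> c)" using rp[OF c] by blast
    have "f (b' \<otimes> c', k' + l') = f (b \<otimes> c, k + l)"
    proof (rule feqI)
      have "a [^] (i + j) \<otimes> (a [^] (k + l) \<otimes> (b' \<otimes> c')) =
          (a [^] i \<otimes> (a [^] k \<otimes> b')) \<otimes> (a [^] j \<otimes> (a [^] l \<otimes> c'))"
        using 1(2) 2(2) by (simp add: pow_a_add m_ac)
      also have "\<dots> = a [^] (i + j) \<otimes> (a [^] (k' + l') \<otimes> (b \<otimes> c))"
        unfolding 1(3) 2(3) using b c by (simp add: pow_a_add m_ac)
      finally show "a [^] (i + j) \<otimes> (a [^] (k + l) \<otimes> (b' \<otimes> c')) =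
          a [^] (i + j) \<otimes> (a [^] (k' + l') \<otimes> (b \<otimes> c))" .
    qed (use 1 2 b c in auto)
    then show ?thesis by (simp add: S_def 1 2)
  qed
  have add: "f (b, k) \<oplus>\<^bsub>S\<^esub> f (c, l) = f (a [^] l \<otimes> b \<oplus> a [^] k \<otimes> c, k + l)"
    if b: "b \<in> carrier B" and c: "c \<in> carrier B" for b c k l
  proof -
    obtain b' k' i where 1: "rp (f (b, k)) = (b', k')" "b' \<in> carrier B"
      "a [^] (i::nat) \<otimes> (a [^] k \<otimes> b') = a [^] i \<otimes> (a [^] k' \<otimes> b)" using rp[OF b] by blast
    obtain c' l' j where 2: "rp (f (c, l)) = (c', l')" "c' \<in> carrier B"
      "a [^] (j::nat) \<otimes> (a [^] l \<otimes> c') = a [^] j \<otimes> (a [^] l' \<otimes> c)" using rp[OF c] by blast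
    have "f (a [^] l' \<otimes> b' \<oplus> a [^] k' \<otimes> c', k' + l') = f (a [^] l \<otimes> b \<oplus> a [^] k \<otimes> c, k + l)"
    proof (rule feqI)
      have "a [^] (i + j) \<otimes> (a [^] (k + l) \<otimes> (a [^] l' \<otimes> b' \<oplus> a [^] k' \<otimes> c')) =
          (a [^] j \<otimes> a [^] l \<otimes> a [^] l') \<otimes> (a [^] i \<otimes> (a [^] k \<otimes> b')) \<oplus>
          (a [^] i \<otimes> a [^] k \<otimes> a [^] k') \<otimes> (a [^] j \<otimes> (a [^] l \<otimes> c'))"
        using 1(2) 2(2) by (simp add: pow_a_add m_ac r_distr)
      also have "\<dots> = a [^] (i + j) \<otimes> (a [^] (k' + l') \<otimes> (a [^] l \<otimes> b \<oplus> a [^] k \<otimes> c))"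
        unfolding 1(3) 2(3) using b c by (simp add: pow_a_add m_ac r_distr)
      finally show "a [^] (i + j) \<otimes> (a [^] (k + l) \<otimes> (a [^] l' \<otimes> b' \<oplus> a [^] k' \<otimes> c')) =
          a [^] (i + j) \<otimes> (a [^] (k' + l') \<otimes> (a [^] l \<otimes> b \<oplus> a [^] k \<otimes> c))" .
    qed (use 1 2 b c in auto)
    then show ?thesis by (simp add: S_def 1 2)
  qed
  have carr: "carrier S = f ` (carrier B \<times> UNIV)" and one: "\<one>\<^bsub>S\<^esub> = f (\<one>, 0)" and zero: "\<zero>\<^bsub>S\<^esub> = f (\<zero>, 0)"
    by (simp_all add: S_def)
  have S: "cring S"
  proof (rule cringI)
    show "abelian_group S"
    proof (rule abelian_groupI)
      fix u v w assume u: "u \<in> carrier S" and v: "v \<in> carrier S" and w: "w \<in> carrier S"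
      obtain b k where b: "u = f (b, k)" "b \<in> carrier B" using u carr by auto
      obtain c l where c: "v = f (c, l)" "c \<in> carrier B" using v carr by auto
      obtain d m where d: "w = f (d, m)" "d \<in> carrier B" using w carr by auto
      show "u \<oplus>\<^bsub>S\<^esub> v \<in> carrier S" using b c by (simp add: add carr)
      show "(u \<oplus>\<^bsub>S\<^esub> v) \<oplus>\<^bsub>S\<^esub> w = u \<oplus>\<^bsub>S\<^esub> (v \<oplus>\<^bsub>S\<^esub> w)"
        using b c d by (simp add: add pow_a_add r_distr m_ac a_ac add.assoc)
      show "u \<oplus>\<^bsub>S\<^esub> v = v \<oplus>\<^bsub>S\<^esub> u" using b c by (simp add: add a_comm Groups.add.commute)
      show "\<zero>\<^bsub>S\<^esub> \<oplus>\<^bsub>S\<^esub> u = u" using b by (simp add: add zero)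
      have "f (\<ominus> b, k) \<oplus>\<^bsub>S\<^esub> u = f (a [^] k \<otimes> (\<ominus> b \<oplus> b), k + k)" using b by (simp add: add r_distr)
      also have "\<dots> = f (\<zero>, 0)" by (rule feqI[of _ _ 0]) (use b in \<open>simp_all add: l_neg\<close>)
      finally show "\<exists>y\<in>carrier S. y \<oplus>\<^bsub>S\<^esub> u = \<zero>\<^bsub>S\<^esub>"
        using b by (intro bexI[of _ "f (\<ominus> b, k)"]) (auto simp: zero carr)
    qed (auto simp: carr zero)
    show "Group.comm_monoid S"
    proof (rule comm_monoidI)
      fix u v w assume u: "u \<in> carrier S" and v: "v \<in> carrier S" and w: "w \<in> carrier S"
      obtain b k where b: "u = f (b, k)" "b \<in> carrier B" using u carr by auto
      obtain c l where c: "v = f (c, l)" "c \<in> carrier B" using v carr by auto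
      obtain d m where d: "w = f (d, m)" "d \<in> carrier B" using w carr by auto
      show "u \<otimes>\<^bsub>S\<^esub> v \<in> carrier S" using b c by (simp add: mult carr)
      show "(u \<otimes>\<^bsub>S\<^esub> v) \<otimes>\<^bsub>S\<^esub> w = u \<otimes>\<^bsub>S\<^esub> (v \<otimes>\<^bsub>S\<^esub> w)"
        using b c d by (simp add: mult m_assoc Groups.add.assoc)
      show "u \<otimes>\<^bsub>S\<^esub> v = v \<otimes>\<^bsub>S\<^esub> u" using b c by (simp add: mult m_comm Groups.add.commute)
      show "\<one>\<^bsub>S\<^esub> \<otimes>\<^bsub>S\<^esub> u = u" using b by (simp add: mult one)
    qed (auto simp: carr one)
    fix u v w assume u: "u \<in> carrier S" and v: "v \<in> carrier S" and w: "w \<in> carrier S"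
    obtain b k where b: "u = f (b, k)" "b \<in> carrier B" using u carr by auto
    obtain c l where c: "v = f (c, l)" "c \<in> carrier B" using v carr by auto
    obtain d m where d: "w = f (d, m)" "d \<in> carrier B" using w carr by auto
    have "f ((a [^] l \<otimes> b \<oplus> a [^] k \<otimes> c) \<otimes> d, k + l + m) =
        f (a [^] (l + m) \<otimes> (b \<otimes> d) \<oplus> a [^] (k + m) \<otimes> (c \<otimes> d), k + m + (l + m))"
      by (rule feqI[of _ _ 0]) (use b c d in \<open>simp_all add: pow_a_add r_distr l_distr m_ac\<close>)
    then show "(u \<oplus>\<^bsub>S\<^esub> v) \<otimes>\<^bsub>S\<^esub> w = u \<otimes>\<^bsub>S\<^esub> w \<oplus>\<^bsub>S\<^esub> v \<otimes>\<^bsub>S\<^esub> w"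
      using b c d by (simp add: add mult)
  qed
  interpret S: cring S by (rule S)
  have apow: "f (a, 0) [^]\<^bsub>S\<^esub> (n::nat) = f (a [^] n, 0)" for n
    by (induct n) (use a in \<open>simp_all add: one mult\<close>)
  have "localization_away B a S (\<lambda>b. f (b, 0))"
    unfolding localization_away_def
  proof (intro conjI ballI impI)
    show "(\<lambda>b. f (b, 0)) \<in> ring_hom B S"
      by (rule ring_hom_memI) (auto simp: carr mult add one)
    have u: "f (a, 0) \<otimes>\<^bsub>S\<^esub> f (\<one>, 1) = \<one>\<^bsub>S\<^esub>"
      unfolding one mult[OF a one_closed] by (rule feqI[of _ _ 0]) (use a in auto)
    moreover have "f (a, 0) \<in> carrier S" "f (\<one>, 1) \<in> carrier S" using a by (auto simp: carr)
    moreover have "f (\<one>, 1) \<otimes>\<^bsub>S\<^esub> f (a, 0) = \<one>\<^bsub>S\<^esub>" using u calculation S.m_comm by metis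
    ultimately show "f (a, 0) \<in> Units S" unfolding Units_def by blast
    fix s assume "s \<in> carrier S"
    then obtain b k where b: "s = f (b, k)" "b \<in> carrier B" using carr by auto
    have "s \<otimes>\<^bsub>S\<^esub> f (a, 0) [^]\<^bsub>S\<^esub> k = f (b \<otimes> a [^] k, k)" using b by (simp add: apow mult)
    also have "\<dots> = f (b, 0)" by (rule feqI[of _ _ 0]) (use b in \<open>simp_all add: m_comm\<close>)
    finally show "\<exists>x\<in>carrier B. \<exists>n::nat. s \<otimes>\<^bsub>S\<^esub> f (a, 0) [^]\<^bsub>S\<^esub> n = f (x, 0)" using b by blast
  next
    fix x assume x: "x \<in> carrier B" "f (x, 0) = \<zero>\<^bsub>S\<^esub>"
    then have "fraction_equiv (x, 0) (\<zero>, 0)" using f[of x \<zero> 0 0] by (simp add: zero)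
    then show "\<exists>n::nat. a [^] n \<otimes> x = \<zero>" using x by (auto simp: fraction_equiv_def)
  qed
  then show ?thesis using S by blast
qed

end

text \<open>The degree of \<open>b / a\<^sup>k\<close> is the degree of \<open>b\<close>, as \<open>a\<close> has degree \<open>0\<close>; it is independent of the
  representation since components commute with multiplication by \<open>a\<close>.\<close>

lemma localized_torsor:
  fixes B :: "'b ring"
  assumes T: "torsor r B gr" and a: "a \<in> gr 0" and inf: "infinite (UNIV :: 'b set)"
  shows "\<exists>(B' :: 'b ring) gr' h. torsor r B' gr' \<and> h \<in> ring_hom B B' \<and> (\<forall>n\<in>Zr r. h ` gr n \<subseteq> gr' n) \<and>
    localization_away B a B' h \<and> localization_away (degree_zero B gr) a (degree_zero B' gr') h"
proof -
  interpret T: torsor_ring r B gr using T by (rule torsor_ringI)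
  have aB: "a \<in> carrier B" using T.gr_carrier[of 0] a by simp
  obtain S :: "'b ring" and h where S: "cring S" and loc: "localization_away B a S h"
    using localization_exists[OF T.is_cring aB inf] by blast
  interpret L: localization B S h a by (rule localizationI[OF T.is_cring S aB loc])
  let ?A = "\<lambda>k::nat. h a [^]\<^bsub>S\<^esub> k"
  have cancel: "s = t" if "s \<otimes>\<^bsub>S\<^esub> ?A k = t \<otimes>\<^bsub>S\<^esub> ?A k" "s \<in> carrier S" "t \<in> carrier S" for s t k
    using that L.hgn_unit[of k] L.S.m_comm[of _ "?A k"] L.S.Units_closed[OF L.hgn_unit[of k]]
      L.S.Units_l_cancel[OF L.hgn_unit[of k] that(2,3)] by simp
  define gr' where "gr' n = {s \<in> carrier S. \<exists>b\<in>gr n. \<exists>k. s \<otimes>\<^bsub>S\<^esub> ?A k = h b}" for n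
  define P where "P n s s' \<longleftrightarrow> s' \<in> carrier S \<and> (\<exists>b\<in>carrier B. \<exists>k. s \<otimes>\<^bsub>S\<^esub> ?A k = h b \<and> s' \<otimes>\<^bsub>S\<^esub> ?A k = h (T.comp n b))" for n s s'
  define \<pi> where "\<pi> n s = (SOME s'. P n s s')" for n s
  have apow: "a [^]\<^bsub>B\<^esub> (k::nat) \<in> gr 0" for k using a by (rule T.gr_pow)
  have comp_apow: "T.comp n (a [^]\<^bsub>B\<^esub> (k::nat) \<otimes>\<^bsub>B\<^esub> b) = a [^]\<^bsub>B\<^esub> k \<otimes>\<^bsub>B\<^esub> T.comp n b"
    if "n \<in> Zr r" "b \<in> carrier B" for n k b
    using T.comp_mult_homogeneous[OF _ that(1) apow that(2), of k] by simp
  have Puniq: "s1 = s2" if n: "n \<in> Zr r" and s: "s \<in> carrier S" and P1: "P n s s1" and P2: "P n s s2" for n s s1 s2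
  proof -
    obtain b k where b: "b \<in> carrier B" "s \<otimes>\<^bsub>S\<^esub> ?A k = h b" "s1 \<otimes>\<^bsub>S\<^esub> ?A k = h (T.comp n b)" "s1 \<in> carrier S"
      using P1 by (auto simp: P_def)
    obtain c l where c: "c \<in> carrier B" "s \<otimes>\<^bsub>S\<^esub> ?A l = h c" "s2 \<otimes>\<^bsub>S\<^esub> ?A l = h (T.comp n c)" "s2 \<in> carrier S"
      using P2 by (auto simp: P_def)
    have "h (a [^]\<^bsub>B\<^esub> l \<otimes>\<^bsub>B\<^esub> b) = ?A l \<otimes>\<^bsub>S\<^esub> (s \<otimes>\<^bsub>S\<^esub> ?A k)" unfolding b(2) using b(1) by (simp add: L.hom_nat_pow)
    also have "\<dots> = ?A k \<otimes>\<^bsub>S\<^esub> (s \<otimes>\<^bsub>S\<^esub> ?A l)" using s by (simp add: L.S.m_ac)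
    also have "\<dots> = h (a [^]\<^bsub>B\<^esub> k \<otimes>\<^bsub>B\<^esub> c)" unfolding c(2) using c(1) by (simp add: L.hom_nat_pow)
    finally obtain j where "a [^]\<^bsub>B\<^esub> (j::nat) \<otimes>\<^bsub>B\<^esub> (a [^]\<^bsub>B\<^esub> l \<otimes>\<^bsub>B\<^esub> b) = a [^]\<^bsub>B\<^esub> j \<otimes>\<^bsub>B\<^esub> (a [^]\<^bsub>B\<^esub> k \<otimes>\<^bsub>B\<^esub> c)"
      using L.hom_eqD b(1) c(1) aB by (metis T.m_closed T.nat_pow_closed)
    then have "T.comp n (a [^]\<^bsub>B\<^esub> j \<otimes>\<^bsub>B\<^esub> (a [^]\<^bsub>B\<^esub> l \<otimes>\<^bsub>B\<^esub> b)) = T.comp n (a [^]\<^bsub>B\<^esub> j \<otimes>\<^bsub>B\<^esub> (a [^]\<^bsub>B\<^esub> k \<otimes>\<^bsub>B\<^esub> c))" by simp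
    then have "a [^]\<^bsub>B\<^esub> j \<otimes>\<^bsub>B\<^esub> (a [^]\<^bsub>B\<^esub> l \<otimes>\<^bsub>B\<^esub> T.comp n b) = a [^]\<^bsub>B\<^esub> j \<otimes>\<^bsub>B\<^esub> (a [^]\<^bsub>B\<^esub> k \<otimes>\<^bsub>B\<^esub> T.comp n c)"
      using b(1) c(1) aB n by (simp add: comp_apow)
    then have "h (a [^]\<^bsub>B\<^esub> j \<otimes>\<^bsub>B\<^esub> (a [^]\<^bsub>B\<^esub> l \<otimes>\<^bsub>B\<^esub> T.comp n b)) = h (a [^]\<^bsub>B\<^esub> j \<otimes>\<^bsub>B\<^esub> (a [^]\<^bsub>B\<^esub> k \<otimes>\<^bsub>B\<^esub> T.comp n c))" by simp
    then have "?A j \<otimes>\<^bsub>S\<^esub> (?A l \<otimes>\<^bsub>S\<^esub> (s1 \<otimes>\<^bsub>S\<^esub> ?A k)) = ?A j \<otimes>\<^bsub>S\<^esub> (?A k \<otimes>\<^bsub>S\<^esub> (s2 \<otimes>\<^bsub>S\<^esub> ?A l))"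
      unfolding b(3) c(3) using T.comp_carrier[OF b(1) n] T.comp_carrier[OF c(1) n] aB by (simp add: L.hom_nat_pow)
    then have "s1 \<otimes>\<^bsub>S\<^esub> ?A (j + k + l) = s2 \<otimes>\<^bsub>S\<^esub> ?A (j + k + l)"
      using b(4) c(4) by (simp add: L.S.nat_pow_mult[symmetric] L.S.m_ac)
    then show ?thesis using b(4) c(4) by (rule cancel)
  qed
  have Pex: "P n s (h (T.comp n b) \<otimes>\<^bsub>S\<^esub> inv\<^bsub>S\<^esub> ?A k)"
    if "n \<in> Zr r" "b \<in> carrier B" "s \<otimes>\<^bsub>S\<^esub> ?A k = h b" for n s b k
    unfolding P_def using that T.comp_carrier[OF that(2,1)] L.hgn_unit[of k]
    by (auto simp: L.S.m_assoc intro!: bexI[of _ b] exI[of _ k])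
  have piP: "P n s (\<pi> n s)" if "n \<in> Zr r" "s \<in> carrier S" for n s
    unfolding \<pi>_def by (rule L.fraction[OF that(2)]) (use Pex that(1) in \<open>blast intro: someI\<close>)
  have pi: "\<pi> n s \<otimes>\<^bsub>S\<^esub> ?A k = h (T.comp n b)" and pic: "\<pi> n s \<in> carrier S"
    if n: "n \<in> Zr r" and s: "s \<in> carrier S" and b: "b \<in> carrier B" "s \<otimes>\<^bsub>S\<^esub> ?A k = h b" for n s b k
  proof -
    have "\<pi> n s = h (T.comp n b) \<otimes>\<^bsub>S\<^esub> inv\<^bsub>S\<^esub> ?A k"
      by (rule Puniq[OF n s piP[OF n s] Pex[OF n b]])
    then show "\<pi> n s \<otimes>\<^bsub>S\<^esub> ?A k = h (T.comp n b)" "\<pi> n s \<in> carrier S"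
      using T.comp_carrier[OF b(1) n] L.hgn_unit[of k] by (simp_all add: L.S.m_assoc)
  qed
  have gr'car: "s \<in> carrier S" if "s \<in> gr' n" for s n using that by (simp add: gr'_def)
  have gr'I: "s \<in> gr' n" if "s \<in> carrier S" "b \<in> gr n" "s \<otimes>\<^bsub>S\<^esub> ?A k = h b" for s n b k
    using that by (auto simp: gr'_def)
  have gr'E: "\<exists>b k. b \<in> gr n \<and> s \<otimes>\<^bsub>S\<^esub> ?A k = h b" if "s \<in> gr' n" for s n
    using that by (auto simp: gr'_def)
  have graded: "graded_cring r S gr'"
  proof (rule graded_cringI[where \<pi> = \<pi>, OF S])
    fix n assume n: "n \<in> Zr r"
    show "subgroup (gr' n) (add_monoid S)"
    proof (rule subgroup.intro)
      show "gr' n \<subseteq> carrier (add_monoid S)" by (auto simp: gr'_def)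
      show "\<one>\<^bsub>add_monoid S\<^esub> \<in> gr' n" using T.gr_zero[OF n] by (auto intro: gr'I[of _ "\<zero>\<^bsub>B\<^esub>" _ 0])
      fix s assume s: "s \<in> gr' n"
      obtain b k where b: "b \<in> gr n" "s \<otimes>\<^bsub>S\<^esub> ?A k = h b" using gr'E[OF s] by blast
      have bB: "b \<in> carrier B" by (rule T.gr_carrier[OF n b(1)])
      show "inv\<^bsub>add_monoid S\<^esub> s \<in> gr' n"
        unfolding a_inv_def[symmetric]
        by (rule gr'I[of _ "\<ominus>\<^bsub>B\<^esub> b" _ k]) (use b bB gr'car[OF s] T.gr_uminus[OF n] in \<open>auto simp: L.S.l_minus\<close>)
      fix t assume t: "t \<in> gr' n"
      obtain c l where c: "c \<in> gr n" "t \<otimes>\<^bsub>S\<^esub> ?A l = h c" using gr'E[OF t] by blast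
      have cB: "c \<in> carrier B" by (rule T.gr_carrier[OF n c(1)])
      have "b \<otimes>\<^bsub>B\<^esub> a [^]\<^bsub>B\<^esub> l \<oplus>\<^bsub>B\<^esub> c \<otimes>\<^bsub>B\<^esub> a [^]\<^bsub>B\<^esub> k \<in> gr n"
        using T.gr_mult[OF n _ b(1) apow] T.gr_mult[OF n _ c(1) apow] by (intro T.gr_add[OF n]) simp_all
      then show "s \<otimes>\<^bsub>add_monoid S\<^esub> t \<in> gr' n"
        using gr'I[OF _ _ L.fraction_add[OF gr'car[OF s] gr'car[OF t] bB cB b(2) c(2)]] gr'car[OF s] gr'car[OF t] by simp
    qed
    fix s assume s: "s \<in> carrier S"
    obtain b k where b: "b \<in> carrier B" "s \<otimes>\<^bsub>S\<^esub> ?A k = h b" using s by (rule L.fraction)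
    show "\<pi> n s \<in> gr' n"
      by (rule gr'I[OF pic[OF n s b] T.comp_props(1)[OF b(1) n] pi[OF n s b]])
    fix t assume t: "t \<in> carrier S"
    obtain c l where c: "c \<in> carrier B" "t \<otimes>\<^bsub>S\<^esub> ?A l = h c" using t by (rule L.fraction)
    have 1: "(s \<oplus>\<^bsub>S\<^esub> t) \<otimes>\<^bsub>S\<^esub> ?A (k + l) = h (b \<otimes>\<^bsub>B\<^esub> a [^]\<^bsub>B\<^esub> l \<oplus>\<^bsub>B\<^esub> c \<otimes>\<^bsub>B\<^esub> a [^]\<^bsub>B\<^esub> k)"
      by (rule L.fraction_add[OF s t b(1) c(1) b(2) c(2)])
    have 2: "(\<pi> n s \<oplus>\<^bsub>S\<^esub> \<pi> n t) \<otimes>\<^bsub>S\<^esub> ?A (k + l) = h (T.comp n b \<otimes>\<^bsub>B\<^esub> a [^]\<^bsub>B\<^esub> l \<oplus>\<^bsub>B\<^esub> T.comp n c \<otimes>\<^bsub>B\<^esub> a [^]\<^bsub>B\<^esub> k)"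
      by (rule L.fraction_add[OF pic[OF n s b] pic[OF n t c] _ _ pi[OF n s b] pi[OF n t c]])
        (use T.comp_carrier b(1) c(1) n in auto)
    have "T.comp n (b \<otimes>\<^bsub>B\<^esub> a [^]\<^bsub>B\<^esub> l \<oplus>\<^bsub>B\<^esub> c \<otimes>\<^bsub>B\<^esub> a [^]\<^bsub>B\<^esub> k) = T.comp n b \<otimes>\<^bsub>B\<^esub> a [^]\<^bsub>B\<^esub> l \<oplus>\<^bsub>B\<^esub> T.comp n c \<otimes>\<^bsub>B\<^esub> a [^]\<^bsub>B\<^esub> k"
      using b(1) c(1) n aB T.comp_carrier by (simp add: T.comp_add T.m_comm[of _ "a [^]\<^bsub>B\<^esub> _"] comp_apow)
    then have "\<pi> n (s \<oplus>\<^bsub>S\<^esub> t) \<otimes>\<^bsub>S\<^esub> ?A (k + l) = (\<pi> n s \<oplus>\<^bsub>S\<^esub> \<pi> n t) \<otimes>\<^bsub>S\<^esub> ?A (k + l)"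
      using pi[OF n _ _ 1] 2 s t b(1) c(1) aB by simp
    then show "\<pi> n (s \<oplus>\<^bsub>S\<^esub> t) = \<pi> n s \<oplus>\<^bsub>S\<^esub> \<pi> n t"
      by (rule cancel) (use pic[OF n _ _ 1] pic[OF n s b] pic[OF n t c] s t b(1) c(1) aB in auto)
  next
    fix m n s assume m: "m \<in> Zr r" and n: "n \<in> Zr r" and s: "s \<in> gr' m"
    obtain b k where b: "b \<in> gr m" "s \<otimes>\<^bsub>S\<^esub> ?A k = h b" using gr'E[OF s] by blast
    have bB: "b \<in> carrier B" by (rule T.gr_carrier[OF m b(1)])
    show "\<pi> n s = (if n = m then s else \<zero>\<^bsub>S\<^esub>)"
      by (rule cancel[of _ k])
        (use pi[OF n gr'car[OF s] bB b(2)] pic[OF n gr'car[OF s] bB b(2)] gr'car[OF s] b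
          T.comp_homogeneous[OF m n b(1)] in auto)
  next
    fix s assume s: "s \<in> carrier S"
    obtain b k where b: "b \<in> carrier B" "s \<otimes>\<^bsub>S\<^esub> ?A k = h b" using s by (rule L.fraction)
    have z: "\<pi> n s = \<zero>\<^bsub>S\<^esub>" if "n \<in> Zr r" "T.comp n b = \<zero>\<^bsub>B\<^esub>" for n
      by (rule cancel[of _ k]) (use pi[OF that(1) s b] pic[OF that(1) s b] that(2) in auto)
    then have "{n \<in> Zr r. \<pi> n s \<noteq> \<zero>\<^bsub>S\<^esub>} \<subseteq> {n \<in> Zr r. T.comp n b \<noteq> \<zero>\<^bsub>B\<^esub>}" by auto
    then show "finite {n \<in> Zr r. \<pi> n s \<noteq> \<zero>\<^bsub>S\<^esub>}" using T.comp_props(2)[OF b(1)] by (rule finite_subset)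
    assume all: "\<And>n. n \<in> Zr r \<Longrightarrow> \<pi> n s = \<zero>\<^bsub>S\<^esub>"
    have hc: "h (T.comp n b) = \<zero>\<^bsub>S\<^esub>" if "n \<in> Zr r" for n
      using pi[OF that s b] all[OF that] by simp
    have hz: "h (finsum B (\<lambda>n. T.comp n b) K) = \<zero>\<^bsub>S\<^esub>" if "finite K" "K \<subseteq> Zr r" for K
      using that
    proof (induct K)
      case (insert x K)
      have c: "(\<lambda>n. T.comp n b) \<in> K \<rightarrow> carrier B" "T.comp x b \<in> carrier B"
        using insert T.comp_carrier[OF b(1)] by auto
      then have "h (finsum B (\<lambda>n. T.comp n b) (insert x K)) = h (T.comp x b) \<oplus>\<^bsub>S\<^esub> h (finsum B (\<lambda>n. T.comp n b) K)"
        using insert by simp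
      then show ?case using insert hc by simp
    qed simp
    have "h b = \<zero>\<^bsub>S\<^esub>" using hz[OF T.comp_props(2)[OF b(1)]] T.comp_props(3)[OF b(1)] by auto
    then have "s \<otimes>\<^bsub>S\<^esub> ?A k = \<zero>\<^bsub>S\<^esub> \<otimes>\<^bsub>S\<^esub> ?A k" using b by simp
    then show "s = \<zero>\<^bsub>S\<^esub>" by (rule cancel) (use s in auto)
  next
    show "\<one>\<^bsub>S\<^esub> \<in> gr' 0" using T.gr_one by (auto intro: gr'I[of _ "\<one>\<^bsub>B\<^esub>" _ 0])
  next
    fix m n s t assume m: "m \<in> Zr r" and n: "n \<in> Zr r" and s: "s \<in> gr' m" and t: "t \<in> gr' n"
    obtain b k where b: "b \<in> gr m" "s \<otimes>\<^bsub>S\<^esub> ?A k = h b" using gr'E[OF s] by blast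
    obtain c l where c: "c \<in> gr n" "t \<otimes>\<^bsub>S\<^esub> ?A l = h c" using gr'E[OF t] by blast
    show "s \<otimes>\<^bsub>S\<^esub> t \<in> gr' (m + n)"
      by (rule gr'I[OF _ T.gr_mult[OF m n b(1) c(1)]
          L.fraction_mult[OF gr'car[OF s] gr'car[OF t] T.gr_carrier[OF m b(1)] T.gr_carrier[OF n c(1)] b(2) c(2)]])
        (use gr'car[OF s] gr'car[OF t] in simp)
  qed
  have hgr: "h ` gr n \<subseteq> gr' n" if n: "n \<in> Zr r" for n
  proof
    fix s assume "s \<in> h ` gr n"
    then obtain b where b: "b \<in> gr n" "s = h b" by blast
    then show "s \<in> gr' n" using T.gr_carrier[OF n b(1)] by (intro gr'I[of _ b _ 0]) auto
  qed
  have tors: "torsor r S gr'"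
    by (rule torsor_hom_image[OF T graded L.homh hgr])
  interpret T': graded r S gr' by unfold_locales (rule graded)
  have "localization_away (degree_zero B gr) a (degree_zero S gr') h"
    unfolding localization_away_def degree_zero_pow
  proof (intro conjI ballI impI)
    show "h \<in> ring_hom (degree_zero B gr) (degree_zero S gr')"
      by (rule degree_zero_hom[OF L.homh hgr]) (use T.gr_carrier[of 0] in auto)
    show "h a \<in> Units (degree_zero S gr')"
      using T'.degree_zero_Units[of "h a"] hgr[of 0] a L.hg_unit by auto
    fix s assume "s \<in> carrier (degree_zero S gr')"
    then show "\<exists>x\<in>carrier (degree_zero B gr). \<exists>n::nat. s \<otimes>\<^bsub>degree_zero S gr'\<^esub> ?A n = h x"
      using gr'E[of s 0] by auto
  next
    fix x assume "x \<in> carrier (degree_zero B gr)" "h x = \<zero>\<^bsub>degree_zero S gr'\<^esub>"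
    then show "\<exists>n::nat. a [^]\<^bsub>B\<^esub> n \<otimes>\<^bsub>degree_zero B gr\<^esub> x = \<zero>\<^bsub>degree_zero B gr\<^esub>"
      using loc T.gr_carrier[of 0 x] by (auto simp: localization_away_def)
  qed
  then show ?thesis using tors L.homh hgr loc by blast
qed

section \<open>Trivial torsors\<close>

subsection \<open>Transport of gradings\<close>

lemma cring_image_ring:
  assumes "cring B" "inj_on i (carrier B)" shows "cring (image_ring i B)"
proof -
  interpret cring B by fact
  have "cring (image_ring i B \<lparr>zero := i \<zero>\<^bsub>B\<^esub>\<rparr>)"
    by (rule ring_iso_imp_img_cring[OF inj_imp_image_ring_iso[OF assms(2)]])
  then show ?thesis by (simp add: image_ring_def image_group_def monoid.defs)
qed

lemma graded_cring_image:
  fixes B :: "'a ring" and i :: "'a \<Rightarrow> 'b"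
  assumes gr: "graded_cring r B gr" and inj: "inj_on i (carrier B)"
  shows "graded_cring r (image_ring i B) (\<lambda>n. i ` gr n)"
proof -
  interpret G: graded r B gr by unfold_locales (rule gr)
  let ?B = "image_ring i B"
  have B': "cring ?B" by (rule cring_image_ring[OF G.is_cring inj])
  interpret B': cring ?B by (rule B')
  have iso: "i \<in> ring_iso B ?B" by (rule inj_imp_image_ring_iso[OF inj])
  interpret i: ring_hom_cring B ?B i by unfold_locales (use iso in \<open>auto simp: ring_iso_def\<close>)
  have carr: "carrier ?B = i ` carrier B" by (rule image_ring_carrier)
  let ?j = "inv_into (carrier B) i"
  have j: "?j (i b) = b" if "b \<in> carrier B" for b using that inj by simp
  have iz: "i b = \<zero>\<^bsub>?B\<^esub> \<longleftrightarrow> b = \<zero>\<^bsub>B\<^esub>" if "b \<in> carrier B" for b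
    using inj_onD[OF inj, of b "\<zero>\<^bsub>B\<^esub>"] that i.hom_zero by auto
  show ?thesis
  proof (rule graded_cringI[where \<pi> = "\<lambda>n u. i (G.comp n (?j u))", OF B'])
    fix n assume n: "n \<in> Zr r"
    show "subgroup (i ` gr n) (add_monoid ?B)"
    proof (rule subgroup.intro)
      show "i ` gr n \<subseteq> carrier (add_monoid ?B)" using G.gr_carrier[OF n] by (auto simp: carr)
      show "\<one>\<^bsub>add_monoid ?B\<^esub> \<in> i ` gr n" using G.gr_zero[OF n] i.hom_zero by (metis imageI monoid.simps(2))
      fix u assume "u \<in> i ` gr n"
      then obtain b where b: "b \<in> gr n" "u = i b" by blast
      have bB: "b \<in> carrier B" by (rule G.gr_carrier[OF n b(1)])
      show "inv\<^bsub>add_monoid ?B\<^esub> u \<in> i ` gr n"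
        unfolding a_inv_def[symmetric] b(2) using i.hom_a_inv[OF bB] G.gr_uminus[OF n b(1)] by (metis imageI)
      fix v assume "v \<in> i ` gr n"
      then obtain c where c: "c \<in> gr n" "v = i c" by blast
      show "u \<otimes>\<^bsub>add_monoid ?B\<^esub> v \<in> i ` gr n"
        using i.hom_add[OF bB G.gr_carrier[OF n c(1)]] G.gr_add[OF n b(1) c(1)] b(2) c(2)
        by (metis imageI monoid.simps(1))
    qed
    fix u assume "u \<in> carrier ?B"
    then obtain b where b: "b \<in> carrier B" "u = i b" by (auto simp: carr)
    show "i (G.comp n (?j u)) \<in> i ` gr n" using G.comp_props(1)[OF b(1) n] b j by auto
    fix v assume "v \<in> carrier ?B"
    then obtain c where c: "c \<in> carrier B" "v = i c" by (auto simp: carr)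
    have "u \<oplus>\<^bsub>?B\<^esub> v = i (b \<oplus>\<^bsub>B\<^esub> c)" using b c by simp
    then have "?j (u \<oplus>\<^bsub>?B\<^esub> v) = b \<oplus>\<^bsub>B\<^esub> c" using j[of "b \<oplus>\<^bsub>B\<^esub> c"] b c by (simp only: G.a_closed)
    moreover have "?j u = b" "?j v = c" using j b c by simp_all
    ultimately show "i (G.comp n (?j (u \<oplus>\<^bsub>?B\<^esub> v))) = i (G.comp n (?j u)) \<oplus>\<^bsub>?B\<^esub> i (G.comp n (?j v))"
      using b c n by (simp only: G.comp_add i.hom_add G.comp_carrier)
  next
    fix m n u assume m: "m \<in> Zr r" and n: "n \<in> Zr r" and "u \<in> i ` gr m"
    then obtain b where b: "b \<in> gr m" "u = i b" by blast
    show "i (G.comp n (?j u)) = (if n = m then u else \<zero>\<^bsub>?B\<^esub>)"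
      using b j[OF G.gr_carrier[OF m b(1)]] G.comp_homogeneous[OF m n b(1)] i.hom_zero by simp
  next
    fix u assume "u \<in> carrier ?B"
    then obtain b where b: "b \<in> carrier B" "u = i b" by (auto simp: carr)
    have "{n \<in> Zr r. i (G.comp n (?j u)) \<noteq> \<zero>\<^bsub>?B\<^esub>} = {n \<in> Zr r. G.comp n b \<noteq> \<zero>\<^bsub>B\<^esub>}"
      using b j iz G.comp_carrier by auto
    then show "finite {n \<in> Zr r. i (G.comp n (?j u)) \<noteq> \<zero>\<^bsub>?B\<^esub>}" using G.comp_props(2)[OF b(1)] by simp
    assume "\<And>n. n \<in> Zr r \<Longrightarrow> i (G.comp n (?j u)) = \<zero>\<^bsub>?B\<^esub>"
    then have "G.comp n b = \<zero>\<^bsub>B\<^esub>" if "n \<in> Zr r" for n using b j iz G.comp_carrier that by metis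
    then have "b = \<zero>\<^bsub>B\<^esub>" by (rule G.comp_separates[OF b(1)])
    then show "u = \<zero>\<^bsub>?B\<^esub>" using b i.hom_zero by simp
  next
    show "\<one>\<^bsub>?B\<^esub> \<in> i ` gr 0" using G.gr_one i.hom_one by (metis imageI)
  next
    fix m n u v assume m: "m \<in> Zr r" and n: "n \<in> Zr r" and "u \<in> i ` gr m" "v \<in> i ` gr n"
    then obtain b c where b: "b \<in> gr m" "u = i b" and c: "c \<in> gr n" "v = i c" by blast
    have "u \<otimes>\<^bsub>?B\<^esub> v = i (b \<otimes>\<^bsub>B\<^esub> c)" using b c G.gr_carrier[OF m b(1)] G.gr_carrier[OF n c(1)] by simp
    then show "u \<otimes>\<^bsub>?B\<^esub> v \<in> i ` gr (m + n)" using G.gr_mult[OF m n b(1) c(1)] by simp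
  qed
qed

subsection \<open>Group rings of the character group\<close>

text \<open>The group ring \<open>C[\<int>\<^sup>r]\<close> with convolution as multiplication: the coordinate ring of the trivial
  torsor over \<open>Spec C\<close>. Its elements are functions with values in \<open>C\<close>, for rings \<open>C\<close> with a carrier.\<close>

definition laurent_ring :: "nat \<Rightarrow> 'b ring \<Rightarrow> (zvec \<Rightarrow> 'b) ring" where
  "laurent_ring r C =
    \<lparr>carrier = {f. (\<forall>n. f n \<in> carrier C) \<and> finite {n. f n \<noteq> \<zero>\<^bsub>C\<^esub>} \<and> (\<forall>n. n \<notin> Zr r \<longrightarrow> f n = \<zero>\<^bsub>C\<^esub>)},
     monoid.mult = (\<lambda>f g n. finsum C (\<lambda>k. f k \<otimes>\<^bsub>C\<^esub> g (n - k)) {k. f k \<noteq> \<zero>\<^bsub>C\<^esub>}),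
     one = (\<lambda>n. if n = 0 then \<one>\<^bsub>C\<^esub> else \<zero>\<^bsub>C\<^esub>),
     ring.zero = (\<lambda>n. \<zero>\<^bsub>C\<^esub>),
     add = (\<lambda>f g n. f n \<oplus>\<^bsub>C\<^esub> g n)\<rparr>"

definition laurent_term :: "'b ring \<Rightarrow> 'b \<Rightarrow> zvec \<Rightarrow> zvec \<Rightarrow> 'b" where
  "laurent_term C c n = (\<lambda>k. if k = n then c else \<zero>\<^bsub>C\<^esub>)"

definition laurent_grading :: "nat \<Rightarrow> 'b ring \<Rightarrow> zvec \<Rightarrow> (zvec \<Rightarrow> 'b) set" where
  "laurent_grading r C n = (\<lambda>c. laurent_term C c n) ` carrier C"

context
  fixes r :: nat and C :: "'b ring" (structure)
  assumes C: "cring C"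
begin

interpretation cring C by (rule C)

abbreviation "LR \<equiv> laurent_ring r C"

lemma laurent_carrierD:
  assumes "f \<in> carrier LR"
  shows "f n \<in> carrier C" "finite {n. f n \<noteq> \<zero>}" "n \<notin> Zr r \<Longrightarrow> f n = \<zero>"
  using assms by (auto simp: laurent_ring_def)

lemma laurent_carrierI:
  assumes "\<And>n. f n \<in> carrier C" "finite {n. f n \<noteq> \<zero>}" "\<And>n. n \<notin> Zr r \<Longrightarrow> f n = \<zero>"
  shows "f \<in> carrier LR"
  using assms by (simp add: laurent_ring_def)

lemma laurent_add: "(f \<oplus>\<^bsub>LR\<^esub> g) = (\<lambda>n. f n \<oplus> g n)" and laurent_zero: "\<zero>\<^bsub>LR\<^esub> = (\<lambda>n. \<zero>)"
  and laurent_one: "\<one>\<^bsub>LR\<^esub> = laurent_term C \<one> 0"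
  by (simp_all add: laurent_ring_def laurent_term_def)

lemma laurent_mult:
  assumes f: "f \<in> carrier LR" and g: "g \<in> carrier LR" and K: "finite K" "{k. f k \<noteq> \<zero>} \<subseteq> K"
  shows "(f \<otimes>\<^bsub>LR\<^esub> g) n = finsum C (\<lambda>k. f k \<otimes> g (n - k)) K"
proof -
  have "finsum C (\<lambda>k. f k \<otimes> g (n - k)) {k. f k \<noteq> \<zero>} = finsum C (\<lambda>k. f k \<otimes> g (n - k)) K"
    by (rule add.finprod_mono_neutral_cong_left)
      (use K laurent_carrierD(1)[OF f] laurent_carrierD(1)[OF g] in auto)
  then show ?thesis by (simp add: laurent_ring_def)
qed

lemma laurent_mult_carrier:
  assumes f: "f \<in> carrier LR" and g: "g \<in> carrier LR" shows "f \<otimes>\<^bsub>LR\<^esub> g \<in> carrier LR"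
proof -
  let ?F = "{k. f k \<noteq> \<zero>}" and ?G = "{k. g k \<noteq> \<zero>}"
  have m: "(f \<otimes>\<^bsub>LR\<^esub> g) n = finsum C (\<lambda>k. f k \<otimes> g (n - k)) ?F" for n
    by (rule laurent_mult[OF f g]) (use laurent_carrierD[OF f] in auto)
  have z: "(f \<otimes>\<^bsub>LR\<^esub> g) n = \<zero>" if "\<And>k. f k \<noteq> \<zero> \<Longrightarrow> g (n - k) = \<zero>" for n
    unfolding m by (rule add.finprod_one_eqI) (use that laurent_carrierD(1)[OF f] in auto)
  have sub: "{n. (f \<otimes>\<^bsub>LR\<^esub> g) n \<noteq> \<zero>} \<subseteq> (\<lambda>(k, l). k + l) ` (?F \<times> ?G)"
  proof
    fix n assume "n \<in> {n. (f \<otimes>\<^bsub>LR\<^esub> g) n \<noteq> \<zero>}"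
    then obtain k where "f k \<noteq> \<zero>" "g (n - k) \<noteq> \<zero>" using z[of n] by auto
    then show "n \<in> (\<lambda>(k, l). k + l) ` (?F \<times> ?G)" by (intro image_eqI[of _ _ "(k, n - k)"]) auto
  qed
  show ?thesis
  proof (rule laurent_carrierI)
    show "(f \<otimes>\<^bsub>LR\<^esub> g) n \<in> carrier C" for n
      unfolding m by (rule finsum_closed) (use laurent_carrierD(1)[OF f] laurent_carrierD(1)[OF g] in auto)
    show "finite {n. (f \<otimes>\<^bsub>LR\<^esub> g) n \<noteq> \<zero>}"
      by (rule finite_subset[OF sub]) (use laurent_carrierD(2)[OF f] laurent_carrierD(2)[OF g] in auto)
    fix n assume n: "n \<notin> Zr r"
    show "(f \<otimes>\<^bsub>LR\<^esub> g) n = \<zero>"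
    proof (rule z)
      fix k assume "f k \<noteq> \<zero>"
      then have k: "k \<in> Zr r" using laurent_carrierD(3)[OF f] by blast
      have "n - k \<notin> Zr r"
      proof
        assume "n - k \<in> Zr r"
        from Zr_closed(2)[OF this k] show False using n by simp
      qed
      then show "g (n - k) = \<zero>" by (rule laurent_carrierD(3)[OF g])
    qed
  qed
qed

lemma laurent_mult_comm:
  assumes f: "f \<in> carrier LR" and g: "g \<in> carrier LR" shows "f \<otimes>\<^bsub>LR\<^esub> g = g \<otimes>\<^bsub>LR\<^esub> f"
proof
  fix n
  let ?F = "{k. f k \<noteq> \<zero>}" and ?G = "{k. g k \<noteq> \<zero>}"
  let ?K = "?F \<union> (\<lambda>k. n - k) ` ?G"
  have fin: "finite ?K" using laurent_carrierD(2)[OF f] laurent_carrierD(2)[OF g] by simp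
  have inj: "inj_on (\<lambda>k. n - k) ?K" by (rule inj_onI) simp
  have "(f \<otimes>\<^bsub>LR\<^esub> g) n = finsum C (\<lambda>k. f k \<otimes> g (n - k)) ?K"
    by (rule laurent_mult[OF f g fin]) auto
  also have "\<dots> = finsum C (\<lambda>k. g (n - k) \<otimes> f (n - (n - k))) ?K"
    by (rule finsum_cong') (use laurent_carrierD(1)[OF f] laurent_carrierD(1)[OF g] in \<open>auto simp: m_comm\<close>)
  also have "\<dots> = finsum C (\<lambda>k. g k \<otimes> f (n - k)) ((\<lambda>k. n - k) ` ?K)"
    by (rule finsum_reindex[symmetric, OF _ inj])
      (use laurent_carrierD(1)[OF f] laurent_carrierD(1)[OF g] in auto)
  also have "\<dots> = (g \<otimes>\<^bsub>LR\<^esub> f) n"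
  proof (rule laurent_mult[OF g f, symmetric])
    show "finite ((\<lambda>k. n - k) ` ?K)" using fin by simp
    show "?G \<subseteq> (\<lambda>k. n - k) ` ?K"
    proof
      fix k assume "k \<in> ?G"
      then show "k \<in> (\<lambda>k. n - k) ` ?K" by (intro image_eqI[of _ _ "n - k"]) auto
    qed
  qed
  finally show "(f \<otimes>\<^bsub>LR\<^esub> g) n = (g \<otimes>\<^bsub>LR\<^esub> f) n" .
qed

lemma laurent_mult_assoc:
  assumes f: "f \<in> carrier LR" and g: "g \<in> carrier LR" and h: "h \<in> carrier LR"
  shows "(f \<otimes>\<^bsub>LR\<^esub> g) \<otimes>\<^bsub>LR\<^esub> h = f \<otimes>\<^bsub>LR\<^esub> (g \<otimes>\<^bsub>LR\<^esub> h)"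
proof
  fix n
  let ?F = "{k. f k \<noteq> \<zero>}" and ?G = "{k. g k \<noteq> \<zero>}"
  let ?J = "{j. (f \<otimes>\<^bsub>LR\<^esub> g) j \<noteq> \<zero>} \<union> (\<lambda>(k, l). k + l) ` (?F \<times> ?G)"
  note fg = laurent_mult_carrier[OF f g] and gh = laurent_mult_carrier[OF g h]
  note c [simp] = laurent_carrierD(1)[OF f] laurent_carrierD(1)[OF g] laurent_carrierD(1)[OF h]
  have fF: "finite ?F" and fG: "finite ?G" using laurent_carrierD(2) f g by auto
  have J: "finite ?J" using laurent_carrierD(2)[OF fg] fF fG by simp
  have "((f \<otimes>\<^bsub>LR\<^esub> g) \<otimes>\<^bsub>LR\<^esub> h) n = finsum C (\<lambda>j. (f \<otimes>\<^bsub>LR\<^esub> g) j \<otimes> h (n - j)) ?J"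
    by (rule laurent_mult[OF fg h J]) auto
  also have "\<dots> = finsum C (\<lambda>j. finsum C (\<lambda>k. f k \<otimes> g (j - k) \<otimes> h (n - j)) ?F) ?J"
  proof (rule finsum_cong')
    fix j
    have "(f \<otimes>\<^bsub>LR\<^esub> g) j = finsum C (\<lambda>k. f k \<otimes> g (j - k)) ?F"
      by (rule laurent_mult[OF f g fF]) auto
    then show "(f \<otimes>\<^bsub>LR\<^esub> g) j \<otimes> h (n - j) = finsum C (\<lambda>k. f k \<otimes> g (j - k) \<otimes> h (n - j)) ?F"
      using fF by (simp add: finsum_ldistr)
  qed auto
  also have "\<dots> = finsum C (\<lambda>k. finsum C (\<lambda>j. f k \<otimes> g (j - k) \<otimes> h (n - j)) ?J) ?F"
    by (rule add.finprod_finprod_swap[OF J fF]) auto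
  also have "\<dots> = finsum C (\<lambda>k. f k \<otimes> (g \<otimes>\<^bsub>LR\<^esub> h) (n - k)) ?F"
  proof (rule finsum_cong')
    fix k assume k: "k \<in> ?F"
    have "finsum C (\<lambda>j. f k \<otimes> g (j - k) \<otimes> h (n - j)) ?J = finsum C (\<lambda>j. f k \<otimes> (g (j - k) \<otimes> h (n - j))) ?J"
      by (rule finsum_cong') (auto simp: m_assoc)
    also have "\<dots> = f k \<otimes> finsum C (\<lambda>j. g (j - k) \<otimes> h (n - j)) ?J"
      using J by (simp add: finsum_rdistr)
    also have "finsum C (\<lambda>j. g (j - k) \<otimes> h (n - j)) ?J =
        finsum C (\<lambda>j. (\<lambda>l. g l \<otimes> h (n - k - l)) (j - k)) ?J"
      by (rule finsum_cong') (auto simp: algebra_simps)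
    also have "\<dots> = finsum C (\<lambda>l. g l \<otimes> h (n - k - l)) ((\<lambda>j. j - k) ` ?J)"
      by (rule finsum_reindex[symmetric]) (auto simp: inj_on_def)
    also have "\<dots> = (g \<otimes>\<^bsub>LR\<^esub> h) (n - k)"
    proof (rule laurent_mult[OF g h, symmetric])
      show "finite ((\<lambda>j. j - k) ` ?J)" using J by simp
      show "?G \<subseteq> (\<lambda>j. j - k) ` ?J"
      proof
        fix l assume "l \<in> ?G"
        then show "l \<in> (\<lambda>j. j - k) ` ?J"
          using k by (intro image_eqI[of _ _ "k + l"] UnI2 image_eqI[of _ _ "(k, l)"]) auto
      qed
    qed
    finally show "finsum C (\<lambda>j. f k \<otimes> g (j - k) \<otimes> h (n - j)) ?J = f k \<otimes> (g \<otimes>\<^bsub>LR\<^esub> h) (n - k)" .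
  qed (use laurent_carrierD(1)[OF gh] in auto)
  also have "\<dots> = (f \<otimes>\<^bsub>LR\<^esub> (g \<otimes>\<^bsub>LR\<^esub> h)) n"
    by (rule laurent_mult[OF f gh fF, symmetric]) auto
  finally show "((f \<otimes>\<^bsub>LR\<^esub> g) \<otimes>\<^bsub>LR\<^esub> h) n = (f \<otimes>\<^bsub>LR\<^esub> (g \<otimes>\<^bsub>LR\<^esub> h)) n" .
qed

lemma laurent_term_carrier: "n \<in> Zr r \<Longrightarrow> c \<in> carrier C \<Longrightarrow> laurent_term C c n \<in> carrier LR"
  by (rule laurent_carrierI) (auto simp: laurent_term_def intro: finite_subset[of _ "{n}"] split: if_splits)

lemma laurent_term_mult_left:
  assumes n: "n \<in> Zr r" and c: "c \<in> carrier C" and g: "g \<in> carrier LR"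
  shows "(laurent_term C c n \<otimes>\<^bsub>LR\<^esub> g) m = c \<otimes> g (m - n)"
proof -
  have "(laurent_term C c n \<otimes>\<^bsub>LR\<^esub> g) m = finsum C (\<lambda>k. laurent_term C c n k \<otimes> g (m - k)) {n}"
    by (rule laurent_mult[OF laurent_term_carrier[OF n c] g]) (auto simp: laurent_term_def)
  then show ?thesis using c laurent_carrierD(1)[OF g] by (simp add: laurent_term_def)
qed

lemma laurent_term_mult:
  assumes "m \<in> Zr r" "n \<in> Zr r" "c \<in> carrier C" "d \<in> carrier C"
  shows "laurent_term C c m \<otimes>\<^bsub>LR\<^esub> laurent_term C d n = laurent_term C (c \<otimes> d) (m + n)"
proof
  fix k
  show "(laurent_term C c m \<otimes>\<^bsub>LR\<^esub> laurent_term C d n) k = laurent_term C (c \<otimes> d) (m + n) k"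
    unfolding laurent_term_mult_left[OF assms(1,3) laurent_term_carrier[OF assms(2,4)]]
    using assms(3) by (auto simp: laurent_term_def)
qed

lemma cring_laurent_ring: "cring LR"
proof (rule cringI)
  show "abelian_group LR"
  proof (rule abelian_groupI)
    fix f g h assume f: "f \<in> carrier LR" and g: "g \<in> carrier LR" and h: "h \<in> carrier LR"
    note c = laurent_carrierD(1)[OF f] laurent_carrierD(1)[OF g] laurent_carrierD(1)[OF h]
    show "f \<oplus>\<^bsub>LR\<^esub> g \<in> carrier LR"
    proof (rule laurent_carrierI)
      show "finite {n. (f \<oplus>\<^bsub>LR\<^esub> g) n \<noteq> \<zero>}"
        by (rule finite_subset[of _ "{n. f n \<noteq> \<zero>} \<union> {n. g n \<noteq> \<zero>}"])
          (use laurent_carrierD(2)[OF f] laurent_carrierD(2)[OF g] in \<open>auto simp: laurent_add\<close>)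
    qed (use c laurent_carrierD(3)[OF f] laurent_carrierD(3)[OF g] in \<open>auto simp: laurent_add\<close>)
    show "(f \<oplus>\<^bsub>LR\<^esub> g) \<oplus>\<^bsub>LR\<^esub> h = f \<oplus>\<^bsub>LR\<^esub> (g \<oplus>\<^bsub>LR\<^esub> h)" using c by (simp add: laurent_add a_assoc)
    show "f \<oplus>\<^bsub>LR\<^esub> g = g \<oplus>\<^bsub>LR\<^esub> f" using c by (simp add: laurent_add a_comm)
    show "\<zero>\<^bsub>LR\<^esub> \<oplus>\<^bsub>LR\<^esub> f = f" using c by (simp add: laurent_add laurent_zero)
    show "\<exists>g\<in>carrier LR. g \<oplus>\<^bsub>LR\<^esub> f = \<zero>\<^bsub>LR\<^esub>"
    proof
      show "(\<lambda>n. \<ominus> f n) \<oplus>\<^bsub>LR\<^esub> f = \<zero>\<^bsub>LR\<^esub>" using c by (simp add: laurent_add laurent_zero l_neg)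
      show "(\<lambda>n. \<ominus> f n) \<in> carrier LR"
        by (rule laurent_carrierI) (use c laurent_carrierD(2,3)[OF f] in auto)
    qed
  qed (rule laurent_carrierI, auto simp: laurent_zero)
  show "Group.comm_monoid LR"
  proof (rule comm_monoidI)
    show "\<one>\<^bsub>LR\<^esub> \<in> carrier LR" unfolding laurent_one by (rule laurent_term_carrier) auto
    fix f assume f: "f \<in> carrier LR"
    show "\<one>\<^bsub>LR\<^esub> \<otimes>\<^bsub>LR\<^esub> f = f"
    proof
      fix n show "(\<one>\<^bsub>LR\<^esub> \<otimes>\<^bsub>LR\<^esub> f) n = f n"
        unfolding laurent_one using laurent_term_mult_left[of 0 \<one> f n] f laurent_carrierD(1)[OF f] by simp
    qed
  qed (use laurent_mult_carrier laurent_mult_assoc laurent_mult_comm in auto)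
  fix f g h assume f: "f \<in> carrier LR" and g: "g \<in> carrier LR" and h: "h \<in> carrier LR"
  note c = laurent_carrierD(1)[OF f] laurent_carrierD(1)[OF g] laurent_carrierD(1)[OF h]
  let ?K = "{n. f n \<noteq> \<zero>} \<union> {n. g n \<noteq> \<zero>}"
  have K: "finite ?K" using laurent_carrierD(2)[OF f] laurent_carrierD(2)[OF g] by simp
  have fg: "f \<oplus>\<^bsub>LR\<^esub> g \<in> carrier LR"
    by (rule laurent_carrierI)
      (use c K laurent_carrierD(3)[OF f] laurent_carrierD(3)[OF g] in \<open>auto simp: laurent_add intro: finite_subset[OF _ K]\<close>)
  show "(f \<oplus>\<^bsub>LR\<^esub> g) \<otimes>\<^bsub>LR\<^esub> h = f \<otimes>\<^bsub>LR\<^esub> h \<oplus>\<^bsub>LR\<^esub> g \<otimes>\<^bsub>LR\<^esub> h"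
  proof
    fix n
    have "((f \<oplus>\<^bsub>LR\<^esub> g) \<otimes>\<^bsub>LR\<^esub> h) n = finsum C (\<lambda>k. (f k \<oplus> g k) \<otimes> h (n - k)) ?K"
      by (subst laurent_mult[OF fg h K]) (auto simp: laurent_add)
    also have "\<dots> = finsum C (\<lambda>k. f k \<otimes> h (n - k) \<oplus> g k \<otimes> h (n - k)) ?K"
      by (rule finsum_cong') (use c in \<open>auto simp: l_distr\<close>)
    also have "\<dots> = finsum C (\<lambda>k. f k \<otimes> h (n - k)) ?K \<oplus> finsum C (\<lambda>k. g k \<otimes> h (n - k)) ?K"
      by (rule finsum_addf) (use c in auto)
    also have "\<dots> = (f \<otimes>\<^bsub>LR\<^esub> h \<oplus>\<^bsub>LR\<^esub> g \<otimes>\<^bsub>LR\<^esub> h) n"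
      unfolding laurent_add using laurent_mult[OF f h K, of n] laurent_mult[OF g h K, of n] by auto
    finally show "((f \<oplus>\<^bsub>LR\<^esub> g) \<otimes>\<^bsub>LR\<^esub> h) n = (f \<otimes>\<^bsub>LR\<^esub> h \<oplus>\<^bsub>LR\<^esub> g \<otimes>\<^bsub>LR\<^esub> h) n" .
  qed
qed

lemma laurent_term_add: "laurent_term C c n \<oplus>\<^bsub>LR\<^esub> laurent_term C d n = laurent_term C (c \<oplus> d) n"
  by (auto simp: laurent_add laurent_term_def)

lemma laurent_term_zero: "laurent_term C \<zero> n = \<zero>\<^bsub>LR\<^esub>"
  by (auto simp: laurent_zero laurent_term_def)

lemma graded_laurent_ring: "graded_cring r LR (laurent_grading r C)"
proof (rule graded_cringI[where \<pi> = "\<lambda>n f. laurent_term C (f n) n", OF cring_laurent_ring])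
  interpret L: cring LR by (rule cring_laurent_ring)
  fix n assume n: "n \<in> Zr r"
  show "subgroup (laurent_grading r C n) (add_monoid LR)"
  proof (rule subgroup.intro)
    show "laurent_grading r C n \<subseteq> carrier (add_monoid LR)"
      using laurent_term_carrier[OF n] by (auto simp: laurent_grading_def)
    show "\<one>\<^bsub>add_monoid LR\<^esub> \<in> laurent_grading r C n"
      unfolding laurent_grading_def by (rule image_eqI[of _ _ \<zero>]) (simp_all add: laurent_term_zero)
    fix f assume "f \<in> laurent_grading r C n"
    then obtain c where c: "c \<in> carrier C" "f = laurent_term C c n" by (auto simp: laurent_grading_def)
    have "laurent_term C (\<ominus> c) n \<oplus>\<^bsub>LR\<^esub> f = \<zero>\<^bsub>LR\<^esub>"
      using c by (simp add: laurent_term_add l_neg laurent_term_zero)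
    then have "\<ominus>\<^bsub>LR\<^esub> f = laurent_term C (\<ominus> c) n"
      using c laurent_term_carrier[OF n] by (intro L.minus_equality) auto
    then show "inv\<^bsub>add_monoid LR\<^esub> f \<in> laurent_grading r C n"
      unfolding a_inv_def[symmetric] using c by (auto simp: laurent_grading_def)
    fix g assume "g \<in> laurent_grading r C n"
    then obtain d where d: "d \<in> carrier C" "g = laurent_term C d n" by (auto simp: laurent_grading_def)
    then show "f \<otimes>\<^bsub>add_monoid LR\<^esub> g \<in> laurent_grading r C n"
      using c by (auto simp: laurent_grading_def laurent_term_add)
  qed
  fix f assume f: "f \<in> carrier LR"
  show "laurent_term C (f n) n \<in> laurent_grading r C n"
    using laurent_carrierD(1)[OF f] by (auto simp: laurent_grading_def)
  fix g assume g: "g \<in> carrier LR"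
  show "laurent_term C ((f \<oplus>\<^bsub>LR\<^esub> g) n) n = laurent_term C (f n) n \<oplus>\<^bsub>LR\<^esub> laurent_term C (g n) n"
    by (simp add: laurent_term_add) (simp add: laurent_add)
next
  fix m n f assume "f \<in> laurent_grading r C m"
  then show "laurent_term C (f n) n = (if n = m then f else \<zero>\<^bsub>LR\<^esub>)"
    by (auto simp: laurent_grading_def laurent_term_def laurent_zero)
next
  fix f assume f: "f \<in> carrier LR"
  have e: "laurent_term C (f n) n = \<zero>\<^bsub>LR\<^esub> \<longleftrightarrow> f n = \<zero>" for n
    by (auto simp: laurent_term_def laurent_zero fun_eq_iff)
  show "finite {n \<in> Zr r. laurent_term C (f n) n \<noteq> \<zero>\<^bsub>LR\<^esub>}"
    unfolding e by (rule finite_subset[OF _ laurent_carrierD(2)[OF f]]) auto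
  assume "\<And>n. n \<in> Zr r \<Longrightarrow> laurent_term C (f n) n = \<zero>\<^bsub>LR\<^esub>"
  then show "f = \<zero>\<^bsub>LR\<^esub>" unfolding e using laurent_carrierD(3)[OF f] by (auto simp: laurent_zero)
next
  show "\<one>\<^bsub>LR\<^esub> \<in> laurent_grading r C 0" by (auto simp: laurent_one laurent_grading_def)
next
  fix m n f g assume "m \<in> Zr r" "n \<in> Zr r" "f \<in> laurent_grading r C m" "g \<in> laurent_grading r C n"
  then show "f \<otimes>\<^bsub>LR\<^esub> g \<in> laurent_grading r C (m + n)"
    by (auto simp: laurent_grading_def laurent_term_mult)
qed

lemma torsor_laurent_ring: "torsor r LR (laurent_grading r C)"
proof (rule torsorI[OF graded_laurent_ring])
  fix n assume n: "n \<in> Zr r"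
  have "\<one>\<^bsub>LR\<^esub> = laurent_term C \<one> n \<otimes>\<^bsub>LR\<^esub> laurent_term C \<one> (- n)"
    using n by (simp add: laurent_term_mult laurent_one)
  then show "\<one>\<^bsub>LR\<^esub> \<in> generate (add_monoid LR)
      {x \<otimes>\<^bsub>LR\<^esub> y | x y. x \<in> laurent_grading r C n \<and> y \<in> laurent_grading r C (- n)}"
    by (intro generate.incl) (auto simp: laurent_grading_def)
qed

lemma laurent_constants_iso: "(\<lambda>c. laurent_term C c 0) \<in> ring_iso C (degree_zero LR (laurent_grading r C))"
proof (rule ring_iso_memI)
  show "bij_betw (\<lambda>c. laurent_term C c 0) (carrier C) (carrier (degree_zero LR (laurent_grading r C)))"
    unfolding bij_betw_def laurent_grading_def by (auto simp: inj_on_def laurent_term_def fun_eq_iff)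
qed (auto simp: laurent_grading_def laurent_term_mult laurent_term_add laurent_one)

text \<open>Combining \<open>f\<close> with the coaction \<open>x \<mapsto> x \<cdot> s\<^sup>n\<close> on elements \<open>x\<close> of degree \<open>n\<close>. On spectra this is the
  map \<open>(y, g) \<mapsto> f(y) g\<close> from the trivial torsor.\<close>

lemma coaction:
  fixes R :: "'a ring"
  assumes gr: "graded_cring r R grR" and f: "f \<in> ring_hom R C"
  defines "co \<equiv> \<lambda>x n. if n \<in> Zr r then f (graded.comp r R grR n x) else \<zero>"
  shows "co \<in> ring_hom R LR"
    and "\<And>n x. n \<in> Zr r \<Longrightarrow> x \<in> grR n \<Longrightarrow> co x = laurent_term C (f x) n"
proof -
  interpret G: graded r R grR by unfold_locales (rule gr)
  interpret f: ring_hom_cring R C f by unfold_locales (rule f)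
  interpret L: cring LR by (rule cring_laurent_ring)
  show hom: "co x = laurent_term C (f x) n" if n: "n \<in> Zr r" and x: "x \<in> grR n" for n x
  proof
    fix k show "co x k = laurent_term C (f x) n k"
      using G.comp_homogeneous[OF n _ x, of k] n by (auto simp: co_def laurent_term_def)
  qed
  have carr: "co x \<in> carrier LR" if x: "x \<in> carrier R" for x
  proof (rule laurent_carrierI)
    have "{n. co x n \<noteq> \<zero>} \<subseteq> {n \<in> Zr r. G.comp n x \<noteq> \<zero>\<^bsub>R\<^esub>}"
      unfolding co_def using f.hom_zero by auto
    then show "finite {n. co x n \<noteq> \<zero>}" using G.comp_props(2)[OF x] by (rule finite_subset)
  qed (use x G.comp_carrier in \<open>auto simp: co_def\<close>)
  have co_add: "co (x \<oplus>\<^bsub>R\<^esub> y) = co x \<oplus>\<^bsub>LR\<^esub> co y" if "x \<in> carrier R" "y \<in> carrier R" for x y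
    using that by (auto simp: co_def laurent_add G.comp_add G.comp_carrier)
  have co_zero: "co \<zero>\<^bsub>R\<^esub> = \<zero>\<^bsub>LR\<^esub>" by (auto simp: co_def laurent_zero G.comp_zero)
  show "co \<in> ring_hom R LR"
  proof (rule ring_hom_memI)
    show "co \<one>\<^bsub>R\<^esub> = \<one>\<^bsub>LR\<^esub>" using hom[of 0 "\<one>\<^bsub>R\<^esub>"] G.gr_one by (simp add: laurent_one)
    fix x y assume x: "x \<in> carrier R" and y: "y \<in> carrier R"
    show "co (x \<otimes>\<^bsub>R\<^esub> y) = co x \<otimes>\<^bsub>LR\<^esub> co y" using x
    proof (induct x rule: G.homogeneous_induct)
      case zero
      then show ?case using y carr by (simp add: co_zero)
    next
      case hx: (homogeneous m x)
      have xR: "x \<in> carrier R" by (rule G.gr_carrier[OF hx])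
      show ?case using y
      proof (induct y rule: G.homogeneous_induct)
        case zero
        then show ?case using xR carr by (simp add: co_zero)
      next
        case hy: (homogeneous n y)
        then show ?case
          using hom[OF Zr_closed(2)[OF hx(1) hy(1)] G.gr_mult[OF hx(1) hy(1) hx(2) hy(2)]]
            hom[OF hx] hom[OF hy] hx(1) xR G.gr_carrier[OF hy] by (simp add: laurent_term_mult)
      next
        case (add y z)
        then show ?case using xR carr by (simp add: G.r_distr co_add L.r_distr)
      qed
    next
      case (add x z)
      then show ?case using y carr by (simp add: G.l_distr co_add L.l_distr)
    qed
  qed (use carr co_add in auto)
qed

end

lemma laurent_map:
  assumes C: "cring C" and D: "cring D" and k: "k \<in> ring_hom C D"
  shows "(\<lambda>f n. k (f n)) \<in> ring_hom (laurent_ring r C) (laurent_ring r D)"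
    and "(\<lambda>n. k (laurent_term C c m n)) = laurent_term D (k c) m"
proof -
  interpret k: ring_hom_cring C D k
    by (intro ring_hom_cring.intro ring_hom_cring_axioms.intro C D k)
  show t: "(\<lambda>n. k (laurent_term C c m n)) = laurent_term D (k c) m" for c m
    using k.hom_zero by (auto simp: laurent_term_def)
  have carr: "(\<lambda>n. k (f n)) \<in> carrier (laurent_ring r D)" if f: "f \<in> carrier (laurent_ring r C)" for f
  proof (rule laurent_carrierI[OF D])
    have "{n. k (f n) \<noteq> \<zero>\<^bsub>D\<^esub>} \<subseteq> {n. f n \<noteq> \<zero>\<^bsub>C\<^esub>}" using k.hom_zero by auto
    then show "finite {n. k (f n) \<noteq> \<zero>\<^bsub>D\<^esub>}" using laurent_carrierD(2)[OF C f] by (rule finite_subset)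
  qed (use laurent_carrierD[OF C f] k.hom_zero in auto)
  show "(\<lambda>f n. k (f n)) \<in> ring_hom (laurent_ring r C) (laurent_ring r D)"
  proof (rule ring_hom_memI)
    fix f g assume f: "f \<in> carrier (laurent_ring r C)" and g: "g \<in> carrier (laurent_ring r C)"
    note c = laurent_carrierD(1)[OF C f] laurent_carrierD(1)[OF C g]
    show "(\<lambda>n. k ((f \<oplus>\<^bsub>laurent_ring r C\<^esub> g) n)) = (\<lambda>n. k (f n)) \<oplus>\<^bsub>laurent_ring r D\<^esub> (\<lambda>n. k (g n))"
      using c by (simp add: laurent_add[OF C] laurent_add[OF D])
    show "(\<lambda>n. k ((f \<otimes>\<^bsub>laurent_ring r C\<^esub> g) n)) = (\<lambda>n. k (f n)) \<otimes>\<^bsub>laurent_ring r D\<^esub> (\<lambda>n. k (g n))"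
    proof
      fix n
      have K: "finite {n. f n \<noteq> \<zero>\<^bsub>C\<^esub>}" by (rule laurent_carrierD(2)[OF C f])
      have "k ((f \<otimes>\<^bsub>laurent_ring r C\<^esub> g) n) = k (finsum C (\<lambda>l. f l \<otimes>\<^bsub>C\<^esub> g (n - l)) {n. f n \<noteq> \<zero>\<^bsub>C\<^esub>})"
        by (subst laurent_mult[OF C f g K]) auto
      also have "\<dots> = finsum D (\<lambda>l. k (f l) \<otimes>\<^bsub>D\<^esub> k (g (n - l))) {n. f n \<noteq> \<zero>\<^bsub>C\<^esub>}"
        using c by (subst k.hom_finsum) (auto simp: comp_def)
      also have "\<dots> = ((\<lambda>n. k (f n)) \<otimes>\<^bsub>laurent_ring r D\<^esub> (\<lambda>n. k (g n))) n"
        by (rule laurent_mult[OF D carr[OF f] carr[OF g] K, symmetric]) (use k.hom_zero in auto)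
      finally show "k ((f \<otimes>\<^bsub>laurent_ring r C\<^esub> g) n) = ((\<lambda>n. k (f n)) \<otimes>\<^bsub>laurent_ring r D\<^esub> (\<lambda>n. k (g n))) n" .
    qed
  qed (use carr t[of "\<one>\<^bsub>C\<^esub>" 0] in \<open>auto simp: laurent_one[OF C] laurent_one[OF D]\<close>)
qed

subsection \<open>Injections into the carrier type\<close>

text \<open>A function is determined by the part of its graph over the support. This is a finite set, and the
  finite subsets of an infinite set are as many as its elements.\<close>

lemma finite_support_injection:
  fixes i :: "'x \<times> 'y \<Rightarrow> 'z"
  assumes i: "inj i" and inf: "infinite (UNIV :: 'z set)"
  shows "\<exists>j :: ('x \<Rightarrow> 'y) \<Rightarrow> 'z. inj_on j {f. finite {x. f x \<noteq> z}}"
proof -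
  obtain e :: "'z set \<Rightarrow> 'z" where e: "bij_betw e (Fpow UNIV) UNIV"
    using eqpoll_Fpow[OF inf] by (auto simp: eqpoll_def)
  let ?g = "\<lambda>f. (\<lambda>x. i (x, f x)) ` {x. f x \<noteq> z}"
  have "inj_on (\<lambda>f. e (?g f)) {f. finite {x. f x \<noteq> z}}"
  proof (rule inj_onI)
    fix f h assume f: "f \<in> {f. finite {x. f x \<noteq> z}}" and h: "h \<in> {f. finite {x. f x \<noteq> z}}"
      and eq: "e (?g f) = e (?g h)"
    have "?g f \<in> Fpow UNIV" "?g h \<in> Fpow UNIV" using f h by (auto simp: Fpow_def)
    then have g: "?g f = ?g h" using eq bij_betw_imp_inj_on[OF e] by (auto dest: inj_onD)
    have sub: "f1 x = f2 x" if "?g f1 = ?g f2" "f1 x \<noteq> z" for f1 f2 x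
    proof -
      have "i (x, f1 x) \<in> ?g f2" using that by auto
      then show ?thesis using i by (auto simp: inj_eq)
    qed
    show "f = h"
    proof
      fix x show "f x = h x" using sub[OF g, of x] sub[OF g[symmetric], of x] by metis
    qed
  qed
  then show ?thesis by blast
qed

lemma zvec_injection: "\<exists>i :: zvec \<Rightarrow> nat. inj i"
proof -
  have "carrier (free_Abelian_group (UNIV :: nat set)) \<approx> (UNIV :: nat set)"
    by (rule eqpoll_free_Abelian_group_infinite) simp
  moreover have "carrier (free_Abelian_group (UNIV :: nat set)) = UNIV"
    by (auto simp: carrier_free_Abelian_group_iff)
  ultimately show ?thesis by (auto simp: eqpoll_def bij_betw_def)
qed

lemma laurent_injection:
  fixes C :: "'b ring"
  assumes inf: "infinite (UNIV :: 'b set)" and C: "cring C"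
  obtains i :: "(zvec \<Rightarrow> 'b) \<Rightarrow> 'b" where "inj_on i (carrier (laurent_ring r C))"
proof -
  obtain a :: "zvec \<Rightarrow> nat" where a: "inj a" using zvec_injection by blast
  obtain b :: "'b \<times> nat \<Rightarrow> 'b" where b: "inj b" using inj_times_nat[OF inf] .
  have "inj (\<lambda>(n, c). b (c, a n))"
    by (rule injI) (auto dest!: injD[OF b] injD[OF a])
  from finite_support_injection[OF this inf, of "\<zero>\<^bsub>C\<^esub>"]
  obtain j :: "(zvec \<Rightarrow> 'b) \<Rightarrow> 'b" where j: "inj_on j {f. finite {x. f x \<noteq> \<zero>\<^bsub>C\<^esub>}}" ..
  have "carrier (laurent_ring r C) \<subseteq> {f. finite {x. f x \<noteq> \<zero>\<^bsub>C\<^esub>}}"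
    using laurent_carrierD(2)[OF C] by blast
  then have "inj_on j (carrier (laurent_ring r C))" by (rule inj_on_subset[OF j])
  then show ?thesis by (rule that)
qed

lemma monoid_ring_injection:
  assumes a: "inj (a :: 't \<Rightarrow> nat)" and inf: "infinite (UNIV :: 'b set)"
  shows "\<exists>i :: ('t \<Rightarrow>\<^sub>0 int) \<Rightarrow> 'b. inj i"
proof -
  obtain b :: "nat \<Rightarrow> 'b" where b: "inj b" using infinite_countable_subset[OF inf] by blast
  have "inj (\<lambda>(t, k). b (to_nat (a t, k :: int)))"
    by (rule injI) (auto dest!: injD[OF b] injD[OF inj_to_nat] injD[OF a])
  from finite_support_injection[OF this inf, of 0]
  obtain j :: "('t \<Rightarrow> int) \<Rightarrow> 'b" where j: "inj_on j {f. finite {x. f x \<noteq> 0}}" ..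
  have "inj (\<lambda>p. j (Poly_Mapping.lookup p))"
  proof (rule injI)
    fix p q :: "'t \<Rightarrow>\<^sub>0 int" assume "j (Poly_Mapping.lookup p) = j (Poly_Mapping.lookup q)"
    then have "Poly_Mapping.lookup p = Poly_Mapping.lookup q" by (rule inj_onD[OF j]) auto
    then show "p = q" by (rule Poly_Mapping.lookup_inject[THEN iffD1])
  qed
  then show ?thesis by blast
qed

section \<open>Quotient stacks\<close>

lemma smooth_at_iso:
  assumes R: "cring R" and A: "cring A" and \<rho>: "\<rho> \<in> ring_iso R A" and q: "q \<in> Spec A"
  shows "smooth_at A q \<longleftrightarrow> smooth_at R (spec_map R \<rho> q)"
proof -
  have one: "smooth_at A' q'"
    if R': "cring R'" and A': "cring A'" and \<rho>': "\<rho>' \<in> ring_iso R' A'"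
      and sm: "smooth_at R' (spec_map R' \<rho>' q')"
    for R' :: "'x ring" and A' :: "'y ring" and \<rho>' q'
  proof -
    obtain g n c f h where *: "g \<in> carrier R' - spec_map R' \<rho>' q'" "c \<le> n"
      "f ` {..<c} \<subseteq> carrier (int_poly_ring n)"
      "localization_away R' g (int_poly_ring n Quot genideal (int_poly_ring n) (f ` {..<c})) h"
      "genideal (int_poly_ring n) (f ` {..<c}) +>\<^bsub>int_poly_ring n\<^esub> jacobian_minor c f
        \<in> Units (int_poly_ring n Quot genideal (int_poly_ring n) (f ` {..<c}))"
      using sm by (auto simp: smooth_at_def Let_def)
    have P: "cring (int_poly_ring n)" by (rule cring_int_poly_ring)
    have Q: "cring (int_poly_ring n Quot genideal (int_poly_ring n) (f ` {..<c}))"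
      by (rule ideal.quotient_is_cring[OF ring.genideal_ideal[OF cring.axioms(1)[OF P] *(3)] P])
    let ?k = "inv_into (carrier R') \<rho>'"
    have k: "?k \<in> ring_iso A' R'" by (rule ring_iso_set_sym[OF cring.axioms(1)[OF R'] \<rho>'])
    have gR: "g \<in> carrier R'" using *(1) by simp
    have bij: "bij_betw \<rho>' (carrier R') (carrier A')" using \<rho>' by (simp add: ring_iso_def)
    have rg: "\<rho>' g \<in> carrier A'" using bij gR by (rule bij_betwE[THEN bspec])
    have kg: "?k (\<rho>' g) = g" by (rule bij_betw_inv_into_left[OF bij gR])
    have "localization_away A' (\<rho>' g) (int_poly_ring n Quot genideal (int_poly_ring n) (f ` {..<c})) (h \<circ> ?k)"
      by (rule localization_away_iso_comp[OF R' A' Q gR *(4) k rg kg])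
    moreover have "\<rho>' g \<in> carrier A' - q'" using *(1) rg by (simp add: spec_map_def)
    ultimately show ?thesis unfolding smooth_at_def Let_def using *(2,3,5) by blast
  qed
  let ?k = "inv_into (carrier R) \<rho>"
  have bij: "bij_betw \<rho> (carrier R) (carrier A)" using \<rho> by (simp add: ring_iso_def)
  have qA: "q \<subseteq> carrier A"
    using q ideal.Icarr[OF primeideal.axioms(1)] by (auto simp: Spec_def)
  have "spec_map A ?k (spec_map R \<rho> q) = q"
  proof (intro Set.set_eqI iffI)
    fix x assume "x \<in> spec_map A ?k (spec_map R \<rho> q)"
    then have "x \<in> carrier A" "\<rho> (?k x) \<in> q" by (auto simp: spec_map_def)
    then show "x \<in> q" using bij_betw_inv_into_right[OF bij] by simp
  next
    fix x assume x: "x \<in> q"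
    then have xA: "x \<in> carrier A" using qA by auto
    have "?k x \<in> carrier R" using bij_betw_inv_into[OF bij] xA by (rule bij_betwE[THEN bspec])
    then show "x \<in> spec_map A ?k (spec_map R \<rho> q)"
      using x xA bij_betw_inv_into_right[OF bij xA] by (simp add: spec_map_def)
  qed
  then show ?thesis
    using one[OF R A \<rho>, of q] one[OF A R ring_iso_set_sym[OF cring.axioms(1)[OF R] \<rho>], of "spec_map R \<rho> q"]
    by auto
qed

text \<open>In a torsor, this ideal defines the complement of the locus in the base over which \<open>y\<close> becomes a
  unit.\<close>

lemma (in graded) homogeneous_multiples_ideal:
  assumes n: "n \<in> Zr r" and y: "y \<in> gr n"
  shows "ideal {y \<otimes> c | c. c \<in> gr (- n)} (degree_zero B gr)"
proof -
  interpret D: cring "degree_zero B gr" by (rule degree_zero_cring)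
  let ?I = "{y \<otimes> c | c. c \<in> gr (- n)}"
  have n': "- n \<in> Zr r" using n by simp
  have yB: "y \<in> carrier B" by (rule gr_carrier[OF n y])
  have sub: "?I \<subseteq> gr 0" using gr_mult_neg[OF n y] by auto
  show ?thesis
  proof (rule idealI[OF D.ring_axioms])
    show "subgroup ?I (add_monoid (degree_zero B gr))"
    proof (rule subgroup.intro)
      show "?I \<subseteq> carrier (add_monoid (degree_zero B gr))" using sub by simp
      have "y \<otimes> \<zero> = \<zero>" using yB by simp
      then show "\<one>\<^bsub>add_monoid (degree_zero B gr)\<^esub> \<in> ?I" using gr_zero[OF n'] by force
      fix u assume u: "u \<in> ?I"
      then obtain c where c: "u = y \<otimes> c" "c \<in> gr (- n)" by blast
      have cB: "c \<in> carrier B" by (rule gr_carrier[OF n' c(2)])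
      have u0: "u \<in> gr 0" using u sub by blast
      have "\<ominus>\<^bsub>degree_zero B gr\<^esub> u = y \<otimes> (\<ominus> c)"
        by (rule D.minus_equality)
          (use c u0 yB cB gr_mult_neg[OF n y gr_uminus[OF n' c(2)]] in \<open>auto simp: r_minus l_neg\<close>)
      then show "inv\<^bsub>add_monoid (degree_zero B gr)\<^esub> u \<in> ?I"
        unfolding a_inv_def[symmetric] using gr_uminus[OF n' c(2)] by blast
      fix v assume "v \<in> ?I"
      then obtain d where d: "v = y \<otimes> d" "d \<in> gr (- n)" by blast
      have "u \<oplus> v = y \<otimes> (c \<oplus> d)" using c d yB cB gr_carrier[OF n' d(2)] by (simp add: r_distr)
      then show "u \<otimes>\<^bsub>add_monoid (degree_zero B gr)\<^esub> v \<in> ?I" using gr_add[OF n' c(2) d(2)] by auto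
    qed
  next
    fix u w assume "u \<in> ?I" "w \<in> carrier (degree_zero B gr)"
    then obtain c where c: "u = y \<otimes> c" "c \<in> gr (- n)" and w: "w \<in> gr 0" by auto
    have cB: "c \<in> carrier B" "w \<in> carrier B" using gr_carrier[OF n' c(2)] gr_carrier[of 0 w] w by simp_all
    have "w \<otimes> u = y \<otimes> (w \<otimes> c)" "u \<otimes> w = y \<otimes> (w \<otimes> c)" using c yB cB by (simp_all add: m_ac)
    then show "w \<otimes>\<^bsub>degree_zero B gr\<^esub> u \<in> ?I" "u \<otimes>\<^bsub>degree_zero B gr\<^esub> w \<in> ?I"
      using gr_mult0[OF n' w c(2)] by auto
  qed
qed

lemma quotient_stackD:
  assumes "\<xi> \<in> quotient_stack r R grR"
  shows "torsor r (tring \<xi>) (tgrad \<xi>)" "tmap \<xi> \<in> ring_hom R (tring \<xi>)"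
    "n \<in> Zr r \<Longrightarrow> x \<in> grR n \<Longrightarrow> tmap \<xi> x \<in> tgrad \<xi> n"
  using assms unfolding quotient_stack_def by blast+

lemma stack_arrowsD:
  assumes "h \<in> stack_arrows r R \<xi> \<xi>'"
  shows "h \<in> ring_hom (tring \<xi>) (tring \<xi>')" "n \<in> Zr r \<Longrightarrow> h ` tgrad \<xi> n \<subseteq> tgrad \<xi>' n"
    "x \<in> carrier R \<Longrightarrow> h (tmap \<xi> x) = tmap \<xi>' x"
  using assms unfolding stack_arrows_def by blast+

lemma open_substackD:
  "open_substack r R grR V \<Longrightarrow> \<xi> \<in> quotient_stack r R grR \<Longrightarrow> \<exists>U. zariski_open (base_ring \<xi>) U \<and>
     (\<forall>\<xi>' \<in> quotient_stack r R grR. \<forall>h \<in> stack_arrows r R \<xi> \<xi>'.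
        \<xi>' \<in> V \<longleftrightarrow> (\<forall>q \<in> Spec (base_ring \<xi>'). spec_map (base_ring \<xi>) h q \<in> U))"
  unfolding open_substack_def by (drule conjunct2) (erule bspec)

lemma base_hom:
  assumes "\<xi> \<in> quotient_stack r R grR" "\<xi>' \<in> quotient_stack r R grR" "h \<in> stack_arrows r R \<xi> \<xi>'"
  shows "ring_hom_cring (base_ring \<xi>) (base_ring \<xi>') h"
proof -
  interpret T: torsor_ring r "tring \<xi>" "tgrad \<xi>" by (rule torsor_ringI[OF quotient_stackD(1)[OF assms(1)]])
  interpret T': torsor_ring r "tring \<xi>'" "tgrad \<xi>'" by (rule torsor_ringI[OF quotient_stackD(1)[OF assms(2)]])
  have "h \<in> ring_hom (base_ring \<xi>) (base_ring \<xi>')"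
    unfolding base_ring_def
    by (rule degree_zero_hom[OF stack_arrowsD(1)[OF assms(3)] stack_arrowsD(2)[OF assms(3)]])
      (use T.gr_carrier[of 0] in auto)
  then show ?thesis
    unfolding base_ring_def
    by (intro ring_hom_cring.intro ring_hom_cring_axioms.intro T.degree_zero_cring T'.degree_zero_cring)
qed

lemma prime_contracts_to_base:
  assumes "\<xi> \<in> quotient_stack r R grR" "Q \<in> Spec (tring \<xi>)"
  shows "spec_map (base_ring \<xi>) id Q \<in> Spec (base_ring \<xi>)"
proof -
  interpret T: torsor_ring r "tring \<xi>" "tgrad \<xi>" by (rule torsor_ringI[OF quotient_stackD(1)[OF assms(1)]])
  have "ring_hom_cring (base_ring \<xi>) (tring \<xi>) id"
    unfolding base_ring_def
    by (intro ring_hom_cring.intro ring_hom_cring_axioms.intro T.degree_zero_cring T.is_cring)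
      (use T.gr_carrier[of 0] in \<open>auto simp: ring_hom_def\<close>)
  then show ?thesis using assms(2) by (rule spec_map_Spec)
qed

text \<open>The total space of \<open>\<xi>'\<close> is the basic open subset of the total space of \<open>\<xi>\<close> where \<open>a\<close> is
  invertible, and the equivariant maps are compatible.\<close>

lemma prime_extends_along_localization:
  assumes \<xi>: "\<xi> \<in> quotient_stack r R grR" and \<xi>': "\<xi>' \<in> quotient_stack r R grR"
    and h: "h \<in> stack_arrows r R \<xi> \<xi>'"
    and a: "a \<in> carrier (base_ring \<xi>)" and loc: "localization_away (base_ring \<xi>) a (base_ring \<xi>') h"
    and Q: "Q \<in> Spec (tring \<xi>)" "a \<notin> Q"
  shows "\<exists>Q' \<in> Spec (tring \<xi>'). spec_map R (tmap \<xi>') Q' = spec_map R (tmap \<xi>) Q"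
proof -
  interpret T: torsor_ring r "tring \<xi>" "tgrad \<xi>" by (rule torsor_ringI[OF quotient_stackD(1)[OF \<xi>]])
  interpret T': torsor_ring r "tring \<xi>'" "tgrad \<xi>'" by (rule torsor_ringI[OF quotient_stackD(1)[OF \<xi>']])
  have a0: "a \<in> tgrad \<xi> 0" using a by (simp add: base_ring_def)
  have "localization_away (tring \<xi>) a (tring \<xi>') h"
    by (rule torsor_localization[OF quotient_stackD(1)[OF \<xi>] T'.graded stack_arrowsD(1)[OF h] stack_arrowsD(2)[OF h] a0])
      (use loc in \<open>simp_all add: base_ring_def\<close>)
  then interpret L: localization "tring \<xi>" "tring \<xi>'" h a
    by (intro localizationI T.is_cring T'.is_cring) (use T.gr_carrier[of 0 a] a0 in auto)
  obtain Q' where Q': "Q' \<in> Spec (tring \<xi>')" "spec_map (tring \<xi>) h Q' = Q" using L.prime_extends[OF Q] by blast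
  have "spec_map R (tmap \<xi>') Q' = spec_map R (tmap \<xi>) Q"
    using Q'(2) stack_arrowsD(3)[OF h] ring_hom_closed[OF quotient_stackD(2)[OF \<xi>]]
    by (auto simp: spec_map_def)
  then show ?thesis using Q'(1) by blast
qed

lemma substack_union_mono:
  "\<V> \<subseteq> \<W> \<Longrightarrow> substack_union r R grR \<V> \<subseteq> substack_union r R grR \<W>"
  unfolding substack_union_def by blast

subsection \<open>Trivial torsors as objects\<close>

text \<open>The trivial torsor over \<open>Spec C\<close> with the equivariant map given by a map \<open>f\<close> from \<open>Spec C\<close> to
  \<open>Spec R\<close>. The injection \<open>j\<close> transports the group ring to the carrier type of the test rings.\<close>

definition trivial_object ::
    "nat \<Rightarrow> 'a ring \<Rightarrow> (zvec \<Rightarrow> 'a set) \<Rightarrow> 'b ring \<Rightarrow> ('a \<Rightarrow> 'b) \<Rightarrow> ((zvec \<Rightarrow> 'b) \<Rightarrow> 'b) \<Rightarrow> ('a, 'b) stack_obj" where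
  "trivial_object r R grR C f j =
     \<lparr>tring = image_ring j (laurent_ring r C), tgrad = (\<lambda>n. j ` laurent_grading r C n),
      tmap = (\<lambda>x. j (\<lambda>n. if n \<in> Zr r then f (graded.comp r R grR n x) else \<zero>\<^bsub>C\<^esub>))\<rparr>"

locale trivial_torsor =
  fixes r :: nat and R :: "'a ring" and grR :: "zvec \<Rightarrow> 'a set" and C :: "'b ring" and f :: "'a \<Rightarrow> 'b"
    and j :: "(zvec \<Rightarrow> 'b) \<Rightarrow> 'b"
  assumes grR: "graded_cring r R grR" and C: "cring C" and f: "f \<in> ring_hom R C"
    and j: "inj_on j (carrier (laurent_ring r C))"
begin

abbreviation "triv \<equiv> trivial_object r R grR C f j"

sublocale R: graded r R grR by unfold_locales (rule grR)
sublocale C: cring C by (rule C)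

lemma j_iso: "j \<in> ring_iso (laurent_ring r C) (tring triv)"
  unfolding trivial_object_def stack_obj.simps by (rule inj_imp_image_ring_iso[OF j])

lemma j_hom: "j \<in> ring_hom (laurent_ring r C) (tring triv)"
  using j_iso by (simp add: ring_iso_def)

lemma triv_graded: "graded_cring r (tring triv) (tgrad triv)"
  unfolding trivial_object_def stack_obj.simps by (rule graded_cring_image[OF graded_laurent_ring[OF C] j])

lemma j_graded: "n \<in> Zr r \<Longrightarrow> j ` laurent_grading r C n \<subseteq> tgrad triv n"
  by (simp add: trivial_object_def)

lemma triv_torsor: "torsor r (tring triv) (tgrad triv)"
  by (rule torsor_hom_image[OF torsor_laurent_ring[OF C] triv_graded j_hom j_graded])

lemma tmap_homogeneous: "n \<in> Zr r \<Longrightarrow> x \<in> grR n \<Longrightarrow> tmap triv x = j (laurent_term C (f x) n)"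
  using coaction(2)[OF C grR f] by (simp add: trivial_object_def)

lemma triv_object: "triv \<in> quotient_stack r R grR"
  unfolding quotient_stack_def
proof (intro CollectI conjI ballI triv_torsor)
  show "tmap triv \<in> ring_hom R (tring triv)"
    using ring_hom_trans[OF coaction(1)[OF C grR f] j_hom] by (simp add: trivial_object_def comp_def)
  fix n assume n: "n \<in> Zr r"
  show "tmap triv ` grR n \<subseteq> tgrad triv n"
  proof
    fix u assume "u \<in> tmap triv ` grR n"
    then obtain x where x: "x \<in> grR n" "u = tmap triv x" by blast
    have "f x \<in> carrier C" using ring_hom_closed[OF f R.gr_carrier[OF n x(1)]] .
    then show "u \<in> tgrad triv n"
      unfolding x(2) tmap_homogeneous[OF n x(1)] by (auto simp: trivial_object_def laurent_grading_def)
  qed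
qed

definition const :: "'b \<Rightarrow> 'b" where "const c = j (laurent_term C c 0)"

lemma const_iso: "const \<in> ring_iso C (base_ring triv)"
proof -
  have L: "cring (laurent_ring r C)" by (rule cring_laurent_ring[OF C])
  interpret G: graded r "laurent_ring r C" "laurent_grading r C"
    by unfold_locales (rule graded_laurent_ring[OF C])
  have "j \<in> ring_iso (degree_zero (laurent_ring r C) (laurent_grading r C)) (base_ring triv)"
    unfolding base_ring_def ring_iso_def mem_Collect_eq
  proof
    show "j \<in> ring_hom (degree_zero (laurent_ring r C) (laurent_grading r C)) (degree_zero (tring triv) (tgrad triv))"
      by (rule degree_zero_hom[OF j_hom j_graded]) (use G.gr_carrier[of 0] in auto)
    have "inj_on j (laurent_grading r C 0)" by (rule inj_on_subset[OF j]) (use G.gr_carrier[of 0] in auto)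
    then show "bij_betw j (carrier (degree_zero (laurent_ring r C) (laurent_grading r C)))
        (carrier (degree_zero (tring triv) (tgrad triv)))"
      by (simp add: bij_betw_def trivial_object_def)
  qed
  then show ?thesis
    using ring_iso_set_trans[OF laurent_constants_iso[OF C]] by (simp add: const_def[abs_def] comp_def)
qed

end

lemma trivial_object_is_atlas:
  assumes T: "trivial_torsor r R grR C i j" and i: "i \<in> ring_iso R C"
  shows "is_atlas r R grR (trivial_object r R grR C i j)"
    and "(\<lambda>x. j (laurent_term C (i x) 0)) \<in> ring_iso R (base_ring (trivial_object r R grR C i j))"
proof -
  interpret trivial_torsor r R grR C i j by (rule T)
  let ?s = "\<lambda>n. j (laurent_term C \<one>\<^bsub>C\<^esub> n)"
  have lt: "laurent_term C c n \<in> carrier (laurent_ring r C)" if "n \<in> Zr r" "c \<in> carrier C" for c n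
    using laurent_term_carrier[OF C that] .
  show iso: "(\<lambda>x. j (laurent_term C (i x) 0)) \<in> ring_iso R (base_ring triv)"
    using ring_iso_set_trans[OF i const_iso] by (simp add: const_def[abs_def] comp_def)
  show "is_atlas r R grR triv"
    unfolding is_atlas_def
  proof (intro conjI triv_object exI[of _ ?s] exI[of _ "\<lambda>x. j (laurent_term C (i x) 0)"] iso ballI)
    show "?s n \<in> tgrad triv n" if "n \<in> Zr r" for n
      by (auto simp: trivial_object_def laurent_grading_def)
    show "?s 0 = \<one>\<^bsub>tring triv\<^esub>"
      using ring_hom_one[OF j_hom] by (simp add: laurent_one[OF C])
    show "?s (m + n) = ?s m \<otimes>\<^bsub>tring triv\<^esub> ?s n" if "m \<in> Zr r" "n \<in> Zr r" for m n
      using ring_hom_mult[OF j_hom lt[OF that(1) C.one_closed] lt[OF that(2) C.one_closed]] that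
      by (simp add: laurent_term_mult[OF C])
    fix n x assume n: "n \<in> Zr r" and x: "x \<in> grR n"
    have "i x \<in> carrier C" using ring_hom_closed[OF f R.gr_carrier[OF n x]] .
    then show "tmap triv x = j (laurent_term C (i x) 0) \<otimes>\<^bsub>tring triv\<^esub> ?s n"
      unfolding tmap_homogeneous[OF n x]
      using ring_hom_mult[OF j_hom lt[of 0 "i x"] lt[OF n, of "\<one>\<^bsub>C\<^esub>"]] n
      by (simp add: laurent_term_mult[OF C])
  qed
qed

lemma trivial_object_map:
  assumes T1: "trivial_torsor r R grR C f1 j1" and T2: "trivial_torsor r R grR D f2 j2"
    and k: "k \<in> ring_hom C D" and fk: "\<And>x. x \<in> carrier R \<Longrightarrow> k (f1 x) = f2 x"
  shows "\<exists>h \<in> stack_arrows r R (trivial_object r R grR C f1 j1) (trivial_object r R grR D f2 j2).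
    \<forall>c \<in> carrier C. h (j1 (laurent_term C c 0)) = j2 (laurent_term D (k c) 0)"
proof -
  interpret A: trivial_torsor r R grR C f1 j1 by (rule T1)
  interpret B: trivial_torsor r R grR D f2 j2 by (rule T2)
  let ?i = "inv_into (carrier (laurent_ring r C)) j1"
  let ?m = "\<lambda>f n. k (f n)"
  let ?h = "j2 \<circ> (?m \<circ> ?i)"
  have "?i \<in> ring_iso (tring A.triv) (laurent_ring r C)"
    by (rule ring_iso_set_sym[OF cring.axioms(1)[OF cring_laurent_ring[OF A.C]] A.j_iso])
  then have i: "?i \<in> ring_hom (tring A.triv) (laurent_ring r C)" by (simp add: ring_iso_def)
  have h: "?h \<in> ring_hom (tring A.triv) (tring B.triv)"
    by (intro ring_hom_trans[OF ring_hom_trans[OF i laurent_map(1)[OF A.C B.C k]] B.j_hom])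
  have ij: "?i (j1 f) = f" if "f \<in> carrier (laurent_ring r C)" for f using A.j that by simp
  have ht: "?h (j1 (laurent_term C c n)) = j2 (laurent_term D (k c) n)" if "c \<in> carrier C" "n \<in> Zr r" for c n
    using ij[OF laurent_term_carrier[OF A.C that(2,1)]] by (simp add: laurent_map(2)[OF A.C B.C k])
  have "?h \<in> stack_arrows r R A.triv B.triv"
    unfolding stack_arrows_def
  proof (intro CollectI conjI ballI h)
    fix n assume n: "n \<in> Zr r"
    show "?h ` tgrad A.triv n \<subseteq> tgrad B.triv n"
    proof
      fix u assume "u \<in> ?h ` tgrad A.triv n"
      then obtain c where c: "c \<in> carrier C" "u = ?h (j1 (laurent_term C c n))"
        by (auto simp: trivial_object_def laurent_grading_def)
      then show "u \<in> tgrad B.triv n"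
        using ht[OF c(1) n] ring_hom_closed[OF k c(1)] by (auto simp: trivial_object_def laurent_grading_def)
    qed
  next
    fix x assume x: "x \<in> carrier R"
    have "(\<lambda>n. if n \<in> Zr r then f1 (A.R.comp n x) else \<zero>\<^bsub>C\<^esub>) \<in> carrier (laurent_ring r C)"
      using ring_hom_closed[OF coaction(1)[OF A.C A.grR A.f] x] .
    then have "?h (tmap A.triv x) = j2 (\<lambda>n. k (if n \<in> Zr r then f1 (A.R.comp n x) else \<zero>\<^bsub>C\<^esub>))"
      by (simp add: trivial_object_def ij)
    also have "\<dots> = tmap B.triv x"
    proof -
      have "k \<zero>\<^bsub>C\<^esub> = \<zero>\<^bsub>D\<^esub>"
        by (rule ring_hom_cring.hom_zero) (intro ring_hom_cring.intro ring_hom_cring_axioms.intro A.C B.C k)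
      then have "(\<lambda>n. k (if n \<in> Zr r then f1 (A.R.comp n x) else \<zero>\<^bsub>C\<^esub>)) =
          (\<lambda>n. if n \<in> Zr r then f2 (A.R.comp n x) else \<zero>\<^bsub>D\<^esub>)"
        using fk[OF A.R.comp_carrier[OF x]] by auto
      then show ?thesis by (simp add: trivial_object_def)
    qed
    finally show "?h (tmap A.triv x) = tmap B.triv x" .
  qed
  then show ?thesis using ht by (intro bexI[of _ ?h]) auto
qed

text \<open>The pullback of a torsor to its own total space is trivial; the identification is the coaction.\<close>

lemma map_to_trivial_object:
  assumes \<xi>: "\<xi> \<in> quotient_stack r R grR" and T: "trivial_torsor r R grR (tring \<xi>) (tmap \<xi>) j"
  shows "\<exists>h. h \<in> stack_arrows r R \<xi> (trivial_object r R grR (tring \<xi>) (tmap \<xi>) j)"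
proof -
  interpret A: trivial_torsor r R grR "tring \<xi>" "tmap \<xi>" j by (rule T)
  interpret T: torsor_ring r "tring \<xi>" "tgrad \<xi>" by (rule torsor_ringI[OF quotient_stackD(1)[OF \<xi>]])
  have id: "(\<lambda>x. x) \<in> ring_hom (tring \<xi>) (tring \<xi>)" by (simp add: ring_hom_def)
  let ?co = "\<lambda>x n. if n \<in> Zr r then T.comp n x else \<zero>\<^bsub>tring \<xi>\<^esub>"
  note co = coaction[OF A.C T.graded id]
  have "(\<lambda>b. j (?co b)) \<in> stack_arrows r R \<xi> A.triv"
    unfolding stack_arrows_def
  proof (intro CollectI conjI ballI)
    show "(\<lambda>b. j (?co b)) \<in> ring_hom (tring \<xi>) (tring A.triv)"
      using ring_hom_trans[OF co(1) A.j_hom] by (simp add: comp_def)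
    fix n assume n: "n \<in> Zr r"
    show "(\<lambda>b. j (?co b)) ` tgrad \<xi> n \<subseteq> tgrad A.triv n"
    proof
      fix u assume "u \<in> (\<lambda>b. j (?co b)) ` tgrad \<xi> n"
      then obtain b where b: "b \<in> tgrad \<xi> n" "u = j (?co b)" by blast
      then have "u = j (laurent_term (tring \<xi>) b n)" using co(2)[OF n b(1)] by simp
      then show "u \<in> tgrad A.triv n"
        using T.gr_carrier[OF n b(1)] by (auto simp: trivial_object_def laurent_grading_def)
    qed
  next
    fix x assume x: "x \<in> carrier R"
    have "?co (tmap \<xi> x) = (\<lambda>n. if n \<in> Zr r then tmap \<xi> (A.R.comp n x) else \<zero>\<^bsub>tring \<xi>\<^esub>)"
    proof
      fix n
      have "tmap \<xi> (A.R.comp n x) = T.comp n (tmap \<xi> x)" if n: "n \<in> Zr r"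
        by (rule graded_hom_comp[OF A.grR T.graded quotient_stackD(2)[OF \<xi>] _ x n])
          (use quotient_stackD(3)[OF \<xi>] in blast)
      then show "?co (tmap \<xi> x) n = (if n \<in> Zr r then tmap \<xi> (A.R.comp n x) else \<zero>\<^bsub>tring \<xi>\<^esub>)" by simp
    qed
    then show "j (?co (tmap \<xi> x)) = tmap A.triv x" by (simp add: trivial_object_def)
  qed
  then show ?thesis by blast
qed

text \<open>Let \<open>Q\<close> be a point of the total space of \<open>\<xi>\<close>. Over a neighbourhood of its image in the base,
  \<open>\<xi>\<close> lies in a smooth open substack \<open>V\<close>. The trivial torsor over the total space of \<open>\<xi>\<close> is at the
  same time a pullback of \<open>\<xi>\<close>, so that it lies in \<open>V\<close>, and of the atlas \<open>Spec R\<close>, along the equivariant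
  map of \<open>\<xi>\<close>. Hence the image of \<open>Q\<close> in \<open>Spec R\<close> is in the preimage of \<open>V\<close> in the atlas.\<close>

lemma stack_smooth_locus_subset:
  fixes R :: "'a ring" and i :: "'a \<Rightarrow> 'b"
  assumes grR: "graded_cring r R grR" and i: "inj_on i (carrier R)" and inf: "infinite (UNIV :: 'b set)"
  shows "(stack_smooth_locus r R grR :: ('a, 'b) stack_obj set) \<subseteq> open_quotient r R grR (smooth_locus R)"
proof
  fix \<xi> :: "('a, 'b) stack_obj" assume "\<xi> \<in> stack_smooth_locus r R grR"
  then have \<xi>: "\<xi> \<in> quotient_stack r R grR" and un: "\<And>q. q \<in> Spec (base_ring \<xi>) \<Longrightarrow>
      \<exists>V. open_substack r R grR V \<and> smooth_substack r R grR V \<and> (\<exists>a \<in> carrier (base_ring \<xi>) - q.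
          \<exists>\<xi>' \<in> V. \<exists>h \<in> stack_arrows r R \<xi> \<xi>'. localization_away (base_ring \<xi>) a (base_ring \<xi>') h)"
    unfolding stack_smooth_locus_def substack_union_def by blast+
  interpret R: graded r R grR by unfold_locales (rule grR)
  show "\<xi> \<in> open_quotient r R grR (smooth_locus R)"
    unfolding open_quotient_def
  proof (intro CollectI conjI ballI \<xi>)
    fix Q assume Q: "Q \<in> Spec (tring \<xi>)"
    obtain V a \<xi>' h where V: "open_substack r R grR V" "smooth_substack r R grR V"
      and a: "a \<in> carrier (base_ring \<xi>)" "a \<notin> spec_map (base_ring \<xi>) id Q"
      and \<xi>V: "\<xi>' \<in> V" and h: "h \<in> stack_arrows r R \<xi> \<xi>'"
      and loc: "localization_away (base_ring \<xi>) a (base_ring \<xi>') h"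
      using un[OF prime_contracts_to_base[OF \<xi> Q]] by blast
    have \<xi>': "\<xi>' \<in> quotient_stack r R grR" using V(1) \<xi>V by (auto simp: open_substack_def)
    have aQ: "a \<notin> Q" using a by (simp add: spec_map_def)
    obtain Q' where Q': "Q' \<in> Spec (tring \<xi>')" "spec_map R (tmap \<xi>') Q' = spec_map R (tmap \<xi>) Q"
      using prime_extends_along_localization[OF \<xi> \<xi>' h a(1) loc Q aQ] by blast
    interpret T': torsor_ring r "tring \<xi>'" "tgrad \<xi>'" by (rule torsor_ringI[OF quotient_stackD(1)[OF \<xi>']])
    \<comment> \<open>\<open>A.triv\<close> is the atlas, over the copy of \<open>R\<close> given by
      \<open>i\<close>; \<open>B.triv\<close> is the trivial torsor over the total space of
      \<open>\<xi>'\<close>. The arrows \<open>k\<close> and \<open>l\<close> exhibit the latter as a pullback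
      of the atlas and of \<open>\<xi>'\<close>.\<close>
    let ?C = "image_ring i R"
    have C: "cring ?C" by (rule cring_image_ring[OF R.is_cring i])
    have iso: "i \<in> ring_iso R ?C" by (rule inj_imp_image_ring_iso[OF i])
    obtain j1 :: "(zvec \<Rightarrow> 'b) \<Rightarrow> 'b" where j1: "inj_on j1 (carrier (laurent_ring r ?C))"
      using laurent_injection[OF inf C] .
    obtain j2 :: "(zvec \<Rightarrow> 'b) \<Rightarrow> 'b" where j2: "inj_on j2 (carrier (laurent_ring r (tring \<xi>')))"
      using laurent_injection[OF inf T'.is_cring] .
    have T1: "trivial_torsor r R grR ?C i j1"
      by (rule trivial_torsor.intro[OF grR C _ j1]) (use iso in \<open>simp add: ring_iso_def\<close>)
    have T2: "trivial_torsor r R grR (tring \<xi>') (tmap \<xi>') j2"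
      by (rule trivial_torsor.intro[OF grR T'.is_cring quotient_stackD(2)[OF \<xi>'] j2])
    interpret A: trivial_torsor r R grR ?C i j1 by (rule T1)
    interpret B: trivial_torsor r R grR "tring \<xi>'" "tmap \<xi>'" j2 by (rule T2)
    define \<kappa> where "\<kappa> = tmap \<xi>' \<circ> inv_into (carrier R) i"
    have "inv_into (carrier R) i \<in> ring_hom ?C R"
      using ring_iso_set_sym[OF R.ring_axioms iso] by (simp add: ring_iso_def)
    then have \<kappa>: "\<kappa> \<in> ring_hom ?C (tring \<xi>')"
      unfolding \<kappa>_def using quotient_stackD(2)[OF \<xi>'] by (rule ring_hom_trans)
    have \<kappa>i: "\<kappa> (i x) = tmap \<xi>' x" if "x \<in> carrier R" for x using that i by (simp add: \<kappa>_def)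
    obtain k where k: "k \<in> stack_arrows r R A.triv B.triv"
      "\<And>c. c \<in> carrier ?C \<Longrightarrow> k (j1 (laurent_term ?C c 0)) = j2 (laurent_term (tring \<xi>') (\<kappa> c) 0)"
      using trivial_object_map[OF T1 T2 \<kappa> \<kappa>i] by blast
    obtain l where l: "l \<in> stack_arrows r R \<xi>' B.triv" using map_to_trivial_object[OF \<xi>' T2] ..
    have BV: "B.triv \<in> V"
    proof -
      from open_substackD[OF V(1) \<xi>'] obtain U where
        U: "\<forall>\<xi>'' \<in> quotient_stack r R grR. \<forall>h \<in> stack_arrows r R \<xi>' \<xi>''.
           \<xi>'' \<in> V \<longleftrightarrow> (\<forall>q \<in> Spec (base_ring \<xi>''). spec_map (base_ring \<xi>') h q \<in> U)"
        by (elim exE conjE) (rule that)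
      have id: "id \<in> stack_arrows r R \<xi>' \<xi>'" by (simp add: stack_arrows_def ring_hom_def)
      have all: "q \<in> U" if q: "q \<in> Spec (base_ring \<xi>')" for q
      proof -
        have "spec_map (base_ring \<xi>') id q = q"
          using q ideal.Icarr[OF primeideal.axioms(1)] by (auto simp: spec_map_def Spec_def)
        moreover have "spec_map (base_ring \<xi>') id q \<in> U" using U[rule_format, OF \<xi>' id, THEN iffD1, OF \<xi>V] q by blast
        ultimately show ?thesis by simp
      qed
      have "spec_map (base_ring \<xi>') l q \<in> U" if "q \<in> Spec (base_ring B.triv)" for q
        by (rule all[OF spec_map_Spec[OF base_hom[OF \<xi>' B.triv_object l] that]])
      then show ?thesis by (intro U[rule_format, OF B.triv_object l, THEN iffD2] ballI)
    qed
    \<comment> \<open>The point \<open>q''\<close> of the base of \<open>B.triv\<close> corresponds to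
      \<open>Q'\<close>, and \<open>qa\<close> is its image in the base of the atlas.\<close>
    let ?\<sigma> = "B.const"
    let ?\<sigma>i = "inv_into (carrier (tring \<xi>')) ?\<sigma>"
    have sbij: "bij_betw ?\<sigma> (carrier (tring \<xi>')) (carrier (base_ring B.triv))"
      using B.const_iso by (simp add: ring_iso_def)
    have bB: "cring (base_ring B.triv)"
      unfolding base_ring_def by (rule graded.degree_zero_cring) (unfold_locales, rule B.triv_graded)
    have bA: "cring (base_ring A.triv)"
      unfolding base_ring_def by (rule graded.degree_zero_cring) (unfold_locales, rule A.triv_graded)
    define q'' where "q'' = spec_map (base_ring B.triv) ?\<sigma>i Q'"
    have q'': "q'' \<in> Spec (base_ring B.triv)"
      unfolding q''_def
    proof (rule spec_map_Spec[OF _ Q'(1)])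
      have "?\<sigma>i \<in> ring_hom (base_ring B.triv) (tring \<xi>')"
        using ring_iso_set_sym[OF T'.ring_axioms B.const_iso] by (simp add: ring_iso_def)
      then show "ring_hom_cring (base_ring B.triv) (tring \<xi>') ?\<sigma>i"
        by (intro ring_hom_cring.intro ring_hom_cring_axioms.intro bB T'.is_cring)
    qed
    define qa where "qa = spec_map (base_ring A.triv) k q''"
    have qa: "qa \<in> Spec (base_ring A.triv)"
      unfolding qa_def by (rule spec_map_Spec[OF base_hom[OF A.triv_object B.triv_object k(1)] q''])
    have "qa \<in> open_locus r R V A.triv"
      unfolding open_locus_def using qa BV k(1) q'' qa_def by blast
    then have sm: "smooth_at (base_ring A.triv) qa"
      using V(2) trivial_object_is_atlas(1)[OF T1 iso] unfolding smooth_substack_def by blast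
    let ?\<rho> = "\<lambda>x. j1 (laurent_term ?C (i x) 0)"
    have \<rho>: "?\<rho> \<in> ring_iso R (base_ring A.triv)" by (rule trivial_object_is_atlas(2)[OF T1 iso])
    have "spec_map R ?\<rho> qa = spec_map R (tmap \<xi>') Q'"
    proof (intro Set.set_eqI)
      fix x
      show "x \<in> spec_map R ?\<rho> qa \<longleftrightarrow> x \<in> spec_map R (tmap \<xi>') Q'"
      proof (cases "x \<in> carrier R")
        case True
        have ix: "i x \<in> carrier ?C" using True by (simp add: image_ring_carrier)
        have tx: "tmap \<xi>' x \<in> carrier (tring \<xi>')" by (rule ring_hom_closed[OF quotient_stackD(2)[OF \<xi>'] True])
        have rx: "?\<rho> x \<in> carrier (base_ring A.triv)" using ring_iso_memE(1)[OF \<rho> True] .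
        have kx: "k (?\<rho> x) = ?\<sigma> (tmap \<xi>' x)" using k(2)[OF ix] \<kappa>i[OF True] by (simp add: B.const_def)
        have sx: "?\<sigma> (tmap \<xi>' x) \<in> carrier (base_ring B.triv)" using ring_iso_memE(1)[OF B.const_iso tx] .
        have "?\<sigma>i (?\<sigma> (tmap \<xi>' x)) = tmap \<xi>' x" by (rule bij_betw_inv_into_left[OF sbij tx])
        then show ?thesis using True rx kx sx by (simp add: spec_map_def qa_def q''_def)
      qed (simp add: spec_map_def)
    qed
    then have eq: "spec_map R ?\<rho> qa = spec_map R (tmap \<xi>) Q" using Q'(2) by simp
    have "smooth_at R (spec_map R (tmap \<xi>) Q)"
      using smooth_at_iso[OF R.is_cring bA \<rho> qa] sm eq by simp
    moreover have "spec_map R (tmap \<xi>) Q \<in> Spec R"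
    proof -
      interpret T: torsor_ring r "tring \<xi>" "tgrad \<xi>" by (rule torsor_ringI[OF quotient_stackD(1)[OF \<xi>]])
      show ?thesis
        by (rule spec_map_Spec[OF _ Q])
          (intro ring_hom_cring.intro ring_hom_cring_axioms.intro R.is_cring T.is_cring quotient_stackD(2)[OF \<xi>])
    qed
    ultimately show "spec_map R (tmap \<xi>) Q \<in> smooth_locus R" by (simp add: smooth_locus_def)
  qed
qed

section \<open>The open substacks where a homogeneous element is invertible\<close>

text \<open>For homogeneous \<open>f\<close>, the quotient of the basic open set of \<open>f\<close>, as the class of objects whose
  equivariant map factors through this set.\<close>

definition inverting_substack :: "nat \<Rightarrow> 'a ring \<Rightarrow> (zvec \<Rightarrow> 'a set) \<Rightarrow> 'a \<Rightarrow> ('a, 'b) stack_obj set" where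
  "inverting_substack r R grR f = {\<xi> \<in> quotient_stack r R grR. tmap \<xi> f \<in> Units (tring \<xi>)}"

text \<open>Let \<open>y\<close> be the image of \<open>f\<close> in the torsor, of degree \<open>n\<close>. The open set is the complement of the zero
  set of the ideal of all \<open>y c\<close> with \<open>c\<close> of degree \<open>- n\<close>. If \<open>y\<close> becomes a unit in a pullback, with inverse
  \<open>c'\<close>, then all elements \<open>u v = (y u) (c' v)\<close> with \<open>u\<close> of degree \<open>- n\<close> and \<open>v\<close> of degree \<open>n\<close> belong to
  the ideal generated by the ideal in question; so does \<open>1\<close>, by \<open>product_induct\<close>. Conversely, if the
  pullback factors through the open set, then no prime contains all multiples of \<open>y\<close> of degree \<open>0\<close>,
  so \<open>1\<close> is one of them.\<close>

lemma inverting_substack_open: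
  assumes grR: "graded_cring r R grR" and n: "n \<in> Zr r" and f: "f \<in> grR n"
  shows "open_substack r R grR (inverting_substack r R grR f :: ('a, 'b) stack_obj set)"
  unfolding open_substack_def
proof (intro conjI ballI)
  show "(inverting_substack r R grR f :: ('a, 'b) stack_obj set) \<subseteq> quotient_stack r R grR"
    by (auto simp: inverting_substack_def)
  fix \<xi> :: "('a, 'b) stack_obj" assume \<xi>: "\<xi> \<in> quotient_stack r R grR"
  interpret R: graded r R grR by unfold_locales (rule grR)
  interpret T: torsor_ring r "tring \<xi>" "tgrad \<xi>" by (rule torsor_ringI[OF quotient_stackD(1)[OF \<xi>]])
  have fR: "f \<in> carrier R" by (rule R.gr_carrier[OF n f])
  have n': "- n \<in> Zr r" using n by simp
  let ?y = "tmap \<xi> f"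
  have y: "?y \<in> tgrad \<xi> n" by (rule quotient_stackD(3)[OF \<xi> n f])
  have yB: "?y \<in> carrier (tring \<xi>)" by (rule T.gr_carrier[OF n y])
  let ?I = "{?y \<otimes>\<^bsub>tring \<xi>\<^esub> c | c. c \<in> tgrad \<xi> (- n)}"
  let ?U = "{p \<in> Spec (base_ring \<xi>). \<not> ?I \<subseteq> p}"
  have "zariski_open (base_ring \<xi>) ?U"
    unfolding zariski_open_def base_ring_def
    by (intro exI[of _ ?I] conjI refl T.homogeneous_multiples_ideal[OF n y])
  moreover have "\<xi>' \<in> inverting_substack r R grR f \<longleftrightarrow>
      (\<forall>q \<in> Spec (base_ring \<xi>'). spec_map (base_ring \<xi>) h q \<in> ?U)"
    if \<xi>': "\<xi>' \<in> quotient_stack r R grR" and h: "h \<in> stack_arrows r R \<xi> \<xi>'" for \<xi>' h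
  proof -
    interpret T': torsor_ring r "tring \<xi>'" "tgrad \<xi>'" by (rule torsor_ringI[OF quotient_stackD(1)[OF \<xi>']])
    interpret h: ring_hom_cring "tring \<xi>" "tring \<xi>'" h
      by (intro ring_hom_cring.intro ring_hom_cring_axioms.intro T.is_cring T'.is_cring stack_arrowsD(1)[OF h])
    have hgr: "h x \<in> tgrad \<xi>' m" if "m \<in> Zr r" "x \<in> tgrad \<xi> m" for x m
      using stack_arrowsD(2)[OF h that(1)] that(2) by blast
    let ?y' = "tmap \<xi>' f"
    have hy: "h ?y = ?y'" by (rule stack_arrowsD(3)[OF h fR])
    have y': "?y' \<in> tgrad \<xi>' n" by (rule quotient_stackD(3)[OF \<xi>' n f])
    have y'B: "?y' \<in> carrier (tring \<xi>')" by (rule T'.gr_carrier[OF n y'])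
    let ?J = "{?y' \<otimes>\<^bsub>tring \<xi>'\<^esub> c | c. c \<in> tgrad \<xi>' (- n)}"
    have bc: "cring (base_ring \<xi>')" unfolding base_ring_def by (rule T'.degree_zero_cring)
    show ?thesis
    proof
      assume "\<xi>' \<in> inverting_substack r R grR f"
      then have "?y' \<in> Units (tring \<xi>')" by (simp add: inverting_substack_def)
      from T'.unit_inverse_homogeneous[OF n y' this] obtain c where
        c: "c \<in> tgrad \<xi>' (- n)" "?y' \<otimes>\<^bsub>tring \<xi>'\<^esub> c = \<one>\<^bsub>tring \<xi>'\<^esub>" by blast
      have cB: "c \<in> carrier (tring \<xi>')" by (rule T'.gr_carrier[OF n' c(1)])
      show "\<forall>q \<in> Spec (base_ring \<xi>'). spec_map (base_ring \<xi>) h q \<in> ?U"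
      proof
        fix q assume q: "q \<in> Spec (base_ring \<xi>')"
        interpret q: ideal q "base_ring \<xi>'" using q by (auto simp: Spec_def dest: primeideal.axioms(1))
        have p: "spec_map (base_ring \<xi>) h q \<in> Spec (base_ring \<xi>)"
          by (rule spec_map_Spec[OF base_hom[OF \<xi> \<xi>' h] q])
        have "\<not> ?I \<subseteq> spec_map (base_ring \<xi>) h q"
        proof
          assume sub: "?I \<subseteq> spec_map (base_ring \<xi>) h q"
          have "h \<one>\<^bsub>tring \<xi>\<^esub> \<in> q"
          proof (rule T.product_induct[OF n', where P = "\<lambda>w. h w \<in> q"])
            show "h \<zero>\<^bsub>tring \<xi>\<^esub> \<in> q" using additive_subgroup.zero_closed[OF q.is_additive_subgroup] by (simp add: base_ring_def)
          next
            fix u v assume u: "u \<in> tgrad \<xi> (- n)" and v: "v \<in> tgrad \<xi> (- (- n))"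
            have uB: "u \<in> carrier (tring \<xi>)" by (rule T.gr_carrier[OF n' u])
            have vn: "v \<in> tgrad \<xi> n" using v by simp
            have vB: "v \<in> carrier (tring \<xi>)" by (rule T.gr_carrier[OF n vn])
            have "?y \<otimes>\<^bsub>tring \<xi>\<^esub> u \<in> ?I" using u by blast
            then have "?y \<otimes>\<^bsub>tring \<xi>\<^esub> u \<in> spec_map (base_ring \<xi>) h q" using sub by blast
            then have yu: "?y' \<otimes>\<^bsub>tring \<xi>'\<^esub> h u \<in> q" using hy yB uB by (simp add: spec_map_def)
            have "h v \<otimes>\<^bsub>tring \<xi>'\<^esub> c \<in> tgrad \<xi>' 0" by (rule T'.gr_mult_neg[OF n hgr[OF n vn] c(1)])
            then have "(?y' \<otimes>\<^bsub>tring \<xi>'\<^esub> h u) \<otimes>\<^bsub>tring \<xi>'\<^esub> (h v \<otimes>\<^bsub>tring \<xi>'\<^esub> c) \<in> q"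
              using q.I_r_closed[OF yu] by (simp add: base_ring_def)
            also have "(?y' \<otimes>\<^bsub>tring \<xi>'\<^esub> h u) \<otimes>\<^bsub>tring \<xi>'\<^esub> (h v \<otimes>\<^bsub>tring \<xi>'\<^esub> c) =
                (?y' \<otimes>\<^bsub>tring \<xi>'\<^esub> c) \<otimes>\<^bsub>tring \<xi>'\<^esub> h (u \<otimes>\<^bsub>tring \<xi>\<^esub> v)"
              using y'B cB uB vB by (simp add: T'.m_ac)
            finally show "h (u \<otimes>\<^bsub>tring \<xi>\<^esub> v) \<in> q" using c(2) uB vB by simp
          next
            fix w assume w: "w \<in> tgrad \<xi> 0" "h w \<in> q"
            have wB: "w \<in> carrier (tring \<xi>)" using T.gr_carrier[of 0] w by simp
            have "\<ominus>\<^bsub>base_ring \<xi>'\<^esub> h w = \<ominus>\<^bsub>tring \<xi>'\<^esub> h w"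
            proof (rule abelian_group.minus_equality[OF ring.is_abelian_group[OF cring.axioms(1)[OF bc]]])
              show "\<ominus>\<^bsub>tring \<xi>'\<^esub> h w \<oplus>\<^bsub>base_ring \<xi>'\<^esub> h w = \<zero>\<^bsub>base_ring \<xi>'\<^esub>"
                using wB by (simp add: base_ring_def T'.l_neg)
            qed (use hgr[of 0 w] w T'.gr_uminus[of 0 "h w"] in \<open>simp_all add: base_ring_def\<close>)
            then show "h (\<ominus>\<^bsub>tring \<xi>\<^esub> w) \<in> q" using additive_subgroup.a_inv_closed[OF q.is_additive_subgroup w(2)] wB by simp
          next
            fix v w assume "v \<in> tgrad \<xi> 0" "w \<in> tgrad \<xi> 0" "h v \<in> q" "h w \<in> q"
            moreover have "v \<in> carrier (tring \<xi>)" "w \<in> carrier (tring \<xi>)"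
              using T.gr_carrier[of 0] calculation by simp_all
            ultimately show "h (v \<oplus>\<^bsub>tring \<xi>\<^esub> w) \<in> q"
              using additive_subgroup.a_closed[OF q.is_additive_subgroup, of "h v" "h w"] by (simp add: base_ring_def)
          qed
          then show False using Spec_one_notin[OF q] by (simp add: base_ring_def)
        qed
        then show "spec_map (base_ring \<xi>) h q \<in> ?U" using p by simp
      qed
    next
      assume all: "\<forall>q \<in> Spec (base_ring \<xi>'). spec_map (base_ring \<xi>) h q \<in> ?U"
      have J: "ideal ?J (base_ring \<xi>')" unfolding base_ring_def by (rule T'.homogeneous_multiples_ideal[OF n y'])
      have "\<one>\<^bsub>base_ring \<xi>'\<^esub> \<in> ?J"
      proof (rule ccontr)
        assume "\<one>\<^bsub>base_ring \<xi>'\<^esub> \<notin> ?J"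
        from exists_prime_containing_ideal[OF bc J this] obtain q where
          q: "q \<in> Spec (base_ring \<xi>')" "?J \<subseteq> q" by blast
        have "\<not> ?I \<subseteq> spec_map (base_ring \<xi>) h q" using all q(1) by simp
        then obtain c where c: "c \<in> tgrad \<xi> (- n)" "?y \<otimes>\<^bsub>tring \<xi>\<^esub> c \<notin> spec_map (base_ring \<xi>) h q" by blast
        have cB: "c \<in> carrier (tring \<xi>)" by (rule T.gr_carrier[OF n' c(1)])
        have "?y' \<otimes>\<^bsub>tring \<xi>'\<^esub> h c \<in> ?J" using hgr[OF n' c(1)] by blast
        then have "h (?y \<otimes>\<^bsub>tring \<xi>\<^esub> c) \<in> q" using q(2) hy yB cB by auto
        then show False using c T.gr_mult_neg[OF n y c(1)] by (simp add: spec_map_def base_ring_def)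
      qed
      then obtain c where c: "c \<in> tgrad \<xi>' (- n)" "\<one>\<^bsub>base_ring \<xi>'\<^esub> = ?y' \<otimes>\<^bsub>tring \<xi>'\<^esub> c" by blast
      have cB: "c \<in> carrier (tring \<xi>')" by (rule T'.gr_carrier[OF n' c(1)])
      have "?y' \<otimes>\<^bsub>tring \<xi>'\<^esub> c = \<one>\<^bsub>tring \<xi>'\<^esub>" using c(2) by (simp add: base_ring_def)
      then have "?y' \<in> Units (tring \<xi>')"
        using y'B cB T'.m_comm[OF y'B cB] by (auto simp: Units_def)
      then show "\<xi>' \<in> inverting_substack r R grR f" using \<xi>' by (simp add: inverting_substack_def)
    qed
  qed
  ultimately show "\<exists>U. zariski_open (base_ring \<xi>) U \<and>
      (\<forall>\<xi>' \<in> quotient_stack r R grR. \<forall>h \<in> stack_arrows r R \<xi> \<xi>'. \<xi>' \<in> inverting_substack r R grR f \<longleftrightarrow>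
         (\<forall>q \<in> Spec (base_ring \<xi>'). spec_map (base_ring \<xi>) h q \<in> U))"
    by (intro exI[of _ ?U] conjI ballI)
qed

text \<open>In the atlas, the image of \<open>f\<close> is the product of \<open>\<rho> f\<close> with a unit, so the open locus consists of
  primes of \<open>R\<close> which do not contain \<open>f\<close>.\<close>

lemma inverting_substack_smooth:
  assumes grR: "graded_cring r R grR" and n: "n \<in> Zr r" and f: "f \<in> grR n"
    and sm: "\<And>p. p \<in> Spec R \<Longrightarrow> f \<notin> p \<Longrightarrow> smooth_at R p"
  shows "smooth_substack r R grR (inverting_substack r R grR f :: ('a, 'b) stack_obj set)"
  unfolding smooth_substack_def
proof (intro allI impI ballI)
  fix \<eta> :: "('a, 'b) stack_obj" and q
  assume atlas: "is_atlas r R grR \<eta>" and q: "q \<in> open_locus r R (inverting_substack r R grR f) \<eta>"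
  interpret R: graded r R grR by unfold_locales (rule grR)
  have fR: "f \<in> carrier R" by (rule R.gr_carrier[OF n f])
  have \<eta>: "\<eta> \<in> quotient_stack r R grR" using atlas by (simp add: is_atlas_def)
  obtain s \<rho> where s: "s n \<in> tgrad \<eta> n" and \<rho>: "\<rho> \<in> ring_iso R (base_ring \<eta>)"
    and act: "tmap \<eta> f = \<rho> f \<otimes>\<^bsub>tring \<eta>\<^esub> s n"
    using atlas n f unfolding is_atlas_def by blast
  obtain \<xi>' k q' where \<xi>': "\<xi>' \<in> quotient_stack r R grR" and un: "tmap \<xi>' f \<in> Units (tring \<xi>')"
    and k: "k \<in> stack_arrows r R \<eta> \<xi>'" and q': "q' \<in> Spec (base_ring \<xi>')" and qq: "spec_map (base_ring \<eta>) k q' = q"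
    and qS: "q \<in> Spec (base_ring \<eta>)"
    using q unfolding open_locus_def inverting_substack_def by blast
  interpret T: torsor_ring r "tring \<eta>" "tgrad \<eta>" by (rule torsor_ringI[OF quotient_stackD(1)[OF \<eta>]])
  interpret T': torsor_ring r "tring \<xi>'" "tgrad \<xi>'" by (rule torsor_ringI[OF quotient_stackD(1)[OF \<xi>']])
  interpret k: ring_hom_cring "tring \<eta>" "tring \<xi>'" k
    by (intro ring_hom_cring.intro ring_hom_cring_axioms.intro T.is_cring T'.is_cring stack_arrowsD(1)[OF k])
  have bA: "cring (base_ring \<eta>)" unfolding base_ring_def by (rule T.degree_zero_cring)
  have \<rho>f: "\<rho> f \<in> tgrad \<eta> 0" using ring_iso_memE(1)[OF \<rho> fR] by (simp add: base_ring_def)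
  have \<rho>fB: "\<rho> f \<in> carrier (tring \<eta>)" using T.gr_carrier[of 0] \<rho>f by simp
  have sB: "s n \<in> carrier (tring \<eta>)" by (rule T.gr_carrier[OF n s])
  have "k (\<rho> f) \<otimes>\<^bsub>tring \<xi>'\<^esub> k (s n) \<in> Units (tring \<xi>')"
    using un stack_arrowsD(3)[OF k fR] act \<rho>fB sB by simp
  then have ku: "k (\<rho> f) \<in> Units (tring \<xi>')"
    by (rule T'.unit_factor) (use \<rho>fB sB in simp_all)
  have k0: "k (\<rho> f) \<in> tgrad \<xi>' 0" using stack_arrowsD(2)[OF k, of 0] \<rho>f by auto
  have "k (\<rho> f) \<notin> q'"
    using Spec_unit_notin[OF q'] T'.degree_zero_Units[OF k0] ku by (simp add: base_ring_def)
  then have "f \<notin> spec_map R \<rho> q" using qq by (auto simp: spec_map_def)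
  moreover have "spec_map R \<rho> q \<in> Spec R"
    by (rule spec_map_Spec[OF _ qS])
      (intro ring_hom_cring.intro ring_hom_cring_axioms.intro R.is_cring bA, use \<rho> in \<open>simp add: ring_iso_def\<close>)
  ultimately have "smooth_at R (spec_map R \<rho> q)" by (intro sm)
  then show "smooth_at (base_ring \<eta>) q" using smooth_at_iso[OF R.is_cring bA \<rho> qS] by simp
qed

text \<open>For homogeneous \<open>y\<close> of degree \<open>n\<close>, membership in this ideal means that all products \<open>y c\<close> with \<open>c\<close> of
  degree \<open>- n\<close> are in \<open>q\<close>. So if no product of this kind gives a neighbourhood of \<open>q\<close> where \<open>y\<close> is a
  unit, then \<open>y\<close> vanishes at a point over \<open>q\<close>.\<close>

lemma (in torsor_ring) ideal_over_prime_of_degree_zero: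
  assumes q: "q \<in> Spec (degree_zero B gr)"
  shows "ideal {b \<in> carrier B. \<forall>c \<in> carrier B. comp 0 (b \<otimes> c) \<in> q} B"
proof -
  let ?J = "{b \<in> carrier B. \<forall>c \<in> carrier B. comp 0 (b \<otimes> c) \<in> q}"
  interpret q: ideal q "degree_zero B gr" using q by (auto simp: Spec_def dest: primeideal.axioms(1))
  have q0: "\<zero> \<in> q" using additive_subgroup.zero_closed[OF q.is_additive_subgroup] by simp
  have qadd: "u \<oplus> v \<in> q" if "u \<in> q" "v \<in> q" for u v using additive_subgroup.a_closed[OF q.is_additive_subgroup that] by simp
  have qmult: "v \<otimes> u \<in> q" if "u \<in> q" "v \<in> gr 0" for u v using q.I_l_closed[OF that(1), of v] that(2) by simp
  have Z: "0 \<in> Zr r" by simp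
  show ?thesis
  proof (rule idealI[OF ring_axioms])
    show "subgroup ?J (add_monoid B)"
    proof (rule subgroup.intro)
      show "?J \<subseteq> carrier (add_monoid B)" by auto
      show "\<one>\<^bsub>add_monoid B\<^esub> \<in> ?J" using q0 comp_zero[OF Z] by simp
      fix u assume u: "u \<in> ?J"
      have "comp 0 ((\<ominus> u) \<otimes> c) \<in> q" if c: "c \<in> carrier B" for c
      proof -
        have "comp 0 (u \<otimes> (\<ominus> c)) \<in> q" using u c by simp
        moreover have "u \<otimes> (\<ominus> c) = (\<ominus> u) \<otimes> c" using u c by (simp add: l_minus r_minus)
        ultimately show ?thesis by simp
      qed
      then show "inv\<^bsub>add_monoid B\<^esub> u \<in> ?J" unfolding a_inv_def[symmetric] using u by simp
      fix v assume v: "v \<in> ?J"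
      show "u \<otimes>\<^bsub>add_monoid B\<^esub> v \<in> ?J" using u v qadd by (simp add: l_distr comp_add[OF _ _ Z])
    qed
    fix u d assume u: "u \<in> ?J" and d: "d \<in> carrier B"
    then show "u \<otimes> d \<in> ?J" by (simp add: m_assoc)
    then show "d \<otimes> u \<in> ?J" using u d m_comm[of d u] by simp
  qed
qed

text \<open>If the equivariant map takes the total space into the union of the basic open sets and \<open>q\<close> is a point
  of the base, then for some \<open>f\<close> in \<open>F\<close> with image \<open>y\<close> there is \<open>c\<close> of opposite degree with \<open>y c\<close> outside
  of \<open>q\<close>: otherwise \<open>ideal_over_prime_of_degree_zero\<close> would be a proper ideal which contains the images
  of all \<open>f\<close>, and a prime above it would be mapped outside of the union. The localization of the torsor
  at \<open>y c\<close> is an object in which \<open>f\<close> is invertible.\<close>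

lemma union_of_inverting_substacks:
  fixes R :: "'a ring"
  assumes grR: "graded_cring r R grR" and F: "\<And>f. f \<in> F \<Longrightarrow> \<exists>n \<in> Zr r. f \<in> grR n"
    and inf: "infinite (UNIV :: 'b set)"
  shows "substack_union r R grR {inverting_substack r R grR f | f. f \<in> F} =
    (open_quotient r R grR (\<Union>f \<in> F. {p \<in> Spec R. f \<notin> p}) :: ('a, 'b) stack_obj set)"
    (is "?L = ?Q")
proof
  interpret R: graded r R grR by unfold_locales (rule grR)
  have FR: "f \<in> carrier R" if "f \<in> F" for f using F[OF that] R.gr_carrier by blast
  show "?L \<subseteq> ?Q"
  proof
    fix \<xi> :: "('a, 'b) stack_obj" assume un: "\<xi> \<in> ?L"
    then have \<xi>: "\<xi> \<in> quotient_stack r R grR" by (simp add: substack_union_def)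
    interpret T: torsor_ring r "tring \<xi>" "tgrad \<xi>" by (rule torsor_ringI[OF quotient_stackD(1)[OF \<xi>]])
    show "\<xi> \<in> ?Q"
      unfolding open_quotient_def
    proof (intro CollectI conjI ballI \<xi>)
      fix Q assume Q: "Q \<in> Spec (tring \<xi>)"
      have "\<exists>V \<in> {inverting_substack r R grR f | f. f \<in> F}. \<exists>a \<in> carrier (base_ring \<xi>) - spec_map (base_ring \<xi>) id Q.
          \<exists>\<xi>' \<in> V. \<exists>h \<in> stack_arrows r R \<xi> \<xi>'. localization_away (base_ring \<xi>) a (base_ring \<xi>') h"
        using un prime_contracts_to_base[OF \<xi> Q] by (simp add: substack_union_def)
      then obtain f a \<xi>' h where f: "f \<in> F" and a: "a \<in> carrier (base_ring \<xi>)" "a \<notin> spec_map (base_ring \<xi>) id Q"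
        and \<xi>'V: "\<xi>' \<in> inverting_substack r R grR f" and h: "h \<in> stack_arrows r R \<xi> \<xi>'"
        and loc: "localization_away (base_ring \<xi>) a (base_ring \<xi>') h" by blast
      have \<xi>': "\<xi>' \<in> quotient_stack r R grR" and unit: "tmap \<xi>' f \<in> Units (tring \<xi>')"
        using \<xi>'V by (simp_all add: inverting_substack_def)
      have aQ: "a \<notin> Q" using a by (simp add: spec_map_def)
      obtain Q' where Q': "Q' \<in> Spec (tring \<xi>')" "spec_map R (tmap \<xi>') Q' = spec_map R (tmap \<xi>) Q"
        using prime_extends_along_localization[OF \<xi> \<xi>' h a(1) loc Q aQ] by blast
      have "f \<notin> spec_map R (tmap \<xi>) Q"
        unfolding Q'(2)[symmetric] using Spec_unit_notin[OF Q'(1) unit] by (simp add: spec_map_def)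
      moreover have "spec_map R (tmap \<xi>) Q \<in> Spec R"
        by (rule spec_map_Spec[OF _ Q])
          (intro ring_hom_cring.intro ring_hom_cring_axioms.intro R.is_cring T.is_cring quotient_stackD(2)[OF \<xi>])
      ultimately show "spec_map R (tmap \<xi>) Q \<in> (\<Union>f \<in> F. {p \<in> Spec R. f \<notin> p})" by (intro UN_I[OF f]) simp
    qed
  qed
  show "?Q \<subseteq> ?L"
  proof
    fix \<xi> :: "('a, 'b) stack_obj" assume "\<xi> \<in> ?Q"
    then have \<xi>: "\<xi> \<in> quotient_stack r R grR" and
      meets: "\<And>Q. Q \<in> Spec (tring \<xi>) \<Longrightarrow> \<exists>f \<in> F. f \<notin> spec_map R (tmap \<xi>) Q"
      by (auto simp: open_quotient_def)
    interpret T: torsor_ring r "tring \<xi>" "tgrad \<xi>" by (rule torsor_ringI[OF quotient_stackD(1)[OF \<xi>]])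
    show "\<xi> \<in> ?L"
      unfolding substack_union_def
    proof (intro CollectI conjI ballI \<xi>)
      fix q assume q: "q \<in> Spec (base_ring \<xi>)"
      have "\<exists>f \<in> F. \<exists>n \<in> Zr r. f \<in> grR n \<and> (\<exists>c \<in> tgrad \<xi> (- n). tmap \<xi> f \<otimes>\<^bsub>tring \<xi>\<^esub> c \<notin> q)"
      proof (rule ccontr)
        assume none: "\<not> ?thesis"
        let ?J = "{b \<in> carrier (tring \<xi>). \<forall>c \<in> carrier (tring \<xi>). T.comp 0 (b \<otimes>\<^bsub>tring \<xi>\<^esub> c) \<in> q}"
        have J: "ideal ?J (tring \<xi>)"
          by (rule T.ideal_over_prime_of_degree_zero) (use q in \<open>simp add: base_ring_def\<close>)
        have "T.comp 0 (\<one>\<^bsub>tring \<xi>\<^esub> \<otimes>\<^bsub>tring \<xi>\<^esub> \<one>\<^bsub>tring \<xi>\<^esub>) = \<one>\<^bsub>tring \<xi>\<^esub>"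
          using T.comp_homogeneous[of 0 0 "\<one>\<^bsub>tring \<xi>\<^esub>"] T.gr_one by simp
        moreover have "\<one>\<^bsub>tring \<xi>\<^esub> \<notin> q" using Spec_one_notin[OF q] by (simp add: base_ring_def)
        ultimately have "\<not> (\<forall>c \<in> carrier (tring \<xi>). T.comp 0 (\<one>\<^bsub>tring \<xi>\<^esub> \<otimes>\<^bsub>tring \<xi>\<^esub> c) \<in> q)"
          by (metis T.one_closed)
        then have "\<one>\<^bsub>tring \<xi>\<^esub> \<notin> ?J" by blast
        from exists_prime_containing_ideal[OF T.is_cring J this] obtain Q where
          Q: "Q \<in> Spec (tring \<xi>)" "?J \<subseteq> Q" by blast
        from meets[OF Q(1)] obtain f where f: "f \<in> F" "f \<notin> spec_map R (tmap \<xi>) Q" ..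
        from F[OF f(1)] obtain n where n: "n \<in> Zr r" "f \<in> grR n" ..
        have y: "tmap \<xi> f \<in> tgrad \<xi> n" by (rule quotient_stackD(3)[OF \<xi> n])
        have "T.comp 0 (tmap \<xi> f \<otimes>\<^bsub>tring \<xi>\<^esub> c) \<in> q" if c: "c \<in> carrier (tring \<xi>)" for c
        proof -
          have "T.comp (n + - n) (tmap \<xi> f \<otimes>\<^bsub>tring \<xi>\<^esub> c) = tmap \<xi> f \<otimes>\<^bsub>tring \<xi>\<^esub> T.comp (- n) c"
            by (rule T.comp_mult_homogeneous[OF n(1) Zr_closed(3)[OF n(1)] y c])
          moreover have "T.comp (- n) c \<in> tgrad \<xi> (- n)" by (rule T.comp_props(1)[OF c Zr_closed(3)[OF n(1)]])
          ultimately show ?thesis using none f(1) n by auto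
        qed
        then have "tmap \<xi> f \<in> ?J" using T.gr_carrier[OF n(1) y] by simp
        then have "f \<in> spec_map R (tmap \<xi>) Q" using Q(2) FR[OF f(1)] by (auto simp: spec_map_def)
        then show False using f(2) by simp
      qed
      then obtain f n c where f: "f \<in> F" and n: "n \<in> Zr r" "f \<in> grR n"
        and c: "c \<in> tgrad \<xi> (- n)" and nq: "tmap \<xi> f \<otimes>\<^bsub>tring \<xi>\<^esub> c \<notin> q" by blast
      let ?a = "tmap \<xi> f \<otimes>\<^bsub>tring \<xi>\<^esub> c"
      have y: "tmap \<xi> f \<in> tgrad \<xi> n" by (rule quotient_stackD(3)[OF \<xi> n])
      have a: "?a \<in> tgrad \<xi> 0" by (rule T.gr_mult_neg[OF n(1) y c])
      obtain B' :: "'b ring" and gr' h where T': "torsor r B' gr'" and h: "h \<in> ring_hom (tring \<xi>) B'"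
        "\<And>m. m \<in> Zr r \<Longrightarrow> h ` tgrad \<xi> m \<subseteq> gr' m"
        and loc: "localization_away (tring \<xi>) ?a B' h"
          "localization_away (degree_zero (tring \<xi>) (tgrad \<xi>)) ?a (degree_zero B' gr') h"
        using localized_torsor[OF quotient_stackD(1)[OF \<xi>] a inf] by (elim exE conjE) (rule that, blast+)
      interpret T': torsor_ring r B' gr' by (rule torsor_ringI[OF T'])
      interpret h: ring_hom_cring "tring \<xi>" B' h
        by (intro ring_hom_cring.intro ring_hom_cring_axioms.intro T.is_cring T'.is_cring h)
      let ?\<xi>' = "\<lparr>tring = B', tgrad = gr', tmap = h \<circ> tmap \<xi>\<rparr> :: ('a, 'b) stack_obj"
      have \<xi>': "?\<xi>' \<in> quotient_stack r R grR"
      proof -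
        have "h \<circ> tmap \<xi> \<in> ring_hom R B'" by (rule ring_hom_trans[OF quotient_stackD(2)[OF \<xi>] h(1)])
        moreover have "(h \<circ> tmap \<xi>) ` grR m \<subseteq> gr' m" if m: "m \<in> Zr r" for m
          using quotient_stackD(3)[OF \<xi> m] h(2)[OF m] by auto
        ultimately show ?thesis using T' by (simp add: quotient_stack_def)
      qed
      have yB: "tmap \<xi> f \<in> carrier (tring \<xi>)" "c \<in> carrier (tring \<xi>)"
        using T.gr_carrier[OF n(1) y] T.gr_carrier[OF Zr_closed(3)[OF n(1)] c] .
      have "h ?a \<in> Units B'" using loc(1) by (simp add: localization_away_def)
      then have "h (tmap \<xi> f) \<otimes>\<^bsub>B'\<^esub> h c \<in> Units B'" using yB by simp
      then have "h (tmap \<xi> f) \<in> Units B'" by (rule T'.unit_factor) (use yB in simp_all)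
      then have V: "?\<xi>' \<in> inverting_substack r R grR f" using \<xi>' by (simp add: inverting_substack_def)
      have hA: "h \<in> stack_arrows r R \<xi> ?\<xi>'" using h by (simp add: stack_arrows_def)
      show "\<exists>V \<in> {inverting_substack r R grR f | f. f \<in> F}. \<exists>a \<in> carrier (base_ring \<xi>) - q.
          \<exists>\<xi>' \<in> V. \<exists>h \<in> stack_arrows r R \<xi> \<xi>'. localization_away (base_ring \<xi>) a (base_ring \<xi>') h"
      proof (intro bexI[of _ "inverting_substack r R grR f"] bexI[of _ ?a] bexI[of _ ?\<xi>'] bexI[of _ h] V hA)
        show "localization_away (base_ring \<xi>) ?a (base_ring ?\<xi>') h" using loc(2) by (simp add: base_ring_def)
        show "?a \<in> carrier (base_ring \<xi>) - q" using a nq by (simp add: base_ring_def)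
        show "inverting_substack r R grR f \<in> {inverting_substack r R grR f | f. f \<in> F}" using f by blast
      qed
    qed
  qed
qed

section \<open>The stacks of smooth sequences\<close>

lemma graded_monoid_ring:
  fixes N :: "'t::ab_group_add set"
  assumes N: "additive_submonoid N" and add: "\<And>s t. \<phi> (s + t) = \<phi> s + \<phi> t"
    and Zr: "\<And>t. \<phi> t \<in> Zr r"
  shows "graded_cring r (monoid_ring N) (phi_grading \<phi> N)"
proof -
  define \<pi> :: "zvec \<Rightarrow> ('t \<Rightarrow>\<^sub>0 int) \<Rightarrow> 't \<Rightarrow>\<^sub>0 int"
    where "\<pi> n = Poly_Mapping.mapp (\<lambda>t k. if \<phi> t = n then k else 0)" for n
  have look: "Poly_Mapping.lookup (\<pi> n p) t = (if \<phi> t = n then Poly_Mapping.lookup p t else 0)" for n p t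
    by (auto simp: \<pi>_def lookup_mapp when_def in_keys_iff)
  have keys: "Poly_Mapping.keys (\<pi> n p) = {t \<in> Poly_Mapping.keys p. \<phi> t = n}" for n p
    by (auto simp: in_keys_iff look split: if_splits)
  have \<phi>0: "\<phi> 0 = 0" using add[of 0 0] by simp
  show ?thesis
  proof (rule graded_cringI[where \<pi> = \<pi>, OF cring_monoid_ring[OF N]])
    fix n assume n: "n \<in> Zr r"
    interpret C: cring "monoid_ring N" by (rule cring_monoid_ring[OF N])
    show "subgroup (phi_grading \<phi> N n) (add_monoid (monoid_ring N))"
    proof (rule subgroup.intro)
      show "phi_grading \<phi> N n \<subseteq> carrier (add_monoid (monoid_ring N))" by (auto simp: phi_grading_def)
      show "\<one>\<^bsub>add_monoid (monoid_ring N)\<^esub> \<in> phi_grading \<phi> N n" by (simp add: phi_grading_def)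
      fix p assume p: "p \<in> phi_grading \<phi> N n"
      have "\<ominus>\<^bsub>monoid_ring N\<^esub> p = - p"
        by (rule C.minus_equality) (use p in \<open>auto simp: phi_grading_def\<close>)
      then show "inv\<^bsub>add_monoid (monoid_ring N)\<^esub> p \<in> phi_grading \<phi> N n"
        unfolding a_inv_def[symmetric] using p by (simp add: phi_grading_def)
      fix q assume q: "q \<in> phi_grading \<phi> N n"
      show "p \<otimes>\<^bsub>add_monoid (monoid_ring N)\<^esub> q \<in> phi_grading \<phi> N n"
        using p q Poly_Mapping.keys_add[of p q] by (auto simp: phi_grading_def)
    qed
    show "\<pi> n p \<in> phi_grading \<phi> N n" if "p \<in> carrier (monoid_ring N)" for p
      using that by (auto simp: phi_grading_def keys)
    show "\<pi> n (p \<oplus>\<^bsub>monoid_ring N\<^esub> q) = \<pi> n p \<oplus>\<^bsub>monoid_ring N\<^esub> \<pi> n q" for p q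
      by (rule poly_mapping_eqI) (simp add: look lookup_add)
  next
    fix m n p assume p: "p \<in> phi_grading \<phi> N m"
    show "\<pi> n p = (if n = m then p else \<zero>\<^bsub>monoid_ring N\<^esub>)"
    proof (rule poly_mapping_eqI)
      fix t
      show "Poly_Mapping.lookup (\<pi> n p) t = Poly_Mapping.lookup (if n = m then p else \<zero>\<^bsub>monoid_ring N\<^esub>) t"
        using p by (cases "t \<in> Poly_Mapping.keys p") (auto simp: phi_grading_def look in_keys_iff)
    qed
  next
    fix p
    have "{n \<in> Zr r. \<pi> n p \<noteq> \<zero>\<^bsub>monoid_ring N\<^esub>} \<subseteq> \<phi> ` Poly_Mapping.keys p"
    proof
      fix n assume "n \<in> {n \<in> Zr r. \<pi> n p \<noteq> \<zero>\<^bsub>monoid_ring N\<^esub>}"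
      then have "Poly_Mapping.keys (\<pi> n p) \<noteq> {}" by simp
      then show "n \<in> \<phi> ` Poly_Mapping.keys p" unfolding keys by blast
    qed
    then show "finite {n \<in> Zr r. \<pi> n p \<noteq> \<zero>\<^bsub>monoid_ring N\<^esub>}" by (rule finite_subset) simp
    assume all: "\<And>n. n \<in> Zr r \<Longrightarrow> \<pi> n p = \<zero>\<^bsub>monoid_ring N\<^esub>"
    show "p = \<zero>\<^bsub>monoid_ring N\<^esub>"
    proof (rule poly_mapping_eqI)
      fix t
      have "Poly_Mapping.lookup (\<pi> (\<phi> t) p) t = 0" using all[OF Zr[of t]] by simp
      then show "Poly_Mapping.lookup p t = Poly_Mapping.lookup \<zero>\<^bsub>monoid_ring N\<^esub> t" by (simp add: look)
    qed
  next
    show "\<one>\<^bsub>monoid_ring N\<^esub> \<in> phi_grading \<phi> N 0"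
      using N by (simp add: phi_grading_def \<phi>0 additive_submonoid_def)
    fix m n p q assume p: "p \<in> phi_grading \<phi> N m" and q: "q \<in> phi_grading \<phi> N n"
    show "p \<otimes>\<^bsub>monoid_ring N\<^esub> q \<in> phi_grading \<phi> N (m + n)"
      unfolding phi_grading_def
    proof (intro CollectI conjI ballI)
      show "p \<otimes>\<^bsub>monoid_ring N\<^esub> q \<in> carrier (monoid_ring N)"
        using p q keys_mult_subset[OF N, of p q] by (simp add: phi_grading_def)
      fix t assume "t \<in> Poly_Mapping.keys (p \<otimes>\<^bsub>monoid_ring N\<^esub> q)"
      then obtain a b where "t = a + b" "a \<in> Poly_Mapping.keys p" "b \<in> Poly_Mapping.keys q"
        using keys_mult[of p q] by auto
      then show "\<phi> t = m + n" using p q by (simp add: phi_grading_def add)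
    qed
  qed
qed

text \<open>By the universal property of the localization at the monomial of \<open>den\<close>. The extended homomorphism
  respects degrees, since a monomial of the larger ring is a homogeneous element of the smaller one times
  the inverse of a power of that monomial.\<close>

lemma (in smooth_seq) X_seq_stack_eq_inverting:
  assumes add: "\<And>s t. \<phi> (s + t) = \<phi> s + \<phi> t" and Zr: "\<And>t. \<phi> t \<in> Zr r"
  shows "(X_seq_stack r \<phi> M Es :: ('t \<Rightarrow>\<^sub>0 int, 'b) stack_obj set) = inverting_substack r (monoid_ring M) (phi_grading \<phi> M) (xmon den)"
proof (rule Set.set_eqI)
  interpret L: localization "monoid_ring M" "monoid_ring N" id "xmon den"
    by (rule localizationI[OF cring_monoid_ring[OF M] cring_monoid_ring[OF N] _ den_localization])
      (simp add: den(1))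
  fix \<xi> :: "('t \<Rightarrow>\<^sub>0 int, 'b) stack_obj"
  show "\<xi> \<in> X_seq_stack r \<phi> M Es \<longleftrightarrow> \<xi> \<in> inverting_substack r (monoid_ring M) (phi_grading \<phi> M) (xmon den)"
  proof
    assume "\<xi> \<in> X_seq_stack r \<phi> M Es"
    then obtain \<eta> where \<xi>: "\<xi> \<in> Z_stack r \<phi> M" and \<eta>: "\<eta> \<in> Z_stack r \<phi> N" "tring \<eta> = tring \<xi>"
      and eq: "\<forall>x \<in> carrier (monoid_ring M). tmap \<xi> x = tmap \<eta> x"
      unfolding X_seq_stack_def by (elim CollectE conjE bexE) (rule that)
    interpret T: torsor_ring r "tring \<xi>" "tgrad \<xi>"
      by (rule torsor_ringI[OF quotient_stackD(1)]) (rule \<xi>[unfolded Z_stack_def])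
    have "tmap \<eta> \<in> ring_hom (monoid_ring N) (tring \<xi>)"
      using quotient_stackD(2)[OF \<eta>(1)[unfolded Z_stack_def]] \<eta>(2) by simp
    then interpret h: ring_hom_cring "monoid_ring N" "tring \<xi>" "tmap \<eta>"
      by (intro ring_hom_cring.intro ring_hom_cring_axioms.intro L.S.is_cring T.is_cring)
    have "tmap \<eta> (xmon den) \<in> Units (tring \<xi>)" using h.hom_Units[OF L.hg_unit] by simp
    then show "\<xi> \<in> inverting_substack r (monoid_ring M) (phi_grading \<phi> M) (xmon den)"
      using \<xi> bspec[OF eq, of "xmon den"] den(1) by (simp add: inverting_substack_def Z_stack_def)
  next
    assume V: "\<xi> \<in> inverting_substack r (monoid_ring M) (phi_grading \<phi> M) (xmon den)"
    then have \<xi>: "\<xi> \<in> quotient_stack r (monoid_ring M) (phi_grading \<phi> M)"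
      and unit: "tmap \<xi> (xmon den) \<in> Units (tring \<xi>)" by (simp_all add: inverting_substack_def)
    interpret T: torsor_ring r "tring \<xi>" "tgrad \<xi>" by (rule torsor_ringI[OF quotient_stackD(1)[OF \<xi>]])
    interpret t: ring_hom_cring "monoid_ring M" "tring \<xi>" "tmap \<xi>"
      by (intro ring_hom_cring.intro ring_hom_cring_axioms.intro L.R.is_cring T.is_cring quotient_stackD(2)[OF \<xi>])
    obtain \<theta> where \<theta>: "\<theta> \<in> ring_hom (monoid_ring N) (tring \<xi>)"
      and ext: "\<And>x. x \<in> carrier (monoid_ring M) \<Longrightarrow> \<theta> x = tmap \<xi> x"
      using L.hom_extends[OF T.is_cring quotient_stackD(2)[OF \<xi>] unit] by auto
    interpret th: ring_hom_cring "monoid_ring N" "tring \<xi>" \<theta>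
      by (intro ring_hom_cring.intro ring_hom_cring_axioms.intro L.S.is_cring T.is_cring \<theta>)
    have monomial: "\<theta> (Poly_Mapping.single m c) \<in> tgrad \<xi> (\<phi> m)" if m: "m \<in> N" for m c
    proof -
      obtain k :: nat where k: "m + zmul (int k) den \<in> M" using den(3)[OF m] by blast
      let ?d = "zmul (int k) den"
      have d: "xmon ?d = xmon den [^]\<^bsub>monoid_ring M\<^esub> k" by (simp add: xmon_power)
      have "xmon den [^]\<^bsub>monoid_ring M\<^esub> k \<in> carrier (monoid_ring M)" by (rule L.R.nat_pow_closed) (simp add: den(1))
      then have dM: "?d \<in> M" unfolding d[symmetric] by simp
      have dN: "?d \<in> N" using dM MN by blast
      have y: "tmap \<xi> (xmon ?d) \<in> tgrad \<xi> (\<phi> ?d)"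
        by (rule quotient_stackD(3)[OF \<xi> Zr]) (simp add: phi_grading_def dM)
      have "tmap \<xi> (xmon ?d) \<in> Units (tring \<xi>)"
        unfolding d using unit by (subst t.hom_nat_pow) (simp_all add: den(1) T.Units_pow_closed)
      from T.unit_inverse_homogeneous[OF Zr y this] obtain z where
        z: "z \<in> tgrad \<xi> (- \<phi> ?d)" "tmap \<xi> (xmon ?d) \<otimes>\<^bsub>tring \<xi>\<^esub> z = \<one>\<^bsub>tring \<xi>\<^esub>" by blast
      have zB: "z \<in> carrier (tring \<xi>)" by (rule T.gr_carrier[OF Zr_closed(3)[OF Zr] z(1)])
      let ?t = "\<theta> (Poly_Mapping.single m c)"
      have tB: "?t \<in> carrier (tring \<xi>)" by (rule th.hom_closed) (simp add: m)
      have dB: "\<theta> (xmon ?d) \<in> carrier (tring \<xi>)" by (rule th.hom_closed) (simp add: dN)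
      have "?t \<otimes>\<^bsub>tring \<xi>\<^esub> \<theta> (xmon ?d) = \<theta> (Poly_Mapping.single m c * xmon ?d)"
        using th.hom_mult[of "Poly_Mapping.single m c" "xmon ?d"] m dN by simp
      also have "\<dots> = tmap \<xi> (Poly_Mapping.single (m + ?d) c)"
        using ext[of "Poly_Mapping.single (m + ?d) c"] k by (simp add: mult_single)
      also have "\<dots> \<in> tgrad \<xi> (\<phi> (m + ?d))"
        by (rule quotient_stackD(3)[OF \<xi> Zr]) (use k in \<open>simp add: phi_grading_def\<close>)
      finally have "(?t \<otimes>\<^bsub>tring \<xi>\<^esub> \<theta> (xmon ?d)) \<otimes>\<^bsub>tring \<xi>\<^esub> z \<in> tgrad \<xi> (\<phi> (m + ?d) + - \<phi> ?d)"
        using T.gr_mult[OF Zr Zr_closed(3)[OF Zr] _ z(1)] by blast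
      also have "(?t \<otimes>\<^bsub>tring \<xi>\<^esub> \<theta> (xmon ?d)) \<otimes>\<^bsub>tring \<xi>\<^esub> z = ?t"
        using z(2) ext[of "xmon ?d"] dM tB dB zB by (simp add: T.m_assoc)
      finally show ?thesis by (simp add: add)
    qed
    have gr: "\<theta> p \<in> tgrad \<xi> n" if n: "n \<in> Zr r" and p: "p \<in> phi_grading \<phi> N n" for n p
    proof -
      have "Poly_Mapping.keys p \<subseteq> {t \<in> N. \<phi> t = n}" using p by (auto simp: phi_grading_def)
      then show ?thesis
      proof (induct p rule: poly_mapping_additive_induct)
        case zero
        then show ?case using th.hom_zero T.gr_zero[OF n] by simp
      next
        case (single m c)
        then show ?case using monomial by auto
      next
        case (add p q)
        have "\<theta> (p + q) = \<theta> p \<oplus>\<^bsub>tring \<xi>\<^esub> \<theta> q" using th.hom_add[of p q] add(1,2) by auto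
        then show ?case using T.gr_add[OF n add(3,4)] by simp
      qed
    qed
    let ?\<eta> = "\<lparr>tring = tring \<xi>, tgrad = tgrad \<xi>, tmap = \<theta>\<rparr>"
    have "\<theta> ` phi_grading \<phi> N n \<subseteq> tgrad \<xi> n" if "n \<in> Zr r" for n using gr[OF that] by blast
    then have "?\<eta> \<in> Z_stack r \<phi> N"
      using quotient_stackD(1)[OF \<xi>] \<theta> by (simp add: Z_stack_def quotient_stack_def)
    then show "\<xi> \<in> X_seq_stack r \<phi> M Es"
      unfolding X_seq_stack_def using \<xi> ext
      by (intro CollectI conjI bexI[of _ ?\<eta>]) (simp_all add: Z_stack_def)
  qed
qed

theorem lemma2p47:
  fixes T\<^sub>p :: "'t::ab_group_add set" and r :: nat and \<phi> :: "'t \<Rightarrow> zvec"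
  assumes fg: "fg_submonoid T\<^sub>p"
    and associated: "\<forall>t. \<exists>a \<in> T\<^sub>p. \<exists>b \<in> T\<^sub>p. t = a - b"
    and free: "\<exists>n. (ambient_group :: 't monoid) \<cong> free_Abelian_group {..<n::nat}"
    and phi: "\<phi> \<in> hom ambient_group (free_Abelian_group {..<r})"
    and large: "infinite (UNIV :: 'b set)"
  shows "X_Theta T\<^sub>p = smooth_locus (monoid_ring T\<^sub>p) \<and>
    (Z_stack_smooth r \<phi> T\<^sub>p :: ('t \<Rightarrow>\<^sub>0 int, 'b) stack_obj set) = X_Theta_stack r \<phi> T\<^sub>p \<and>
    (X_Theta_stack r \<phi> T\<^sub>p :: ('t \<Rightarrow>\<^sub>0 int, 'b) stack_obj set) =
      open_quotient r (monoid_ring T\<^sub>p) (phi_grading \<phi> T\<^sub>p) (X_Theta T\<^sub>p)"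
proof -
  let ?R = "monoid_ring T\<^sub>p" and ?gr = "phi_grading \<phi> T\<^sub>p"
  obtain n where n: "(ambient_group :: 't monoid) \<cong> free_Abelian_group {..<n::nat}" using free ..
  have coord: "has_coordinates TYPE('t)" by (rule free_has_coordinates[OF n])
  have add: "\<phi> (s + t) = \<phi> s + \<phi> t" for s t using phi by (auto simp: hom_def)
  have Zr: "\<phi> t \<in> Zr r" for t using phi by (auto simp: hom_def)
  have M: "additive_submonoid T\<^sub>p" by (rule fg_submonoid_additive[OF fg])
  have gr: "graded_cring r ?R ?gr" by (rule graded_monoid_ring[OF M add Zr])
  have locus: "X_Theta T\<^sub>p = smooth_locus ?R"
    by (rule X_Theta_eq_smooth_locus[OF fg associated[rule_format] coord])
  \<comment> \<open>By \<open>seq_open_eq\<close> and \<open>X_seq_stack_eq_inverting\<close>, both unions are governed by these monomials.\<close>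
  define F where "F = (\<lambda>Es. xmon (smooth_seq.den T\<^sub>p Es) :: 't \<Rightarrow>\<^sub>0 int) ` smooth_sequences T\<^sub>p"
  have seq: "smooth_seq T\<^sub>p Es" if "Es \<in> smooth_sequences T\<^sub>p" for Es
    by (rule smooth_seq.intro[OF fg]) (use that in \<open>simp add: smooth_sequences_def\<close>)
  have F: "\<exists>n \<in> Zr r. f \<in> ?gr n" if f: "f \<in> F" for f
  proof -
    obtain Es where Es: "Es \<in> smooth_sequences T\<^sub>p" "f = xmon (smooth_seq.den T\<^sub>p Es)"
      using f unfolding F_def by blast
    have "f \<in> ?gr (\<phi> (smooth_seq.den T\<^sub>p Es))"
      using smooth_seq.den(1)[OF seq[OF Es(1)]] by (simp add: Es(2) phi_grading_def)
    then show ?thesis using Zr by blast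
  qed
  have theta: "X_Theta T\<^sub>p = (\<Union>f \<in> F. {p \<in> Spec ?R. f \<notin> p})"
    unfolding X_Theta_def F_def UN_simps(10) using smooth_seq.seq_open_eq[OF seq] by (intro SUP_cong refl)
  have stacks: "{X_seq_stack r \<phi> T\<^sub>p Es | Es. Es \<in> smooth_sequences T\<^sub>p} =
      ({inverting_substack r ?R ?gr f | f. f \<in> F} :: ('t \<Rightarrow>\<^sub>0 int, 'b) stack_obj set set)"
  proof -
    have "{X_seq_stack r \<phi> T\<^sub>p Es | Es. Es \<in> smooth_sequences T\<^sub>p} =
        (\<lambda>Es. X_seq_stack r \<phi> T\<^sub>p Es :: ('t \<Rightarrow>\<^sub>0 int, 'b) stack_obj set) ` smooth_sequences T\<^sub>p"
      by (rule Setcompr_eq_image)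
    also have "\<dots> = (\<lambda>Es. inverting_substack r ?R ?gr (xmon (smooth_seq.den T\<^sub>p Es))) ` smooth_sequences T\<^sub>p"
      by (rule image_cong[OF refl smooth_seq.X_seq_stack_eq_inverting[OF seq add Zr]])
    also have "\<dots> = (inverting_substack r ?R ?gr) ` F" by (simp only: F_def image_image)
    also have "\<dots> = {inverting_substack r ?R ?gr f | f. f \<in> F}" by (rule Setcompr_eq_image[symmetric])
    finally show ?thesis .
  qed
  have quotient: "(X_Theta_stack r \<phi> T\<^sub>p :: ('t \<Rightarrow>\<^sub>0 int, 'b) stack_obj set) = open_quotient r ?R ?gr (X_Theta T\<^sub>p)"
    unfolding X_Theta_stack_def stacks theta by (rule union_of_inverting_substacks[OF gr F large])
  have sub: "(X_Theta_stack r \<phi> T\<^sub>p :: ('t \<Rightarrow>\<^sub>0 int, 'b) stack_obj set) \<subseteq> Z_stack_smooth r \<phi> T\<^sub>p"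
    unfolding X_Theta_stack_def Z_stack_smooth_def stack_smooth_locus_def stacks
  proof (rule substack_union_mono, rule subsetI)
    fix V :: "('t \<Rightarrow>\<^sub>0 int, 'b) stack_obj set" assume "V \<in> {inverting_substack r ?R ?gr f | f. f \<in> F}"
    then obtain f where f: "f \<in> F" "V = inverting_substack r ?R ?gr f" by blast
    from F[OF f(1)] obtain m where m: "m \<in> Zr r" "f \<in> ?gr m" ..
    have "smooth_at ?R p" if p: "p \<in> Spec ?R" "f \<notin> p" for p
    proof -
      have "p \<in> X_Theta T\<^sub>p" unfolding theta by (rule UN_I[OF f(1)]) (use p in simp)
      then show ?thesis unfolding locus by (simp add: smooth_locus_def)
    qed
    then show "V \<in> {V. open_substack r ?R ?gr V \<and> smooth_substack r ?R ?gr V}"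
      unfolding f(2) using inverting_substack_open[OF gr m] inverting_substack_smooth[OF gr m] by blast
  qed
  obtain j where j: "j \<in> Group.iso (ambient_group :: 't monoid) (free_Abelian_group {..<n})"
    using n by (auto simp: is_iso_def)
  then have "inj j" by (auto simp: Group.iso_def bij_betw_def)
  moreover obtain a :: "zvec \<Rightarrow> nat" where "inj a" using zvec_injection ..
  ultimately have "inj (a \<circ> j)" by (rule inj_compose[rotated])
  from monoid_ring_injection[OF this large] obtain i :: "('t \<Rightarrow>\<^sub>0 int) \<Rightarrow> 'b" where i: "inj i" ..
  have "(Z_stack_smooth r \<phi> T\<^sub>p :: ('t \<Rightarrow>\<^sub>0 int, 'b) stack_obj set) \<subseteq> open_quotient r ?R ?gr (smooth_locus ?R)"
    unfolding Z_stack_smooth_def by (rule stack_smooth_locus_subset[OF gr inj_on_subset[OF i subset_UNIV] large])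
  then have "(Z_stack_smooth r \<phi> T\<^sub>p :: ('t \<Rightarrow>\<^sub>0 int, 'b) stack_obj set) = X_Theta_stack r \<phi> T\<^sub>p"
    using sub unfolding quotient locus by (rule equalityI)
  then show ?thesis using locus quotient by blast
qed

end
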